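(* Let $A$ be a finite dimensional $k$-algebra, $k=\overline{\mathbb F}_q$, with a Frobenius morphism $F_A$ and fixed-point algebra $A^F$. Let $\varphi:L\to M$ be a minimal right almost split morphism in $\mathrm{mod}\text{-}A$. Then there exists an induced morphism $\tilde\varphi:\tilde L\to\tilde M$ of $F$-stable modules such that its restriction $\tilde\varphi^F:\tilde L^F\to\tilde M^F$ is a minimal right almost split morphism in $\mathrm{mod}\text{-}A^F$. In particular, every almost split sequence $0\to N\xrightarrow{\psi}L\xrightarrow{\varphi}M\to0$ in $\mathrm{mod}\text{-}A$ gives rise to an almost split sequence $$0\to\tilde N^F\xrightarrow{\tilde\psi^F}\tilde L^F\xrightarrow{\tilde\varphi^F}\tilde M^F\to0$$ in $\mathrm{mod}\text{-}A^F$. Moreover, every almost split sequence of $A^F$-modules can be constructed in this way.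
   Context: Let $q$ be a prime power and $k=\overline{\mathbb F}_q$. All modules are left modules, finite dimensional over the base field. A Frobenius map on a $k$-vector space $V$ is an $\mathbb F_q$-linear isomorphism $F:V\to V$ with $F(\lambda v)=\lambda^qF(v)$ ($\lambda\in k$) such that for every $v$ there is $n>0$ with $F^n(v)=v$; $V^F$ denotes the fixed points. A Frobenius morphism on a $k$-algebra $A$ is a Frobenius map $F_A$ on $A$ that is also an $\mathbb F_q$-algebra isomorphism with $F_A(1)=1$; $A^F$ is its fixed-point algebra. An $A$-module $M$ with Frobenius map $F_M$ is $F$-stable if $F_M(am)=F_A(a)F_M(m)$ for all $a,m$; then $M^F=M^{F_M}$ is an $A^F$-module. A morphism of $F$-stable modules is an $A$-homomorphism commuting with the Frobenius maps; it restricts to an $A^F$-homomorphism of fixed points. Frobenius twist: each $A$-module $M$ is given some Frobenius map $F_M$ on its underlying space (no compatibility required). $M^{[1]}$ is the same vector space with action $a*m=F_M(F_A^{-1}(a)F_M^{-1}(m))$; for $f\in\mathrm{Hom}_A(M,N)$, $f^{[1]}=F_N\circ f\circ F_M^{-1}\in\mathrm{Hom}_A(M^{[1]},N^{[1]})$; $M^{[s]}$, $f^{[s]}$ are the $s$-fold iterates. Since $A$ is finite dimensional, each $M$ has a period $p(M)$, the least $r\ge1$ with $M^{[r]}\cong M$. A morphism $\varphi:L\to M$ is minimal right almost split if it is not a split epimorphism, any morphism $X\to M$ that is not a split epimorphism factors through $\varphi$, and any $f:L\to L$ with $\varphi=\varphi f$ is an isomorphism. Minimal left almost split is the dual notion.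 A short exact sequence $0\to N\xrightarrow{\psi}L\xrightarrow{\varphi}M\to0$ is almost split if $\varphi$ is minimal right almost split (equivalently $\psi$ is minimal left almost split). If $\varphi:L\to M$ is minimal right almost split, $M$ is indecomposable. Induced morphism: given a minimal right almost split $\varphi:L\to M$ and $r=p(M)$, one has $L^{[r]}\cong L$. Up to replacing $M$, $L$ by isomorphic modules on the same spaces and $\varphi$ by its composite with isomorphisms, one may arrange $M^{[r]}=M$, $L^{[r]}=L$, $\varphi^{[r]}=\varphi$. Then $\tilde M=\bigoplus_{i=0}^{r-1}M^{[i]}$ and $\tilde L=\bigoplus_{i=0}^{r-1}L^{[i]}$, with Frobenius maps $(x_0,\dots,x_{r-1})\mapsto(F(x_{r-1}),F(x_0),\dots,F(x_{r-2}))$ for $F=F_M$, resp. $F=F_L$, are $F$-stable, and the induced morphism is $\tilde\varphi=\mathrm{diag}(\varphi,\varphi^{[1]},\dots,\varphi^{[r-1]})$. For an almost split sequence, $\tilde N$ and $\tilde\psi$ are formed in the same way with the same $r$ (so $\tilde N=\bigoplus_{i=0}^{r-1}N^{[i]}$, identified with $\ker\tilde\varphi$, and $\tilde\psi=\mathrm{diag}(\psi,\dots,\psi^{[r-1]})$). *)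

theory Defs
  imports
    "HOL-Algebra.Algebraic_Closure"
    "HOL-Number_Theory.Prime_Powers"
    "Jordan_Normal_Form.Missing_VectorSpace"
begin

section \<open>Finite dimensional algebras and modules\<close>

text \<open>
  An algebra \<open>A\<close> over a field \<open>K\<close>, and a left module over \<open>A\<close>, are both records of type
  \<^typ>\<open>('s, 'm) module\<close>. For an algebra all fields are used and \<open>smult\<close> is the action of \<open>K\<close>.
  For a module \<open>smult\<close> is the action of \<open>A\<close>, while \<open>mult\<close> and \<open>one\<close> carry no information (as usual
  for this record). The locale \<^locale>\<open>module\<close> cannot be used here, because it requires
  commutative scalars. Functions are only meaningful on carriers, so equality of morphisms is
  always pointwise equality on the carrier.
\<close>

definition fd_algebra :: "'k ring \<Rightarrow> ('k, 'a) module \<Rightarrow> bool" where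
  "fd_algebra K A \<longleftrightarrow>
     vectorspace K A \<and> vectorspace.fin_dim K A \<and> ring A \<and>
     (\<forall>c\<in>carrier K. \<forall>x\<in>carrier A. \<forall>y\<in>carrier A.
        (c \<odot>\<^bsub>A\<^esub> x) \<otimes>\<^bsub>A\<^esub> y = c \<odot>\<^bsub>A\<^esub> (x \<otimes>\<^bsub>A\<^esub> y) \<and>
        x \<otimes>\<^bsub>A\<^esub> (c \<odot>\<^bsub>A\<^esub> y) = c \<odot>\<^bsub>A\<^esub> (x \<otimes>\<^bsub>A\<^esub> y))"

locale left_module = A?: ring A + M?: abelian_group M
  for A :: "('k, 'a) module" and M :: "('a, 'm) module" +
  assumes lm_closed: "\<lbrakk>a \<in> carrier A; x \<in> carrier M\<rbrakk> \<Longrightarrow> a \<odot>\<^bsub>M\<^esub> x \<in> carrier M"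
    and lm_l_distr: "\<lbrakk>a \<in> carrier A; b \<in> carrier A; x \<in> carrier M\<rbrakk> \<Longrightarrow>
      (a \<oplus>\<^bsub>A\<^esub> b) \<odot>\<^bsub>M\<^esub> x = a \<odot>\<^bsub>M\<^esub> x \<oplus>\<^bsub>M\<^esub> b \<odot>\<^bsub>M\<^esub> x"
    and lm_r_distr: "\<lbrakk>a \<in> carrier A; x \<in> carrier M; y \<in> carrier M\<rbrakk> \<Longrightarrow>
      a \<odot>\<^bsub>M\<^esub> (x \<oplus>\<^bsub>M\<^esub> y) = a \<odot>\<^bsub>M\<^esub> x \<oplus>\<^bsub>M\<^esub> a \<odot>\<^bsub>M\<^esub> y"
    and lm_assoc: "\<lbrakk>a \<in> carrier A; b \<in> carrier A; x \<in> carrier M\<rbrakk> \<Longrightarrow>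
      (a \<otimes>\<^bsub>A\<^esub> b) \<odot>\<^bsub>M\<^esub> x = a \<odot>\<^bsub>M\<^esub> (b \<odot>\<^bsub>M\<^esub> x)"
    and lm_one: "x \<in> carrier M \<Longrightarrow> \<one>\<^bsub>A\<^esub> \<odot>\<^bsub>M\<^esub> x = x"

text \<open>The underlying \<open>K\<close>-space of an \<open>A\<close>-module: \<open>c\<close> acts as \<open>c \<cdot> 1\<^sub>A\<close>.\<close>

definition base_space :: "'k ring \<Rightarrow> ('k, 'a) module \<Rightarrow> ('a, 'm) module \<Rightarrow> ('k, 'm) module" where
  "base_space K A M =
     \<lparr>carrier = carrier M, monoid.mult = monoid.mult M, one = one M, zero = zero M, add = add M,
      smult = (\<lambda>c x. (c \<odot>\<^bsub>A\<^esub> \<one>\<^bsub>A\<^esub>) \<odot>\<^bsub>M\<^esub> x)\<rparr>"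

definition fd_module :: "'k ring \<Rightarrow> ('k, 'a) module \<Rightarrow> ('a, 'm) module \<Rightarrow> bool" where
  "fd_module K A M \<longleftrightarrow> left_module A M \<and> vectorspace.fin_dim K (base_space K A M)"

definition module_iso :: "('k, 'a) module \<Rightarrow> ('a, 'm) module \<Rightarrow> ('a, 'n) module \<Rightarrow> ('m \<Rightarrow> 'n) set"
  where
  "module_iso A M N = {f \<in> module_hom A M N. bij_betw f (carrier M) (carrier N)}"


section \<open>Almost split morphisms and sequences\<close>

definition split_epi ::
  "('k, 'a) module \<Rightarrow> ('a, 'l) module \<Rightarrow> ('a, 'm) module \<Rightarrow> ('l \<Rightarrow> 'm) \<Rightarrow> bool" where
  "split_epi A L M \<phi> \<longleftrightarrow> (\<exists>s\<in>module_hom A M L. \<forall>x\<in>carrier M. \<phi> (s x) = x)"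

text \<open>
  The test modules \<open>T\<close> range over the finite dimensional modules with elements in
  \<^typ>\<open>nat \<Rightarrow> 'k\<close>. Every finite dimensional module is isomorphic to one of these
  (\<open>fd_module_iso_standard\<close> below), so this is no restriction
  (\<open>minimal_right_almost_split_factors\<close>).
\<close>

definition minimal_right_almost_split ::
  "'k ring \<Rightarrow> ('k, 'a) module \<Rightarrow> ('a, 'l) module \<Rightarrow> ('a, 'm) module \<Rightarrow> ('l \<Rightarrow> 'm) \<Rightarrow> bool" where
  "minimal_right_almost_split K A L M \<phi> \<longleftrightarrow>
     fd_module K A L \<and> fd_module K A M \<and> \<phi> \<in> module_hom A L M \<and>
     \<not> split_epi A L M \<phi> \<and>
     (\<forall>(T :: ('a, nat \<Rightarrow> 'k) module) f.
        fd_module K A T \<and> f \<in> module_hom A T M \<and> \<not> split_epi A T M f \<longrightarrow>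
        (\<exists>g\<in>module_hom A T L. \<forall>x\<in>carrier T. f x = \<phi> (g x))) \<and>
     (\<forall>f\<in>module_hom A L L. (\<forall>x\<in>carrier L. \<phi> x = \<phi> (f x)) \<longrightarrow> f \<in> module_iso A L L)"

definition short_exact ::
  "('k, 'a) module \<Rightarrow> ('a, 'n) module \<Rightarrow> ('a, 'l) module \<Rightarrow> ('a, 'm) module \<Rightarrow>
   ('n \<Rightarrow> 'l) \<Rightarrow> ('l \<Rightarrow> 'm) \<Rightarrow> bool" where
  "short_exact A N L M \<psi> \<phi> \<longleftrightarrow>
     \<psi> \<in> module_hom A N L \<and> \<phi> \<in> module_hom A L M \<and>
     inj_on \<psi> (carrier N) \<and>
     \<psi> ` carrier N = {x \<in> carrier L. \<phi> x = \<zero>\<^bsub>M\<^esub>} \<and>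
     \<phi> ` carrier L = carrier M"

definition almost_split ::
  "'k ring \<Rightarrow> ('k, 'a) module \<Rightarrow> ('a, 'n) module \<Rightarrow> ('a, 'l) module \<Rightarrow> ('a, 'm) module \<Rightarrow>
   ('n \<Rightarrow> 'l) \<Rightarrow> ('l \<Rightarrow> 'm) \<Rightarrow> bool" where
  "almost_split K A N L M \<psi> \<phi> \<longleftrightarrow>
     fd_module K A N \<and> fd_module K A L \<and> fd_module K A M \<and>
     short_exact A N L M \<psi> \<phi> \<and> minimal_right_almost_split K A L M \<phi>"

definition isomorphic_sequences ::
  "('k, 'a) module \<Rightarrow>
   ('a, 'n1) module \<Rightarrow> ('a, 'l1) module \<Rightarrow> ('a, 'm1) module \<Rightarrow> ('n1 \<Rightarrow> 'l1) \<Rightarrow> ('l1 \<Rightarrow> 'm1) \<Rightarrow>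
   ('a, 'n2) module \<Rightarrow> ('a, 'l2) module \<Rightarrow> ('a, 'm2) module \<Rightarrow> ('n2 \<Rightarrow> 'l2) \<Rightarrow> ('l2 \<Rightarrow> 'm2) \<Rightarrow>
   bool" where
  "isomorphic_sequences A N1 L1 M1 \<psi>1 \<phi>1 N2 L2 M2 \<psi>2 \<phi>2 \<longleftrightarrow>
     (\<exists>\<nu>\<in>module_iso A N1 N2. \<exists>\<rho>\<in>module_iso A L1 L2. \<exists>\<mu>\<in>module_iso A M1 M2.
        (\<forall>x\<in>carrier N1. \<rho> (\<psi>1 x) = \<psi>2 (\<nu> x)) \<and> (\<forall>x\<in>carrier L1. \<mu> (\<phi>1 x) = \<phi>2 (\<rho> x)))"


section \<open>Frobenius maps and fixed points\<close>

text \<open>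
  Linearity over the field with \<open>q\<close> elements follows from additivity and semilinearity, since
  \<open>c ^ q = c\<close> for \<open>c\<close> in that field.
\<close>

definition frobenius_map :: "nat \<Rightarrow> 'k ring \<Rightarrow> ('k, 'v) module \<Rightarrow> ('v \<Rightarrow> 'v) \<Rightarrow> bool" where
  "frobenius_map q K V F \<longleftrightarrow>
     bij_betw F (carrier V) (carrier V) \<and>
     (\<forall>x\<in>carrier V. \<forall>y\<in>carrier V. F (x \<oplus>\<^bsub>V\<^esub> y) = F x \<oplus>\<^bsub>V\<^esub> F y) \<and>
     (\<forall>c\<in>carrier K. \<forall>x\<in>carrier V. F (c \<odot>\<^bsub>V\<^esub> x) = (c [^]\<^bsub>K\<^esub> q) \<odot>\<^bsub>V\<^esub> F x) \<and>
     (\<forall>x\<in>carrier V. \<exists>n>0. (F ^^ n) x = x)"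

definition frobenius_morphism :: "nat \<Rightarrow> 'k ring \<Rightarrow> ('k, 'a) module \<Rightarrow> ('a \<Rightarrow> 'a) \<Rightarrow> bool" where
  "frobenius_morphism q K A F \<longleftrightarrow>
     frobenius_map q K A F \<and>
     (\<forall>x\<in>carrier A. \<forall>y\<in>carrier A. F (x \<otimes>\<^bsub>A\<^esub> y) = F x \<otimes>\<^bsub>A\<^esub> F y) \<and>
     F \<one>\<^bsub>A\<^esub> = \<one>\<^bsub>A\<^esub>"

definition F_stable ::
  "nat \<Rightarrow> 'k ring \<Rightarrow> ('k, 'a) module \<Rightarrow> ('a \<Rightarrow> 'a) \<Rightarrow> ('a, 'm) module \<Rightarrow> ('m \<Rightarrow> 'm) \<Rightarrow> bool" where
  "F_stable q K A F\<^sub>A M F \<longleftrightarrow>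
     fd_module K A M \<and> frobenius_map q K (base_space K A M) F \<and>
     (\<forall>a\<in>carrier A. \<forall>x\<in>carrier M. F (a \<odot>\<^bsub>M\<^esub> x) = F\<^sub>A a \<odot>\<^bsub>M\<^esub> F x)"

definition F_stable_hom ::
  "('k, 'a) module \<Rightarrow> ('a, 'l) module \<Rightarrow> ('l \<Rightarrow> 'l) \<Rightarrow> ('a, 'm) module \<Rightarrow> ('m \<Rightarrow> 'm) \<Rightarrow>
   ('l \<Rightarrow> 'm) set" where
  "F_stable_hom A L F\<^sub>L M F\<^sub>M =
     {f \<in> module_hom A L M. \<forall>x\<in>carrier L. f (F\<^sub>L x) = F\<^sub>M (f x)}"

text \<open>Used both for \<open>A\<^sup>F\<close> and for \<open>M\<^sup>F\<close>.\<close>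

definition fixed_points :: "('m \<Rightarrow> 'm) \<Rightarrow> ('s, 'm) module \<Rightarrow> ('s, 'm) module" where
  "fixed_points F M = M\<lparr>carrier := {x \<in> carrier M. F x = x}\<rparr>"


section \<open>Frobenius twists\<close>

text \<open>
  The twist only changes the action of \<open>A\<close>; the underlying \<open>K\<close>-space of \<open>M\<^bsup>[1]\<^esup>\<close> is that of \<open>M\<close>,
  and it is equipped with the same Frobenius map. Iterated twists are therefore obtained
  as \<open>twist A F\<^sub>A F\<^sub>M ^^ s\<close> and \<open>hom_twist L F\<^sub>L F\<^sub>M ^^ s\<close>.
\<close>

definition twist ::
  "('k, 'a) module \<Rightarrow> ('a \<Rightarrow> 'a) \<Rightarrow> ('m \<Rightarrow> 'm) \<Rightarrow> ('a, 'm) module \<Rightarrow> ('a, 'm) module" where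
  "twist A F\<^sub>A F\<^sub>M M =
     M\<lparr>smult := (\<lambda>a x. F\<^sub>M (inv_into (carrier A) F\<^sub>A a \<odot>\<^bsub>M\<^esub> inv_into (carrier M) F\<^sub>M x))\<rparr>"

definition hom_twist ::
  "('a, 'l) module \<Rightarrow> ('l \<Rightarrow> 'l) \<Rightarrow> ('m \<Rightarrow> 'm) \<Rightarrow> ('l \<Rightarrow> 'm) \<Rightarrow> ('l \<Rightarrow> 'm)" where
  "hom_twist L F\<^sub>L F\<^sub>M f = F\<^sub>M \<circ> f \<circ> inv_into (carrier L) F\<^sub>L"

definition period ::
  "('k, 'a) module \<Rightarrow> ('a \<Rightarrow> 'a) \<Rightarrow> ('m \<Rightarrow> 'm) \<Rightarrow> ('a, 'm) module \<Rightarrow> nat" where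
  "period A F\<^sub>A F\<^sub>M M = (LEAST r. 1 \<le> r \<and> module_iso A ((twist A F\<^sub>A F\<^sub>M ^^ r) M) M \<noteq> {})"

text \<open>Equality of \<open>A\<close>-modules as structures on the carrier.\<close>

definition same_module :: "('k, 'a) module \<Rightarrow> ('a, 'm) module \<Rightarrow> ('a, 'm) module \<Rightarrow> bool" where
  "same_module A M N \<longleftrightarrow>
     carrier M = carrier N \<and> \<zero>\<^bsub>M\<^esub> = \<zero>\<^bsub>N\<^esub> \<and>
     (\<forall>x\<in>carrier M. \<forall>y\<in>carrier M. x \<oplus>\<^bsub>M\<^esub> y = x \<oplus>\<^bsub>N\<^esub> y) \<and>
     (\<forall>a\<in>carrier A. \<forall>x\<in>carrier M. a \<odot>\<^bsub>M\<^esub> x = a \<odot>\<^bsub>N\<^esub> x)"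


section \<open>The induced morphism and the induced sequence\<close>

text \<open>
  \<open>M'\<close> is an \<open>A\<close>-module on the same \<open>K\<close>-space as \<open>M\<close>, isomorphic to \<open>M\<close> via \<open>\<beta>\<close>, with
  \<open>M'\<^bsup>[r]\<^esup> = M'\<close>. The twist of \<open>M'\<close> uses the Frobenius map given on the common underlying space.
\<close>

definition periodic_replacement ::
  "'k ring \<Rightarrow> ('k, 'a) module \<Rightarrow> ('a \<Rightarrow> 'a) \<Rightarrow> nat \<Rightarrow> ('m \<Rightarrow> 'm) \<Rightarrow>
   ('a, 'm) module \<Rightarrow> ('a, 'm) module \<Rightarrow> ('m \<Rightarrow> 'm) \<Rightarrow> bool" where
  "periodic_replacement K A F\<^sub>A r F\<^sub>M M M' \<beta> \<longleftrightarrow>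
     left_module A M' \<and>
     carrier M' = carrier M \<and> \<zero>\<^bsub>M'\<^esub> = \<zero>\<^bsub>M\<^esub> \<and>
     (\<forall>x\<in>carrier M. \<forall>y\<in>carrier M. x \<oplus>\<^bsub>M'\<^esub> y = x \<oplus>\<^bsub>M\<^esub> y) \<and>
     (\<forall>c\<in>carrier K. \<forall>x\<in>carrier M. c \<odot>\<^bsub>base_space K A M'\<^esub> x = c \<odot>\<^bsub>base_space K A M\<^esub> x) \<and>
     \<beta> \<in> module_iso A M M' \<and>
     same_module A ((twist A F\<^sub>A F\<^sub>M ^^ r) M') M'"

text \<open>
  \<open>\<phi>' = \<beta> \<circ> \<phi> \<circ> \<alpha>\<inverse>\<close> and \<open>\<phi>'\<^bsup>[r]\<^esup> = \<phi>'\<close>, where \<open>\<alpha>\<close> and \<open>\<beta>\<close> are the isomorphisms onto the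
  replacing modules \<open>L'\<close> and \<open>M'\<close>.
\<close>

definition periodic_composite ::
  "nat \<Rightarrow> ('a, 'l) module \<Rightarrow> ('l \<Rightarrow> 'l) \<Rightarrow> ('m \<Rightarrow> 'm) \<Rightarrow> ('l \<Rightarrow> 'm) \<Rightarrow>
   ('l \<Rightarrow> 'l) \<Rightarrow> ('m \<Rightarrow> 'm) \<Rightarrow> ('l \<Rightarrow> 'm) \<Rightarrow> bool" where
  "periodic_composite r L F\<^sub>L F\<^sub>M \<phi> \<alpha> \<beta> \<phi>' \<longleftrightarrow>
     (\<forall>x\<in>carrier L. \<phi>' (\<alpha> x) = \<beta> (\<phi> x)) \<and>
     (\<forall>x\<in>carrier L. (hom_twist L F\<^sub>L F\<^sub>M ^^ r) \<phi>' x = \<phi>' x)"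

text \<open>
  The direct sum of \<open>M, M\<^bsup>[1]\<^esup>, \<dots>, M\<^bsup>[r-1]\<^esup>\<close>; its elements are the \<open>r\<close>-tuples, represented as
  extensional functions on \<^term>\<open>{..<r}\<close>.
\<close>

definition twist_sum ::
  "('k, 'a) module \<Rightarrow> ('a \<Rightarrow> 'a) \<Rightarrow> nat \<Rightarrow> ('m \<Rightarrow> 'm) \<Rightarrow> ('a, 'm) module \<Rightarrow>
   ('a, nat \<Rightarrow> 'm) module" where
  "twist_sum A F\<^sub>A r F\<^sub>M M =
     \<lparr>carrier = (\<Pi>\<^sub>E i\<in>{..<r}. carrier ((twist A F\<^sub>A F\<^sub>M ^^ i) M)),
      monoid.mult = (\<lambda>x y. \<lambda>i\<in>{..<r}. x i \<otimes>\<^bsub>(twist A F\<^sub>A F\<^sub>M ^^ i) M\<^esub> y i),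
      one = (\<lambda>i\<in>{..<r}. \<one>\<^bsub>(twist A F\<^sub>A F\<^sub>M ^^ i) M\<^esub>),
      zero = (\<lambda>i\<in>{..<r}. \<zero>\<^bsub>(twist A F\<^sub>A F\<^sub>M ^^ i) M\<^esub>),
      add = (\<lambda>x y. \<lambda>i\<in>{..<r}. x i \<oplus>\<^bsub>(twist A F\<^sub>A F\<^sub>M ^^ i) M\<^esub> y i),
      smult = (\<lambda>a x. \<lambda>i\<in>{..<r}. a \<odot>\<^bsub>(twist A F\<^sub>A F\<^sub>M ^^ i) M\<^esub> x i)\<rparr>"

definition cyclic_frobenius :: "nat \<Rightarrow> ('m \<Rightarrow> 'm) \<Rightarrow> (nat \<Rightarrow> 'm) \<Rightarrow> (nat \<Rightarrow> 'm)" where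
  "cyclic_frobenius r F x = (\<lambda>i\<in>{..<r}. F (x (if i = 0 then r - 1 else i - 1)))"

definition diag_hom ::
  "nat \<Rightarrow> ('a, 'l) module \<Rightarrow> ('l \<Rightarrow> 'l) \<Rightarrow> ('m \<Rightarrow> 'm) \<Rightarrow> ('l \<Rightarrow> 'm) \<Rightarrow>
   (nat \<Rightarrow> 'l) \<Rightarrow> (nat \<Rightarrow> 'm)" where
  "diag_hom r L F\<^sub>L F\<^sub>M \<phi> x = (\<lambda>i\<in>{..<r}. (hom_twist L F\<^sub>L F\<^sub>M ^^ i) \<phi> (x i))"

text \<open>
  \<open>\<phi>t : Lt \<rightarrow> Mt\<close>, together with the Frobenius maps \<open>GL\<close> and \<open>GM\<close> of \<open>Lt\<close> and \<open>Mt\<close>, is an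
  induced morphism of \<open>\<phi> : L \<rightarrow> M\<close>. The replacements are not unique, so this is a relation.
\<close>

definition induced_morphism ::
  "'k ring \<Rightarrow> ('k, 'a) module \<Rightarrow> ('a \<Rightarrow> 'a) \<Rightarrow>
   ('a, 'l) module \<Rightarrow> ('l \<Rightarrow> 'l) \<Rightarrow> ('a, 'm) module \<Rightarrow> ('m \<Rightarrow> 'm) \<Rightarrow> ('l \<Rightarrow> 'm) \<Rightarrow>
   ('a, nat \<Rightarrow> 'l) module \<Rightarrow> ((nat \<Rightarrow> 'l) \<Rightarrow> nat \<Rightarrow> 'l) \<Rightarrow>
   ('a, nat \<Rightarrow> 'm) module \<Rightarrow> ((nat \<Rightarrow> 'm) \<Rightarrow> nat \<Rightarrow> 'm) \<Rightarrow>
   ((nat \<Rightarrow> 'l) \<Rightarrow> nat \<Rightarrow> 'm) \<Rightarrow> bool" where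
  "induced_morphism K A F\<^sub>A L F\<^sub>L M F\<^sub>M \<phi> Lt GL Mt GM \<phi>t \<longleftrightarrow>
     (let r = period A F\<^sub>A F\<^sub>M M in
      \<exists>L' \<alpha> M' \<beta> \<phi>'.
        periodic_replacement K A F\<^sub>A r F\<^sub>L L L' \<alpha> \<and>
        periodic_replacement K A F\<^sub>A r F\<^sub>M M M' \<beta> \<and>
        periodic_composite r L F\<^sub>L F\<^sub>M \<phi> \<alpha> \<beta> \<phi>' \<and>
        Lt = twist_sum A F\<^sub>A r F\<^sub>L L' \<and> GL = cyclic_frobenius r F\<^sub>L \<and>
        Mt = twist_sum A F\<^sub>A r F\<^sub>M M' \<and> GM = cyclic_frobenius r F\<^sub>M \<and>
        \<phi>t = diag_hom r L' F\<^sub>L F\<^sub>M \<phi>')"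

text \<open>The number of summands of all three modules is the period of \<open>M\<close>.\<close>

definition induced_sequence ::
  "'k ring \<Rightarrow> ('k, 'a) module \<Rightarrow> ('a \<Rightarrow> 'a) \<Rightarrow>
   ('a, 'n) module \<Rightarrow> ('n \<Rightarrow> 'n) \<Rightarrow> ('a, 'l) module \<Rightarrow> ('l \<Rightarrow> 'l) \<Rightarrow>
   ('a, 'm) module \<Rightarrow> ('m \<Rightarrow> 'm) \<Rightarrow> ('n \<Rightarrow> 'l) \<Rightarrow> ('l \<Rightarrow> 'm) \<Rightarrow>
   ('a, nat \<Rightarrow> 'n) module \<Rightarrow> ((nat \<Rightarrow> 'n) \<Rightarrow> nat \<Rightarrow> 'n) \<Rightarrow>
   ('a, nat \<Rightarrow> 'l) module \<Rightarrow> ((nat \<Rightarrow> 'l) \<Rightarrow> nat \<Rightarrow> 'l) \<Rightarrow>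
   ('a, nat \<Rightarrow> 'm) module \<Rightarrow> ((nat \<Rightarrow> 'm) \<Rightarrow> nat \<Rightarrow> 'm) \<Rightarrow>
   ((nat \<Rightarrow> 'n) \<Rightarrow> nat \<Rightarrow> 'l) \<Rightarrow> ((nat \<Rightarrow> 'l) \<Rightarrow> nat \<Rightarrow> 'm) \<Rightarrow> bool" where
  "induced_sequence K A F\<^sub>A N F\<^sub>N L F\<^sub>L M F\<^sub>M \<psi> \<phi> Nt GN Lt GL Mt GM \<psi>t \<phi>t \<longleftrightarrow>
     (let r = period A F\<^sub>A F\<^sub>M M in
      \<exists>N' \<nu> L' \<alpha> M' \<beta> \<psi>' \<phi>'.
        periodic_replacement K A F\<^sub>A r F\<^sub>N N N' \<nu> \<and>
        periodic_replacement K A F\<^sub>A r F\<^sub>L L L' \<alpha> \<and>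
        periodic_replacement K A F\<^sub>A r F\<^sub>M M M' \<beta> \<and>
        periodic_composite r N F\<^sub>N F\<^sub>L \<psi> \<nu> \<alpha> \<psi>' \<and>
        periodic_composite r L F\<^sub>L F\<^sub>M \<phi> \<alpha> \<beta> \<phi>' \<and>
        Nt = twist_sum A F\<^sub>A r F\<^sub>N N' \<and> GN = cyclic_frobenius r F\<^sub>N \<and>
        Lt = twist_sum A F\<^sub>A r F\<^sub>L L' \<and> GL = cyclic_frobenius r F\<^sub>L \<and>
        Mt = twist_sum A F\<^sub>A r F\<^sub>M M' \<and> GM = cyclic_frobenius r F\<^sub>M \<and>
        \<psi>t = diag_hom r N' F\<^sub>N F\<^sub>L \<psi>' \<and>
        \<phi>t = diag_hom r L' F\<^sub>L F\<^sub>M \<phi>')"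


section \<open>Independence of the type of test modules\<close>

lemma base_space_simps [simp]:
  "carrier (base_space K A M) = carrier M" "\<zero>\<^bsub>base_space K A M\<^esub> = \<zero>\<^bsub>M\<^esub>"
  "x \<oplus>\<^bsub>base_space K A M\<^esub> y = x \<oplus>\<^bsub>M\<^esub> y"
  "c \<odot>\<^bsub>base_space K A M\<^esub> x = (c \<odot>\<^bsub>A\<^esub> \<one>\<^bsub>A\<^esub>) \<odot>\<^bsub>M\<^esub> x"
  by (simp_all add: base_space_def)

lemma vectorspace_base_space:
  assumes A: "fd_algebra K A" and M: "left_module A M"
  shows "vectorspace K (base_space K A M)"
proof -
  interpret A: vectorspace K A using A by (simp add: fd_algebra_def)
  interpret M: left_module A M by fact
  have A2: "\<And>c x y. \<lbrakk>c \<in> carrier K; x \<in> carrier A; y \<in> carrier A\<rbrakk> \<Longrightarrow>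
      (c \<odot>\<^bsub>A\<^esub> x) \<otimes>\<^bsub>A\<^esub> y = c \<odot>\<^bsub>A\<^esub> (x \<otimes>\<^bsub>A\<^esub> y)"
    using A by (auto simp: fd_algebra_def)
  have eq: "(c \<otimes>\<^bsub>K\<^esub> d) \<odot>\<^bsub>A\<^esub> \<one>\<^bsub>A\<^esub> = (c \<odot>\<^bsub>A\<^esub> \<one>\<^bsub>A\<^esub>) \<otimes>\<^bsub>A\<^esub> (d \<odot>\<^bsub>A\<^esub> \<one>\<^bsub>A\<^esub>)"
    if "c \<in> carrier K" "d \<in> carrier K" for c d
    using that by (simp add: A2 A.smult_assoc1 M.A.l_one)
  have ab: "abelian_group (base_space K A M)"
  proof (rule abelian_groupI)
    fix x y z
    assume "x \<in> carrier (base_space K A M)" "y \<in> carrier (base_space K A M)"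
      "z \<in> carrier (base_space K A M)"
    then show "x \<oplus>\<^bsub>base_space K A M\<^esub> y \<oplus>\<^bsub>base_space K A M\<^esub> z =
        x \<oplus>\<^bsub>base_space K A M\<^esub> (y \<oplus>\<^bsub>base_space K A M\<^esub> z)"
      by (simp add: M.M.a_assoc)
  next
    fix x y
    assume "x \<in> carrier (base_space K A M)" "y \<in> carrier (base_space K A M)"
    then show "x \<oplus>\<^bsub>base_space K A M\<^esub> y = y \<oplus>\<^bsub>base_space K A M\<^esub> x"
      by (simp add: M.M.a_comm)
  next
    fix x
    assume "x \<in> carrier (base_space K A M)"
    then show "\<exists>y\<in>carrier (base_space K A M). y \<oplus>\<^bsub>base_space K A M\<^esub> x = \<zero>\<^bsub>base_space K A M\<^esub>"
      by (auto intro!: bexI[of _ "\<ominus>\<^bsub>M\<^esub> x"] simp: M.M.l_neg)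
  qed auto
  have "module K (base_space K A M)"
    by (rule moduleI)
      (auto simp: A.R.cring_axioms ab eq M.lm_closed M.lm_l_distr M.lm_r_distr M.lm_assoc
        M.lm_one A.smult_l_distr intro: A.R.is_cring)
  then show ?thesis
    by (simp add: vectorspace_def A.field_axioms)
qed

lemma left_module_transport:
  fixes N :: "('a, 'n) module"
  assumes M: "left_module A M" and e: "bij_betw e (carrier M) (carrier N)"
    and add: "\<And>x y. \<lbrakk>x \<in> carrier M; y \<in> carrier M\<rbrakk> \<Longrightarrow> e (x \<oplus>\<^bsub>M\<^esub> y) = e x \<oplus>\<^bsub>N\<^esub> e y"
    and zero: "e \<zero>\<^bsub>M\<^esub> = \<zero>\<^bsub>N\<^esub>"
    and smult: "\<And>a x. \<lbrakk>a \<in> carrier A; x \<in> carrier M\<rbrakk> \<Longrightarrow> e (a \<odot>\<^bsub>M\<^esub> x) = a \<odot>\<^bsub>N\<^esub> e x"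
  shows "left_module A N"
proof -
  interpret M: left_module A M by fact
  have car: "carrier N = e ` carrier M" using e by (simp add: bij_betw_def)
  have "abelian_group N"
  proof (rule abelian_groupI)
    fix x assume "x \<in> carrier N"
    then obtain u where u: "u \<in> carrier M" "x = e u" using car by auto
    then show "\<exists>y\<in>carrier N. y \<oplus>\<^bsub>N\<^esub> x = \<zero>\<^bsub>N\<^esub>"
      by (metis M.M.a_inv_closed M.M.l_neg add car imageI zero)
  qed (auto simp: car add[symmetric] zero[symmetric] M.M.a_ac)
  moreover have "left_module_axioms A N"
    by unfold_locales
      (auto simp: car add[symmetric] smult[symmetric] M.lm_closed M.lm_l_distr M.lm_r_distr
        M.lm_assoc M.lm_one)
  ultimately show ?thesis
    by (simp add: left_module_def M.A.ring_axioms)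
qed

lemma fd_module_iso_standard:
  fixes K :: "'k ring" and M :: "('a, 'm) module"
  assumes A: "fd_algebra K A" and M: "fd_module K A M"
  obtains N :: "('a, nat \<Rightarrow> 'k) module" and e where "fd_module K A N" "e \<in> module_iso A M N"
proof -
  interpret A: vectorspace K A using A by (simp add: fd_algebra_def)
  interpret M: left_module A M using M by (simp add: fd_module_def)
  interpret V: vectorspace K "base_space K A M"
    by (rule vectorspace_base_space[OF A M.left_module_axioms])
  have fd: "V.fin_dim" using M by (simp add: fd_module_def)
  then obtain B where B: "finite B" "B \<subseteq> carrier M" "V.span B = carrier M"
    by (auto simp: V.fin_dim_def)
  have "\<exists>a. a \<in> B \<rightarrow> carrier K \<and> x = V.lincomb a B" if "x \<in> carrier M" for x
  proof -
    have "V.span B = {V.lincomb a B |a. a \<in> B \<rightarrow> carrier K}"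
      using B by (intro V.finite_span) simp_all
    then have "x \<in> {V.lincomb a B |a. a \<in> B \<rightarrow> carrier K}" using that B(3) by metis
    then show ?thesis by blast
  qed
  then obtain c where c: "\<And>x. x \<in> carrier M \<Longrightarrow> c x \<in> B \<rightarrow> carrier K"
    "\<And>x. x \<in> carrier M \<Longrightarrow> x = V.lincomb (c x) B"
    by metis
  obtain b where b: "bij_betw b {..<card B} B"
    using B(1) ex_bij_betw_nat_finite lessThan_atLeast0 by metis
  define e where "e x = (\<lambda>i. if i < card B then c x (b i) else undefined)" for x
  have inj: "inj_on e (carrier M)"
  proof (rule inj_onI)
    fix x y assume xy: "x \<in> carrier M" "y \<in> carrier M" "e x = e y"
    have eq: "c x v = c y v" if "v \<in> B" for v
    proof -
      have "v \<in> b ` {..<card B}" using b that by (simp add: bij_betw_def)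
      then obtain i where "i < card B" "v = b i" by blast
      then show ?thesis using fun_cong[OF xy(3), of i] by (simp add: e_def)
    qed
    have "V.lincomb (c x) B = V.lincomb (c y) B"
      unfolding V.lincomb_def
    proof (rule V.M.finsum_cong'[OF refl])
      show "(\<lambda>v. c y v \<odot>\<^bsub>base_space K A M\<^esub> v) \<in> B \<rightarrow> carrier (base_space K A M)"
        using B(2) c(1)[OF xy(2)] by (intro Pi_I V.smult_closed) auto
    qed (simp add: eq)
    then show "x = y" using c(2) xy by metis
  qed
  define d where "d = inv_into (carrier M) e"
  have d [simp]: "d (e x) = x" if "x \<in> carrier M" for x
    using inj that by (simp add: d_def)
  define N :: "('a, nat \<Rightarrow> 'k) module" where
    "N = \<lparr>carrier = e ` carrier M, monoid.mult = undefined, one = undefined, zero = e \<zero>\<^bsub>M\<^esub>,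
      add = (\<lambda>u v. e (d u \<oplus>\<^bsub>M\<^esub> d v)), smult = (\<lambda>a u. e (a \<odot>\<^bsub>M\<^esub> d u))\<rparr>"
  have bij: "bij_betw e (carrier M) (carrier N)"
    using inj by (simp add: bij_betw_def N_def)
  have add: "e (x \<oplus>\<^bsub>M\<^esub> y) = e x \<oplus>\<^bsub>N\<^esub> e y" if "x \<in> carrier M" "y \<in> carrier M" for x y
    using that by (simp add: N_def)
  have smult: "e (a \<odot>\<^bsub>M\<^esub> x) = a \<odot>\<^bsub>N\<^esub> e x" if "x \<in> carrier M" for a x
    using that by (simp add: N_def)
  have N: "left_module A N"
    by (rule left_module_transport[OF M.left_module_axioms bij add _ smult]) (simp_all add: N_def)
  have e: "e \<in> module_hom A M N"
    using bij by (auto simp: module_hom_def add smult dest: bij_betwE)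
  interpret W: vectorspace K "base_space K A N"
    by (rule vectorspace_base_space[OF A N])
  have "e \<in> module_hom K (base_space K A M) (base_space K A N)"
    using bij by (auto simp: module_hom_def add smult dest: bij_betwE)
  then interpret E: linear_map K "base_space K A M" "base_space K A N" e
    by unfold_locales
  have "W.fin_dim"
    by (rule E.surj_fin_dim[OF fd]) (use bij in \<open>simp add: bij_betw_def\<close>)
  then have "fd_module K A N" using N by (simp add: fd_module_def)
  moreover have "e \<in> module_iso A M N" using e bij by (simp add: module_iso_def)
  ultimately show thesis by (rule that)
qed

lemma module_iso_inv_into:
  assumes M: "left_module A M" and e: "e \<in> module_iso A M N"
  shows "inv_into (carrier M) e \<in> module_hom A N M"
proof -
  interpret M: left_module A M by fact
  have bij: "bij_betw e (carrier M) (carrier N)" and hom: "e \<in> module_hom A M N"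
    using e by (auto simp: module_iso_def)
  let ?d = "inv_into (carrier M) e"
  have d: "?d u \<in> carrier M" "e (?d u) = u" if "u \<in> carrier N" for u
    using bij that by (auto simp: bij_betw_def inv_into_into f_inv_into_f)
  have de: "?d (e x) = x" if "x \<in> carrier M" for x
    using bij that by (simp add: bij_betw_def)
  have "?d (u \<oplus>\<^bsub>N\<^esub> v) = ?d u \<oplus>\<^bsub>M\<^esub> ?d v" if "u \<in> carrier N" "v \<in> carrier N" for u v
    using d that de module_hom_add[OF hom, of "?d u" "?d v"] by (metis M.M.a_closed)
  moreover have "?d (a \<odot>\<^bsub>N\<^esub> u) = a \<odot>\<^bsub>M\<^esub> ?d u" if "a \<in> carrier A" "u \<in> carrier N" for a u
    using d that de module_hom_smult[OF hom, of a "?d u"] by (metis M.lm_closed)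
  ultimately show ?thesis
    using d by (auto simp: module_hom_def)
qed

lemma module_hom_comp:
  "\<lbrakk>f \<in> module_hom A M N; g \<in> module_hom A N P\<rbrakk> \<Longrightarrow> g \<circ> f \<in> module_hom A M P"
  by (auto simp: module_hom_def Pi_def)

lemma minimal_right_almost_split_factors:
  fixes K :: "'k ring" and Y :: "('a, 'y) module"
  assumes A: "fd_algebra K A" and \<phi>: "minimal_right_almost_split K A L M \<phi>"
    and Y: "fd_module K A Y" and f: "f \<in> module_hom A Y M" and nse: "\<not> split_epi A Y M f"
  shows "\<exists>g\<in>module_hom A Y L. \<forall>x\<in>carrier Y. f x = \<phi> (g x)"
proof -
  obtain T :: "('a, nat \<Rightarrow> 'k) module" and e where T: "fd_module K A T" and e: "e \<in> module_iso A Y T"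
    using fd_module_iso_standard[OF A Y] .
  have lmY: "left_module A Y" using Y by (simp add: fd_module_def)
  have eh: "e \<in> module_hom A Y T" and bij: "bij_betw e (carrier Y) (carrier T)"
    using e by (auto simp: module_iso_def)
  define d where "d = inv_into (carrier Y) e"
  have dh: "d \<in> module_hom A T Y" unfolding d_def by (rule module_iso_inv_into[OF lmY e])
  have de: "d (e x) = x" if "x \<in> carrier Y" for x
    using bij that by (simp add: bij_betw_def d_def)
  have "\<not> split_epi A T M (f \<circ> d)"
  proof
    assume "split_epi A T M (f \<circ> d)"
    then obtain s where "s \<in> module_hom A M T" "\<forall>x\<in>carrier M. f (d (s x)) = x"
      by (auto simp: split_epi_def)
    then have "split_epi A Y M f"
      unfolding split_epi_def by (intro bexI[of _ "d \<circ> s"] module_hom_comp[OF _ dh]) auto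
    with nse show False ..
  qed
  then obtain g where g: "g \<in> module_hom A T L" "\<forall>x\<in>carrier T. (f \<circ> d) x = \<phi> (g x)"
    using \<phi> T module_hom_comp[OF dh f] unfolding minimal_right_almost_split_def by blast
  show ?thesis
  proof (intro bexI[of _ "g \<circ> e"] ballI module_hom_comp[OF eh g(1)])
    fix x assume "x \<in> carrier Y"
    then show "f x = \<phi> ((g \<circ> e) x)"
      using g(2)[rule_format, of "e x"] de bij_betwE[OF bij] by simp
  qed
qed

end

theory Submission
  imports Defs
begin

text \<open>Write \<open>r\<close> for the period of \<open>M\<close>. An isomorphism \<open>M\<^bsup>[r]\<^esup> \<cong> M\<close> is a semilinear bijection \<open>\<theta>\<close> of \<open>M\<close> with finite
  orbits, and by Lang's theorem the \<open>F\<close>-fixed points of \<open>M\<^bsup>[0]\<^esup> \<oplus> \<dots> \<oplus> M\<^bsup>[r-1]\<^esup>\<close> are isomorphic to \<open>M\<^sup>\<theta>\<close>. An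
  \<open>A\<^sup>F\<close>-homomorphism on \<open>M\<^sup>\<theta>\<close> is a sum of \<open>r\<close> components that extend to semilinear maps of degree
  \<open>0, \<dots>, r - 1\<close> on \<open>M\<close>. By minimality of \<open>r\<close> and locality of \<open>End M\<close>, components of positive degree of an
  endomorphism are not invertible, and Gaussian elimination reduces invertibility over \<open>A\<^sup>F\<close> to the
  component of degree \<open>0\<close>. Factorisations descend by traces, since some scalar has trace \<open>1\<close>. An almost
  split morphism \<open>\<phi> : L \<rightarrow> M\<close> intertwines \<open>\<theta>\<close> with such a semilinear bijection of \<open>L\<close>, because \<open>\<theta> \<circ> \<phi>\<close> factors
  through \<open>\<phi>\<close>. Conversely, the end term of an almost split sequence over \<open>A\<^sup>F\<close> is \<open>M\<^sup>\<theta>\<close> for an indecomposable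
  summand \<open>M\<close> of its scalar extension.\<close>

section \<open>Finite subfields of an algebraically closed field\<close>


text \<open>An \<open>AF\<close>-homomorphism from \<open>M\<^sup>\<theta>\<close> to an
  \<open>A\<close>-module is the same as an \<open>A\<close>-homomorphism from the scalar extension
  of \<open>M\<^sup>\<theta>\<close>. That extension is the sum of the twists of degree 0 to r - 1,
  because the field with q^r elements, tensored with itself over the field with q elements, splits
  into r copies. This is the origin of the r components. Tensor products and dual bases are replaced
  by one orthogonality relation, \<open>units_fixed_sum\<close>: it recovers a vector from its
  traces (\<open>tr_expand\<close>) and projects onto components (\<open>hpart\<close>). A second
  recurring device is that a semilinear map commutes with a power of a Frobenius map, hence acts on
  a finite set of fixed vectors that spans the space; idempotent powers and finite orbits are found
  by counting there. The converse meets an obstacle: an \<open>A\<close>-homomorphism need not map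
  fixed points to fixed points, only its traces do. Each trace is treated separately, and the
  orthogonality relation puts the results together with the weights
  \<open>\<ominus> (inv c)\<close>.\<close>

lemma (in field) pow_card:
  assumes fin: "finite (carrier R)" and x: "x \<in> carrier R"
  shows "x [^] card (carrier R) = x"
proof -
  have c: "card (carrier R) > 0" using fin x by (auto simp: card_gt_0_iff)
  show ?thesis
  proof (cases "x = \<zero>")
    case True then show ?thesis using c by (simp add: nat_pow_zero)
  next
    case False
    interpret G: group "Multiplicative_Group.mult_of R" by (rule field_mult_group)
    have "order (Multiplicative_Group.mult_of R) = card (carrier R) - 1" using fin by (simp add: order_def)
    then have "x [^] (card (carrier R) - 1) = \<one>" using G.pow_order_eq_1[of x] x False by (simp add: Multiplicative_Group.nat_pow_mult_of)
    then have "x [^] Suc (card (carrier R) - 1) = x" using x by simp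
    then show ?thesis using c by simp
  qed
qed

text \<open>On a field with m elements the polynomial X^m - X + 1 takes only the value one, by
  \<open>pow_card\<close>, so it would have no root.\<close>

lemma (in algebraically_closed) infinite_carrier: "infinite (carrier L)"
proof
  assume fin: "finite (carrier L)"
  define m where "m = card (carrier L)"
  have m2: "m > 1"
    using fin card_mono[OF fin, of "{\<zero>, \<one>}"] zero_not_one by (simp add: m_def)
  define p where "p = \<one> # replicate (m - 2) \<zero> @ [\<ominus> \<one>, \<one>]"
  have p: "p \<in> carrier (poly_ring L)"
    by (auto simp: p_def univ_poly_carrier[symmetric] polynomial_def set_replicate_conv_if)
  have deg: "degree p = m" using m2 by (simp add: p_def)
  have pow: "x [^] m = x" if "x \<in> carrier L" for x using pow_card[OF fin that] by (simp add: m_def)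
  have ev: "eval p x = \<one>" if x: "x \<in> carrier L" for x
  proof -
    have "m = Suc (Suc (m - 2))" using m2 by simp
    from arg_cong[OF this, of "\<lambda>n. x [^] n"] have "x [^] (m - 2) \<otimes> x \<otimes> x = x [^] m" by simp
    then have "eval p x = x [^] m \<oplus> eval ([\<ominus> \<one>, \<one>]) x"
      using x m2 eval_replicate[of "[\<ominus> \<one>, \<one>]" x "m - 2"] by (simp add: p_def)
    also have "\<dots> = \<one>" using x pow[OF x] by (simp add: l_minus) algebra
    finally show ?thesis .
  qed
  have "size (roots p) = m" using roots_over_carrier[OF p] deg by (simp add: splitted_def)
  then obtain a where "a \<in># roots p" using m2 by (metis gr_implies_not0 multiset_nonemptyE size_empty)
  then have "is_root p a" using roots_mem_iff_is_root[OF p] by simp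
  then have "a \<in> carrier L" "eval p a = \<zero>" by (simp_all add: is_root_def)
  then show False using ev zero_not_one by simp
qed

text \<open>Additivity of the q-th power stands in for a statement on the characteristic. It is
  later read off from the Frobenius morphism, which raises the coefficients of multiples of the unit
  of \<open>A\<close> to the q-th power.\<close>

locale frobenius_field = algebraically_closed L for L (structure) +
  fixes q :: nat
  assumes q_gt_1: "1 < q"
    and frob_add: "\<lbrakk>x \<in> carrier L; y \<in> carrier L\<rbrakk> \<Longrightarrow> (x \<oplus> y) [^] q = x [^] q \<oplus> y [^] q"
begin

text \<open>For \<open>n > 0\<close> this is the field with q^n elements
  (\<open>card_fixed\<close>); \<open>fixed 0\<close> is the whole field.\<close>

definition fixed :: "nat \<Rightarrow> 'a set" where
  "fixed n = {c \<in> carrier L. c [^] (q ^ n) = c}"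

definition units_fixed :: "nat \<Rightarrow> 'a set" where
  "units_fixed n = fixed n - {\<zero>}"

lemma fixed_closed: "c \<in> fixed n \<Longrightarrow> c \<in> carrier L"
  by (simp add: fixed_def)

lemma units_fixed_closed: "c \<in> units_fixed n \<Longrightarrow> c \<in> carrier L"
  by (auto simp: units_fixed_def fixed_closed)

lemma q_pow_pos [simp]: "0 < q ^ n"
  using q_gt_1 by simp

lemma pow_q_Suc: "x \<in> carrier L \<Longrightarrow> x [^] (q ^ Suc n) = (x [^] (q ^ n)) [^] q"
  by (simp add: nat_pow_pow mult.commute)

lemma pow_q_add: "x \<in> carrier L \<Longrightarrow> x [^] (q ^ (m + n)) = (x [^] (q ^ m)) [^] (q ^ n)"
  by (simp add: nat_pow_pow power_add)

lemma frob_pow_add: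
  "\<lbrakk>x \<in> carrier L; y \<in> carrier L\<rbrakk> \<Longrightarrow> (x \<oplus> y) [^] (q ^ n) = x [^] (q ^ n) \<oplus> y [^] (q ^ n)"
  by (induction n) (simp_all add: pow_q_Suc frob_add del: power_Suc)

lemma frob_pow_zero: "\<zero> [^] (q ^ n) = \<zero>"
  using q_pow_pos[of n] by (intro nat_pow_zero) simp

lemma frob_pow_minus: "x \<in> carrier L \<Longrightarrow> (\<ominus> x) [^] (q ^ n) = \<ominus> (x [^] (q ^ n))"
  using frob_pow_add[of "\<ominus> x" x n] by (simp add: l_neg frob_pow_zero minus_equality)

lemma frob_pow_diff:
  "\<lbrakk>x \<in> carrier L; y \<in> carrier L\<rbrakk> \<Longrightarrow> (x \<ominus> y) [^] (q ^ n) = x [^] (q ^ n) \<ominus> y [^] (q ^ n)"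
  by (simp add: minus_eq frob_pow_add frob_pow_minus)

lemma frob_pow_finsum:
  "\<lbrakk>finite I; f \<in> I \<rightarrow> carrier L\<rbrakk> \<Longrightarrow> (\<Oplus>i\<in>I. f i) [^] (q ^ n) = (\<Oplus>i\<in>I. f i [^] (q ^ n))"
proof (induction I rule: finite_induct)
  case empty then show ?case by (simp add: frob_pow_zero)
next
  case (insert i I)
  then have "(\<lambda>i. f i [^] (q ^ n)) \<in> I \<rightarrow> carrier L" "f \<in> I \<rightarrow> carrier L" "f i \<in> carrier L" by auto
  with insert show ?case by (simp add: frob_pow_add)
qed

text \<open>It suffices that X^Q - X, with Q = q^n, has simple roots. At a double root a, additivity
  of the power gives (x - a)^Q - (x - a) = (x - a)^2 g(x). Division by x - a yields a polynomial
  with infinitely many zeros whose value at a is one.\<close>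

lemma card_fixed:
  assumes n: "n > 0" shows "finite (fixed n)" "card (fixed n) = q ^ n"
proof -
  define Q where "Q = q ^ n"
  have Q2: "Q > 1" unfolding Q_def using q_gt_1 n by (rule one_less_power)
  \<comment> \<open>The coefficient list of X^Q - X.\<close>
  define p where "p = \<one> # replicate (Q - 2) \<zero> @ [\<ominus> \<one>, \<zero>]"
  interpret UP: domain "poly_ring L" using univ_poly_is_domain[OF carrier_is_subring] .
  have p: "p \<in> carrier (poly_ring L)"
    by (auto simp: p_def univ_poly_carrier[symmetric] polynomial_def set_replicate_conv_if)
  have pne: "p \<noteq> []" by (simp add: p_def)
  have deg: "degree p = Q" using Q2 by (simp add: p_def)
  have ev: "eval p x = x [^] Q \<ominus> x" if x: "x \<in> carrier L" for x
  proof -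
    have "Q = Suc (Suc (Q - 2))" using Q2 by simp
    from arg_cong[OF this, of "\<lambda>n. x [^] n"] have "x [^] (Q - 2) \<otimes> x \<otimes> x = x [^] Q" by simp
    then have "eval p x = x [^] Q \<oplus> eval ([\<ominus> \<one>, \<zero>]) x"
      using x Q2 eval_replicate[of "[\<ominus> \<one>, \<zero>]" x "Q - 2"] by (simp add: p_def)
    also have "\<dots> = x [^] Q \<ominus> x" using x by (simp add: l_minus minus_eq)
    finally show ?thesis .
  qed
  have root: "is_root p a \<longleftrightarrow> a \<in> fixed n" for a
    using pne by (auto simp: is_root_def fixed_def ev Q_def[symmetric])
  then have set_roots: "set_mset (roots p) = fixed n"
    using roots_mem_iff_is_root[OF p] by auto
  then show fin: "finite (fixed n)" by (metis finite_set_mset)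
  have mult: "count (roots p) a \<le> 1" if a: "a \<in> carrier L" for a
  proof (rule ccontr)
    assume multiple: "\<not> ?thesis"
    then have "alg_mult p a \<ge> 2" using alg_mult_eq_count_roots[OF p] by simp
    then have dvd: "[\<one>, \<ominus> a] [^]\<^bsub>poly_ring L\<^esub> (2::nat) pdivides p"
      using le_alg_mult_imp_pdivides[OF a p] by simp
    define l where "l = [\<one>, \<ominus> a]"
    have l: "l \<in> carrier (poly_ring L)" using a by (simp add: l_def univ_poly_carrier[symmetric] polynomial_def)
    have evl: "eval l x = x \<ominus> a" if "x \<in> carrier L" for x using that a by (simp add: l_def minus_eq)
    obtain g where g: "g \<in> carrier (poly_ring L)" "p = (l \<otimes>\<^bsub>poly_ring L\<^esub> l) \<otimes>\<^bsub>poly_ring L\<^esub> g"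
      using dvd l unfolding pdivides_def factor_def
      by (auto simp: l_def[symmetric] numeral_2_eq_2)
    have "a \<in> fixed n"
      using multiple root roots_mem_iff_is_root[OF p, of a] by (metis count_inI le0 zero_le_one)
    then have aQ: "a [^] Q = a" by (simp add: fixed_def Q_def)
    \<comment> \<open>With y = x - a, the equation y^2 g(x) = y^Q - y divided by y says that h(x) =
      0 for x different from a, while h(a) = 1 because Q - 1 is positive.\<close>
    define h where "h = (l \<otimes>\<^bsub>poly_ring L\<^esub> g) \<ominus>\<^bsub>poly_ring L\<^esub> (l [^]\<^bsub>poly_ring L\<^esub> (Q - 1)) \<oplus>\<^bsub>poly_ring L\<^esub> \<one>\<^bsub>poly_ring L\<^esub>"
    have h: "h \<in> carrier (poly_ring L)" using l g by (simp add: h_def)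
    have hom: "ring_hom_cring (poly_ring L) L (\<lambda>p. eval p x)" if "x \<in> carrier L" for x
      using eval_cring_hom[OF carrier_is_subring that] .
    have evh: "eval h x = (x \<ominus> a) \<otimes> eval g x \<ominus> (x \<ominus> a) [^] (Q - 1) \<oplus> \<one>" if x: "x \<in> carrier L" for x
    proof -
      interpret H: ring_hom_cring "poly_ring L" L "\<lambda>p. eval p x" by (rule hom[OF x])
      have "eval (l [^]\<^bsub>poly_ring L\<^esub> m) x = (x \<ominus> a) [^] m" for m :: nat
        using l x by (induction m) (simp_all add: evl)
      then show ?thesis using l g by (simp add: h_def evl[OF x] minus_eq UP.minus_eq)
    qed
    have evg: "eval g x \<in> carrier L" if x: "x \<in> carrier L" for x
    proof -
      interpret H: ring_hom_cring "poly_ring L" L "\<lambda>p. eval p x" by (rule hom[OF x])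
      show ?thesis using g by simp
    qed
    have h0: "eval h x = \<zero>" if x: "x \<in> carrier L" "x \<noteq> a" for x
    proof -
      interpret H: ring_hom_cring "poly_ring L" L "\<lambda>p. eval p x" by (rule hom[OF x(1)])
      define y where "y = x \<ominus> a"
      have y: "y \<in> carrier L" "y \<noteq> \<zero>" using x a by (auto simp: y_def)
      have "y \<otimes> (y \<otimes> eval g x) = eval p x"
        using g l a x y evg by (simp add: g(2) evl y_def[symmetric] m_assoc)
      also have "\<dots> = y [^] Q \<ominus> y"
      proof -
        have cancel: "(u \<ominus> a) \<ominus> (x \<ominus> a) = u \<ominus> x" if "u \<in> carrier L" for u
          using that x a by algebra
        have "y [^] Q = x [^] Q \<ominus> a"
          using x a aQ by (simp add: y_def frob_pow_diff Q_def)
        then show ?thesis using x by (simp add: ev y_def cancel)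
      qed
      also have "y [^] Q = y \<otimes> y [^] (Q - 1)"
        using y Q2 nat_pow_Suc2[of y "Q - 1"] by simp
      also have "y \<otimes> y [^] (Q - 1) \<ominus> y = y \<otimes> (y [^] (Q - 1) \<ominus> \<one>)"
      proof -
        have "y \<otimes> u \<ominus> y = y \<otimes> (u \<ominus> \<one>)" if "u \<in> carrier L" for u
          using that y(1) by algebra
        then show ?thesis using y by simp
      qed
      finally have "y \<otimes> eval g x = y [^] (Q - 1) \<ominus> \<one>"
        using y x evg by (metis m_closed m_lcancel minus_closed nat_pow_closed one_closed)
      moreover have "u \<ominus> \<one> \<ominus> u \<oplus> \<one> = \<zero>" if "u \<in> carrier L" for u
        using that by (simp add: minus_eq a_assoc) (simp add: a_assoc[symmetric] r_neg a_comm l_neg)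
      moreover have "y [^] (Q - 1) \<in> carrier L" using y by simp
      ultimately show ?thesis
        using evh[OF x(1)] unfolding y_def[symmetric] by simp
    qed
    show False
    proof (cases "h = []")
      case True
      have "eval h a = \<one>"
        using Q2 a evg[OF a] by (simp add: evh r_neg minus_eq nat_pow_zero)
      then show False using True by simp
    next
      case False
      then have "carrier L - {a} \<subseteq> {x. is_root h x}" using h0 by (auto simp: is_root_def)
      then have "finite (carrier L - {a})" using finite_number_of_roots[OF h] finite_subset by blast
      then show False using infinite_carrier by simp
    qed
  qed
  have "count (roots p) a = (if a \<in> fixed n then 1 else 0)" for a
  proof (cases "a \<in> fixed n")
    case True
    then have "count (roots p) a > 0" unfolding count_greater_zero_iff set_roots by simp
    then have "count (roots p) a = 1" using mult[OF fixed_closed[OF True]] by linarith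
    then show ?thesis using True by simp
  next
    case False
    then show ?thesis unfolding set_roots[symmetric] by (simp add: not_in_iff)
  qed
  then have "roots p = mset_set (fixed n)"
    using fin by (intro multiset_eqI) simp
  then have "size (roots p) = card (fixed n)" by simp
  then show "card (fixed n) = q ^ n"
    using roots_over_carrier[OF p] deg by (simp add: splitted_def Q_def)
qed

lemma fixed_ring_closed:
  shows "\<zero> \<in> fixed n" "\<one> \<in> fixed n"
    and "\<lbrakk>x \<in> fixed n; y \<in> fixed n\<rbrakk> \<Longrightarrow> x \<oplus> y \<in> fixed n"
    and "\<lbrakk>x \<in> fixed n; y \<in> fixed n\<rbrakk> \<Longrightarrow> x \<otimes> y \<in> fixed n"
    and "x \<in> fixed n \<Longrightarrow> \<ominus> x \<in> fixed n"
  by (auto simp: fixed_def frob_pow_zero frob_pow_add frob_pow_minus nat_pow_distrib)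

lemma units_fixed_inv: "x \<in> units_fixed n \<Longrightarrow> inv x \<in> units_fixed n"
proof -
  assume "x \<in> units_fixed n"
  then have x: "x \<in> carrier L" "x \<noteq> \<zero>" "x [^] (q ^ n) = x" by (auto simp: units_fixed_def fixed_def)
  then have u: "x \<in> Units L" by (simp add: field_Units)
  have "(inv x) [^] (q ^ n) \<otimes> x = (inv x \<otimes> x) [^] (q ^ n)"
    using u x by (simp only: nat_pow_distrib Units_inv_closed)
  then have "(inv x) [^] (q ^ n) = inv x"
    using u x by (metis Units_inv_closed Units_l_inv inv_char m_comm nat_pow_closed nat_pow_one)
  moreover have "inv x \<noteq> \<zero>" using u x by (metis Units_l_inv l_null zero_not_one)
  ultimately show ?thesis using u by (simp add: units_fixed_def fixed_def)
qed

lemma fixed_pow_mod: assumes c: "c \<in> fixed n" shows "c [^] (q ^ i) = c [^] (q ^ (i mod n))"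
proof -
  have "c [^] (q ^ (n * j)) = c" for j
    using c by (induction j) (simp_all add: fixed_def pow_q_add)
  then have "c [^] (q ^ (n * (i div n) + i mod n)) = c [^] (q ^ (i mod n))"
    using c fixed_closed by (simp only: pow_q_add)
  then show ?thesis by simp
qed

lemma fixed_mult: "c \<in> fixed n \<Longrightarrow> c \<in> fixed (n * j)"
  using fixed_pow_mod[of c n "n * j"] by (simp add: fixed_def)

lemma finite_units_fixed: "n > 0 \<Longrightarrow> finite (units_fixed n)"
  by (simp add: units_fixed_def card_fixed)

lemma units_fixed_nonzero: "c \<in> units_fixed n \<Longrightarrow> c \<in> Units L"
  by (auto simp: units_fixed_def field_Units fixed_closed)

lemma units_fixed_mult:
  "\<lbrakk>g \<in> units_fixed n; c \<in> units_fixed n\<rbrakk> \<Longrightarrow> g \<otimes> c \<in> units_fixed n"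
  by (auto simp: units_fixed_def fixed_closed intro: fixed_ring_closed dest: integral)

lemma units_fixed_reindex:
  assumes g: "g \<in> units_fixed n" shows "bij_betw (\<lambda>c. g \<otimes> c) (units_fixed n) (units_fixed n)"
proof (rule bij_betw_byWitness[where f' = "\<lambda>c. inv g \<otimes> c"])
  have g': "g \<in> Units L" "inv g \<in> units_fixed n" using g by (simp_all add: units_fixed_nonzero units_fixed_inv)
  show "\<forall>c\<in>units_fixed n. inv g \<otimes> (g \<otimes> c) = c" "\<forall>c\<in>units_fixed n. g \<otimes> (inv g \<otimes> c) = c"
    using g' Units_closed[OF g'(1)] by (auto simp: m_assoc[symmetric] units_fixed_closed)
  show "(\<lambda>c. g \<otimes> c) ` units_fixed n \<subseteq> units_fixed n" "(\<lambda>c. inv g \<otimes> c) ` units_fixed n \<subseteq> units_fixed n"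
    using g g' by (auto simp: units_fixed_mult)
qed

lemma units_fixed_inv_reindex: "bij_betw (\<lambda>c. inv c) (units_fixed n) (units_fixed n)"
  by (rule bij_betw_byWitness[where f' = "\<lambda>c. inv c"])
    (auto simp: units_fixed_inv units_fixed_nonzero)

lemma finsum_bij:
  assumes "bij_betw h I J" "f \<in> J \<rightarrow> carrier L"
  shows "(\<Oplus>i\<in>I. f (h i)) = (\<Oplus>j\<in>J. f j)"
  using assms finsum_reindex[of f h I] by (auto simp: bij_betw_def)

text \<open>Adding one permutes the field with q^n elements. Comparing the sums over c and over c +
  1 shows that the sum of ones over the whole field vanishes, and removing the element zero leaves
  minus one.\<close>

lemma card_units_fixed_sum:
  assumes n: "n > 0" shows "(\<Oplus>c\<in>units_fixed n. \<one>) = \<ominus> \<one>"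
proof -
  have fin: "finite (fixed n)" using n by (rule card_fixed(1))
  have "bij_betw (\<lambda>c. c \<oplus> \<one>) (fixed n) (fixed n)"
  proof (rule bij_betw_byWitness[where f' = "\<lambda>c. c \<oplus> \<ominus> \<one>"])
    show "(\<lambda>c. c \<oplus> \<one>) ` fixed n \<subseteq> fixed n" "(\<lambda>c. c \<oplus> \<ominus> \<one>) ` fixed n \<subseteq> fixed n"
      by (auto intro!: fixed_ring_closed)
  qed (auto simp: a_assoc fixed_closed r_neg l_neg)
  then have "(\<Oplus>c\<in>fixed n. c \<oplus> \<one>) = (\<Oplus>c\<in>fixed n. c)"
    using finsum_bij[of "\<lambda>c. c \<oplus> \<one>" "fixed n" "fixed n" "\<lambda>c. c"] by (auto simp: fixed_closed)
  moreover have "(\<Oplus>c\<in>fixed n. c \<oplus> \<one>) = (\<Oplus>c\<in>fixed n. c) \<oplus> (\<Oplus>c\<in>fixed n. \<one>)"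
    by (rule finsum_addf) (auto simp: fixed_closed)
  moreover have "(\<Oplus>c\<in>fixed n. c) \<in> carrier L" by (rule finsum_closed) (auto simp: fixed_closed)
  ultimately have "(\<Oplus>c\<in>fixed n. \<one>) = \<zero>"
    by (metis (no_types, lifting) Pi_I add.l_cancel finsum_closed one_closed r_zero zero_closed)
  moreover have "fixed n = insert \<zero> (units_fixed n)"
    by (auto simp: units_fixed_def fixed_ring_closed)
  moreover have "finite (units_fixed n)" "\<zero> \<notin> units_fixed n"
    using fin by (auto simp: units_fixed_def)
  ultimately have "\<one> \<oplus> (\<Oplus>c\<in>units_fixed n. \<one>) = \<zero>" by simp
  then show ?thesis
    by (metis (no_types, lifting) Pi_I add.inv_equality finsum_closed one_closed a_comm)
qed

text \<open>These are the dual basis relations of the finite field with \<open>q ^ n\<close> elements over the one with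
  \<open>q\<close> elements, without the choice of a basis.\<close>

lemma units_fixed_sum:
  assumes n: "n > 0"
  shows "(\<Oplus>c\<in>units_fixed n. inv c \<otimes> c [^] (q ^ i)) = (if n dvd i then \<ominus> \<one> else \<zero>)"
proof (cases "n dvd i")
  case True
  have "(\<Oplus>c\<in>units_fixed n. inv c \<otimes> c [^] (q ^ i)) = (\<Oplus>c\<in>units_fixed n. \<one>)"
  proof (rule finsum_cong')
    fix c assume c: "c \<in> units_fixed n"
    have "c [^] (q ^ i) = c"
      using c True fixed_pow_mod[of c n i] units_fixed_closed[OF c] by (simp add: units_fixed_def dvd_eq_mod_eq_0)
    then show "inv c \<otimes> c [^] (q ^ i) = \<one>" using c by (simp add: units_fixed_nonzero)
  qed auto
  then show ?thesis using True n by (simp add: card_units_fixed_sum)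
next
  case False
  define m where "m = i mod n"
  have m: "0 < m" "m < n" using False n by (auto simp: m_def dvd_eq_mod_eq_0)
  \<comment> \<open>The field with q^m elements is too small to contain the one with q^n elements,
    so some g is moved by the power q^i. Replacing c by g c multiplies the sum by
    \<open>inv g \<otimes> g [^] (q ^ i)\<close>, which differs from one, so the sum is
    zero.\<close>
  have "card (fixed m) < card (fixed n)"
    using card_fixed m n q_gt_1 by simp
  then have "\<not> fixed n \<subseteq> fixed m" using card_fixed(1)[OF m(1)] card_mono linorder_not_le by blast
  then obtain g where g: "g \<in> fixed n" "g \<notin> fixed m" by blast
  then have g': "g \<in> units_fixed n" by (auto simp: units_fixed_def fixed_ring_closed)
  have gu: "g \<in> Units L" "g \<in> carrier L" using g' by (auto simp: units_fixed_nonzero units_fixed_closed)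
  have ne: "g [^] (q ^ i) \<noteq> g"
    using g fixed_pow_mod[OF g(1), of i] fixed_closed[OF g(1)] by (auto simp: fixed_def m_def)
  let ?f = "\<lambda>c. inv c \<otimes> c [^] (q ^ i)"
  define S where "S = (\<Oplus>c\<in>units_fixed n. ?f c)"
  have f: "?f \<in> units_fixed n \<rightarrow> carrier L" by (auto simp: units_fixed_nonzero units_fixed_closed)
  then have S: "S \<in> carrier L" unfolding S_def by (rule finsum_closed)
  have "S = (\<Oplus>c\<in>units_fixed n. ?f (g \<otimes> c))"
    unfolding S_def using finsum_bij[OF units_fixed_reindex[OF g'] f] by simp
  also have "\<dots> = (\<Oplus>c\<in>units_fixed n. ?f g \<otimes> ?f c)"
  proof (rule finsum_cong')
    fix c assume c: "c \<in> units_fixed n"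
    then have cu: "c \<in> Units L" "c \<in> carrier L" by (auto simp: units_fixed_nonzero units_fixed_closed)
    have "(g \<otimes> c) \<otimes> (inv g \<otimes> inv c) = (g \<otimes> inv g) \<otimes> (c \<otimes> inv c)"
      using cu gu by (simp add: m_ac)
    then have "inv (g \<otimes> c) = inv g \<otimes> inv c" using cu gu by (intro comm_inv_char) simp_all
    then show "?f (g \<otimes> c) = ?f g \<otimes> ?f c" using gu cu by (simp add: nat_pow_distrib m_ac)
  qed (use f gu in auto)
  also have "\<dots> = ?f g \<otimes> S"
    unfolding S_def using f gu by (intro finsum_rdistr[symmetric]) (auto simp: finite_units_fixed n)
  finally have eq: "S = ?f g \<otimes> S" .
  have "g \<otimes> S = g [^] (q ^ i) \<otimes> S"
  proof -
    have "g \<otimes> S = g \<otimes> (?f g \<otimes> S)" using eq by simp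
    also have "\<dots> = (g \<otimes> inv g) \<otimes> (g [^] (q ^ i) \<otimes> S)"
      using gu S by (simp add: m_assoc del: Units_r_inv)
    also have "\<dots> = g [^] (q ^ i) \<otimes> S" unfolding Units_r_inv[OF gu(1)] using gu S by simp
    finally show ?thesis .
  qed
  then have "S = \<zero>" using ne gu S by (metis m_rcancel nat_pow_closed)
  then show ?thesis using False by (simp add: S_def)
qed

end

section \<open>Exchange and cyclic shift of finite sums\<close>

lemma (in abelian_monoid) finsum_swap:
  assumes "finite I" "finite J" "\<And>i j. \<lbrakk>i \<in> I; j \<in> J\<rbrakk> \<Longrightarrow> f i j \<in> carrier G"
  shows "(\<Oplus>i\<in>I. \<Oplus>j\<in>J. f i j) = (\<Oplus>j\<in>J. \<Oplus>i\<in>I. f i j)"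
  using assms(1,3)
proof (induction I rule: finite_induct)
  case empty
  then show ?case by simp
next
  case (insert i I)
  then have "(\<Oplus>j\<in>J. \<Oplus>i\<in>insert i I. f i j) = (\<Oplus>j\<in>J. f i j \<oplus> (\<Oplus>i\<in>I. f i j))"
    by (intro finsum_cong') (auto intro!: finsum_closed)
  also have "\<dots> = (\<Oplus>j\<in>J. f i j) \<oplus> (\<Oplus>j\<in>J. \<Oplus>i\<in>I. f i j)"
    using insert.prems by (intro finsum_addf) (auto intro!: finsum_closed)
  finally show ?case using insert by (simp add: Pi_def)
qed

lemma (in abelian_monoid) finsum_lessThan_shift:
  assumes "\<And>i. f i \<in> carrier G"
  shows "(\<Oplus>i\<in>{..<Suc n}. f i) = f 0 \<oplus> (\<Oplus>i\<in>{..<n}. f (Suc i))"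
  using assms by (induction n) (simp_all add: lessThan_Suc a_ac)

lemma (in abelian_group) finsum_lessThan_cyclic:
  assumes "\<And>i. f i \<in> carrier G" "f n = f 0"
  shows "(\<Oplus>i\<in>{..<n}. f (Suc i)) = (\<Oplus>i\<in>{..<n}. f i)"
proof -
  have "f 0 \<oplus> (\<Oplus>i\<in>{..<n}. f (Suc i)) = f 0 \<oplus> (\<Oplus>i\<in>{..<n}. f i)"
    using finsum_lessThan_shift[of f n, OF assms(1)] assms by (simp add: lessThan_Suc)
  moreover have "(\<Oplus>i\<in>{..<n}. f (Suc i)) \<in> carrier G" "(\<Oplus>i\<in>{..<n}. f i) \<in> carrier G"
    using assms(1) by (auto intro: finsum_closed)
  ultimately show ?thesis using assms(1)[of 0] by (metis add.l_cancel)
qed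

context frobenius_field
begin

end

section \<open>Semilinear maps and Frobenius maps of vector spaces\<close>

text \<open>The subset \<open>S\<close> allows for maps that are additive on fixed points only. With
  the identity as \<open>h\<close>, the first conclusion is the closure of \<open>S\<close> under
  finite sums.\<close>

lemma additive_finsum:
  assumes V: "abelian_monoid V" and W: "abelian_monoid W"
    and S: "S \<subseteq> carrier V" "\<zero>\<^bsub>V\<^esub> \<in> S" "\<And>x y. \<lbrakk>x \<in> S; y \<in> S\<rbrakk> \<Longrightarrow> x \<oplus>\<^bsub>V\<^esub> y \<in> S"
    and h: "\<And>x. x \<in> S \<Longrightarrow> h x \<in> carrier W" "h \<zero>\<^bsub>V\<^esub> = \<zero>\<^bsub>W\<^esub>"
      "\<And>x y. \<lbrakk>x \<in> S; y \<in> S\<rbrakk> \<Longrightarrow> h (x \<oplus>\<^bsub>V\<^esub> y) = h x \<oplus>\<^bsub>W\<^esub> h y"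
    and I: "finite I" "\<And>i. i \<in> I \<Longrightarrow> f i \<in> S"
  shows "(\<Oplus>\<^bsub>V\<^esub>i\<in>I. f i) \<in> S" "h (\<Oplus>\<^bsub>V\<^esub>i\<in>I. f i) = (\<Oplus>\<^bsub>W\<^esub>i\<in>I. h (f i))"
proof -
  interpret V: abelian_monoid V by fact
  interpret W: abelian_monoid W by fact
  have "(\<Oplus>\<^bsub>V\<^esub>i\<in>I. f i) \<in> S \<and> h (\<Oplus>\<^bsub>V\<^esub>i\<in>I. f i) = (\<Oplus>\<^bsub>W\<^esub>i\<in>I. h (f i))"
    using I
  proof (induction I rule: finite_induct)
    case empty
    then show ?case using S h by simp
  next
    case (insert i I)
    have "f \<in> I \<rightarrow> carrier V" "f i \<in> carrier V" "(\<lambda>i. h (f i)) \<in> I \<rightarrow> carrier W" "h (f i) \<in> carrier W"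
      using insert.prems S(1) h(1) by auto
    with insert show ?case using S h by (simp add: V.finsum_insert W.finsum_insert)
  qed
  then show "(\<Oplus>\<^bsub>V\<^esub>i\<in>I. f i) \<in> S" "h (\<Oplus>\<^bsub>V\<^esub>i\<in>I. f i) = (\<Oplus>\<^bsub>W\<^esub>i\<in>I. h (f i))" by blast+
qed

lemma (in module) finsum_smult_rdistr:
  assumes "finite I" "\<And>i. i \<in> I \<Longrightarrow> c i \<in> carrier R" "x \<in> carrier M"
  shows "(\<Oplus>i\<in>I. c i) \<odot>\<^bsub>M\<^esub> x = (\<Oplus>\<^bsub>M\<^esub>i\<in>I. c i \<odot>\<^bsub>M\<^esub> x)"
  using assms
proof (induction I rule: finite_induct)
  case (insert i I)
  have "c \<in> I \<rightarrow> carrier R" "(\<lambda>i. c i \<odot>\<^bsub>M\<^esub> x) \<in> I \<rightarrow> carrier M" using insert.prems by auto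
  with insert show ?case by (simp add: smult_l_distr)
qed (simp add: smult_l_null)

lemma (in vectorspace) smult_right_cancel:
  assumes "c \<in> carrier K" "d \<in> carrier K" "x \<in> carrier V" "x \<noteq> \<zero>\<^bsub>V\<^esub>" "c \<odot>\<^bsub>V\<^esub> x = d \<odot>\<^bsub>V\<^esub> x"
  shows "c = d"
proof (rule ccontr)
  assume "c \<noteq> d"
  let ?e = "c \<ominus>\<^bsub>K\<^esub> d"
  have e: "?e \<in> carrier K" "?e \<noteq> \<zero>\<^bsub>K\<^esub>" using assms(1,2) \<open>c \<noteq> d\<close> by (auto simp: R.r_right_minus_eq)
  have "?e \<oplus>\<^bsub>K\<^esub> d = c" using assms(1,2) by (simp add: R.minus_eq R.a_assoc R.l_neg)
  then have "?e \<odot>\<^bsub>V\<^esub> x \<oplus>\<^bsub>V\<^esub> d \<odot>\<^bsub>V\<^esub> x = d \<odot>\<^bsub>V\<^esub> x" using smult_l_distr[of ?e d x] e assms by simp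
  then have "?e \<odot>\<^bsub>V\<^esub> x = \<zero>\<^bsub>V\<^esub>" using e(1) assms(2,3) by simp
  then have "inv\<^bsub>K\<^esub> ?e \<odot>\<^bsub>V\<^esub> (?e \<odot>\<^bsub>V\<^esub> x) = \<zero>\<^bsub>V\<^esub>" using e by (simp add: field_Units)
  then show False using e assms(3,4) smult_assoc1[of "inv\<^bsub>K\<^esub> ?e" ?e x] by (simp add: field_Units)
qed

lemma (in vectorspace) basis_coords:
  assumes B: "finite B" "basis B"
  obtains \<gamma> where "\<And>x b. \<lbrakk>x \<in> carrier V; b \<in> B\<rbrakk> \<Longrightarrow> \<gamma> x b \<in> carrier K"
    "\<And>x. x \<in> carrier V \<Longrightarrow> (\<Oplus>\<^bsub>V\<^esub>b\<in>B. \<gamma> x b \<odot>\<^bsub>V\<^esub> b) = x"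
    "\<And>a b. \<lbrakk>a \<in> B \<rightarrow> carrier K; b \<in> B\<rbrakk> \<Longrightarrow> \<gamma> (\<Oplus>\<^bsub>V\<^esub>b\<in>B. a b \<odot>\<^bsub>V\<^esub> b) b = a b"
    "\<And>x y b. \<lbrakk>x \<in> carrier V; y \<in> carrier V; b \<in> B\<rbrakk> \<Longrightarrow> \<gamma> (x \<oplus>\<^bsub>V\<^esub> y) b = \<gamma> x b \<oplus>\<^bsub>K\<^esub> \<gamma> y b"
    "\<And>c x b. \<lbrakk>c \<in> carrier K; x \<in> carrier V; b \<in> B\<rbrakk> \<Longrightarrow> \<gamma> (c \<odot>\<^bsub>V\<^esub> x) b = c \<otimes>\<^bsub>K\<^esub> \<gamma> x b"
    "\<And>b b'. \<lbrakk>b \<in> B; b' \<in> B\<rbrakk> \<Longrightarrow> \<gamma> b b' = (if b = b' then \<one>\<^bsub>K\<^esub> else \<zero>\<^bsub>K\<^esub>)"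
proof -
  have BV: "B \<subseteq> carrier V" using B by (simp add: basis_def)
  have ex1: "\<exists>!a. a \<in> B \<rightarrow>\<^sub>E carrier K \<and> lincomb a B = x" if "x \<in> carrier V" for x
    using basis_criterion[OF B(1) BV] B(2) that by blast
  define \<gamma> where "\<gamma> x = (THE a. a \<in> B \<rightarrow>\<^sub>E carrier K \<and> lincomb a B = x)" for x
  have \<gamma>E: "\<gamma> x \<in> B \<rightarrow>\<^sub>E carrier K \<and> lincomb (\<gamma> x) B = x" if "x \<in> carrier V" for x
    unfolding \<gamma>_def by (rule theI'[OF ex1[OF that]])
  have \<gamma>: "\<gamma> x \<in> B \<rightarrow> carrier K" "(\<Oplus>\<^bsub>V\<^esub>b\<in>B. \<gamma> x b \<odot>\<^bsub>V\<^esub> b) = x" if "x \<in> carrier V" for x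
    using \<gamma>E[OF that] by (auto simp: lincomb_def)
  have \<gamma>u: "\<gamma> (\<Oplus>\<^bsub>V\<^esub>b\<in>B. a b \<odot>\<^bsub>V\<^esub> b) b = a b" if a: "a \<in> B \<rightarrow> carrier K" and b: "b \<in> B" for a b
  proof -
    have cl: "lincomb a B \<in> carrier V" using a BV by simp
    have "lincomb (restrict a B) B = lincomb a B"
      unfolding lincomb_def using a BV by (intro finsum_cong') auto
    then have "\<gamma> (lincomb a B) = restrict a B"
      using ex1[OF cl] \<gamma>E[OF cl] a by (metis restrict_PiE)
    then show ?thesis using b by (simp add: lincomb_def)
  qed
  have \<gamma>c: "\<gamma> x b \<in> carrier K" if "x \<in> carrier V" "b \<in> B" for x b using \<gamma>(1) that by blast
  have add: "\<gamma> (x \<oplus>\<^bsub>V\<^esub> y) b = \<gamma> x b \<oplus>\<^bsub>K\<^esub> \<gamma> y b" if "x \<in> carrier V" "y \<in> carrier V" "b \<in> B" for x y b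
  proof -
    have "(\<Oplus>\<^bsub>V\<^esub>b\<in>B. (\<gamma> x b \<oplus>\<^bsub>K\<^esub> \<gamma> y b) \<odot>\<^bsub>V\<^esub> b) = (\<Oplus>\<^bsub>V\<^esub>b\<in>B. \<gamma> x b \<odot>\<^bsub>V\<^esub> b \<oplus>\<^bsub>V\<^esub> \<gamma> y b \<odot>\<^bsub>V\<^esub> b)"
      using that BV \<gamma>c by (intro finsum_cong') (auto simp: smult_l_distr subset_eq)
    also have "\<dots> = (\<Oplus>\<^bsub>V\<^esub>b\<in>B. \<gamma> x b \<odot>\<^bsub>V\<^esub> b) \<oplus>\<^bsub>V\<^esub> (\<Oplus>\<^bsub>V\<^esub>b\<in>B. \<gamma> y b \<odot>\<^bsub>V\<^esub> b)"
      using that BV \<gamma>c by (intro finsum_addf) auto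
    also have "\<dots> = x \<oplus>\<^bsub>V\<^esub> y" using that \<gamma> by simp
    finally show ?thesis
      using \<gamma>u[of "\<lambda>b. \<gamma> x b \<oplus>\<^bsub>K\<^esub> \<gamma> y b" b] that \<gamma>c by auto
  qed
  have smult: "\<gamma> (c \<odot>\<^bsub>V\<^esub> x) b = c \<otimes>\<^bsub>K\<^esub> \<gamma> x b" if "c \<in> carrier K" "x \<in> carrier V" "b \<in> B" for c x b
  proof -
    have "(\<Oplus>\<^bsub>V\<^esub>b\<in>B. (c \<otimes>\<^bsub>K\<^esub> \<gamma> x b) \<odot>\<^bsub>V\<^esub> b) = (\<Oplus>\<^bsub>V\<^esub>b\<in>B. c \<odot>\<^bsub>V\<^esub> (\<gamma> x b \<odot>\<^bsub>V\<^esub> b))"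
      using that BV \<gamma>c by (intro finsum_cong') (auto simp: smult_assoc1 subset_eq)
    also have "\<dots> = c \<odot>\<^bsub>V\<^esub> (\<Oplus>\<^bsub>V\<^esub>b\<in>B. \<gamma> x b \<odot>\<^bsub>V\<^esub> b)"
      using that BV \<gamma>c B by (intro finsum_smult_ldistr[symmetric]) auto
    also have "\<dots> = c \<odot>\<^bsub>V\<^esub> x" using that \<gamma> by simp
    finally show ?thesis
      using \<gamma>u[of "\<lambda>b. c \<otimes>\<^bsub>K\<^esub> \<gamma> x b" b] that \<gamma>c by auto
  qed
  have unit: "\<gamma> b b' = (if b = b' then \<one>\<^bsub>K\<^esub> else \<zero>\<^bsub>K\<^esub>)" if b: "b \<in> B" "b' \<in> B" for b b'
  proof -
    have "(\<Oplus>\<^bsub>V\<^esub>b'\<in>B. (if b = b' then \<one>\<^bsub>K\<^esub> else \<zero>\<^bsub>K\<^esub>) \<odot>\<^bsub>V\<^esub> b') = (\<Oplus>\<^bsub>V\<^esub>b'\<in>B. if b = b' then b' else \<zero>\<^bsub>V\<^esub>)"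
      using BV by (intro finsum_cong') auto
    also have "\<dots> = b" using b B BV by (intro finsum_singleton) auto
    finally show ?thesis using \<gamma>u[of "\<lambda>b'. if b = b' then \<one>\<^bsub>K\<^esub> else \<zero>\<^bsub>K\<^esub>" b'] b by auto
  qed
  show thesis using that[OF \<gamma>c \<gamma>(2) \<gamma>u add smult unit] by blast
qed

text \<open>A maximal independent subset of \<open>S\<close> spans \<open>S\<close>. The spanning
  set will consist of the fixed vectors of a Frobenius map.\<close>

lemma (in vectorspace) basis_within_spanning_set:
  assumes fd: "fin_dim" and S: "S \<subseteq> carrier V" "carrier V \<subseteq> span S"
  obtains B where "B \<subseteq> S" "finite B" "basis B"
proof -
  have "\<exists>B. finite B \<and> maximal B (\<lambda>B. B \<subseteq> S \<and> lin_indpt B)"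
  proof (rule maximal_exists)
    show "{} \<subseteq> S \<and> lin_indpt {}" by (simp add: lin_dep_def)
  qed (use li_le_dim[OF fd] S(1) in blast)
  then obtain B where B: "finite B" "maximal B (\<lambda>B. B \<subseteq> S \<and> lin_indpt B)" by blast
  have BS: "B \<subseteq> S" "lin_indpt B" using B by (auto simp: maximal_def)
  have BV: "B \<subseteq> carrier V" using BS S by blast
  have "S \<subseteq> span B"
  proof
    fix v assume v: "v \<in> S"
    show "v \<in> span B"
    proof (cases "v \<in> B")
      case True then show ?thesis using in_own_span[OF BV] by blast
    next
      case False
      then have "lin_dep (B \<union> {v})" using B(2) v BS by (auto simp: maximal_def)
      then show ?thesis using lin_dep_iff_in_span[OF BV BS(2)] v S False by blast
    qed
  qed
  then have "span S \<subseteq> span B" by (rule span_is_subset) (rule span_is_submodule[OF BV])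
  then have "basis B" using S(2) BS(2) BV span_is_subset2[OF BV] by (auto simp: basis_def)
  then show thesis using that B BS by blast
qed

lemma (in vectorspace) subspace_fin_dim:
  assumes fd: "fin_dim" and W: "submodule K W V"
  shows "vectorspace.fin_dim K (vs W)"
proof -
  interpret W: vectorspace K "vs W"
    using W by (intro subspace_is_vs) (simp add: subspace_def vectorspace_axioms)
  have "\<exists>B. finite B \<and> maximal B (\<lambda>B. B \<subseteq> carrier (vs W) \<and> W.lin_indpt B)"
  proof (rule maximal_exists)
    show "{} \<subseteq> carrier (vs W) \<and> W.lin_indpt {}" by (simp add: W.lin_dep_def)
  next
    fix B assume B: "B \<subseteq> carrier (vs W) \<and> W.lin_indpt B"
    then have "B \<subseteq> carrier V" "lin_indpt B"
      using W span_li_not_depend(2)[OF _ W, of B] by (auto simp: submodule_def)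
    then show "finite B \<and> card B \<le> dim" using li_le_dim[OF fd] by blast
  qed
  then obtain B where B: "finite B" "maximal B (\<lambda>B. B \<subseteq> carrier (vs W) \<and> W.lin_indpt B)" by blast
  then have "W.basis B" by (intro W.max_li_is_basis)
  then show ?thesis using B(1) by (auto simp: W.fin_dim_def W.basis_def)
qed

section \<open>Semilinear maps, traces and Lang's theorem\<close>

context frobenius_field
begin

definition slin :: "nat \<Rightarrow> ('a, 'v) module \<Rightarrow> ('a, 'w) module \<Rightarrow> ('v \<Rightarrow> 'w) \<Rightarrow> bool" where
  "slin n V W u \<longleftrightarrow>
     u \<in> carrier V \<rightarrow> carrier W \<and>
     (\<forall>x\<in>carrier V. \<forall>y\<in>carrier V. u (x \<oplus>\<^bsub>V\<^esub> y) = u x \<oplus>\<^bsub>W\<^esub> u y) \<and>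
     (\<forall>c\<in>carrier L. \<forall>x\<in>carrier V. u (c \<odot>\<^bsub>V\<^esub> x) = c [^] (q ^ n) \<odot>\<^bsub>W\<^esub> u x)"

text \<open>Bijectivity is a consequence of the finite orbits (\<open>frob_bij\<close>). The degree
  0 is allowed, so that linear automorphisms are covered.\<close>

definition frob :: "nat \<Rightarrow> ('a, 'v) module \<Rightarrow> ('v \<Rightarrow> 'v) \<Rightarrow> bool" where
  "frob r V F \<longleftrightarrow> slin r V V F \<and> (\<forall>x\<in>carrier V. \<exists>n>0. (F ^^ n) x = x)"

definition fixpts :: "('a, 'v) module \<Rightarrow> ('v \<Rightarrow> 'v) \<Rightarrow> 'v set" where
  "fixpts V F = {x \<in> carrier V. F x = x}"

text \<open>If \<open>F ^^ n\<close> fixes x and c lies in the field with q^(r n) elements, this is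
  the trace of c x down to the fixed points of F. The scalar c is a parameter because all its values
  together determine x (\<open>tr_expand\<close>), and a single good choice makes the trace the
  identity on fixed vectors (\<open>tr_fixed_point\<close>).\<close>

definition tr :: "('a, 'v) module \<Rightarrow> ('v \<Rightarrow> 'v) \<Rightarrow> nat \<Rightarrow> 'a \<Rightarrow> 'v \<Rightarrow> 'v" where
  "tr V F n c x = (\<Oplus>\<^bsub>V\<^esub>i\<in>{..<n}. (F ^^ i) (c \<odot>\<^bsub>V\<^esub> x))"

lemma slinD:
  assumes "slin n V W u"
  shows "x \<in> carrier V \<Longrightarrow> u x \<in> carrier W"
    and "\<lbrakk>x \<in> carrier V; y \<in> carrier V\<rbrakk> \<Longrightarrow> u (x \<oplus>\<^bsub>V\<^esub> y) = u x \<oplus>\<^bsub>W\<^esub> u y"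
    and "\<lbrakk>c \<in> carrier L; x \<in> carrier V\<rbrakk> \<Longrightarrow> u (c \<odot>\<^bsub>V\<^esub> x) = c [^] (q ^ n) \<odot>\<^bsub>W\<^esub> u x"
  using assms by (auto simp: slin_def)

lemma slin_comp: "\<lbrakk>slin n V W u; slin m W U v\<rbrakk> \<Longrightarrow> slin (n + m) V U (\<lambda>x. v (u x))"
  by (auto simp: slin_def Pi_def pow_q_add)

lemma slin_id: "vectorspace L V \<Longrightarrow> slin 0 V V (\<lambda>x. x)"
  by (auto simp: slin_def)

lemma slin_funpow:
  assumes "vectorspace L V" "slin n V V F" shows "slin (n * m) V V (F ^^ m)"
proof (induction m)
  case 0 then show ?case using slin_id[OF assms(1)] by (simp add: slin_def)
next
  case (Suc m) then show ?case using slin_comp[OF Suc assms(2)] by (simp add: add.commute comp_def)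
qed

lemma slin_zero:
  assumes V: "vectorspace L V" and W: "vectorspace L W" and u: "slin n V W u"
  shows "u \<zero>\<^bsub>V\<^esub> = \<zero>\<^bsub>W\<^esub>"
proof -
  interpret V: vectorspace L V by fact
  interpret W: vectorspace L W by fact
  have "u \<zero>\<^bsub>V\<^esub> \<oplus>\<^bsub>W\<^esub> u \<zero>\<^bsub>V\<^esub> = u \<zero>\<^bsub>V\<^esub>" using slinD(2)[OF u, of "\<zero>\<^bsub>V\<^esub>" "\<zero>\<^bsub>V\<^esub>"] by simp
  then show ?thesis using slinD(1)[OF u, of "\<zero>\<^bsub>V\<^esub>"] by simp
qed

lemma slin_finsum:
  assumes V: "vectorspace L V" and W: "vectorspace L W" and u: "slin n V W u"
    and I: "finite I" "\<And>i. i \<in> I \<Longrightarrow> f i \<in> carrier V"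
  shows "u (\<Oplus>\<^bsub>V\<^esub>i\<in>I. f i) = (\<Oplus>\<^bsub>W\<^esub>i\<in>I. u (f i))"
proof -
  interpret V: vectorspace L V by fact
  interpret W: vectorspace L W by fact
  show ?thesis
    by (rule additive_finsum(2)[OF V.abelian_monoid_axioms W.abelian_monoid_axioms, where S = "carrier V"])
      (use I slinD[OF u] slin_zero[OF V W u] in auto)
qed

lemma funpow_mult_fixed: "(F ^^ n) x = x \<Longrightarrow> (F ^^ (n * m)) x = x"
  by (induction m) (simp_all add: funpow_add)

lemma frob_common_power:
  assumes F: "frob r V F" and S: "finite S" "S \<subseteq> carrier V" and m: "m > 0"
  obtains n where "n > 0" "m dvd n" "\<And>x. x \<in> S \<Longrightarrow> (F ^^ n) x = x"
proof -
  have "\<exists>n>0. m dvd n \<and> (\<forall>x\<in>S. (F ^^ n) x = x)"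
    using S
  proof (induction S rule: finite_induct)
    case empty then show ?case using m by auto
  next
    case (insert x S)
    then obtain n where n: "n > 0" "m dvd n" "\<forall>x\<in>S. (F ^^ n) x = x" by auto
    obtain l where l: "l > 0" "(F ^^ l) x = x" using insert.prems F by (auto simp: frob_def)
    have "(F ^^ (n * l)) y = y" if "y \<in> insert x S" for y
      using that n(3) l(2) funpow_mult_fixed[of n F y l] funpow_mult_fixed[of l F x n]
      by (auto simp: mult.commute)
    then show ?case using n l by (intro exI[of _ "n * l"]) auto
  qed
  then show thesis using that by blast
qed

text \<open>If F x = F y, some positive power of F fixes both x and y, and it factors through
  F.\<close>

lemma frob_bij:
  assumes V: "vectorspace L V" and F: "frob r V F" shows "bij_betw F (carrier V) (carrier V)"
proof -
  interpret V: vectorspace L V by fact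
  have s: "slin r V V F" using F by (simp add: frob_def)
  have cl: "(F ^^ n) x \<in> carrier V" if "x \<in> carrier V" for n x
    using that slinD(1)[OF s] by (induction n) auto
  have "inj_on F (carrier V)"
  proof (rule inj_onI)
    fix x y assume xy: "x \<in> carrier V" "y \<in> carrier V" "F x = F y"
    obtain n where n: "n > 0" "\<And>z. z \<in> {x, y} \<Longrightarrow> (F ^^ n) z = z"
      using frob_common_power[OF F, of "{x, y}" 1] xy by auto
    obtain m where "n = Suc m" using n by (cases n) auto
    then show "x = y" using n(2)[of x] n(2)[of y] xy(3) by (simp add: funpow_Suc_right del: funpow.simps)
  qed
  moreover have "F ` carrier V = carrier V"
  proof (intro equalityI subsetI)
    fix x assume x: "x \<in> carrier V"
    then obtain n where n: "n > 0" "(F ^^ n) x = x" using F by (auto simp: frob_def)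
    obtain m where "n = Suc m" using n by (cases n) auto
    then have "x = F ((F ^^ m) x)" using n by simp
    then show "x \<in> F ` carrier V" using cl[OF x] by blast
  qed (use slinD(1)[OF s] in auto)
  ultimately show ?thesis by (simp add: bij_betw_def)
qed

lemma frob_funpow:
  assumes V: "vectorspace L V" and F: "frob r V F" and m: "m > 0" shows "frob (r * m) V (F ^^ m)"
proof -
  have "\<exists>n>0. ((F ^^ m) ^^ n) x = x" if "x \<in> carrier V" for x
  proof -
    obtain n where n: "n > 0" "(F ^^ n) x = x" using F \<open>x \<in> _\<close> by (auto simp: frob_def)
    then have "((F ^^ m) ^^ n) x = x"
      using funpow_mult_fixed[of n F x m] by (simp add: funpow_mult mult.commute)
    then show ?thesis using n by blast
  qed
  then show ?thesis using F slin_funpow[OF V] by (simp add: frob_def)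
qed

lemma tr_closed:
  assumes V: "vectorspace L V" and F: "slin r V V F" and x: "x \<in> carrier V" "c \<in> carrier L"
  shows "tr V F n c x \<in> carrier V"
proof -
  interpret V: vectorspace L V by fact
  show ?thesis
    unfolding tr_def using x slinD(1)[OF slin_funpow[OF V F]]
    by (intro V.finsum_closed) auto
qed

text \<open>F shifts the summands cyclically: the new last term is c^(q^(r n)) times
  \<open>(F ^^ n) x\<close>, which is c x again.\<close>

lemma tr_fix:
  assumes V: "vectorspace L V" and F: "slin r V V F" and x: "x \<in> carrier V" "(F ^^ n) x = x"
    and c: "c \<in> fixed (r * n)"
  shows "tr V F n c x \<in> fixpts V F"
proof -
  interpret V: vectorspace L V by fact
  have cl: "(F ^^ i) (c \<odot>\<^bsub>V\<^esub> x) \<in> carrier V" for i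
    using x c slinD(1)[OF slin_funpow[OF V F]] fixed_closed by auto
  have "F (tr V F n c x) = (\<Oplus>\<^bsub>V\<^esub>i\<in>{..<n}. (F ^^ Suc i) (c \<odot>\<^bsub>V\<^esub> x))"
    unfolding tr_def using cl by (subst slin_finsum[OF V V F]) auto
  also have "\<dots> = tr V F n c x"
    unfolding tr_def
  proof (rule V.finsum_lessThan_cyclic[of "\<lambda>i. (F ^^ i) (c \<odot>\<^bsub>V\<^esub> x)"])
    show "(F ^^ n) (c \<odot>\<^bsub>V\<^esub> x) = (F ^^ 0) (c \<odot>\<^bsub>V\<^esub> x)"
      using x c slinD(3)[OF slin_funpow[OF V F]] by (simp add: fixed_def)
  qed (rule cl)
  finally show ?thesis using tr_closed[OF V F] x c fixed_closed by (simp add: fixpts_def)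
qed

text \<open>This is \<open>units_fixed_sum\<close> with the opposite sign, applied to a vector. It
  selects the exponents divisible by r.\<close>

lemma dual_sum:
  assumes V: "vectorspace L V" and r: "r > 0" and x: "x \<in> carrier V"
  shows "(\<Oplus>\<^bsub>V\<^esub>d\<in>units_fixed r. (\<ominus> (inv d \<otimes> d [^] (q ^ j))) \<odot>\<^bsub>V\<^esub> x) = (if r dvd j then x else \<zero>\<^bsub>V\<^esub>)"
proof -
  interpret V: vectorspace L V by fact
  have fin: "finite (units_fixed r)" using r by (rule finite_units_fixed)
  note cU = units_fixed_closed Units_inv_closed[OF units_fixed_nonzero]
  have "(\<Oplus>\<^bsub>V\<^esub>d\<in>units_fixed r. (\<ominus> (inv d \<otimes> d [^] (q ^ j))) \<odot>\<^bsub>V\<^esub> x) =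
      (\<Oplus>d\<in>units_fixed r. \<ominus> (inv d \<otimes> d [^] (q ^ j))) \<odot>\<^bsub>V\<^esub> x"
    using x by (intro V.finsum_smult_rdistr[symmetric]) (auto simp: cU fin)
  also have "(\<Oplus>d\<in>units_fixed r. \<ominus> (inv d \<otimes> d [^] (q ^ j))) =
      (\<Oplus>d\<in>units_fixed r. \<ominus> \<one> \<otimes> (inv d \<otimes> d [^] (q ^ j)))"
    by (intro finsum_cong') (auto simp: cU l_minus)
  also have "\<dots> = \<ominus> \<one> \<otimes> (\<Oplus>d\<in>units_fixed r. inv d \<otimes> d [^] (q ^ j))"
    by (intro finsum_rdistr[symmetric]) (auto simp: cU fin)
  also have "\<dots> = (if r dvd j then \<one> else \<zero>)"
    by (simp add: units_fixed_sum[OF r] l_minus)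
  finally show ?thesis using x by simp
qed

text \<open>After exchanging the two sums, the coefficient of \<open>(F ^^ i) x\<close> is that of
  \<open>dual_sum\<close> for the field with q^(r n) elements. It is one for i = 0 and zero for 0 <
  i < n, since r n does not divide r i.\<close>

lemma tr_expand:
  assumes V: "vectorspace L V" and F: "slin r V V F" and x: "x \<in> carrier V"
    and n: "r > 0" "n > 0"
  shows "(\<Oplus>\<^bsub>V\<^esub>c\<in>units_fixed (r * n). (\<ominus> (inv c)) \<odot>\<^bsub>V\<^esub> tr V F n c x) = x"
proof -
  interpret V: vectorspace L V by fact
  have rn: "r * n > 0" using n by simp
  note cU = units_fixed_closed Units_inv_closed[OF units_fixed_nonzero]
  have cl: "(F ^^ i) x \<in> carrier V" for i using slinD(1)[OF slin_funpow[OF V F]] x by auto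
  have Fi: "(F ^^ i) (c \<odot>\<^bsub>V\<^esub> x) = c [^] (q ^ (r * i)) \<odot>\<^bsub>V\<^esub> (F ^^ i) x" if "c \<in> carrier L" for c i
    using slinD(3)[OF slin_funpow[OF V F]] x that by simp
  have "(\<Oplus>\<^bsub>V\<^esub>c\<in>units_fixed (r * n). (\<ominus> (inv c)) \<odot>\<^bsub>V\<^esub> tr V F n c x) =
      (\<Oplus>\<^bsub>V\<^esub>c\<in>units_fixed (r * n). \<Oplus>\<^bsub>V\<^esub>i\<in>{..<n}. (\<ominus> (inv c \<otimes> c [^] (q ^ (r * i)))) \<odot>\<^bsub>V\<^esub> (F ^^ i) x)"
  proof (rule V.finsum_cong')
    fix c assume c: "c \<in> units_fixed (r * n)"
    note c' = cU[OF c]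
    have "(\<ominus> (inv c)) \<odot>\<^bsub>V\<^esub> tr V F n c x =
        (\<Oplus>\<^bsub>V\<^esub>i\<in>{..<n}. (\<ominus> (inv c)) \<odot>\<^bsub>V\<^esub> (F ^^ i) (c \<odot>\<^bsub>V\<^esub> x))"
      unfolding tr_def using c' cl by (intro V.finsum_smult_ldistr) (auto simp: Fi)
    also have "\<dots> = (\<Oplus>\<^bsub>V\<^esub>i\<in>{..<n}. (\<ominus> (inv c \<otimes> c [^] (q ^ (r * i)))) \<odot>\<^bsub>V\<^esub> (F ^^ i) x)"
      using c' cl by (intro V.finsum_cong') (auto simp: Fi V.smult_assoc1[symmetric] l_minus)
    finally show "(\<ominus> (inv c)) \<odot>\<^bsub>V\<^esub> tr V F n c x =
        (\<Oplus>\<^bsub>V\<^esub>i\<in>{..<n}. (\<ominus> (inv c \<otimes> c [^] (q ^ (r * i)))) \<odot>\<^bsub>V\<^esub> (F ^^ i) x)" .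
  qed (auto intro!: V.finsum_closed simp: cU cl)
  also have "\<dots> = (\<Oplus>\<^bsub>V\<^esub>i\<in>{..<n}. \<Oplus>\<^bsub>V\<^esub>c\<in>units_fixed (r * n). (\<ominus> (inv c \<otimes> c [^] (q ^ (r * i)))) \<odot>\<^bsub>V\<^esub> (F ^^ i) x)"
    using cl by (intro V.finsum_swap) (auto simp: cU finite_units_fixed rn n)
  also have "\<dots> = (\<Oplus>\<^bsub>V\<^esub>i\<in>{..<n}. if i = 0 then x else \<zero>\<^bsub>V\<^esub>)"
  proof (rule V.finsum_cong')
    fix i assume i: "i \<in> {..<n}"
    have "r * n dvd r * i \<longleftrightarrow> i = 0" using i n by (auto dest: dvd_imp_le)
    then show "(\<Oplus>\<^bsub>V\<^esub>c\<in>units_fixed (r * n). (\<ominus> (inv c \<otimes> c [^] (q ^ (r * i)))) \<odot>\<^bsub>V\<^esub> (F ^^ i) x) =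
        (if i = 0 then x else \<zero>\<^bsub>V\<^esub>)" using dual_sum[OF V rn cl[of i], of "r * i"] by simp
  qed (use x in auto)
  also have "\<dots> = x"
    using n x V.finsum_singleton[of 0 "{..<n}" "\<lambda>_. x"] by (simp add: if_distrib)
  finally show ?thesis .
qed

text \<open>The field as a module over itself, so that traces of scalars and matrix entries become
  instances of \<open>slin\<close>.\<close>

definition LM :: "('a, 'a) module" where
  "LM = \<lparr>carrier = carrier L, monoid.mult = monoid.mult L, one = one L, zero = zero L, add = add L,
    smult = monoid.mult L\<rparr>"

lemma LM_simps [simp]: "carrier LM = carrier L" "zero LM = zero L" "add LM = add L" "smult LM = monoid.mult L"
  "finsum LM = finsum L"
  by (simp_all add: LM_def finsum_def finprod_def fun_eq_iff)

lemma vs_LM: "vectorspace L LM"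
proof -
  have "abelian_group LM"
    by (rule abelian_groupI) (auto simp: a_ac intro: bexI[of _ "\<ominus> _"] l_neg)
  then have "module L LM"
    by (intro moduleI) (auto simp: is_cring l_distr r_distr m_assoc)
  then show ?thesis by (simp add: vectorspace_def field_axioms)
qed

text \<open>If all traces vanished, \<open>tr_expand\<close> would write the element one of the
  field as zero. So some trace is nonzero, and it can be normalised.\<close>

lemma trace_one:
  assumes r: "r > 0" and n: "n > 0"
  obtains c where "c \<in> fixed (r * n)" "(\<Oplus>l\<in>{..<n}. c [^] (q ^ (r * l))) = \<one>"
proof -
  let ?F = "\<lambda>x. x [^] (q ^ r)"
  define T where "T c = (\<Oplus>l\<in>{..<n}. c [^] (q ^ (r * l)))" for c
  have F: "slin r LM LM ?F" by (simp add: slin_def frob_pow_add nat_pow_distrib)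
  have Fi: "(?F ^^ l) c = c [^] (q ^ (r * l))" if "c \<in> carrier L" for c l
    by (induction l) (use that in \<open>simp_all add: pow_q_add[symmetric] add.commute\<close>)
  have tr: "tr LM ?F n c \<one> = T c" if "c \<in> carrier L" for c using that by (simp add: tr_def T_def Fi)
  have T: "T c \<in> carrier L" if "c \<in> carrier L" for c
    unfolding T_def using that by (intro finsum_closed) auto
  have "\<exists>c\<in>units_fixed (r * n). T c \<noteq> \<zero>"
  proof (rule ccontr)
    assume "\<not> ?thesis"
    then have "(\<Oplus>c\<in>units_fixed (r * n). (\<ominus> (inv c)) \<otimes> tr LM ?F n c \<one>) = (\<Oplus>c\<in>units_fixed (r * n). \<zero>)"
      by (intro finsum_cong') (simp_all add: tr units_fixed_closed units_fixed_nonzero)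
    then show False using tr_expand[OF vs_LM F _ r n, of \<one>] by simp
  qed
  then obtain c where c: "c \<in> units_fixed (r * n)" "T c \<noteq> \<zero>" by blast
  then have cc: "c \<in> carrier L" "c \<in> fixed (r * n)" by (auto simp: units_fixed_closed units_fixed_def)
  have "T c [^] (q ^ r) = T c"
    using tr_fix[OF vs_LM F _ _ cc(2), of \<one>] Fi[of \<one> n] by (simp add: fixpts_def tr[OF cc(1)])
  then have Tc: "T c \<in> units_fixed r" using c T[OF cc(1)] by (simp add: units_fixed_def fixed_def)
  \<comment> \<open>\<open>T\<close> takes this c into the field with q^r elements and is linear
    over that field, so division by \<open>T c\<close> gives trace one.\<close>
  define t where "t = inv (T c)"
  have t: "t \<in> units_fixed r" "t \<in> carrier L" "T c \<in> Units L"
    using Tc units_fixed_inv units_fixed_nonzero by (auto simp: t_def units_fixed_closed)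
  have tf: "t \<in> fixed (r * l)" for l using t fixed_mult[of t r l] by (simp add: units_fixed_def)
  have "T (t \<otimes> c) = (\<Oplus>l\<in>{..<n}. t \<otimes> c [^] (q ^ (r * l)))"
    unfolding T_def using t cc tf
    by (intro finsum_cong') (auto simp: nat_pow_distrib fixed_def)
  also have "\<dots> = t \<otimes> T c" unfolding T_def using t cc by (intro finsum_rdistr[symmetric]) auto
  also have "\<dots> = \<one>" using t by (simp add: t_def)
  finally have "T (t \<otimes> c) = \<one>" .
  moreover have "t \<otimes> c \<in> fixed (r * n)" using tf cc by (intro fixed_ring_closed)
  ultimately show thesis using that by (simp add: T_def)
qed

text \<open>The essential half of Lang's theorem: \<open>tr_expand\<close> writes x as a combination
  of its traces, and these are fixed as soon as n is a multiple of the orbit length of x.\<close>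

lemma fixpts_span:
  assumes V: "vectorspace L V" and F: "frob r V F" and r: "r > 0"
  shows "carrier V \<subseteq> module.span L V (fixpts V F)"
proof
  fix x assume x: "x \<in> carrier V"
  interpret V: vectorspace L V by fact
  have s: "slin r V V F" using F by (simp add: frob_def)
  obtain n where n: "n > 0" "(F ^^ n) x = x" using F x by (auto simp: frob_def)
  have sub: "fixpts V F \<subseteq> carrier V" by (auto simp: fixpts_def)
  interpret W: submodule L "V.span (fixpts V F)" V by (rule V.span_is_submodule[OF sub])
  have "(\<Oplus>\<^bsub>V\<^esub>c\<in>units_fixed (r * n). (\<ominus> (inv c)) \<odot>\<^bsub>V\<^esub> tr V F n c x) \<in> V.span (fixpts V F)"
  proof (rule additive_finsum(1)[OF V.abelian_monoid_axioms V.abelian_monoid_axioms, where h = "\<lambda>x. x"])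
    fix c assume c: "c \<in> units_fixed (r * n)"
    then have "tr V F n c x \<in> fixpts V F"
      by (intro tr_fix[OF V s x n(2)]) (simp add: units_fixed_def)
    then have "tr V F n c x \<in> V.span (fixpts V F)" using V.in_own_span[OF sub] by blast
    then show "(\<ominus> (inv c)) \<odot>\<^bsub>V\<^esub> tr V F n c x \<in> V.span (fixpts V F)"
      using c by (intro W.smult_closed) (auto simp: units_fixed_nonzero)
  qed (use W.subset r n in \<open>auto simp: finite_units_fixed\<close>)
  then show "x \<in> V.span (fixpts V F)" using tr_expand[OF V s x r n(1)] by simp
qed

lemma slin_basis_map:
  assumes V: "vectorspace L V" and W: "vectorspace L W" and B: "finite B" "vectorspace.basis L V B"
    and h: "h \<in> B \<rightarrow> carrier W"
  obtains u where "slin n V W u" "\<And>b. b \<in> B \<Longrightarrow> u b = h b"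
proof -
  interpret V: vectorspace L V by fact
  interpret W: vectorspace L W by fact
  obtain \<gamma> where \<gamma>c: "\<And>x b. \<lbrakk>x \<in> carrier V; b \<in> B\<rbrakk> \<Longrightarrow> \<gamma> x b \<in> carrier L"
    and add: "\<And>x y b. \<lbrakk>x \<in> carrier V; y \<in> carrier V; b \<in> B\<rbrakk> \<Longrightarrow> \<gamma> (x \<oplus>\<^bsub>V\<^esub> y) b = \<gamma> x b \<oplus> \<gamma> y b"
    and smult: "\<And>c x b. \<lbrakk>c \<in> carrier L; x \<in> carrier V; b \<in> B\<rbrakk> \<Longrightarrow> \<gamma> (c \<odot>\<^bsub>V\<^esub> x) b = c \<otimes> \<gamma> x b"
    and unit: "\<And>b b'. \<lbrakk>b \<in> B; b' \<in> B\<rbrakk> \<Longrightarrow> \<gamma> b b' = (if b = b' then \<one> else \<zero>)"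
    by (rule V.basis_coords[OF B]) blast
  define u where "u x = (\<Oplus>\<^bsub>W\<^esub>b\<in>B. \<gamma> x b [^] (q ^ n) \<odot>\<^bsub>W\<^esub> h b)" for x
  have uc: "u x \<in> carrier W" if "x \<in> carrier V" for x
    unfolding u_def using that \<gamma>c h by (intro W.finsum_closed) auto
  have "slin n V W u"
    unfolding slin_def
  proof (intro conjI ballI funcsetI)
    fix x y assume xy: "x \<in> carrier V" "y \<in> carrier V"
    have "u (x \<oplus>\<^bsub>V\<^esub> y) = (\<Oplus>\<^bsub>W\<^esub>b\<in>B. \<gamma> x b [^] (q ^ n) \<odot>\<^bsub>W\<^esub> h b \<oplus>\<^bsub>W\<^esub> \<gamma> y b [^] (q ^ n) \<odot>\<^bsub>W\<^esub> h b)"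
      unfolding u_def using xy \<gamma>c h
      by (intro W.finsum_cong') (auto simp: add frob_pow_add W.smult_l_distr Pi_def)
    then show "u (x \<oplus>\<^bsub>V\<^esub> y) = u x \<oplus>\<^bsub>W\<^esub> u y"
      unfolding u_def using xy \<gamma>c h by (subst W.finsum_addf[symmetric]) auto
  next
    fix c x assume cx: "c \<in> carrier L" "x \<in> carrier V"
    have "u (c \<odot>\<^bsub>V\<^esub> x) = (\<Oplus>\<^bsub>W\<^esub>b\<in>B. c [^] (q ^ n) \<odot>\<^bsub>W\<^esub> (\<gamma> x b [^] (q ^ n) \<odot>\<^bsub>W\<^esub> h b))"
      unfolding u_def using cx \<gamma>c h
      by (intro W.finsum_cong') (auto simp: smult nat_pow_distrib W.smult_assoc1 Pi_def)
    then show "u (c \<odot>\<^bsub>V\<^esub> x) = c [^] (q ^ n) \<odot>\<^bsub>W\<^esub> u x"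
      unfolding u_def using cx \<gamma>c h B by (subst W.finsum_smult_ldistr) auto
  qed (rule uc)
  moreover have "u b = h b" if b: "b \<in> B" for b
  proof -
    have "u b = (\<Oplus>\<^bsub>W\<^esub>b'\<in>B. if b = b' then h b' else \<zero>\<^bsub>W\<^esub>)"
      unfolding u_def using h unit[OF b] by (intro W.finsum_cong') (auto simp: frob_pow_zero Pi_def)
    also have "\<dots> = h b" using b B h by (intro W.finsum_singleton) auto
    finally show ?thesis .
  qed
  ultimately show thesis using that by blast
qed

lemma slin_eq_on_span:
  assumes V: "vectorspace L V" and W: "vectorspace L W" and S: "S \<subseteq> carrier V" "carrier V \<subseteq> module.span L V S"
    and u: "slin n V W u" "slin n V W v" and eq: "\<And>b. b \<in> S \<Longrightarrow> u b = v b" and x: "x \<in> carrier V"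
  shows "u x = v x"
proof -
  interpret V: vectorspace L V by fact
  interpret W: vectorspace L W by fact
  have "x \<in> V.span S" using S(2) x by (rule subsetD)
  then obtain a B where a: "finite B" "B \<subseteq> S" "a \<in> B \<rightarrow> carrier L" "x = V.lincomb a B"
    unfolding V.span_def mem_Collect_eq by (elim exE conjE)
  have *: "w x = (\<Oplus>\<^bsub>W\<^esub>b\<in>B. a b [^] (q ^ n) \<odot>\<^bsub>W\<^esub> w b)" if w: "slin n V W w" for w
  proof -
    have ab: "a b \<in> carrier L" "b \<in> carrier V" if "b \<in> B" for b using a S(1) that by auto
    have "w x = (\<Oplus>\<^bsub>W\<^esub>b\<in>B. w (a b \<odot>\<^bsub>V\<^esub> b))"
      unfolding a(4) V.lincomb_def using a(1) ab by (intro slin_finsum[OF V W w]) auto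
    also have "\<dots> = (\<Oplus>\<^bsub>W\<^esub>b\<in>B. a b [^] (q ^ n) \<odot>\<^bsub>W\<^esub> w b)"
      using ab slinD[OF w] by (intro W.finsum_cong') auto
    finally show ?thesis .
  qed
  have "a b \<in> carrier L" "b \<in> carrier V" if "b \<in> B" for b using a S(1) that by auto
  then have "(\<Oplus>\<^bsub>W\<^esub>b\<in>B. a b [^] (q ^ n) \<odot>\<^bsub>W\<^esub> u b) = (\<Oplus>\<^bsub>W\<^esub>b\<in>B. a b [^] (q ^ n) \<odot>\<^bsub>W\<^esub> v b)"
    using a eq slinD(1)[OF u(2)] by (intro W.finsum_cong') auto
  then show ?thesis using *[OF u(1)] *[OF u(2)] by simp
qed

lemma slin_eq_on_fixpts:
  assumes V: "vectorspace L V" and W: "vectorspace L W" and F: "frob r V F" "r > 0"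
    and u: "slin n V W u" "slin n V W v" and eq: "\<And>b. b \<in> fixpts V F \<Longrightarrow> u b = v b" and x: "x \<in> carrier V"
  shows "u x = v x"
  by (rule slin_eq_on_span[OF V W _ fixpts_span[OF V F] u eq x]) (auto simp: fixpts_def)

lemma fixpts_basis:
  assumes V: "vectorspace L V" "vectorspace.fin_dim L V" and F: "frob r V F" "r > 0"
  obtains B where "finite B" "B \<subseteq> fixpts V F" "vectorspace.basis L V B"
proof -
  interpret V: vectorspace L V by fact
  have "fixpts V F \<subseteq> carrier V" by (auto simp: fixpts_def)
  then show thesis
    by (rule V.basis_within_spanning_set[OF V(2) _ fixpts_span[OF V(1) F]]) (rule that)
qed

text \<open>Applying F raises the coordinates with respect to fixed basis vectors to the power q^r.
  As F x = x and coordinates are unique, they lie in the field with q^r elements.\<close>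

lemma fixpts_coords:
  assumes V: "vectorspace L V" and F: "frob r V F" and B: "finite B" "vectorspace.basis L V B" "B \<subseteq> fixpts V F"
    and x: "x \<in> fixpts V F"
  obtains a where "a \<in> B \<rightarrow> fixed r" "x = (\<Oplus>\<^bsub>V\<^esub>b\<in>B. a b \<odot>\<^bsub>V\<^esub> b)"
proof -
  interpret V: vectorspace L V by fact
  obtain \<gamma> where \<gamma>c: "\<And>x b. \<lbrakk>x \<in> carrier V; b \<in> B\<rbrakk> \<Longrightarrow> \<gamma> x b \<in> carrier L"
      and \<gamma>: "\<And>x. x \<in> carrier V \<Longrightarrow> (\<Oplus>\<^bsub>V\<^esub>b\<in>B. \<gamma> x b \<odot>\<^bsub>V\<^esub> b) = x"
      "\<And>a b. \<lbrakk>a \<in> B \<rightarrow> carrier L; b \<in> B\<rbrakk> \<Longrightarrow> \<gamma> (\<Oplus>\<^bsub>V\<^esub>b\<in>B. a b \<odot>\<^bsub>V\<^esub> b) b = a b"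
    by (rule V.basis_coords[OF B(1,2)]) blast
  have s: "slin r V V F" using F by (simp add: frob_def)
  have xV: "x \<in> carrier V" "F x = x" using x by (auto simp: fixpts_def)
  have BV: "b \<in> carrier V" "F b = b" if "b \<in> B" for b using B(3) that by (auto simp: fixpts_def)
  have ga: "\<gamma> x b \<in> carrier L" if "b \<in> B" for b using \<gamma>c xV that by blast
  have "x = F (\<Oplus>\<^bsub>V\<^esub>b\<in>B. \<gamma> x b \<odot>\<^bsub>V\<^esub> b)" using \<gamma> xV by simp
  also have "\<dots> = (\<Oplus>\<^bsub>V\<^esub>b\<in>B. F (\<gamma> x b \<odot>\<^bsub>V\<^esub> b))"
    using ga BV B by (intro slin_finsum[OF V V s]) auto
  also have "\<dots> = (\<Oplus>\<^bsub>V\<^esub>b\<in>B. \<gamma> x b [^] (q ^ r) \<odot>\<^bsub>V\<^esub> b)"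
    using ga BV by (intro V.finsum_cong') (auto simp: slinD(3)[OF s])
  finally have "\<gamma> x b = \<gamma> x b [^] (q ^ r)" if "b \<in> B" for b
    using \<gamma>(2)[of "\<lambda>b. \<gamma> x b [^] (q ^ r)" b] that ga by auto
  then show thesis using that[of "\<gamma> x"] \<gamma>(1)[OF xV(1)] ga by (auto simp: fixed_def)
qed

lemma finite_fixpts:
  assumes V: "vectorspace L V" "vectorspace.fin_dim L V" and F: "frob r V F" "r > 0"
  shows "finite (fixpts V F)"
proof -
  interpret V: vectorspace L V by fact
  obtain B where B: "finite B" "B \<subseteq> fixpts V F" "vectorspace.basis L V B"
    using fixpts_basis[OF V F] .
  have "fixpts V F \<subseteq> (\<lambda>a. \<Oplus>\<^bsub>V\<^esub>b\<in>B. a b \<odot>\<^bsub>V\<^esub> b) ` (B \<rightarrow>\<^sub>E fixed r)"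
  proof
    fix x assume "x \<in> fixpts V F"
    then obtain a where a: "a \<in> B \<rightarrow> fixed r" "x = (\<Oplus>\<^bsub>V\<^esub>b\<in>B. a b \<odot>\<^bsub>V\<^esub> b)"
      using fixpts_coords[OF V(1) F(1) B(1,3,2)] by blast
    have "x = (\<Oplus>\<^bsub>V\<^esub>b\<in>B. restrict a B b \<odot>\<^bsub>V\<^esub> b)"
      unfolding a(2) using a(1) B(2)
      by (intro V.finsum_cong') (auto simp: fixpts_def fixed_def Pi_def subset_eq)
    then show "x \<in> (\<lambda>a. \<Oplus>\<^bsub>V\<^esub>b\<in>B. a b \<odot>\<^bsub>V\<^esub> b) ` (B \<rightarrow>\<^sub>E fixed r)" using a(1) by (intro image_eqI) auto
  qed
  moreover have "finite (B \<rightarrow>\<^sub>E fixed r)" using B(1) card_fixed(1)[OF F(2)] by (intro finite_PiE) auto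
  ultimately show ?thesis using finite_surj by blast
qed

lemma fixpts_closed:
  assumes V: "vectorspace L V" and F: "slin r V V F"
  shows "\<zero>\<^bsub>V\<^esub> \<in> fixpts V F" "\<lbrakk>x \<in> fixpts V F; y \<in> fixpts V F\<rbrakk> \<Longrightarrow> x \<oplus>\<^bsub>V\<^esub> y \<in> fixpts V F"
    "\<lbrakk>c \<in> fixed r; x \<in> fixpts V F\<rbrakk> \<Longrightarrow> c \<odot>\<^bsub>V\<^esub> x \<in> fixpts V F"
proof -
  interpret V: vectorspace L V by fact
  show "\<zero>\<^bsub>V\<^esub> \<in> fixpts V F" "\<lbrakk>x \<in> fixpts V F; y \<in> fixpts V F\<rbrakk> \<Longrightarrow> x \<oplus>\<^bsub>V\<^esub> y \<in> fixpts V F"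
    "\<lbrakk>c \<in> fixed r; x \<in> fixpts V F\<rbrakk> \<Longrightarrow> c \<odot>\<^bsub>V\<^esub> x \<in> fixpts V F"
    using slin_zero[OF V V F] slinD[OF F] by (auto simp: fixpts_def fixed_def)
qed

text \<open>A basis of V made of fixed vectors also generates the fixed points over the field with
  q^r elements (\<open>fixpts_coords\<close>). So V is the scalar extension of its fixed points, and
  prescribing images of that basis prescribes the map.\<close>

lemma slin_extension:
  assumes V: "vectorspace L V" "vectorspace.fin_dim L V" and F: "frob r V F" "r > 0"
    and W: "vectorspace L W" and h: "\<And>x. x \<in> fixpts V F \<Longrightarrow> h x \<in> carrier W"
    "\<And>x y. \<lbrakk>x \<in> fixpts V F; y \<in> fixpts V F\<rbrakk> \<Longrightarrow> h (x \<oplus>\<^bsub>V\<^esub> y) = h x \<oplus>\<^bsub>W\<^esub> h y"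
    "\<And>c x. \<lbrakk>c \<in> fixed r; x \<in> fixpts V F\<rbrakk> \<Longrightarrow> h (c \<odot>\<^bsub>V\<^esub> x) = c [^] (q ^ n) \<odot>\<^bsub>W\<^esub> h x"
  obtains u where "slin n V W u" "\<And>x. x \<in> fixpts V F \<Longrightarrow> u x = h x"
proof -
  interpret V: vectorspace L V by fact
  interpret W: vectorspace L W by fact
  have s: "slin r V V F" using F by (simp add: frob_def)
  obtain B where B: "finite B" "B \<subseteq> fixpts V F" "vectorspace.basis L V B"
    using fixpts_basis[OF V F] .
  obtain u where u: "slin n V W u" "\<And>b. b \<in> B \<Longrightarrow> u b = h b"
    using slin_basis_map[OF V(1) W B(1,3), of h n] h(1) B(2) by blast
  have "u x = h x" if x: "x \<in> fixpts V F" for x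
  proof -
    obtain a where a: "a \<in> B \<rightarrow> fixed r" "x = (\<Oplus>\<^bsub>V\<^esub>b\<in>B. a b \<odot>\<^bsub>V\<^esub> b)"
      using fixpts_coords[OF V(1) F(1) B(1,3,2) x] .
    have ab: "a b \<in> fixed r" "a b \<in> carrier L" "b \<in> carrier V" "b \<in> fixpts V F" "a b \<odot>\<^bsub>V\<^esub> b \<in> fixpts V F"
      if "b \<in> B" for b
    proof -
      show *: "a b \<in> fixed r" "b \<in> fixpts V F" using a(1) B(2) that by blast+
      then show "a b \<in> carrier L" "b \<in> carrier V" by (simp_all add: fixed_closed fixpts_def)
      show "a b \<odot>\<^bsub>V\<^esub> b \<in> fixpts V F" using fixpts_closed(3)[OF V(1) s *] .
    qed
    have "h \<zero>\<^bsub>V\<^esub> \<oplus>\<^bsub>W\<^esub> h \<zero>\<^bsub>V\<^esub> = h \<zero>\<^bsub>V\<^esub>" "h \<zero>\<^bsub>V\<^esub> \<in> carrier W"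
      using h(1,2) fixpts_closed[OF V(1) s] V.zero_closed by (metis V.r_zero)+
    then have h0: "h \<zero>\<^bsub>V\<^esub> = \<zero>\<^bsub>W\<^esub>" by simp
    have "h x = (\<Oplus>\<^bsub>W\<^esub>b\<in>B. h (a b \<odot>\<^bsub>V\<^esub> b))"
      unfolding a(2)
      by (rule additive_finsum(2)[OF V.abelian_monoid_axioms W.abelian_monoid_axioms, where S = "fixpts V F"])
        (use h h0 fixpts_closed[OF V(1) s] ab B in \<open>auto simp: fixpts_def\<close>)
    also have "\<dots> = (\<Oplus>\<^bsub>W\<^esub>b\<in>B. u (a b \<odot>\<^bsub>V\<^esub> b))"
      using ab u h slinD[OF u(1)] by (intro W.finsum_cong') auto
    also have "\<dots> = u x"
      unfolding a(2) using ab B by (intro slin_finsum[OF V(1) W u(1), symmetric]) auto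
    finally show ?thesis by simp
  qed
  then show thesis using that u(1) by blast
qed

text \<open>Map a basis fixed by F bijectively to a basis fixed by G. Both sides of the intertwining
  relation are semilinear of degree r and agree on the first basis. This is the uniqueness of the
  structure over a finite field.\<close>

lemma frob_conjugate:
  assumes V: "vectorspace L V" "vectorspace.fin_dim L V" and F: "frob r V F" "frob r V G" "r > 0"
  obtains g where "slin 0 V V g" "bij_betw g (carrier V) (carrier V)" "\<And>x. x \<in> carrier V \<Longrightarrow> g (F x) = G (g x)"
proof -
  interpret V: vectorspace L V by fact
  obtain B where B: "finite B" "B \<subseteq> fixpts V F" "V.basis B" using fixpts_basis[OF V F(1,3)] .
  obtain C where C: "finite C" "C \<subseteq> fixpts V G" "V.basis C" using fixpts_basis[OF V F(2,3)] .
  have BC: "B \<subseteq> carrier V" "C \<subseteq> carrier V" using B C by (auto simp: V.basis_def)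
  have "card B = card C" using V.dim_basis B C by metis
  then obtain \<pi> where \<pi>: "bij_betw \<pi> B C" using finite_same_card_bij B C by blast
  define \<rho> where "\<rho> = inv_into B \<pi>"
  have \<rho>: "bij_betw \<rho> C B" using \<pi> by (simp add: \<rho>_def bij_betw_inv_into)
  have \<pi>\<rho>: "\<pi> (\<rho> c) = c" if "c \<in> C" for c using \<pi> that by (simp add: \<rho>_def bij_betw_inv_into_right)
  have \<rho>\<pi>: "\<rho> (\<pi> b) = b" if "b \<in> B" for b using \<pi> that by (simp add: \<rho>_def bij_betw_inv_into_left)
  have \<pi>m: "\<pi> b \<in> C" if "b \<in> B" for b using \<pi> that by (auto dest: bij_betwE)
  have \<rho>m: "\<rho> b \<in> B" if "b \<in> C" for b using \<rho> that by (auto dest: bij_betwE)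
  obtain g where g: "slin 0 V V g" "\<And>b. b \<in> B \<Longrightarrow> g b = \<pi> b"
    using slin_basis_map[OF V(1) V(1) B(1,3), of \<pi> 0] \<pi>m BC by blast
  obtain g' where g': "slin 0 V V g'" "\<And>b. b \<in> C \<Longrightarrow> g' b = \<rho> b"
    using slin_basis_map[OF V(1) V(1) C(1,3), of \<rho> 0] \<rho>m BC by blast
  have spB: "carrier V \<subseteq> V.span B" "carrier V \<subseteq> V.span C" using B C by (auto simp: V.basis_def)
  have g'g: "g' (g x) = x" if "x \<in> carrier V" for x
    by (rule slin_eq_on_span[OF V(1) V(1) BC(1) spB(1), of 0 "\<lambda>x. g' (g x)" "\<lambda>x. x"])
      (use slin_comp[OF g(1) g'(1)] slin_id[OF V(1)] g g' \<pi>m \<rho>\<pi> that in auto)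
  have gg': "g (g' x) = x" if "x \<in> carrier V" for x
    by (rule slin_eq_on_span[OF V(1) V(1) BC(2) spB(2), of 0 "\<lambda>x. g (g' x)" "\<lambda>x. x"])
      (use slin_comp[OF g'(1) g(1)] slin_id[OF V(1)] g g' \<rho>m \<pi>\<rho> that in auto)
  have "bij_betw g (carrier V) (carrier V)"
    by (rule bij_betw_byWitness[where f' = g']) (use g'g gg' slinD(1)[OF g(1)] slinD(1)[OF g'(1)] in auto)
  moreover have s: "slin r V V F" "slin r V V G" using F by (auto simp: frob_def)
  have FG: "\<And>b. b \<in> B \<Longrightarrow> F b = b" "\<And>c. c \<in> C \<Longrightarrow> G c = c"
    using B(2) C(2) by (auto simp: fixpts_def)
  have "g (F x) = G (g x)" if "x \<in> carrier V" for x
    by (rule slin_eq_on_span[OF V(1) V(1) BC(1) spB(1), of r "\<lambda>x. g (F x)" "\<lambda>x. G (g x)"])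
      (use slin_comp[OF s(1) g(1)] slin_comp[OF g(1) s(2)] g \<pi>m FG that in auto)
  ultimately show thesis using that g(1) by blast
qed

text \<open>Every semilinear map is defined over some finite field: choose m such that
  \<open>G ^^ m\<close> fixes the images of a finite basis fixed by F, and compare two semilinear
  maps of equal degree on this basis.\<close>

lemma slin_commutes_power:
  assumes V: "vectorspace L V" "vectorspace.fin_dim L V" and F: "frob r V F" "r > 0"
    and W: "vectorspace L W" and G: "frob r W G" and g: "slin n V W g" and l: "l > 0"
  obtains m where "m > 0" "l dvd m" "\<And>x. x \<in> carrier V \<Longrightarrow> g ((F ^^ m) x) = (G ^^ m) (g x)"
proof -
  interpret V: vectorspace L V by fact
  obtain B where B: "finite B" "B \<subseteq> fixpts V F" "V.basis B" using fixpts_basis[OF V F] .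
  have BV: "B \<subseteq> carrier V" using B by (auto simp: V.basis_def)
  obtain m where m: "m > 0" "l dvd m" "\<And>y. y \<in> g ` B \<Longrightarrow> (G ^^ m) y = y"
    by (rule frob_common_power[OF G _ _ l, of "g ` B"]) (use B BV slinD(1)[OF g] in auto)
  have s: "slin r V V F" "slin r W W G" using F G by (auto simp: frob_def)
  have Fb: "(F ^^ m) b = b" if "b \<in> B" for b
    using that B(2) funpow_mult_fixed[of 1 F b m] by (auto simp: fixpts_def)
  have "g ((F ^^ m) x) = (G ^^ m) (g x)" if "x \<in> carrier V" for x
    by (rule slin_eq_on_span[OF V(1) W BV, of "n + r * m" "\<lambda>x. g ((F ^^ m) x)" "\<lambda>x. (G ^^ m) (g x)"])
      (use slin_comp[OF slin_funpow[OF V(1) s(1)] g] slin_comp[OF g slin_funpow[OF W s(2)]] m Fb that B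
        in \<open>auto simp: V.basis_def add.commute\<close>)
  then show thesis using that m by blast
qed

end

section \<open>Idempotent powers and finite orbits\<close>

lemma finite_idempotent_power:
  assumes S: "finite S" "\<And>x. x \<in> S \<Longrightarrow> g x \<in> S"
  obtains m where "m > 0" "\<And>x. x \<in> S \<Longrightarrow> (g ^^ m) ((g ^^ m) x) = (g ^^ m) x"
proof -
  have cl: "(g ^^ i) x \<in> S" if "x \<in> S" for i x using that S(2) by (induction i) auto
  define \<Phi> where "\<Phi> i = restrict (g ^^ i) S" for i
  have "\<Phi> i \<in> S \<rightarrow>\<^sub>E S" for i using cl by (auto simp: \<Phi>_def)
  then have "\<Phi> ` UNIV \<subseteq> (S \<rightarrow>\<^sub>E S)" by blast
  then have "finite (\<Phi> ` UNIV)" using S(1) by (meson finite_PiE finite_subset)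
  then have "\<not> inj \<Phi>" using finite_imageD by blast
  then obtain a b where ab: "a < b" "\<Phi> a = \<Phi> b" unfolding inj_def by (metis linorder_neqE_nat)
  define d where "d = b - a"
  have d: "d > 0" "b = d + a" using ab by (auto simp: d_def)
  have eq: "(g ^^ (d + a)) x = (g ^^ a) x" if "x \<in> S" for x
    using fun_cong[OF ab(2), of x] that d(2) by (simp add: \<Phi>_def)
  have step: "(g ^^ (d + i)) x = (g ^^ i) x" if "x \<in> S" "a \<le> i" for x i
  proof -
    have "(g ^^ (d + i)) x = (g ^^ (d + a)) ((g ^^ (i - a)) x)"
      using that(2) by (simp add: funpow_add[symmetric, THEN fun_cong, unfolded comp_def])
    also have "\<dots> = (g ^^ a) ((g ^^ (i - a)) x)" using eq[OF cl[OF that(1)]] .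
    also have "\<dots> = (g ^^ i) x" using that(2) by (simp add: funpow_add[symmetric, THEN fun_cong, unfolded comp_def])
    finally show ?thesis .
  qed
  have steps: "(g ^^ (d * j + i)) x = (g ^^ i) x" if "x \<in> S" "a \<le> i" for x i j
    using that by (induction j) (simp_all add: step add.assoc)
  \<comment> \<open>A multiple of the period \<open>d\<close> that is at least the preperiod
    \<open>a\<close>, so that adding m to an exponent m changes nothing.\<close>
  define m where "m = d * Suc a"
  have "a \<le> m" "m > 0" using d(1) by (auto simp: m_def trans_le_add2 Suc_leI intro: order_trans[of _ "1 * Suc a"])
  moreover from this have "(g ^^ m) ((g ^^ m) x) = (g ^^ m) x" if "x \<in> S" for x
    using steps[OF that, of m "Suc a"] by (simp only: m_def[symmetric] funpow_add comp_apply)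
  ultimately show thesis using that by blast
qed

context frobenius_field
begin

text \<open>This takes the place of Fitting's lemma. The map g commutes with some
  \<open>F ^^ l\<close>, hence acts on the finite set of vectors fixed by it. A power that is
  idempotent there is idempotent everywhere, because these vectors span.\<close>

lemma linear_idempotent_power:
  assumes V: "vectorspace L V" "vectorspace.fin_dim L V" and F: "frob r V F" "r > 0" and g: "slin 0 V V g"
  obtains m where "m > 0" "\<And>x. x \<in> carrier V \<Longrightarrow> (g ^^ m) ((g ^^ m) x) = (g ^^ m) x"
proof -
  obtain l where l: "l > 0" "\<And>x. x \<in> carrier V \<Longrightarrow> g ((F ^^ l) x) = (F ^^ l) (g x)"
    by (rule slin_commutes_power[OF V F V(1) F(1) g, of 1]) (simp, blast)
  have G: "frob (r * l) V (F ^^ l)" "r * l > 0" using frob_funpow[OF V(1) F(1) l(1)] F(2) l(1) by auto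
  have "g x \<in> fixpts V (F ^^ l)" if "x \<in> fixpts V (F ^^ l)" for x
    using that l(2) slinD(1)[OF g] by (auto simp: fixpts_def) metis
  then obtain m where m: "m > 0" "\<And>x. x \<in> fixpts V (F ^^ l) \<Longrightarrow> (g ^^ m) ((g ^^ m) x) = (g ^^ m) x"
    using finite_idempotent_power[OF finite_fixpts[OF V G], of g] by blast
  have gm: "slin 0 V V (g ^^ m)" using slin_funpow[OF V(1) g, of m] by simp
  have "(g ^^ m) ((g ^^ m) x) = (g ^^ m) x" if "x \<in> carrier V" for x
    by (rule slin_eq_on_fixpts[OF V(1) V(1) G, of 0 "\<lambda>x. (g ^^ m) ((g ^^ m) x)"])
      (use slin_comp[OF gm gm] gm m(2) that in auto)
  then show thesis using that m(1) by blast
qed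

text \<open>An injective map with an idempotent power has finite orbits, and the idempotent power
  exists on any finite invariant set.\<close>

lemma slin_inj_frob:
  assumes V: "vectorspace L V" "vectorspace.fin_dim L V" and F: "frob r V F" "r > 0"
    and g: "slin n V V g" "inj_on g (carrier V)"
  shows "frob n V g"
proof -
  have "\<exists>m>0. (g ^^ m) x = x" if x: "x \<in> carrier V" for x
  proof -
    obtain k where k: "k > 0" "(F ^^ k) x = x" using F x by (auto simp: frob_def)
    \<comment> \<open>As l is a multiple of the orbit length k, the vector x itself lies in the
      finite set of fixed points of \<open>F ^^ l\<close>, which g preserves.\<close>
    obtain l where l: "l > 0" "k dvd l" "\<And>x. x \<in> carrier V \<Longrightarrow> g ((F ^^ l) x) = (F ^^ l) (g x)"
      by (rule slin_commutes_power[OF V F V(1) F(1) g(1) k(1)]) blast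
    have G: "frob (r * l) V (F ^^ l)" "r * l > 0" using frob_funpow[OF V(1) F(1) l(1)] F(2) l(1) by auto
    have "g y \<in> fixpts V (F ^^ l)" if "y \<in> fixpts V (F ^^ l)" for y
      using that l(3) slinD(1)[OF g(1)] by (auto simp: fixpts_def) metis
    then obtain m where m: "m > 0" "\<And>x. x \<in> fixpts V (F ^^ l) \<Longrightarrow> (g ^^ m) ((g ^^ m) x) = (g ^^ m) x"
      using finite_idempotent_power[OF finite_fixpts[OF V G], of g] by blast
    have "(F ^^ l) x = x" using l(2) funpow_mult_fixed[OF k(2)] by (auto elim: dvdE)
    then have "(g ^^ m) ((g ^^ m) x) = (g ^^ m) x" using m(2) x by (simp add: fixpts_def)
    moreover have cl: "(g ^^ i) y \<in> carrier V" if "y \<in> carrier V" for i y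
      using that slinD(1)[OF g(1)] by (induction i) auto
    have "(g ^^ i) y = (g ^^ i) z \<Longrightarrow> y = z" if "y \<in> carrier V" "z \<in> carrier V" for i y z
      using that
    proof (induction i)
      case (Suc i)
      then have "(g ^^ i) y = (g ^^ i) z" using inj_onD[OF g(2)] cl by (metis comp_apply funpow.simps(2))
      then show ?case using Suc by blast
    qed simp
    ultimately show ?thesis using m(1) x cl by blast
  qed
  then show ?thesis using g(1) by (simp add: frob_def)
qed

end

section \<open>Semilinear maps of modules\<close>

declare base_space_simps(4) [simp del]

lemma (in left_module) smult_zero: "a \<in> carrier A \<Longrightarrow> a \<odot>\<^bsub>M\<^esub> \<zero>\<^bsub>M\<^esub> = \<zero>\<^bsub>M\<^esub>"
  using lm_r_distr[of a "\<zero>\<^bsub>M\<^esub>" "\<zero>\<^bsub>M\<^esub>"] lm_closed[of a "\<zero>\<^bsub>M\<^esub>"] by (metis M.add.l_cancel_one' M.zero_closed M.r_zero)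

lemma (in left_module) zero_smult: "x \<in> carrier M \<Longrightarrow> \<zero>\<^bsub>A\<^esub> \<odot>\<^bsub>M\<^esub> x = \<zero>\<^bsub>M\<^esub>"
  using lm_l_distr[of "\<zero>\<^bsub>A\<^esub>" "\<zero>\<^bsub>A\<^esub>" x] lm_closed[of "\<zero>\<^bsub>A\<^esub>" x] by (metis M.add.l_cancel_one' A.zero_closed A.r_zero)

lemma finsum_base_space [simp]: "finsum (base_space K A M) f I = finsum M f I"
  by (simp add: finsum_def finprod_def base_space_def)

lemma fixed_points_simps [simp]:
  "carrier (fixed_points F M) = {x \<in> carrier M. F x = x}" "zero (fixed_points F M) = zero M"
  "add (fixed_points F M) = add M" "smult (fixed_points F M) = smult M"
  "monoid.mult (fixed_points F M) = monoid.mult M" "one (fixed_points F M) = one M"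
  by (simp_all add: fixed_points_def)

lemma finsum_subset:
  assumes H: "abelian_monoid H" and G: "abelian_monoid G"
    and eq: "carrier H \<subseteq> carrier G" "zero H = zero G" "add H = add G"
    and I: "finite I" "\<And>i. i \<in> I \<Longrightarrow> f i \<in> carrier H"
  shows "finsum H f I = finsum G f I"
proof -
  interpret H: abelian_monoid H by fact
  have "\<zero>\<^bsub>G\<^esub> \<in> carrier H" "\<And>x y. \<lbrakk>x \<in> carrier H; y \<in> carrier H\<rbrakk> \<Longrightarrow> x \<oplus>\<^bsub>G\<^esub> y \<in> carrier H"
    using H.zero_closed H.a_closed eq by simp_all
  then show ?thesis
    by (rule_tac additive_finsum(2)[OF H G, where S = "carrier H" and h = "\<lambda>x. x"]) (use eq I in auto)
qed

lemma (in vectorspace) finite_carrier_fin_dim: "finite (carrier V) \<Longrightarrow> fin_dim"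
  using in_own_span[of "carrier V"] span_is_subset2[of "carrier V"] by (auto simp: fin_dim_def)

lemma (in vectorspace) fin_dim_finite_carrier:
  assumes "fin_dim" "finite (carrier K)" shows "finite (carrier V)"
proof -
  obtain B where B: "finite B" "B \<subseteq> carrier V" "span B = carrier V" using assms(1) by (auto simp: fin_dim_def)
  have "carrier V \<subseteq> (\<lambda>a. lincomb a B) ` (B \<rightarrow>\<^sub>E carrier K)"
  proof
    fix x assume "x \<in> carrier V"
    then obtain a where a: "a \<in> B \<rightarrow> carrier K" "x = lincomb a B"
      using finite_in_span[OF B(1,2)] B(3) by metis
    have "x = lincomb (restrict a B) B"
      unfolding a(2) lincomb_def using a(1) B(2)
      by (intro finsum_cong') (auto intro!: smult_closed)
    then show "x \<in> (\<lambda>a. lincomb a B) ` (B \<rightarrow>\<^sub>E carrier K)" using a(1) by (intro image_eqI) auto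
  qed
  moreover have "finite (B \<rightarrow>\<^sub>E carrier K)" using B assms(2) by (intro finite_PiE) auto
  ultimately show ?thesis using finite_surj by blast
qed

text \<open>The zero algebra is excluded because scalars are compared through their multiples of the
  unit of \<open>A\<close>. The existence of an almost split morphism already forces the unit to be
  nonzero (\<open>minimal_right_almost_split_nonzero\<close>).\<close>

locale frobenius_algebra = frobenius_field L q
  for L :: "'k ring" (structure) and q :: nat +
  fixes A :: "('k, 'a) module" and FA :: "'a \<Rightarrow> 'a"
  assumes fd_A: "fd_algebra L A" and frob_A: "frobenius_morphism q L A FA"
    and one_not_zero_A: "\<one>\<^bsub>A\<^esub> \<noteq> \<zero>\<^bsub>A\<^esub>"
begin

abbreviation K1 where "K1 \<equiv> L\<lparr>carrier := fixed (Suc 0)\<rparr>"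
abbreviation AF where "AF \<equiv> fixed_points FA A"
abbreviation bs :: "('a, 'm) module \<Rightarrow> ('k, 'm) module" where "bs M \<equiv> base_space L A M"

text \<open>\<open>u\<close> is a homomorphism from \<open>M\<^bsup>[j]\<^esup>\<close> to \<open>N\<^bsup>[i]\<^esup>\<close>. Only \<open>j - i\<close> matters (\<open>tlin_shift\<close>); two indices are
  used because this difference can be negative.\<close>

definition tlin :: "nat \<Rightarrow> nat \<Rightarrow> ('a, 'm) module \<Rightarrow> ('a, 'n) module \<Rightarrow> ('m \<Rightarrow> 'n) \<Rightarrow> bool" where
  "tlin i j M N u \<longleftrightarrow>
     u \<in> carrier M \<rightarrow> carrier N \<and>
     (\<forall>x\<in>carrier M. \<forall>y\<in>carrier M. u (x \<oplus>\<^bsub>M\<^esub> y) = u x \<oplus>\<^bsub>N\<^esub> u y) \<and>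
     (\<forall>a\<in>carrier A. \<forall>x\<in>carrier M. u ((FA ^^ i) a \<odot>\<^bsub>M\<^esub> x) = (FA ^^ j) a \<odot>\<^bsub>N\<^esub> u x)"

text \<open>An isomorphism from the r-th twist of M to M, precomposed with \<open>F ^^ r\<close>, is
  such a map, but the Frobenius map chosen on M has disappeared from the description. For r = 1 the
  pair is an F-stable module (\<open>tfrob_F_stable\<close>).\<close>

definition tfrob :: "nat \<Rightarrow> ('a, 'm) module \<Rightarrow> ('m \<Rightarrow> 'm) \<Rightarrow> bool" where
  "tfrob r M \<theta> \<longleftrightarrow> fd_module L A M \<and> r > 0 \<and> tlin 0 r M M \<theta> \<and> (\<forall>x\<in>carrier M. \<exists>n>0. (\<theta> ^^ n) x = x)"

lemma tlinD:
  assumes "tlin i j M N u"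
  shows "x \<in> carrier M \<Longrightarrow> u x \<in> carrier N"
    and "\<lbrakk>x \<in> carrier M; y \<in> carrier M\<rbrakk> \<Longrightarrow> u (x \<oplus>\<^bsub>M\<^esub> y) = u x \<oplus>\<^bsub>N\<^esub> u y"
    and "\<lbrakk>a \<in> carrier A; x \<in> carrier M\<rbrakk> \<Longrightarrow> u ((FA ^^ i) a \<odot>\<^bsub>M\<^esub> x) = (FA ^^ j) a \<odot>\<^bsub>N\<^esub> u x"
  using assms by (auto simp: tlin_def)

lemma tlinI:
  assumes "\<And>x. x \<in> carrier M \<Longrightarrow> u x \<in> carrier N"
    and "\<And>x y. \<lbrakk>x \<in> carrier M; y \<in> carrier M\<rbrakk> \<Longrightarrow> u (x \<oplus>\<^bsub>M\<^esub> y) = u x \<oplus>\<^bsub>N\<^esub> u y"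
    and "\<And>a x. \<lbrakk>a \<in> carrier A; x \<in> carrier M\<rbrakk> \<Longrightarrow> u ((FA ^^ i) a \<odot>\<^bsub>M\<^esub> x) = (FA ^^ j) a \<odot>\<^bsub>N\<^esub> u x"
  shows "tlin i j M N u"
  using assms by (auto simp: tlin_def)

lemma tlin_module_hom: "tlin 0 0 M N u \<longleftrightarrow> u \<in> module_hom A M N"
  by (auto simp: tlin_def module_hom_def)

lemma vs_A: "vectorspace L A" and fin_dim_A: "vectorspace.fin_dim L A" and ring_A: "ring A"
  using fd_A by (auto simp: fd_algebra_def)

sublocale A: ring A by (rule ring_A)
sublocale AV: vectorspace L A by (rule vs_A)

lemma smult_mult_A:
  "\<lbrakk>c \<in> carrier L; x \<in> carrier A; y \<in> carrier A\<rbrakk> \<Longrightarrow> (c \<odot>\<^bsub>A\<^esub> x) \<otimes>\<^bsub>A\<^esub> y = c \<odot>\<^bsub>A\<^esub> (x \<otimes>\<^bsub>A\<^esub> y)"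
  "\<lbrakk>c \<in> carrier L; x \<in> carrier A; y \<in> carrier A\<rbrakk> \<Longrightarrow> x \<otimes>\<^bsub>A\<^esub> (c \<odot>\<^bsub>A\<^esub> y) = c \<odot>\<^bsub>A\<^esub> (x \<otimes>\<^bsub>A\<^esub> y)"
  using fd_A by (auto simp: fd_algebra_def)

lemma FA_frob: "frob (Suc 0) A FA"
  using frob_A unfolding frobenius_morphism_def frobenius_map_def frob_def slin_def
  by (auto dest: bij_betwE)

lemma FA_slin: "slin n A A (FA ^^ n)"
  using slin_funpow[OF vs_A, of "Suc 0" FA n] FA_frob by (simp add: frob_def)

lemma FA_closed: "a \<in> carrier A \<Longrightarrow> (FA ^^ n) a \<in> carrier A"
  using slinD(1)[OF FA_slin] .

lemma FA_mult: "\<lbrakk>a \<in> carrier A; b \<in> carrier A\<rbrakk> \<Longrightarrow> (FA ^^ n) (a \<otimes>\<^bsub>A\<^esub> b) = (FA ^^ n) a \<otimes>\<^bsub>A\<^esub> (FA ^^ n) b"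
  using frob_A FA_closed by (induction n) (auto simp: frobenius_morphism_def)

lemma FA_one: "(FA ^^ n) \<one>\<^bsub>A\<^esub> = \<one>\<^bsub>A\<^esub>"
  using frob_A by (induction n) (auto simp: frobenius_morphism_def)

lemma FA_scalar: "c \<in> carrier L \<Longrightarrow> (FA ^^ n) (c \<odot>\<^bsub>A\<^esub> \<one>\<^bsub>A\<^esub>) = c [^] (q ^ n) \<odot>\<^bsub>A\<^esub> \<one>\<^bsub>A\<^esub>"
  using slinD(3)[OF FA_slin, of c "\<one>\<^bsub>A\<^esub>" n] by (simp add: FA_one)

lemma FA_fixed: "a \<in> carrier AF \<Longrightarrow> (FA ^^ n) a = a"
  by (induction n) auto

lemma FA_bij: "bij_betw (FA ^^ n) (carrier A) (carrier A)"
proof (induction n)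
  case (Suc n)
  have "bij_betw FA (carrier A) (carrier A)" by (rule frob_bij[OF vs_A FA_frob])
  then show ?case using bij_betw_trans[OF Suc, of FA "carrier A"] by (simp add: comp_def)
qed (simp add: bij_betw_def)

lemma FA_surj: "a \<in> carrier A \<Longrightarrow> \<exists>b\<in>carrier A. (FA ^^ n) b = a"
  using FA_bij[of n] unfolding bij_betw_def by (metis imageE)

lemma AF_fixpts: "carrier AF = fixpts A FA"
  by (simp add: fixpts_def)

lemma AF_closed: "a \<in> carrier AF \<Longrightarrow> a \<in> carrier A"
  by simp

lemma scalar_AF: "c \<in> fixed (Suc 0) \<Longrightarrow> c \<odot>\<^bsub>A\<^esub> \<one>\<^bsub>A\<^esub> \<in> carrier AF"
  using FA_scalar[of c "Suc 0"] by (auto simp: fixed_def)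

text \<open>\<open>FA\<close> is bijective on \<open>A\<close>, so a common power of it can be
  absorbed into the algebra element. This makes formal differences of degrees meaningful.\<close>

lemma tlin_shift: "tlin (i + m) (j + m) M N u \<longleftrightarrow> tlin i j M N u"
proof
  assume u: "tlin (i + m) (j + m) M N u"
  show "tlin i j M N u"
  proof (rule tlinI)
    fix a x assume "a \<in> carrier A" "x \<in> carrier M"
    moreover obtain b where "b \<in> carrier A" "(FA ^^ m) b = a" using FA_surj \<open>a \<in> _\<close> by blast
    ultimately show "u ((FA ^^ i) a \<odot>\<^bsub>M\<^esub> x) = (FA ^^ j) a \<odot>\<^bsub>N\<^esub> u x"
      using tlinD(3)[OF u, of b x] by (simp add: funpow_add)
  qed (use tlinD[OF u] in auto)
next
  assume u: "tlin i j M N u"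
  show "tlin (i + m) (j + m) M N u"
    by (rule tlinI) (use tlinD[OF u] FA_closed in \<open>auto simp: funpow_add\<close>)
qed

lemma tlin_comp:
  assumes u: "tlin i j M N u" and v: "tlin i' j' N P v"
  shows "tlin (i + i') (j + j') M P (\<lambda>x. v (u x))"
proof (rule tlinI)
  fix a x assume ax: "a \<in> carrier A" "x \<in> carrier M"
  have "v (u ((FA ^^ (i + i')) a \<odot>\<^bsub>M\<^esub> x)) = v ((FA ^^ (j + i')) a \<odot>\<^bsub>N\<^esub> u x)"
    using tlinD(3)[OF u, of "(FA ^^ i') a" x] ax FA_closed by (simp add: funpow_add)
  also have "\<dots> = (FA ^^ (j + j')) a \<odot>\<^bsub>P\<^esub> v (u x)"
    using tlinD(3)[OF v, of "(FA ^^ j) a" "u x"] ax FA_closed tlinD(1)[OF u]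
    by (simp add: funpow_add[symmetric, THEN fun_cong, unfolded comp_def] add.commute)
  finally show "v (u ((FA ^^ (i + i')) a \<odot>\<^bsub>M\<^esub> x)) = (FA ^^ (j + j')) a \<odot>\<^bsub>P\<^esub> v (u x)" .
qed (use tlinD[OF u] tlinD[OF v] in auto)

lemma tlin_comp0: "\<lbrakk>tlin 0 i M N u; tlin 0 j N P v\<rbrakk> \<Longrightarrow> tlin 0 (i + j) M P (\<lambda>x. v (u x))"
  using tlin_comp[of 0 i M N u 0 j P v] by simp

lemma tlin_id: "tlin i i M M (\<lambda>x. x)"
  by (auto simp: tlin_def)

lemma tlin_funpow: "tlin i j M M u \<Longrightarrow> tlin (n * i) (n * j) M M (u ^^ n)"
proof (induction n)
  case 0 then show ?case using tlin_id[of 0 M] by (simp add: tlin_def)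
next
  case (Suc n) then show ?case using tlin_comp[OF Suc.IH Suc.prems] by (simp add: add.commute comp_def Suc)
qed

lemma tlin_cong: "\<lbrakk>tlin i j M N u; \<And>x. x \<in> carrier M \<Longrightarrow> v x = u x; left_module A M\<rbrakk> \<Longrightarrow> tlin i j M N v"
proof -
  assume u: "tlin i j M N u" "\<And>x. x \<in> carrier M \<Longrightarrow> v x = u x" and M: "left_module A M"
  interpret M: left_module A M by fact
  show ?thesis
    by (rule tlinI) (use tlinD[OF u(1)] u(2) FA_closed M.lm_closed in auto)
qed

lemma vs_bs: "left_module A M \<Longrightarrow> vectorspace L (bs M)"
  by (rule vectorspace_base_space[OF fd_A])

lemma bs_central:
  assumes M: "left_module A M" and "a \<in> carrier A" "c \<in> carrier L" "x \<in> carrier M"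
  shows "a \<odot>\<^bsub>M\<^esub> (c \<odot>\<^bsub>bs M\<^esub> x) = c \<odot>\<^bsub>bs M\<^esub> (a \<odot>\<^bsub>M\<^esub> x)"
proof -
  interpret M: left_module A M by fact
  show ?thesis
    using assms smult_mult_A[of c "\<one>\<^bsub>A\<^esub>" a] smult_mult_A[of c a "\<one>\<^bsub>A\<^esub>"]
    by (simp add: base_space_simps(4) M.lm_assoc[symmetric])
qed

lemma bs_smult_A:
  assumes M: "left_module A M" and "a \<in> carrier A" "c \<in> carrier L" "x \<in> carrier M"
  shows "(c \<odot>\<^bsub>A\<^esub> a) \<odot>\<^bsub>M\<^esub> x = c \<odot>\<^bsub>bs M\<^esub> (a \<odot>\<^bsub>M\<^esub> x)"
proof -
  interpret M: left_module A M by fact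
  show ?thesis
    using assms smult_mult_A[of c "\<one>\<^bsub>A\<^esub>" a]
    by (simp add: base_space_simps(4) M.lm_assoc[symmetric])
qed

text \<open>Evaluate the compatibility with \<open>A\<close> at multiples of the unit, on which
  \<open>FA\<close> acts by the q-th power of the coefficient.\<close>

lemma tlin_slin: "\<lbrakk>tlin 0 j M N u; left_module A M\<rbrakk> \<Longrightarrow> slin j (bs M) (bs N) u"
  unfolding slin_def using tlinD[of 0 j M N u]
  by (auto simp: base_space_simps(4) FA_scalar[symmetric])

lemma tlin_add:
  assumes N: "left_module A N" and u: "tlin i j M N u" and v: "tlin i j M N v"
  shows "tlin i j M N (\<lambda>x. u x \<oplus>\<^bsub>N\<^esub> v x)"
proof -
  interpret N: left_module A N by fact
  show ?thesis
    by (rule tlinI) (use tlinD[OF u] tlinD[OF v] FA_closed in \<open>auto simp: N.lm_r_distr N.M.a_ac\<close>)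
qed

lemma tlin_smult:
  assumes N: "left_module A N" and u: "tlin i j M N u" and c: "c \<in> carrier L"
  shows "tlin i j M N (\<lambda>x. c \<odot>\<^bsub>bs N\<^esub> u x)"
proof -
  interpret N: left_module A N by fact
  interpret V: vectorspace L "bs N" by (rule vs_bs[OF N])
  show ?thesis
    by (rule tlinI)
      (use tlinD[OF u] c FA_closed V.smult_closed V.smult_r_distr in \<open>auto simp: bs_central[OF N]\<close>)
qed

lemma tlin_zero:
  assumes N: "left_module A N" shows "tlin i j M N (\<lambda>x. \<zero>\<^bsub>N\<^esub>)"
proof -
  interpret N: left_module A N by fact
  have "a \<odot>\<^bsub>N\<^esub> \<zero>\<^bsub>N\<^esub> = \<zero>\<^bsub>N\<^esub>" if "a \<in> carrier A" for a
  proof -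
    have "a \<odot>\<^bsub>N\<^esub> \<zero>\<^bsub>N\<^esub> \<oplus>\<^bsub>N\<^esub> a \<odot>\<^bsub>N\<^esub> \<zero>\<^bsub>N\<^esub> = a \<odot>\<^bsub>N\<^esub> \<zero>\<^bsub>N\<^esub>"
      using N.lm_r_distr[OF that, of "\<zero>\<^bsub>N\<^esub>" "\<zero>\<^bsub>N\<^esub>"] by simp
    then show ?thesis using N.lm_closed[OF that, of "\<zero>\<^bsub>N\<^esub>"] by simp
  qed
  then show ?thesis by (intro tlinI) (simp_all add: FA_closed)
qed

lemma tlin_finsum:
  assumes M: "left_module A M" and N: "left_module A N" and I: "finite I" "\<And>l. l \<in> I \<Longrightarrow> tlin i j M N (u l)"
  shows "tlin i j M N (\<lambda>x. \<Oplus>\<^bsub>N\<^esub>l\<in>I. u l x)"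
  using I
proof (induction I rule: finite_induct)
  case empty
  interpret N: left_module A N by fact
  show ?case using tlin_zero[OF N] by simp
next
  case (insert l I)
  interpret N: left_module A N by fact
  have *: "tlin i j M N (\<lambda>x. u l x \<oplus>\<^bsub>N\<^esub> (\<Oplus>\<^bsub>N\<^esub>l\<in>I. u l x))"
    using insert by (intro tlin_add[OF N]) auto
  have eq: "(\<Oplus>\<^bsub>N\<^esub>l\<in>insert l I. u l x) = u l x \<oplus>\<^bsub>N\<^esub> (\<Oplus>\<^bsub>N\<^esub>l\<in>I. u l x)" if "x \<in> carrier M" for x
    using insert that tlinD(1)[OF insert.prems] by (subst N.M.finsum_insert) auto
  show ?case by (rule tlin_cong[OF * eq M])
qed

lemma ring_AF: "ring AF"
proof -
  have "subring (fixpts A FA) A"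
  proof (rule A.subringI)
    show "fixpts A FA \<subseteq> carrier A" by (auto simp: fixpts_def)
    show "\<one>\<^bsub>A\<^esub> \<in> fixpts A FA" using FA_one[of "Suc 0"] by (simp add: fixpts_def)
  next
    fix h assume h: "h \<in> fixpts A FA"
    have "\<ominus>\<^bsub>A\<^esub> h = (\<ominus> \<one>) \<odot>\<^bsub>A\<^esub> h" using h by (simp add: AV.smult_l_minus fixpts_def)
    also have "\<dots> \<in> fixpts A FA"
      using FA_slin[of "Suc 0"] h fixed_ring_closed by (intro fixpts_closed(3)[OF vs_A, of "Suc 0"]) auto
    finally show "\<ominus>\<^bsub>A\<^esub> h \<in> fixpts A FA" .
  next
    fix g h assume "g \<in> fixpts A FA" "h \<in> fixpts A FA"
    then show "g \<otimes>\<^bsub>A\<^esub> h \<in> fixpts A FA" "g \<oplus>\<^bsub>A\<^esub> h \<in> fixpts A FA"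
      using FA_mult[of g h "Suc 0"] fixpts_closed(2)[OF vs_A, of "Suc 0" FA] FA_slin[of "Suc 0"] by (auto simp: fixpts_def)
  qed
  then show ?thesis using A.subring_is_ring by (simp add: fixed_points_def fixpts_def)
qed

lemma field_K1: "field K1"
proof -
  have "subfield (fixed (Suc 0)) L"
  proof (rule subfieldI')
    show "subring (fixed (Suc 0)) L"
      by (rule subringI) (auto intro: fixed_ring_closed simp: fixed_closed)
  next
    fix x assume "x \<in> fixed (Suc 0) - {\<zero>}"
    then show "inv x \<in> fixed (Suc 0)" using units_fixed_inv[of x "Suc 0"] by (auto simp: units_fixed_def)
  qed
  then show ?thesis using subfield_iff(2) by blast
qed

lemma fd_AF: "fd_algebra K1 AF"
proof -
  interpret K1: field K1 by (rule field_K1)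
  interpret AF: ring AF by (rule ring_AF)
  have sm: "c \<odot>\<^bsub>A\<^esub> a \<in> carrier AF" if "c \<in> fixed (Suc 0)" "a \<in> carrier AF" for a c
    using fixpts_closed(3)[OF vs_A, of "Suc 0" FA c a] FA_slin[of "Suc 0"] that by (simp add: fixpts_def)
  have "module K1 AF"
  proof (rule moduleI)
    show "cring K1" "abelian_group AF" by (rule K1.is_cring, rule AF.abelian_group_axioms)
  qed (use sm in \<open>auto simp: AV.smult_l_distr AV.smult_r_distr AV.smult_assoc1 fixed_closed\<close>)
  then interpret V: vectorspace K1 AF unfolding vectorspace_def using K1.field_axioms by blast
  have "finite (carrier AF)"
    using finite_fixpts[OF vs_A fin_dim_A FA_frob] by (simp add: AF_fixpts del: fixed_points_simps)
  then have "V.fin_dim" by (rule V.finite_carrier_fin_dim)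
  then show ?thesis
    by (simp add: fd_algebra_def V.vectorspace_axioms AF.ring_axioms smult_mult_A fixed_closed)
qed

text \<open>The base field of \<open>AF\<close> is finite. It follows that one power of a Frobenius
  map fixes all values of a given homomorphism defined on \<open>Y\<close>.\<close>

lemma finite_AF_module:
  assumes Y: "fd_module K1 AF Y" shows "finite (carrier Y)"
proof -
  interpret V: vectorspace K1 "base_space K1 AF Y"
    using Y by (intro vectorspace_base_space[OF fd_AF]) (simp add: fd_module_def)
  have "finite (carrier (base_space K1 AF Y))"
    using Y card_fixed(1)[of "Suc 0"] by (intro V.fin_dim_finite_carrier) (auto simp: fd_module_def)
  then show ?thesis by simp
qed

lemma fd_AF_moduleI:
  assumes Y: "left_module AF Y" "finite (carrier Y)" shows "fd_module K1 AF Y"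
proof -
  interpret V: vectorspace K1 "base_space K1 AF Y" by (intro vectorspace_base_space[OF fd_AF] Y)
  show ?thesis using Y V.finite_carrier_fin_dim by (simp add: fd_module_def)
qed

lemma tfrobD:
  assumes "tfrob r M \<theta>"
  shows "left_module A M" "vectorspace L (bs M)" "vectorspace.fin_dim L (bs M)" "r > 0"
    "tlin 0 r M M \<theta>" "frob r (bs M) \<theta>" "slin r (bs M) (bs M) \<theta>" "fd_module L A M"
    "bij_betw \<theta> (carrier M) (carrier M)"
proof -
  show M: "left_module A M" "vectorspace.fin_dim L (bs M)" "r > 0" "tlin 0 r M M \<theta>" "fd_module L A M"
    using assms by (auto simp: tfrob_def fd_module_def)
  show V: "vectorspace L (bs M)" using vs_bs M by blast
  show "slin r (bs M) (bs M) \<theta>" using tlin_slin M by blast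
  then show F: "frob r (bs M) \<theta>" using assms by (auto simp: frob_def tfrob_def)
  show "bij_betw \<theta> (carrier M) (carrier M)" using frob_bij[OF V F] by simp
qed

lemma fixpts_carrier: "fixpts (bs M) \<theta> = carrier (fixed_points \<theta> M)"
  by (simp add: fixpts_def)

lemma finite_fixed_points: "tfrob r M \<theta> \<Longrightarrow> finite (carrier (fixed_points \<theta> M))"
  using finite_fixpts[of "bs M" r \<theta>] tfrobD[of r M \<theta>] by (simp add: fixpts_def)

lemma left_module_fixed_points:
  assumes M: "tfrob r M \<theta>" shows "left_module AF (fixed_points \<theta> M)"
proof -
  let ?FM = "fixed_points \<theta> M"
  note D = tfrobD[OF M]
  interpret M: left_module A M by (rule D)
  interpret V: vectorspace L "bs M" by (rule D)
  note cl = fixpts_closed[OF D(2,7)]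
  have th: "\<theta> (a \<odot>\<^bsub>M\<^esub> x) = a \<odot>\<^bsub>M\<^esub> \<theta> x" if "a \<in> carrier AF" "x \<in> carrier M" for a x
    using tlinD(3)[OF D(5), of a x] that FA_fixed[OF that(1)] by simp
  have "abelian_group ?FM"
  proof (rule abelian_groupI)
    fix x assume x: "x \<in> carrier ?FM"
    have "(\<ominus> \<one>) \<odot>\<^bsub>bs M\<^esub> x \<in> fixpts (bs M) \<theta>"
      using x by (intro cl(3)) (auto simp: fixpts_def intro: fixed_ring_closed)
    moreover have "(\<ominus> \<one>) \<odot>\<^bsub>bs M\<^esub> x \<oplus>\<^bsub>M\<^esub> x = \<zero>\<^bsub>M\<^esub>"
      using V.smult_l_distr[of "\<ominus> \<one>" \<one> x] x by (simp add: l_neg)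
    ultimately show "\<exists>y\<in>carrier ?FM. y \<oplus>\<^bsub>?FM\<^esub> x = \<zero>\<^bsub>?FM\<^esub>"
      by (auto simp: fixpts_def)
  qed (use cl(1,2) in \<open>auto simp: fixpts_def M.M.a_ac\<close>)
  moreover have "left_module_axioms AF ?FM"
    by unfold_locales (auto simp: th M.lm_closed M.lm_l_distr M.lm_r_distr M.lm_assoc M.lm_one)
  ultimately show ?thesis by (simp add: left_module_def ring_AF)
qed

lemma fd_fixed_points: "tfrob r M \<theta> \<Longrightarrow> fd_module K1 AF (fixed_points \<theta> M)"
  by (intro fd_AF_moduleI left_module_fixed_points finite_fixed_points)

end

lemma module_homD:
  assumes "h \<in> module_hom R M N"
  shows "x \<in> carrier M \<Longrightarrow> h x \<in> carrier N"
    and "\<lbrakk>x \<in> carrier M; y \<in> carrier M\<rbrakk> \<Longrightarrow> h (x \<oplus>\<^bsub>M\<^esub> y) = h x \<oplus>\<^bsub>N\<^esub> h y"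
    and "\<lbrakk>a \<in> carrier R; x \<in> carrier M\<rbrakk> \<Longrightarrow> h (a \<odot>\<^bsub>M\<^esub> x) = a \<odot>\<^bsub>N\<^esub> h x"
  using assms by (auto simp: module_hom_def)

lemma module_homI:
  assumes "\<And>x. x \<in> carrier M \<Longrightarrow> h x \<in> carrier N"
    and "\<And>x y. \<lbrakk>x \<in> carrier M; y \<in> carrier M\<rbrakk> \<Longrightarrow> h (x \<oplus>\<^bsub>M\<^esub> y) = h x \<oplus>\<^bsub>N\<^esub> h y"
    and "\<And>a x. \<lbrakk>a \<in> carrier R; x \<in> carrier M\<rbrakk> \<Longrightarrow> h (a \<odot>\<^bsub>M\<^esub> x) = a \<odot>\<^bsub>N\<^esub> h x"
  shows "h \<in> module_hom R M N"
  using assms by (auto simp: module_hom_def)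

lemma additive_zero:
  assumes M: "abelian_group M" and N: "abelian_group N" and h: "h \<in> carrier M \<rightarrow> carrier N"
    "\<And>x y. \<lbrakk>x \<in> carrier M; y \<in> carrier M\<rbrakk> \<Longrightarrow> h (x \<oplus>\<^bsub>M\<^esub> y) = h x \<oplus>\<^bsub>N\<^esub> h y"
  shows "h \<zero>\<^bsub>M\<^esub> = \<zero>\<^bsub>N\<^esub>"
proof -
  interpret M: abelian_group M by fact
  interpret N: abelian_group N by fact
  have "h \<zero>\<^bsub>M\<^esub> \<in> carrier N" "h \<zero>\<^bsub>M\<^esub> \<oplus>\<^bsub>N\<^esub> h \<zero>\<^bsub>M\<^esub> = h \<zero>\<^bsub>M\<^esub>" using h(1) h(2)[of "\<zero>\<^bsub>M\<^esub>" "\<zero>\<^bsub>M\<^esub>"] by auto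
  then show ?thesis by simp
qed

lemma additive_inj:
  assumes M: "abelian_group M" and N: "abelian_group N" and h: "h \<in> carrier M \<rightarrow> carrier N"
    "\<And>x y. \<lbrakk>x \<in> carrier M; y \<in> carrier M\<rbrakk> \<Longrightarrow> h (x \<oplus>\<^bsub>M\<^esub> y) = h x \<oplus>\<^bsub>N\<^esub> h y"
    and ker: "\<And>x. \<lbrakk>x \<in> carrier M; h x = \<zero>\<^bsub>N\<^esub>\<rbrakk> \<Longrightarrow> x = \<zero>\<^bsub>M\<^esub>"
  shows "inj_on h (carrier M)"
proof (rule inj_onI)
  interpret M: abelian_group M by fact
  interpret N: abelian_group N by fact
  fix x y assume xy: "x \<in> carrier M" "y \<in> carrier M" "h x = h y"
  have "h (x \<ominus>\<^bsub>M\<^esub> y) \<oplus>\<^bsub>N\<^esub> h y = h ((x \<ominus>\<^bsub>M\<^esub> y) \<oplus>\<^bsub>M\<^esub> y)" using xy h(2) by simp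
  also have "\<dots> = h y" using xy by (simp add: M.minus_eq M.a_assoc M.l_neg)
  finally have "h (x \<ominus>\<^bsub>M\<^esub> y) \<oplus>\<^bsub>N\<^esub> h y = h y" .
  then have "h (x \<ominus>\<^bsub>M\<^esub> y) = \<zero>\<^bsub>N\<^esub>" 
  proof -
    have "h (x \<ominus>\<^bsub>M\<^esub> y) \<in> carrier N" "h y \<in> carrier N" using xy h(1) by auto
    then show ?thesis using \<open>h (x \<ominus>\<^bsub>M\<^esub> y) \<oplus>\<^bsub>N\<^esub> h y = h y\<close> by simp
  qed
  then have "x \<ominus>\<^bsub>M\<^esub> y = \<zero>\<^bsub>M\<^esub>" using ker xy by blast
  then show "x = y" using xy by simp
qed

lemma module_hom_finsum:
  assumes M: "left_module R M" and N: "abelian_group N" and h: "h \<in> module_hom R M N"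
    and I: "finite I" "\<And>i. i \<in> I \<Longrightarrow> f i \<in> carrier M"
  shows "h (\<Oplus>\<^bsub>M\<^esub>i\<in>I. f i) = (\<Oplus>\<^bsub>N\<^esub>i\<in>I. h (f i))"
proof -
  interpret M: left_module R M by fact
  interpret N: abelian_group N by fact
  have "h \<zero>\<^bsub>M\<^esub> = \<zero>\<^bsub>N\<^esub>"
    by (rule additive_zero[OF M.M.abelian_group_axioms N]) (use module_homD[OF h] in auto)
  then show ?thesis
    by (intro additive_finsum(2)[OF M.M.abelian_monoid_axioms N.abelian_monoid_axioms, where S = "carrier M"])
      (use I module_homD[OF h] in auto)
qed

context frobenius_algebra
begin

lemma module_hom_fixed_points:
  assumes f: "f \<in> module_hom A P M" and fx: "\<And>x. \<lbrakk>x \<in> carrier P; F x = x\<rbrakk> \<Longrightarrow> G (f x) = f x"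
  shows "f \<in> module_hom AF (fixed_points F P) (fixed_points G M)"
proof (rule module_homI)
  fix x assume "x \<in> carrier (fixed_points F P)"
  then have x: "x \<in> carrier P" "F x = x" by simp_all
  show "f x \<in> carrier (fixed_points G M)" using fx[OF x] module_homD(1)[OF f x(1)] by simp
  show "f (x \<oplus>\<^bsub>fixed_points F P\<^esub> y) = f x \<oplus>\<^bsub>fixed_points G M\<^esub> f y" if "y \<in> carrier (fixed_points F P)" for y
    using module_homD(2)[OF f x(1), of y] that by simp
  show "f (a \<odot>\<^bsub>fixed_points F P\<^esub> x) = a \<odot>\<^bsub>fixed_points G M\<^esub> f x" if "a \<in> carrier AF" for a
    using module_homD(3)[OF f AF_closed[OF that] x(1)] by simp
qed

lemma tlin_inv:
  assumes M: "left_module A M" and u: "tlin i j M N u" "bij_betw u (carrier M) (carrier N)"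
  shows "tlin j i N M (inv_into (carrier M) u)"
proof -
  interpret M: left_module A M by fact
  let ?v = "inv_into (carrier M) u"
  have v: "?v y \<in> carrier M" "u (?v y) = y" if "y \<in> carrier N" for y
    using u(2) that by (auto simp: bij_betw_def inv_into_into f_inv_into_f)
  have eq: "?v (u x) = x" if "x \<in> carrier M" for x using u(2) that by (simp add: bij_betw_def)
  show ?thesis
  proof (rule tlinI)
    fix x y assume "x \<in> carrier N" "y \<in> carrier N"
    then show "?v (x \<oplus>\<^bsub>N\<^esub> y) = ?v x \<oplus>\<^bsub>M\<^esub> ?v y"
      using v eq tlinD(2)[OF u(1), of "?v x" "?v y"] by (metis M.M.a_closed)
  next
    fix a x assume "a \<in> carrier A" "x \<in> carrier N"
    then show "?v ((FA ^^ j) a \<odot>\<^bsub>N\<^esub> x) = (FA ^^ i) a \<odot>\<^bsub>M\<^esub> ?v x"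
      using v eq tlinD(3)[OF u(1), of a "?v x"] FA_closed by (metis M.lm_closed)
  qed (rule v)
qed

section \<open>Extension of homomorphisms from fixed points, and their components\<close>

lemma left_mult_slin:
  assumes M: "left_module A M"
  shows "a \<in> carrier A \<Longrightarrow> slin 0 (bs M) (bs M) (\<lambda>x. a \<odot>\<^bsub>M\<^esub> x)"
    and "x \<in> carrier M \<Longrightarrow> slin 0 A (bs M) (\<lambda>a. a \<odot>\<^bsub>M\<^esub> x)"
proof -
  interpret M: left_module A M by fact
  show "a \<in> carrier A \<Longrightarrow> slin 0 (bs M) (bs M) (\<lambda>x. a \<odot>\<^bsub>M\<^esub> x)"
    "x \<in> carrier M \<Longrightarrow> slin 0 A (bs M) (\<lambda>a. a \<odot>\<^bsub>M\<^esub> x)"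
    by (auto simp: slin_def M.lm_closed M.lm_r_distr M.lm_l_distr bs_central[OF M] bs_smult_A[OF M])
qed

lemma tlin_eq:
  assumes M: "tfrob r M \<theta>" and N: "left_module A N" and u: "tlin 0 j M N u" "tlin 0 j M N v"
    and eq: "\<And>x. \<lbrakk>x \<in> carrier M; \<theta> x = x\<rbrakk> \<Longrightarrow> u x = v x" and x: "x \<in> carrier M"
  shows "u x = v x"
  by (rule slin_eq_on_fixpts[OF tfrobD(2)[OF M] vs_bs[OF N] tfrobD(6,4)[OF M], of j])
    (use u x eq tlin_slin tfrobD(1)[OF M] in \<open>auto simp: fixpts_def\<close>)

lemma hom_AF_scalar:
  assumes "h \<in> module_hom AF Y N" "c \<in> fixed (Suc 0)" "x \<in> carrier Y"
  shows "h ((c \<odot>\<^bsub>A\<^esub> \<one>\<^bsub>A\<^esub>) \<odot>\<^bsub>Y\<^esub> x) = c \<odot>\<^bsub>bs N\<^esub> h x"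
  using module_homD(3)[OF assms(1) scalar_AF[OF assms(2)] assms(3)] by (simp add: base_space_simps(4))

text \<open>As a map of spaces, h extends because M is the scalar extension of its fixed points.
  Compatibility with \<open>A\<close> is obtained in two stages: for fixed a both sides are
  semilinear in x and agree on fixed vectors, then for any x both sides are semilinear in a and
  agree on \<open>AF\<close>, which spans \<open>A\<close>.\<close>

lemma hom_extension:
  assumes M: "tfrob r M \<theta>" and N: "left_module A N" and h: "h \<in> module_hom AF (fixed_points \<theta> M) N"
    and semi: "\<And>c x. \<lbrakk>c \<in> fixed r; x \<in> carrier M; \<theta> x = x\<rbrakk> \<Longrightarrow> h (c \<odot>\<^bsub>bs M\<^esub> x) = c [^] (q ^ j) \<odot>\<^bsub>bs N\<^esub> h x"
  obtains u where "tlin 0 j M N u" "\<And>x. \<lbrakk>x \<in> carrier M; \<theta> x = x\<rbrakk> \<Longrightarrow> u x = h x"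
proof -
  note D = tfrobD[OF M]
  interpret M: left_module A M by (rule D)
  interpret N: left_module A N by fact
  note vN = vs_bs[OF N]
  have hc: "h x \<in> carrier N" if "x \<in> carrier M" "\<theta> x = x" for x
    using module_homD(1)[OF h] that by simp
  have hadd: "h (x \<oplus>\<^bsub>M\<^esub> y) = h x \<oplus>\<^bsub>N\<^esub> h y"
    if "x \<in> carrier M" "\<theta> x = x" "y \<in> carrier M" "\<theta> y = y" for x y
    using module_homD(2)[OF h] that by simp
  have hA: "h (a \<odot>\<^bsub>M\<^esub> x) = a \<odot>\<^bsub>N\<^esub> h x" if "x \<in> carrier M" "\<theta> x = x" "a \<in> carrier AF" for a x
    using module_homD(3)[OF h, of a x] that by simp
  obtain u where u: "slin j (bs M) (bs N) u" "\<And>x. x \<in> fixpts (bs M) \<theta> \<Longrightarrow> u x = h x"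
    by (rule slin_extension[OF D(2,3,6,4) vN, of h j]) (use hc hadd semi in \<open>auto simp: fixpts_def\<close>)
  have uh: "u x = h x" if "x \<in> carrier M" "\<theta> x = x" for x using u(2) that by (simp add: fixpts_def)
  have th: "\<theta> (a \<odot>\<^bsub>M\<^esub> x) = a \<odot>\<^bsub>M\<^esub> \<theta> x" if "a \<in> carrier AF" "x \<in> carrier M" for a x
    using tlinD(3)[OF D(5), of a x] that FA_fixed[OF that(1)] by simp
  have step1: "u (a \<odot>\<^bsub>M\<^esub> x) = a \<odot>\<^bsub>N\<^esub> u x" if a: "a \<in> carrier AF" and x: "x \<in> carrier M" for a x
  proof (rule slin_eq_on_fixpts[OF D(2) vN D(6,4), where n = j and u = "\<lambda>x. u (a \<odot>\<^bsub>M\<^esub> x)" and v = "\<lambda>x. a \<odot>\<^bsub>N\<^esub> u x" and x = x])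
    show "slin j (bs M) (bs N) (\<lambda>x. u (a \<odot>\<^bsub>M\<^esub> x))"
      using slin_comp[OF left_mult_slin(1)[OF D(1) AF_closed[OF a]] u(1)] by simp
    show "slin j (bs M) (bs N) (\<lambda>x. a \<odot>\<^bsub>N\<^esub> u x)"
      using slin_comp[OF u(1) left_mult_slin(1)[OF N AF_closed[OF a]]] by simp
  next
    fix b assume b: "b \<in> fixpts (bs M) \<theta>"
    then show "u (a \<odot>\<^bsub>M\<^esub> b) = a \<odot>\<^bsub>N\<^esub> u b"
      using a hA[of b a] uh th[OF a, of b] M.lm_closed[of a b] by (simp add: fixpts_def)
  qed (use x in simp)
  have "u (a \<odot>\<^bsub>M\<^esub> x) = (FA ^^ j) a \<odot>\<^bsub>N\<^esub> u x" if a: "a \<in> carrier A" and x: "x \<in> carrier M" for a x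
  proof (rule slin_eq_on_fixpts[OF vs_A vN FA_frob zero_less_Suc, where n = j
        and u = "\<lambda>a. u (a \<odot>\<^bsub>M\<^esub> x)" and v = "\<lambda>a. (FA ^^ j) a \<odot>\<^bsub>N\<^esub> u x" and x = a])
    show "slin j A (bs N) (\<lambda>a. u (a \<odot>\<^bsub>M\<^esub> x))"
      using slin_comp[OF left_mult_slin(2)[OF D(1) x] u(1)] by simp
    have "u x \<in> carrier N" using slinD(1)[OF u(1)] x by simp
    then show "slin j A (bs N) (\<lambda>a. (FA ^^ j) a \<odot>\<^bsub>N\<^esub> u x)"
      using slin_comp[OF FA_slin left_mult_slin(2)[OF N]] by simp
  next
    fix b assume "b \<in> fixpts A FA"
    then have b: "b \<in> carrier AF" by (simp add: fixpts_def)
    then show "u (b \<odot>\<^bsub>M\<^esub> x) = (FA ^^ j) b \<odot>\<^bsub>N\<^esub> u x"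
      using step1[OF b x] FA_fixed[OF b] by simp
  qed (rule a)
  then have "tlin 0 j M N u"
    using slinD[OF u(1)] by (intro tlinI) auto
  then show thesis using that uh by blast
qed

text \<open>For r = 1 the scalars concerned act through elements of \<open>AF\<close>, so that h has
  a single component.\<close>

lemma F_stable_extension:
  assumes M: "tfrob (Suc 0) M F" and N: "left_module A N" and h: "h \<in> module_hom AF (fixed_points F M) N"
  obtains u where "u \<in> module_hom A M N" "\<And>x. \<lbrakk>x \<in> carrier M; F x = x\<rbrakk> \<Longrightarrow> u x = h x"
proof -
  have "h (c \<odot>\<^bsub>bs M\<^esub> x) = c [^] (q ^ 0) \<odot>\<^bsub>bs N\<^esub> h x" if "c \<in> fixed (Suc 0)" "x \<in> carrier M" "F x = x" for c x
    using hom_AF_scalar[OF h that(1), of x] that fixed_closed by (simp add: base_space_simps(4))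
  then show thesis using hom_extension[OF M N h, of 0] that by (metis tlin_module_hom)
qed

text \<open>A homomorphism \<open>h\<close> from \<open>M\<^sup>\<theta>\<close> to \<open>N\<close> commutes with the field of \<open>q\<close> elements only, while the field of
  \<open>q ^ r\<close> elements acts on \<open>M\<^sup>\<theta>\<close>. The component of \<open>h\<close> that is semilinear with exponent \<open>q ^ j\<close> is cut out
  by the relations \<open>units_fixed_sum\<close>.\<close>

definition hpart :: "nat \<Rightarrow> ('a, 'm) module \<Rightarrow> ('a, 'n) module \<Rightarrow> nat \<Rightarrow> ('m \<Rightarrow> 'n) \<Rightarrow> 'm \<Rightarrow> 'n" where
  "hpart r M N j h x = (\<Oplus>\<^bsub>N\<^esub>d\<in>units_fixed r. (\<ominus> (d [^] (q ^ j))) \<odot>\<^bsub>bs N\<^esub> h (inv d \<odot>\<^bsub>bs M\<^esub> x))"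

lemma fixed_points_smult:
  assumes M: "tfrob r M \<theta>" and "c \<in> fixed r" "x \<in> carrier M" "\<theta> x = x"
  shows "c \<odot>\<^bsub>bs M\<^esub> x \<in> carrier M" "\<theta> (c \<odot>\<^bsub>bs M\<^esub> x) = c \<odot>\<^bsub>bs M\<^esub> x"
  using fixpts_closed(3)[OF tfrobD(2,7)[OF M] assms(2), of x] assms by (auto simp: fixpts_def)

lemma units_inv_fixed: "d \<in> units_fixed r \<Longrightarrow> inv d \<in> fixed r"
  using units_fixed_inv[of d r] by (simp add: units_fixed_def)

lemma hom_AF_combination:
  fixes Y :: "('a, 'y) module"
  assumes N: "left_module A N" and I: "finite I" and h: "\<And>i. i \<in> I \<Longrightarrow> h i \<in> module_hom AF Y N" and c: "\<And>i. i \<in> I \<Longrightarrow> c i \<in> carrier L"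
  shows "(\<lambda>x. \<Oplus>\<^bsub>N\<^esub>i\<in>I. c i \<odot>\<^bsub>bs N\<^esub> h i x) \<in> module_hom AF Y N"
proof (rule module_homI)
  interpret N: left_module A N by (rule N)
  interpret V: vectorspace L "bs N" by (rule vs_bs[OF N])
  fix x assume x: "x \<in> carrier Y"
  have hc: "h i x \<in> carrier N" "c i \<odot>\<^bsub>bs N\<^esub> h i x \<in> carrier N" if "i \<in> I" "x \<in> carrier Y" for i x
    using module_homD(1)[OF h[OF that(1)] that(2)] V.smult_closed[OF c[OF that(1)], of "h i x"] by simp_all
  show "(\<Oplus>\<^bsub>N\<^esub>i\<in>I. c i \<odot>\<^bsub>bs N\<^esub> h i x) \<in> carrier N" by (rule N.M.finsum_closed) (use hc x in auto)
  show "(\<Oplus>\<^bsub>N\<^esub>i\<in>I. c i \<odot>\<^bsub>bs N\<^esub> h i (x \<oplus>\<^bsub>Y\<^esub> y)) = (\<Oplus>\<^bsub>N\<^esub>i\<in>I. c i \<odot>\<^bsub>bs N\<^esub> h i x) \<oplus>\<^bsub>N\<^esub> (\<Oplus>\<^bsub>N\<^esub>i\<in>I. c i \<odot>\<^bsub>bs N\<^esub> h i y)"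
    if y: "y \<in> carrier Y" for y
  proof -
    have "(\<Oplus>\<^bsub>N\<^esub>i\<in>I. c i \<odot>\<^bsub>bs N\<^esub> h i (x \<oplus>\<^bsub>Y\<^esub> y)) = (\<Oplus>\<^bsub>N\<^esub>i\<in>I. c i \<odot>\<^bsub>bs N\<^esub> h i x \<oplus>\<^bsub>N\<^esub> c i \<odot>\<^bsub>bs N\<^esub> h i y)"
    proof (rule N.M.finsum_cong')
      fix i assume i: "i \<in> I"
      show "c i \<odot>\<^bsub>bs N\<^esub> h i (x \<oplus>\<^bsub>Y\<^esub> y) = c i \<odot>\<^bsub>bs N\<^esub> h i x \<oplus>\<^bsub>N\<^esub> c i \<odot>\<^bsub>bs N\<^esub> h i y"
        using module_homD(2)[OF h[OF i] x y] V.smult_r_distr[OF c[OF i], of "h i x" "h i y"] hc[OF i x] hc[OF i y] by simp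
    qed (use hc x y in auto)
    also have "\<dots> = (\<Oplus>\<^bsub>N\<^esub>i\<in>I. c i \<odot>\<^bsub>bs N\<^esub> h i x) \<oplus>\<^bsub>N\<^esub> (\<Oplus>\<^bsub>N\<^esub>i\<in>I. c i \<odot>\<^bsub>bs N\<^esub> h i y)"
      by (rule N.M.finsum_addf) (use hc x y in auto)
    finally show ?thesis .
  qed
  show "(\<Oplus>\<^bsub>N\<^esub>i\<in>I. c i \<odot>\<^bsub>bs N\<^esub> h i (a \<odot>\<^bsub>Y\<^esub> x)) = a \<odot>\<^bsub>N\<^esub> (\<Oplus>\<^bsub>N\<^esub>i\<in>I. c i \<odot>\<^bsub>bs N\<^esub> h i x)" if a: "a \<in> carrier AF" for a
  proof -
    note aA = AF_closed[OF a]
    have "(\<Oplus>\<^bsub>N\<^esub>i\<in>I. c i \<odot>\<^bsub>bs N\<^esub> h i (a \<odot>\<^bsub>Y\<^esub> x)) = (\<Oplus>\<^bsub>N\<^esub>i\<in>I. a \<odot>\<^bsub>N\<^esub> (c i \<odot>\<^bsub>bs N\<^esub> h i x))"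
    proof (rule N.M.finsum_cong')
      fix i assume i: "i \<in> I"
      show "c i \<odot>\<^bsub>bs N\<^esub> h i (a \<odot>\<^bsub>Y\<^esub> x) = a \<odot>\<^bsub>N\<^esub> (c i \<odot>\<^bsub>bs N\<^esub> h i x)"
        using module_homD(3)[OF h[OF i] a x] bs_central[OF N aA c[OF i] hc(1)[OF i x]] by simp
    qed (use hc x N.lm_closed[OF aA] in auto)
    also have "\<dots> = a \<odot>\<^bsub>N\<^esub> (\<Oplus>\<^bsub>N\<^esub>i\<in>I. c i \<odot>\<^bsub>bs N\<^esub> h i x)"
      using slin_finsum[OF vs_bs[OF N] vs_bs[OF N] left_mult_slin(1)[OF N aA] I, of "\<lambda>i. c i \<odot>\<^bsub>bs N\<^esub> h i x"] hc x by simp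
    finally show ?thesis .
  qed
qed

lemma fixed_scalar_hom:
  assumes M: "tfrob r M \<theta>" and c: "c \<in> fixed r"
  shows "(\<lambda>x. c \<odot>\<^bsub>bs M\<^esub> x) \<in> module_hom AF (fixed_points \<theta> M) (fixed_points \<theta> M)"
proof (rule module_homI)
  note D = tfrobD[OF M]
  interpret V: vectorspace L "bs M" by (rule D)
  note cL = fixed_closed[OF c]
  fix x assume x: "x \<in> carrier (fixed_points \<theta> M)"
  show "c \<odot>\<^bsub>bs M\<^esub> x \<in> carrier (fixed_points \<theta> M)" using fixed_points_smult[OF M c] x by simp
  show "c \<odot>\<^bsub>bs M\<^esub> (x \<oplus>\<^bsub>fixed_points \<theta> M\<^esub> y) = c \<odot>\<^bsub>bs M\<^esub> x \<oplus>\<^bsub>fixed_points \<theta> M\<^esub> c \<odot>\<^bsub>bs M\<^esub> y"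
    if "y \<in> carrier (fixed_points \<theta> M)" for y using V.smult_r_distr[OF cL, of x y] x that by simp
  show "c \<odot>\<^bsub>bs M\<^esub> (a \<odot>\<^bsub>fixed_points \<theta> M\<^esub> x) = a \<odot>\<^bsub>fixed_points \<theta> M\<^esub> (c \<odot>\<^bsub>bs M\<^esub> x)" if "a \<in> carrier AF" for a
    using bs_central[OF D(1) AF_closed[OF that] cL, of x] x by simp
qed

text \<open>Summing over all units makes the component semilinear over the field with q^r elements:
  multiplication by c is absorbed by the substitution of c d for d. The rest is
  \<open>hom_extension\<close>.\<close>

lemma hpart_extension:
  assumes M: "tfrob r M \<theta>" and N: "left_module A N" and h: "h \<in> module_hom AF (fixed_points \<theta> M) N"
  obtains u where "tlin 0 j M N u" "\<And>x. \<lbrakk>x \<in> carrier M; \<theta> x = x\<rbrakk> \<Longrightarrow> u x = hpart r M N j h x"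
proof -
  note D = tfrobD[OF M]
  interpret M: left_module A M by (rule D)
  interpret N: left_module A N by fact
  interpret V: vectorspace L "bs M" by (rule D)
  interpret W: vectorspace L "bs N" by (rule vs_bs[OF N])
  have fin: "finite (units_fixed r)" using D(4) by (rule finite_units_fixed)
  note sm = fixed_points_smult[OF M]
  have hD: "h x \<in> carrier N" if "x \<in> carrier M" "\<theta> x = x" for x using module_homD(1)[OF h, of x] that by simp
  define T where "T x d = (\<ominus> (d [^] (q ^ j))) \<odot>\<^bsub>bs N\<^esub> h (inv d \<odot>\<^bsub>bs M\<^esub> x)" for x d
  have Tc: "T x d \<in> carrier N" if "x \<in> carrier M" "\<theta> x = x" "d \<in> units_fixed r" for x d
  proof -
    have "h (inv d \<odot>\<^bsub>bs M\<^esub> x) \<in> carrier N" using that sm[OF units_inv_fixed] hD by metis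
    then show ?thesis unfolding T_def using that W.smult_closed units_fixed_closed by simp
  qed
  have C: "hpart r M N j h x = (\<Oplus>\<^bsub>N\<^esub>d\<in>units_fixed r. T x d)" for x by (simp add: hpart_def T_def)
  have "hpart r M N j h \<in> module_hom AF (fixed_points \<theta> M) N"
    unfolding hpart_def[abs_def]
  proof (rule hom_AF_combination[OF N fin])
    fix d assume d: "d \<in> units_fixed r"
    show "(\<lambda>x. h (inv d \<odot>\<^bsub>bs M\<^esub> x)) \<in> module_hom AF (fixed_points \<theta> M) N"
      using module_hom_comp[OF fixed_scalar_hom[OF M units_inv_fixed[OF d]] h] by (simp add: comp_def)
    show "\<ominus> (d [^] (q ^ j)) \<in> carrier L" using units_fixed_closed[OF d] by simp
  qed
  moreover have "hpart r M N j h (c \<odot>\<^bsub>bs M\<^esub> x) = c [^] (q ^ j) \<odot>\<^bsub>bs N\<^esub> hpart r M N j h x"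
    if c: "c \<in> fixed r" and x: "x \<in> carrier M" "\<theta> x = x" for c x
  proof (cases "c = \<zero>")
    case True
    have "T \<zero>\<^bsub>M\<^esub> d = \<zero>\<^bsub>N\<^esub>" if d: "d \<in> units_fixed r" for d
    proof -
      have "h \<zero>\<^bsub>M\<^esub> = \<zero>\<^bsub>N\<^esub>"
        using additive_zero[of "fixed_points \<theta> M" N h] left_module_fixed_points[OF M] module_homD[OF h]
          N.M.abelian_group_axioms by (auto simp: left_module_def)
      then show ?thesis using d units_fixed_closed[OF d] fixed_closed[OF units_inv_fixed[OF d]]
          V.smult_r_null[of "inv d"] W.smult_r_null[of "\<ominus> (d [^] (q ^ j))"] by (simp add: T_def)
    qed
    then have "(\<Oplus>\<^bsub>N\<^esub>d\<in>units_fixed r. T \<zero>\<^bsub>M\<^esub> d) = \<zero>\<^bsub>N\<^esub>" by (simp cong: N.M.finsum_cong')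
    moreover have "(\<Oplus>\<^bsub>N\<^esub>d\<in>units_fixed r. T x d) \<in> carrier N"
      using x Tc by (intro N.M.finsum_closed) auto
    ultimately show ?thesis using True x V.smult_l_null[of x] W.smult_l_null by (simp add: C frob_pow_zero)
  next
    case False
    then have cu: "c \<in> units_fixed r" using c by (simp add: units_fixed_def)
    note c' = units_fixed_closed[OF cu] units_fixed_nonzero[OF cu]
    \<comment> \<open>The scalar c cancels inside h against \<open>inv c\<close>, and reappears
      outside as its power q^j.\<close>
    have "T (c \<odot>\<^bsub>bs M\<^esub> x) (c \<otimes> d) = c [^] (q ^ j) \<odot>\<^bsub>bs N\<^esub> T x d" if d: "d \<in> units_fixed r" for d
    proof -
      note d' = units_inv_fixed[OF d] units_fixed_closed[OF d] units_fixed_nonzero[OF d]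
      have "(inv d \<otimes> inv c) \<otimes> (c \<otimes> d) = inv d \<otimes> (inv c \<otimes> c) \<otimes> d"
        using c' d' Units_inv_closed[OF c'(2)] Units_inv_closed[OF d'(3)]
        by (simp only: m_assoc m_closed)
      also have "\<dots> = \<one>" using c' d' by (simp add: Units_l_inv)
      finally have "inv (c \<otimes> d) = inv d \<otimes> inv c"
        using c' d' Units_inv_closed[OF c'(2)] Units_inv_closed[OF d'(3)]
        by (intro comm_inv_char) (simp_all add: m_comm)
      then have *: "inv (c \<otimes> d) \<odot>\<^bsub>bs M\<^esub> (c \<odot>\<^bsub>bs M\<^esub> x) = inv d \<odot>\<^bsub>bs M\<^esub> x"
        using c' d' x Units_inv_closed[OF c'(2)] Units_inv_closed[OF d'(3)]
        by (simp add: V.smult_assoc1[symmetric] m_assoc)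
      have "h (inv d \<odot>\<^bsub>bs M\<^esub> x) \<in> carrier N" using sm[OF d'(1) x] hD by blast
      then show ?thesis unfolding T_def *
        using c' d' by (simp add: nat_pow_distrib W.smult_assoc1[symmetric] r_minus)
    qed
    then have "(\<Oplus>\<^bsub>N\<^esub>d\<in>units_fixed r. T (c \<odot>\<^bsub>bs M\<^esub> x) (c \<otimes> d)) = (\<Oplus>\<^bsub>N\<^esub>d\<in>units_fixed r. c [^] (q ^ j) \<odot>\<^bsub>bs N\<^esub> T x d)"
      using x Tc W.smult_closed c' by (intro N.M.finsum_cong') auto
    also have "\<dots> = c [^] (q ^ j) \<odot>\<^bsub>bs N\<^esub> (\<Oplus>\<^bsub>N\<^esub>d\<in>units_fixed r. T x d)"
      using W.finsum_smult_ldistr[OF fin, of "c [^] (q ^ j)" "T x"] c' x Tc by simp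
    finally have "(\<Oplus>\<^bsub>N\<^esub>d\<in>units_fixed r. T (c \<odot>\<^bsub>bs M\<^esub> x) (c \<otimes> d)) = c [^] (q ^ j) \<odot>\<^bsub>bs N\<^esub> (\<Oplus>\<^bsub>N\<^esub>d\<in>units_fixed r. T x d)" .
    moreover have "(\<Oplus>\<^bsub>N\<^esub>d\<in>units_fixed r. T (c \<odot>\<^bsub>bs M\<^esub> x) (c \<otimes> d)) = (\<Oplus>\<^bsub>N\<^esub>d\<in>units_fixed r. T (c \<odot>\<^bsub>bs M\<^esub> x) d)"
      using units_fixed_reindex[OF cu] N.M.finsum_reindex[of "T (c \<odot>\<^bsub>bs M\<^esub> x)" "\<lambda>d. c \<otimes> d" "units_fixed r"]
        Tc[OF sm[OF c x]] by (auto simp: bij_betw_def)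
    ultimately show ?thesis by (simp add: C)
  qed
  ultimately show thesis using hom_extension[OF M N] that by metis
qed

text \<open>Summed over j, the coefficients give minus the trace of d, an element of the field with
  q elements, which may be moved through h. Inside h the order of summation is exchanged, and
  \<open>dual_sum\<close> leaves the term j = 0 only.\<close>

lemma hpart_decomposition:
  assumes M: "tfrob r M \<theta>" and N: "left_module A N" and h: "h \<in> module_hom AF (fixed_points \<theta> M) N"
    and x: "x \<in> carrier M" "\<theta> x = x"
  shows "(\<Oplus>\<^bsub>N\<^esub>j\<in>{..<r}. hpart r M N j h x) = h x"
proof -
  note D = tfrobD[OF M]
  interpret M: left_module A M by (rule D)
  interpret N: left_module A N by fact
  interpret V: vectorspace L "bs M" by (rule D)
  interpret W: vectorspace L "bs N" by (rule vs_bs[OF N])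
  have fin: "finite (units_fixed r)" using D(4) by (rule finite_units_fixed)
  note sm = fixed_points_smult[OF M]
  have hc: "h y \<in> carrier N" if "y \<in> carrier M" "\<theta> y = y" for y using module_homD(1)[OF h] that by simp
  \<comment> \<open>Minus the trace of d down to the field with q elements.\<close>
  define t where "t d = (\<Oplus>j\<in>{..<r}. \<ominus> (d [^] (q ^ j)))" for d
  have tf: "t d \<in> fixed (Suc 0)" if d: "d \<in> units_fixed r" for d
  proof -
    have dc: "d \<in> carrier L" "d [^] (q ^ r) = d" using d by (auto simp: units_fixed_def fixed_def)
    have minus_q: "(\<ominus> z) [^] q = \<ominus> (z [^] q)" if "z \<in> carrier L" for z
      using frob_pow_minus[OF that, of "Suc 0"] by simp
    have "t d [^] (q ^ Suc 0) = (\<Oplus>j\<in>{..<r}. \<ominus> (d [^] (q ^ Suc j)))"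
      unfolding t_def using dc
      by (subst frob_pow_finsum) (auto simp: minus_q pow_q_Suc simp del: power_Suc intro!: finsum_cong')
    also have "\<dots> = t d"
      unfolding t_def using dc by (intro finsum_lessThan_cyclic[of "\<lambda>j. \<ominus> (d [^] (q ^ j))"]) auto
    finally show ?thesis using dc unfolding t_def fixed_def by auto
  qed
  have dd: "inv d \<odot>\<^bsub>bs M\<^esub> x \<in> carrier M" "\<theta> (inv d \<odot>\<^bsub>bs M\<^esub> x) = inv d \<odot>\<^bsub>bs M\<^esub> x" "d \<in> carrier L" "inv d \<in> carrier L"
    if "d \<in> units_fixed r" for d
    using that sm[OF units_inv_fixed x] units_fixed_closed fixed_closed[OF units_inv_fixed] by auto
  have tdx: "t d \<odot>\<^bsub>bs M\<^esub> (inv d \<odot>\<^bsub>bs M\<^esub> x) \<in> carrier (fixed_points \<theta> M)" if "d \<in> units_fixed r" for d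
  proof -
    have "t d \<in> fixed r" using fixed_mult[OF tf[OF that], of r] by simp
    then show ?thesis using sm[OF _ dd(1,2)[OF that]] by simp
  qed
  have "(\<Oplus>\<^bsub>N\<^esub>j\<in>{..<r}. hpart r M N j h x) =
      (\<Oplus>\<^bsub>N\<^esub>d\<in>units_fixed r. \<Oplus>\<^bsub>N\<^esub>j\<in>{..<r}. (\<ominus> (d [^] (q ^ j))) \<odot>\<^bsub>bs N\<^esub> h (inv d \<odot>\<^bsub>bs M\<^esub> x))"
    unfolding hpart_def
    by (rule N.M.finsum_swap) (use fin dd hc W.smult_closed in auto)
  also have "\<dots> = (\<Oplus>\<^bsub>N\<^esub>d\<in>units_fixed r. h (t d \<odot>\<^bsub>bs M\<^esub> (inv d \<odot>\<^bsub>bs M\<^esub> x)))"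
  proof (rule N.M.finsum_cong')
    fix d assume d: "d \<in> units_fixed r"
    have "(\<Oplus>\<^bsub>N\<^esub>j\<in>{..<r}. (\<ominus> (d [^] (q ^ j))) \<odot>\<^bsub>bs N\<^esub> h (inv d \<odot>\<^bsub>bs M\<^esub> x)) = t d \<odot>\<^bsub>bs N\<^esub> h (inv d \<odot>\<^bsub>bs M\<^esub> x)"
      unfolding t_def
      using W.finsum_smult_rdistr[of "{..<r}" "\<lambda>j. \<ominus> (d [^] (q ^ j))" "h (inv d \<odot>\<^bsub>bs M\<^esub> x)"] dd[OF d] hc by simp
    also have "\<dots> = h (t d \<odot>\<^bsub>bs M\<^esub> (inv d \<odot>\<^bsub>bs M\<^esub> x))"
      using hom_AF_scalar[OF h tf[OF d], of "inv d \<odot>\<^bsub>bs M\<^esub> x"] dd[OF d] by (simp add: base_space_simps(4)[of _ _ M "t d"])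
    finally show "(\<Oplus>\<^bsub>N\<^esub>j\<in>{..<r}. (\<ominus> (d [^] (q ^ j))) \<odot>\<^bsub>bs N\<^esub> h (inv d \<odot>\<^bsub>bs M\<^esub> x)) =
        h (t d \<odot>\<^bsub>bs M\<^esub> (inv d \<odot>\<^bsub>bs M\<^esub> x))" .
  qed (use tdx hc in auto)
  also have "\<dots> = h (\<Oplus>\<^bsub>fixed_points \<theta> M\<^esub>d\<in>units_fixed r. t d \<odot>\<^bsub>bs M\<^esub> (inv d \<odot>\<^bsub>bs M\<^esub> x))"
    by (rule module_hom_finsum[OF left_module_fixed_points[OF M] N.M.abelian_group_axioms h fin, symmetric]) (rule tdx)
  also have "(\<Oplus>\<^bsub>fixed_points \<theta> M\<^esub>d\<in>units_fixed r. t d \<odot>\<^bsub>bs M\<^esub> (inv d \<odot>\<^bsub>bs M\<^esub> x)) =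
      (\<Oplus>\<^bsub>M\<^esub>d\<in>units_fixed r. t d \<odot>\<^bsub>bs M\<^esub> (inv d \<odot>\<^bsub>bs M\<^esub> x))"
    by (rule finsum_subset)
      (use left_module_fixed_points[OF M] M.M.abelian_monoid_axioms fin tdx in
        \<open>auto simp: left_module_def abelian_group_def\<close>)
  also have "\<dots> = (\<Oplus>\<^bsub>M\<^esub>d\<in>units_fixed r. \<Oplus>\<^bsub>M\<^esub>j\<in>{..<r}. (\<ominus> (inv d \<otimes> d [^] (q ^ j))) \<odot>\<^bsub>bs M\<^esub> x)"
  proof (rule M.M.finsum_cong')
    fix d assume d: "d \<in> units_fixed r"
    have "t d \<odot>\<^bsub>bs M\<^esub> (inv d \<odot>\<^bsub>bs M\<^esub> x) = (\<Oplus>\<^bsub>M\<^esub>j\<in>{..<r}. (\<ominus> (d [^] (q ^ j))) \<odot>\<^bsub>bs M\<^esub> (inv d \<odot>\<^bsub>bs M\<^esub> x))"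
      unfolding t_def
      using V.finsum_smult_rdistr[of "{..<r}" "\<lambda>j. \<ominus> (d [^] (q ^ j))" "inv d \<odot>\<^bsub>bs M\<^esub> x"] dd[OF d] by simp
    also have "\<dots> = (\<Oplus>\<^bsub>M\<^esub>j\<in>{..<r}. (\<ominus> (inv d \<otimes> d [^] (q ^ j))) \<odot>\<^bsub>bs M\<^esub> x)"
    proof (rule M.M.finsum_cong')
      fix j
      have "(\<ominus> (d [^] (q ^ j))) \<otimes> inv d = \<ominus> (inv d \<otimes> d [^] (q ^ j))"
        using dd[OF d] l_minus[of "d [^] (q ^ j)" "inv d"] m_comm[of "d [^] (q ^ j)" "inv d"] by simp
      then show "(\<ominus> (d [^] (q ^ j))) \<odot>\<^bsub>bs M\<^esub> (inv d \<odot>\<^bsub>bs M\<^esub> x) = (\<ominus> (inv d \<otimes> d [^] (q ^ j))) \<odot>\<^bsub>bs M\<^esub> x"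
        using dd[OF d] x V.smult_assoc1[of "\<ominus> (d [^] (q ^ j))" "inv d" x] by simp
    qed (use dd[OF d] x V.smult_closed in auto)
    finally show "t d \<odot>\<^bsub>bs M\<^esub> (inv d \<odot>\<^bsub>bs M\<^esub> x) = (\<Oplus>\<^bsub>M\<^esub>j\<in>{..<r}. (\<ominus> (inv d \<otimes> d [^] (q ^ j))) \<odot>\<^bsub>bs M\<^esub> x)" .
  qed (use dd x V.smult_closed in \<open>auto intro!: M.M.finsum_closed\<close>)
  also have "\<dots> = (\<Oplus>\<^bsub>M\<^esub>j\<in>{..<r}. \<Oplus>\<^bsub>M\<^esub>d\<in>units_fixed r. (\<ominus> (inv d \<otimes> d [^] (q ^ j))) \<odot>\<^bsub>bs M\<^esub> x)"
    by (rule M.M.finsum_swap) (use fin dd x V.smult_closed in auto)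
  also have "\<dots> = (\<Oplus>\<^bsub>M\<^esub>j\<in>{..<r}. if j = 0 then x else \<zero>\<^bsub>M\<^esub>)"
  proof (rule M.M.finsum_cong')
    fix j assume j: "j \<in> {..<r}"
    show "(\<Oplus>\<^bsub>M\<^esub>d\<in>units_fixed r. (\<ominus> (inv d \<otimes> d [^] (q ^ j))) \<odot>\<^bsub>bs M\<^esub> x) = (if j = 0 then x else \<zero>\<^bsub>M\<^esub>)"
      using dual_sum[OF D(2,4), of x j] x j D(4) by (auto dest: dvd_imp_le)
  qed (use x in auto)
  also have "\<dots> = x"
    using D(4) x M.M.finsum_singleton[of 0 "{..<r}" "\<lambda>_. x"] by (simp add: if_distrib)
  finally show ?thesis .
qed

text \<open>The coefficients of \<open>hpart\<close> lie in the field with q^r elements and are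
  therefore unchanged by the power q^(r l), so a semilinear map of a degree divisible by r passes
  through the sum. Besides homomorphisms this covers powers of \<open>\<theta>\<close>.\<close>

lemma hpart_comp_slin:
  assumes M: "tfrob r M \<theta>" and Y: "left_module A Y" and N: "left_module A N" and g: "slin (r * l) (bs Y) (bs N) g"
    and v: "\<And>x. \<lbrakk>x \<in> carrier M; \<theta> x = x\<rbrakk> \<Longrightarrow> v x \<in> carrier Y" and x: "x \<in> carrier M" "\<theta> x = x"
  shows "hpart r M N j (\<lambda>x. g (v x)) x = g (hpart r M Y j v x)"
proof -
  interpret N: left_module A N by (rule N)
  interpret VY: vectorspace L "bs Y" by (rule vs_bs[OF Y])
  interpret VN: vectorspace L "bs N" by (rule vs_bs[OF N])
  have dx: "v (inv d \<odot>\<^bsub>bs M\<^esub> x) \<in> carrier Y" if "d \<in> units_fixed r" for d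
    using v fixed_points_smult[OF M units_inv_fixed[OF that] x] by simp
  define m where "m d = \<ominus> (d [^] (q ^ j))" for d
  have m: "m d \<in> carrier L" "m d [^] (q ^ (r * l)) = m d" if d: "d \<in> units_fixed r" for d
  proof -
    have dL: "d \<in> carrier L" "d [^] (q ^ (r * l)) = d" using units_fixed_closed[OF d] fixed_mult[of d r l] d by (simp_all add: units_fixed_def fixed_def)
    then show "m d \<in> carrier L" by (simp add: m_def)
    show "m d [^] (q ^ (r * l)) = m d"
      using pow_q_add[OF dL(1), of j "r * l"] pow_q_add[OF dL(1), of "r * l" j] frob_pow_minus[of "d [^] (q ^ j)" "r * l"] dL
      by (simp add: m_def add.commute)
  qed
  have "g (hpart r M Y j v x) = (\<Oplus>\<^bsub>N\<^esub>d\<in>units_fixed r. g (m d \<odot>\<^bsub>bs Y\<^esub> v (inv d \<odot>\<^bsub>bs M\<^esub> x)))"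
    unfolding hpart_def m_def[symmetric]
    using slin_finsum[OF vs_bs[OF Y] vs_bs[OF N] g finite_units_fixed[OF tfrobD(4)[OF M]], of "\<lambda>d. m d \<odot>\<^bsub>bs Y\<^esub> v (inv d \<odot>\<^bsub>bs M\<^esub> x)"]
      VY.smult_closed dx m by simp
  also have "\<dots> = hpart r M N j (\<lambda>x. g (v x)) x"
    unfolding hpart_def m_def[symmetric]
  proof (rule N.M.finsum_cong')
    fix d assume d: "d \<in> units_fixed r"
    show "g (m d \<odot>\<^bsub>bs Y\<^esub> v (inv d \<odot>\<^bsub>bs M\<^esub> x)) = m d \<odot>\<^bsub>bs N\<^esub> g (v (inv d \<odot>\<^bsub>bs M\<^esub> x))"
      using slinD(3)[OF g m(1)[OF d], of "v (inv d \<odot>\<^bsub>bs M\<^esub> x)"] dx[OF d] by (simp only: m(2)[OF d] base_space_simps(1))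
  next
    show "(\<lambda>d. m d \<odot>\<^bsub>bs N\<^esub> g (v (inv d \<odot>\<^bsub>bs M\<^esub> x))) \<in> units_fixed r \<rightarrow> carrier N"
    proof
      fix d assume d: "d \<in> units_fixed r"
      show "m d \<odot>\<^bsub>bs N\<^esub> g (v (inv d \<odot>\<^bsub>bs M\<^esub> x)) \<in> carrier N"
        using VN.smult_closed[OF m(1)[OF d], of "g (v (inv d \<odot>\<^bsub>bs M\<^esub> x))"] slinD(1)[OF g] dx[OF d] by simp
    qed
  qed simp
  finally show ?thesis by simp
qed

lemma hpart_hom:
  assumes M: "tfrob r M \<theta>" and N: "left_module A N" and P: "left_module A P"
    and \<phi>: "\<phi> \<in> module_hom A N P" and h: "h \<in> module_hom AF (fixed_points \<theta> M) N"
    and x: "x \<in> carrier M" "\<theta> x = x"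
  shows "\<phi> (hpart r M N j h x) = hpart r M P j (\<lambda>x. \<phi> (h x)) x"
proof (rule hpart_comp_slin[OF M N P, where l = 0 and g = \<phi> and v = h, OF _ _ x, symmetric])
  show "slin (r * 0) (bs N) (bs P) \<phi>" using tlin_slin[of 0 N P \<phi>] N \<phi> by (simp add: tlin_module_hom)
  show "h x \<in> carrier N" if "x \<in> carrier M" "\<theta> x = x" for x using module_homD(1)[OF h, of x] that by simp
qed

lemma hpart_cong:
  assumes M: "tfrob r M \<theta>" and N: "left_module A N"
    and eq: "\<And>x. \<lbrakk>x \<in> carrier M; \<theta> x = x\<rbrakk> \<Longrightarrow> g x = h x \<and> h x \<in> carrier N"
    and x: "x \<in> carrier M" "\<theta> x = x"
  shows "hpart r M N j g x = hpart r M N j h x"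
proof -
  interpret N: left_module A N by fact
  interpret W: vectorspace L "bs N" by (rule vs_bs[OF N])
  show ?thesis
    unfolding hpart_def
    by (rule N.M.finsum_cong')
      (use eq fixed_points_smult[OF M units_inv_fixed x] W.smult_closed units_fixed_closed in auto)
qed

section \<open>Traces of homomorphisms\<close>

lemma theta_AF:
  assumes M: "tfrob r M \<theta>" and a: "a \<in> carrier AF" "x \<in> carrier M"
  shows "(\<theta> ^^ n) (a \<odot>\<^bsub>M\<^esub> x) = a \<odot>\<^bsub>M\<^esub> (\<theta> ^^ n) x"
  using tlinD(3)[OF tlin_funpow[OF tfrobD(5)[OF M]], of a x n] a FA_fixed[OF a(1)] by simp

text \<open>Elements of \<open>AF\<close> commute with \<open>\<theta>\<close> and with scalars, so
  taking traces of values keeps \<open>AF\<close>-linearity while moving the values into the fixed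
  points.\<close>

lemma tr_hom:
  assumes M: "tfrob r M \<theta>" and Y: "left_module AF Y" and h: "h \<in> module_hom AF Y M"
    and per: "\<And>x. x \<in> carrier Y \<Longrightarrow> (\<theta> ^^ n) (h x) = h x" and c: "c \<in> fixed (r * n)"
  shows "(\<lambda>x. tr (bs M) \<theta> n c (h x)) \<in> module_hom AF Y (fixed_points \<theta> M)"
proof -
  note D = tfrobD[OF M]
  interpret M: left_module A M by (rule D)
  interpret Y: left_module AF Y by fact
  interpret V: vectorspace L "bs M" by (rule D)
  have cl: "c \<in> carrier L" using c fixed_closed by blast
  have sl: "slin (r * i) (bs M) (bs M) (\<theta> ^^ i)" for i by (rule slin_funpow[OF D(2,7)])
  note hD = module_homD[OF h]
  have cc: "c \<odot>\<^bsub>bs M\<^esub> y \<in> carrier M" if "y \<in> carrier M" for y using V.smult_closed[OF cl] that by simp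
  have tc: "(\<theta> ^^ i) y \<in> carrier M" if "y \<in> carrier M" for i y using slinD(1)[OF sl] that by simp
  show ?thesis
  proof (rule module_homI)
    fix x assume x: "x \<in> carrier Y"
    show "tr (bs M) \<theta> n c (h x) \<in> carrier (fixed_points \<theta> M)"
      using tr_fix[OF D(2,7) _ _ c, of "h x"] hD(1)[OF x] per[OF x] by (simp add: fixpts_def)
  next
    fix x y assume xy: "x \<in> carrier Y" "y \<in> carrier Y"
    have "c \<odot>\<^bsub>bs M\<^esub> (h x \<oplus>\<^bsub>M\<^esub> h y) = c \<odot>\<^bsub>bs M\<^esub> h x \<oplus>\<^bsub>M\<^esub> c \<odot>\<^bsub>bs M\<^esub> h y"
      using V.smult_r_distr[OF cl, of "h x" "h y"] hD(1) xy by simp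
    then have "tr (bs M) \<theta> n c (h (x \<oplus>\<^bsub>Y\<^esub> y)) =
        (\<Oplus>\<^bsub>M\<^esub>i\<in>{..<n}. (\<theta> ^^ i) (c \<odot>\<^bsub>bs M\<^esub> h x) \<oplus>\<^bsub>M\<^esub> (\<theta> ^^ i) (c \<odot>\<^bsub>bs M\<^esub> h y))"
      unfolding tr_def using xy hD cc tc slinD(2)[OF sl] by (simp cong: M.M.finsum_cong')
    also have "\<dots> = tr (bs M) \<theta> n c (h x) \<oplus>\<^bsub>M\<^esub> tr (bs M) \<theta> n c (h y)"
      unfolding tr_def finsum_base_space using xy hD(1) cc tc by (intro M.M.finsum_addf) auto
    finally show "tr (bs M) \<theta> n c (h (x \<oplus>\<^bsub>Y\<^esub> y)) =
        tr (bs M) \<theta> n c (h x) \<oplus>\<^bsub>fixed_points \<theta> M\<^esub> tr (bs M) \<theta> n c (h y)" by simp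
  next
    fix a x assume ax: "a \<in> carrier AF" "x \<in> carrier Y"
    have "(\<theta> ^^ i) (c \<odot>\<^bsub>bs M\<^esub> h (a \<odot>\<^bsub>Y\<^esub> x)) = a \<odot>\<^bsub>M\<^esub> (\<theta> ^^ i) (c \<odot>\<^bsub>bs M\<^esub> h x)" for i
      using bs_central[OF D(1) AF_closed[OF ax(1)] cl hD(1)[OF ax(2)]] theta_AF[OF M ax(1) cc[OF hD(1)[OF ax(2)]]]
        hD(3)[OF ax] by simp
    then have "tr (bs M) \<theta> n c (h (a \<odot>\<^bsub>Y\<^esub> x)) = (\<Oplus>\<^bsub>bs M\<^esub>i\<in>{..<n}. a \<odot>\<^bsub>M\<^esub> (\<theta> ^^ i) (c \<odot>\<^bsub>bs M\<^esub> h x))"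
      unfolding tr_def by simp
    also have "\<dots> = a \<odot>\<^bsub>M\<^esub> tr (bs M) \<theta> n c (h x)"
      unfolding tr_def using ax hD(1) cc tc
      by (intro slin_finsum[OF D(2) D(2) left_mult_slin(1)[OF D(1) AF_closed[OF ax(1)]], symmetric]) auto
    finally show "tr (bs M) \<theta> n c (h (a \<odot>\<^bsub>Y\<^esub> x)) = a \<odot>\<^bsub>fixed_points \<theta> M\<^esub> tr (bs M) \<theta> n c (h x)" by simp
  qed
qed

lemma tr_equivariant:
  assumes M: "tfrob r M \<theta>" and N: "tfrob r' N \<theta>'" and \<phi>: "\<phi> \<in> module_hom A M N"
    and comm: "\<And>x. x \<in> carrier M \<Longrightarrow> \<phi> (\<theta> x) = \<theta>' (\<phi> x)" and x: "x \<in> carrier M" and c: "c \<in> carrier L"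
  shows "\<phi> (tr (bs M) \<theta> n c x) = tr (bs N) \<theta>' n c (\<phi> x)"
proof -
  note D = tfrobD[OF M] and E = tfrobD[OF N]
  interpret N: left_module A N by (rule E)
  interpret V: vectorspace L "bs M" by (rule D)
  interpret W: vectorspace L "bs N" by (rule E)
  have s: "slin 0 (bs M) (bs N) \<phi>" using \<phi> by (intro tlin_slin D) (simp add: tlin_module_hom)
  have cx: "c \<odot>\<^bsub>bs M\<^esub> x \<in> carrier M" using V.smult_closed[OF c] x by simp
  have tc: "(\<theta> ^^ i) y \<in> carrier M" if "y \<in> carrier M" for i y
    using slinD(1)[OF slin_funpow[OF D(2,7)]] that by simp
  have comm': "\<phi> ((\<theta> ^^ i) y) = (\<theta>' ^^ i) (\<phi> y)" if "y \<in> carrier M" for i y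
    using that by (induction i) (simp_all add: comm tc)
  have "\<phi> (tr (bs M) \<theta> n c x) = (\<Oplus>\<^bsub>bs N\<^esub>i\<in>{..<n}. \<phi> ((\<theta> ^^ i) (c \<odot>\<^bsub>bs M\<^esub> x)))"
    unfolding tr_def by (rule slin_finsum[OF D(2) E(2) s]) (use cx tc in auto)
  also have "\<dots> = tr (bs N) \<theta>' n c (\<phi> x)"
    unfolding tr_def using comm' cx slinD(3)[OF s c, of x] x c by simp
  finally show ?thesis .
qed

lemma tr_fixed_point:
  assumes V: "vectorspace L V" and F: "slin r V V F" and x: "x \<in> carrier V" "F x = x"
    and c: "c \<in> carrier L" "(\<Oplus>l\<in>{..<n}. c [^] (q ^ (r * l))) = \<one>"
  shows "tr V F n c x = x"
proof -
  interpret V: vectorspace L V by fact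
  have "(F ^^ i) x = x" for i using x(2) by (induction i) auto
  then have "tr V F n c x = (\<Oplus>\<^bsub>V\<^esub>i\<in>{..<n}. c [^] (q ^ (r * i)) \<odot>\<^bsub>V\<^esub> x)"
    unfolding tr_def using slinD(3)[OF slin_funpow[OF V F] c(1) x(1)] by simp
  also have "\<dots> = (\<Oplus>l\<in>{..<n}. c [^] (q ^ (r * l))) \<odot>\<^bsub>V\<^esub> x"
    using c x by (intro V.finsum_smult_rdistr[symmetric]) auto
  finally show ?thesis using c x by simp
qed

end

section \<open>Invertible endomorphisms of fixed point modules\<close>

lemma funpow_image: "f ` S = S \<Longrightarrow> (f ^^ n) ` S = S"
proof (induction n)
  case (Suc n)
  have "(f ^^ Suc n) ` S = f ` ((f ^^ n) ` S)" by (simp add: image_image)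
  then show ?case using Suc by simp
qed simp

context frobenius_algebra
begin

lemma tlin_0: "tlin i j M N u \<Longrightarrow> left_module A M \<Longrightarrow> left_module A N \<Longrightarrow> u \<zero>\<^bsub>M\<^esub> = \<zero>\<^bsub>N\<^esub>"
  by (rule additive_zero) (auto dest: tlinD simp: left_module_def tlin_def)

text \<open>Gaussian elimination over the additive category with objects \<open>V\<^bsup>[0]\<^esup>, \<dots>, V\<^bsup>[n-1]\<^esup>\<close>: the
  entry in row \<open>i\<close> and column \<open>j\<close> is a homomorphism \<open>V\<^bsup>[j]\<^esup> \<rightarrow> V\<^bsup>[i]\<^esup>\<close>.\<close>

lemma gauss_elimination:
  assumes V: "left_module A V"
    and J_add: "\<And>i j u v. \<lbrakk>tlin i j V V u; tlin i j V V v; J u; J v\<rbrakk> \<Longrightarrow> J (\<lambda>x. u x \<oplus>\<^bsub>V\<^esub> v x)"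
    and J_comp: "\<And>i j i' j' u v. \<lbrakk>tlin i j V V u; J u; tlin i' j' V V v\<rbrakk> \<Longrightarrow> J (\<lambda>x. u (v x))"
    and J_bij: "\<And>u. \<lbrakk>u \<in> module_hom A V V; J u\<rbrakk> \<Longrightarrow> bij_betw (\<lambda>x. x \<oplus>\<^bsub>V\<^esub> u x) (carrier V) (carrier V)"
    and \<rho>: "\<And>i j. \<lbrakk>i < n; j < n\<rbrakk> \<Longrightarrow> tlin i j V V (\<rho> i j) \<and> J (\<rho> i j)"
    and x: "\<And>i. i < n \<Longrightarrow> x i \<in> carrier V"
    and eq: "\<And>i. i < n \<Longrightarrow> x i \<oplus>\<^bsub>V\<^esub> (\<Oplus>\<^bsub>V\<^esub>j\<in>{..<n}. \<rho> i j (x j)) = \<zero>\<^bsub>V\<^esub>"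
    and i: "i < n"
  shows "x i = \<zero>\<^bsub>V\<^esub>"
  using \<rho> x eq i
proof (induction n arbitrary: \<rho> i)
  case 0 then show ?case by simp
next
  case (Suc n)
  interpret V: left_module A V by fact
  interpret B: vectorspace L "bs V" by (rule vs_bs[OF V])
  have \<rho>: "tlin i j V V (\<rho> i j)" "J (\<rho> i j)" if "i \<le> n" "j \<le> n" for i j using Suc.prems(1) that by auto
  have x: "x i \<in> carrier V" if "i \<le> n" for i using Suc.prems(2) that by auto
  have \<rho>x: "\<rho> i j y \<in> carrier V" if "i \<le> n" "j \<le> n" "y \<in> carrier V" for i j y using tlinD(1)[OF \<rho>(1)] that by blast
  define S where "S i = (\<Oplus>\<^bsub>V\<^esub>j\<in>{..<n}. \<rho> i j (x j))" for i
  have Sc: "S i \<in> carrier V" if "i \<le> n" for i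
    unfolding S_def using that \<rho>x x by (intro V.M.finsum_closed) auto
  have eq: "x i \<oplus>\<^bsub>V\<^esub> (\<rho> i n (x n) \<oplus>\<^bsub>V\<^esub> S i) = \<zero>\<^bsub>V\<^esub>" if "i \<le> n" for i
  proof -
    have "(\<Oplus>\<^bsub>V\<^esub>j\<in>{..<Suc n}. \<rho> i j (x j)) = \<rho> i n (x n) \<oplus>\<^bsub>V\<^esub> S i"
      unfolding S_def lessThan_Suc using that \<rho>x x by (intro V.M.finsum_insert) auto
    then show ?thesis using Suc.prems(3)[of i] that by simp
  qed
  \<comment> \<open>The pivot of the last row, invertible by \<open>J_bij\<close>.\<close>
  define a where "a y = y \<oplus>\<^bsub>V\<^esub> \<rho> n n y" for y
  have nn: "\<rho> n n \<in> module_hom A V V"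
    using \<rho>(1)[of n n] tlin_shift[of 0 n 0 V V "\<rho> n n"] by (simp add: tlin_module_hom)
  have a: "tlin 0 0 V V a" "bij_betw a (carrier V) (carrier V)"
    unfolding a_def using tlin_add[OF V tlin_id[of 0 V], of "\<rho> n n"] nn J_bij[OF nn \<rho>(2)[of n n]]
    by (simp_all add: tlin_module_hom)
  define b where "b = inv_into (carrier V) a"
  have b: "tlin 0 0 V V b" unfolding b_def by (rule tlin_inv[OF V a])
  have ba: "b (a y) = y" if "y \<in> carrier V" for y using a(2) that by (simp add: b_def bij_betw_def)
  define nb where "nb y = (\<ominus> \<one>) \<odot>\<^bsub>bs V\<^esub> b y" for y
  have nb: "tlin 0 0 V V nb" unfolding nb_def by (rule tlin_smult[OF V b]) simp
  have nbn: "nb y = \<ominus>\<^bsub>V\<^esub> b y" if "y \<in> carrier V" for y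
  proof -
    have "b y \<in> carrier V" using tlinD(1)[OF b that] .
    then have "nb y \<oplus>\<^bsub>V\<^esub> b y = \<zero>\<^bsub>V\<^esub>"
      using B.smult_l_distr[of "\<ominus> \<one>" \<one> "b y"] by (simp add: nb_def l_neg)
    then show ?thesis using \<open>b y \<in> carrier V\<close> tlinD(1)[OF nb that] by (simp add: V.M.minus_equality)
  qed
  have xn: "x n = nb (S n)"
  proof -
    have "a (x n) \<oplus>\<^bsub>V\<^esub> S n = \<zero>\<^bsub>V\<^esub>" using eq[of n] x[of n] \<rho>x[of n n "x n"] Sc[of n] by (simp add: a_def V.M.a_assoc)
    then have "a (x n) = \<ominus>\<^bsub>V\<^esub> S n"
      using x[of n] Sc[of n] tlinD(1)[OF a(1), of "x n"] by (simp add: V.M.minus_equality)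
    then have "x n = b (\<ominus>\<^bsub>V\<^esub> S n)" using ba[of "x n"] x[of n] by simp
    also have "b (\<ominus>\<^bsub>V\<^esub> S n) \<oplus>\<^bsub>V\<^esub> b (S n) = b \<zero>\<^bsub>V\<^esub>"
      using tlinD(2)[OF b, of "\<ominus>\<^bsub>V\<^esub> S n" "S n"] Sc[of n] by (simp add: V.M.l_neg)
    then have "b (\<ominus>\<^bsub>V\<^esub> S n) = \<ominus>\<^bsub>V\<^esub> b (S n)"
      using tlin_0[OF b V V] tlinD(1)[OF b] Sc[of n] by (simp add: V.M.minus_equality)
    finally show ?thesis using nbn Sc[of n] by simp
  qed
  \<comment> \<open>Substituting the solution for the last unknown into the other rows leaves this
    Schur complement. It stays in \<open>J\<close> because \<open>J\<close> is closed under addition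
    and under composition on the right.\<close>
  define \<rho>' where "\<rho>' i j y = \<rho> i j y \<oplus>\<^bsub>V\<^esub> \<rho> i n (nb (\<rho> n j y))" for i j y
  have c1: "tlin i j V V (\<lambda>y. \<rho> i n (nb (\<rho> n j y)))" "J (\<lambda>y. \<rho> i n (nb (\<rho> n j y)))" if "i \<le> n" "j \<le> n" for i j
  proof -
    have v: "tlin n j V V (\<lambda>y. nb (\<rho> n j y))" using tlin_comp[OF \<rho>(1)[of n j] nb] that by simp
    have "tlin (n + i) (j + n) V V (\<lambda>y. \<rho> i n (nb (\<rho> n j y)))"
      using tlin_comp[OF v \<rho>(1)[of i n]] that by simp
    then show "tlin i j V V (\<lambda>y. \<rho> i n (nb (\<rho> n j y)))" using tlin_shift[of i n j V V] by (simp add: add.commute)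
    show "J (\<lambda>y. \<rho> i n (nb (\<rho> n j y)))"
      using J_comp[OF \<rho>(1)[of i n] \<rho>(2)[of i n] v] that by simp
  qed
  have \<rho>'_ok: "tlin i j V V (\<rho>' i j) \<and> J (\<rho>' i j)" if "i < n" "j < n" for i j
    unfolding \<rho>'_def using that tlin_add[OF V \<rho>(1) c1(1)] J_add[OF \<rho>(1) c1(1) \<rho>(2) c1(2)] by simp
  have zero: "x i = \<zero>\<^bsub>V\<^esub>" if i: "i < n" for i
  proof (rule Suc.IH[OF \<rho>'_ok _ _ i])
    fix i assume i: "i < n"
    have "(\<Oplus>\<^bsub>V\<^esub>j\<in>{..<n}. \<rho>' i j (x j)) = S i \<oplus>\<^bsub>V\<^esub> (\<Oplus>\<^bsub>V\<^esub>j\<in>{..<n}. \<rho> i n (nb (\<rho> n j (x j))))"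
      unfolding \<rho>'_def S_def using i \<rho>x x tlinD(1)[OF nb] by (intro V.M.finsum_addf) auto
    also have "(\<Oplus>\<^bsub>V\<^esub>j\<in>{..<n}. \<rho> i n (nb (\<rho> n j (x j)))) = \<rho> i n (nb (S n))"
    proof -
      have t: "tlin i n V V (\<lambda>y. \<rho> i n (nb y))" using tlin_comp[OF nb \<rho>(1)[of i n]] i by simp
      have "(\<lambda>y. \<rho> i n (nb y)) (\<Oplus>\<^bsub>V\<^esub>j\<in>{..<n}. \<rho> n j (x j)) = (\<Oplus>\<^bsub>V\<^esub>j\<in>{..<n}. (\<lambda>y. \<rho> i n (nb y)) (\<rho> n j (x j)))"
        by (rule additive_finsum(2)[OF V.M.abelian_monoid_axioms V.M.abelian_monoid_axioms, where S = "carrier V"])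
          (use tlinD[OF t] tlin_0[OF t V V] \<rho>x x in auto)
      then show ?thesis by (simp add: S_def)
    qed
    finally show "x i \<oplus>\<^bsub>V\<^esub> (\<Oplus>\<^bsub>V\<^esub>j\<in>{..<n}. \<rho>' i j (x j)) = \<zero>\<^bsub>V\<^esub>"
      using eq[of i] i xn Sc[of i] \<rho>x[of i n "x n"] x[of n] by (simp add: V.M.a_comm)
  qed (use x in auto)
  have "S n = \<zero>\<^bsub>V\<^esub>"
  proof -
    have "S n = (\<Oplus>\<^bsub>V\<^esub>j\<in>{..<n}. \<zero>\<^bsub>V\<^esub>)"
      unfolding S_def using zero tlin_0[OF \<rho>(1) V V] by (intro V.M.finsum_cong') auto
    then show ?thesis by simp
  qed
  then have "x n = \<zero>\<^bsub>V\<^esub>" using xn tlin_0[OF nb V V] by simp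
  then show ?case using zero Suc.prems(4) by (cases "i = n") auto
qed

text \<open>A single equation in degrees 0 to r - 1 is not square. At a vector fixed by
  \<open>\<theta>\<close> it can be repeated r times as a circulant system, whose unknowns are all
  equal to x, and then \<open>gauss_elimination\<close> applies.\<close>

lemma fixed_point_elimination:
  assumes V: "tfrob r V \<theta>"
    and J_add: "\<And>i j u v. \<lbrakk>tlin i j V V u; tlin i j V V v; J u; J v\<rbrakk> \<Longrightarrow> J (\<lambda>x. u x \<oplus>\<^bsub>V\<^esub> v x)"
    and J_comp: "\<And>i j i' j' u v. \<lbrakk>tlin i j V V u; J u; tlin i' j' V V v\<rbrakk> \<Longrightarrow> J (\<lambda>x. u (v x))"
    and J_bij: "\<And>u. \<lbrakk>u \<in> module_hom A V V; J u\<rbrakk> \<Longrightarrow> bij_betw (\<lambda>x. x \<oplus>\<^bsub>V\<^esub> u x) (carrier V) (carrier V)"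
    and \<rho>: "\<And>j. j < r \<Longrightarrow> tlin 0 j V V (\<rho> j) \<and> J (\<rho> j)"
    and x: "x \<in> carrier V" "\<theta> x = x"
    and eq: "x \<oplus>\<^bsub>V\<^esub> (\<Oplus>\<^bsub>V\<^esub>j\<in>{..<r}. \<rho> j x) = \<zero>\<^bsub>V\<^esub>"
  shows "x = \<zero>\<^bsub>V\<^esub>"
proof -
  note D = tfrobD[OF V]
  interpret V: left_module A V by (rule D)
  let ?t = "inv_into (carrier V) \<theta>"
  have t: "tlin r 0 V V ?t" by (rule tlin_inv[OF D(1,5,9)])
  have tx: "?t x = x" using D(9) x by (metis bij_betw_def inv_into_f_f)
  \<comment> \<open>Below the diagonal the degree j - i is negative. It is obtained by composing the
    component of degree j - i + r with the inverse of \<open>\<theta>\<close>.\<close>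
  define \<rho>' where "\<rho>' i j = (if i \<le> j then \<rho> (j - i) else (\<lambda>y. \<rho> (j + r - i) (?t y)))" for i j
  have ok: "tlin i j V V (\<rho>' i j) \<and> J (\<rho>' i j)" if "i < r" "j < r" for i j
  proof (cases "i \<le> j")
    case True
    then show ?thesis
      using \<rho>[of "j - i"] that tlin_shift[of 0 i "j - i" V V "\<rho> (j - i)"] by (simp add: \<rho>'_def)
  next
    case False
    then have lt: "j + r - i < r" using that by simp
    have "tlin r (j + r - i) V V (\<lambda>y. \<rho> (j + r - i) (?t y))"
      using tlin_comp[OF t, of 0 "j + r - i" V "\<rho> (j + r - i)"] \<rho>[OF lt] by simp
    then have "tlin i j V V (\<lambda>y. \<rho> (j + r - i) (?t y))"
      using tlin_shift[of i "r - i" j V V] that by simp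
    moreover have "J (\<lambda>y. \<rho> (j + r - i) (?t y))" using J_comp[of 0 "j + r - i"] \<rho>[OF lt] t by blast
    ultimately show ?thesis using False by (simp add: \<rho>'_def)
  qed
  have "x \<oplus>\<^bsub>V\<^esub> (\<Oplus>\<^bsub>V\<^esub>j\<in>{..<r}. \<rho>' i j x) = \<zero>\<^bsub>V\<^esub>" if i: "i < r" for i
  proof -
    \<comment> \<open>In row i the column j carries the component of degree j - i modulo r. So each
      row evaluated at x runs through all components, and the inverse of \<open>\<theta>\<close>
      does not affect x.\<close>
    define s where "s j = (if i \<le> j then j - i else j + r - i)" for j
    have "bij_betw s {..<r} {..<r}"
      by (rule bij_betw_byWitness[where f' = "\<lambda>d. if d + i < r then d + i else d + i - r"])
        (use i in \<open>auto simp: s_def\<close>)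
    then have "(\<Oplus>\<^bsub>V\<^esub>j\<in>{..<r}. \<rho> (s j) x) = (\<Oplus>\<^bsub>V\<^esub>d\<in>{..<r}. \<rho> d x)"
      using V.M.finsum_reindex[of "\<lambda>d. \<rho> d x" s "{..<r}"] tlinD(1)[OF conjunct1[OF \<rho>]] x
      by (auto simp: bij_betw_def)
    moreover have "\<rho>' i j x = \<rho> (s j) x" for j by (simp add: \<rho>'_def s_def tx)
    ultimately show ?thesis using eq by simp
  qed
  note row = this
  show ?thesis
  proof (rule gauss_elimination[where J = J and V = V and n = r and \<rho> = \<rho>' and x = "\<lambda>_. x" and i = 0])
    fix i j u v assume "tlin i j V V u" "tlin i j V V v" "J u" "J v"
    then show "J (\<lambda>x. u x \<oplus>\<^bsub>V\<^esub> v x)" by (rule J_add)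
  next
    fix i j i' j' u v assume "tlin i j V V u" "J u" "tlin i' j' V V v"
    then show "J (\<lambda>x. u (v x))" by (rule J_comp)
  next
    fix u assume "u \<in> module_hom A V V" "J u"
    then show "bij_betw (\<lambda>x. x \<oplus>\<^bsub>V\<^esub> u x) (carrier V) (carrier V)" by (rule J_bij)
  next
    fix i j assume "i < r" "j < r"
    then show "tlin i j V V (\<rho>' i j) \<and> J (\<rho>' i j)" by (rule ok)
  qed (use D(1,4) x(1) row in auto)
qed

text \<open>The endomorphism ring of M is local, with units described as bijections. This is the
  form in which the indecomposability of M is used.\<close>

definition local_module :: "('a, 'm) module \<Rightarrow> bool" where
  "local_module M \<longleftrightarrow>
     (\<exists>x\<in>carrier M. x \<noteq> \<zero>\<^bsub>M\<^esub>) \<and>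
     (\<forall>f\<in>module_hom A M M. \<forall>g\<in>module_hom A M M. (\<forall>x\<in>carrier M. f x \<oplus>\<^bsub>M\<^esub> g x = x) \<longrightarrow>
        bij_betw f (carrier M) (carrier M) \<or> bij_betw g (carrier M) (carrier M))"

text \<open>By \<open>module_iso_tw_iff\<close> this says that no twist of M with exponent strictly
  between 0 and r is isomorphic to M, which is the minimality contained in the period.\<close>

definition aperiodic :: "nat \<Rightarrow> ('a, 'm) module \<Rightarrow> bool" where
  "aperiodic r M \<longleftrightarrow> (\<forall>j u. 0 < j \<and> j < r \<and> tlin 0 j M M u \<longrightarrow> \<not> bij_betw u (carrier M) (carrier M))"

lemma hom_idempotent_power:
  assumes V: "tfrob r V \<theta>" and u: "u \<in> module_hom A V V"
  obtains m where "m > 0" "\<And>x. x \<in> carrier V \<Longrightarrow> (u ^^ m) ((u ^^ m) x) = (u ^^ m) x"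
proof -
  note D = tfrobD[OF V]
  have "slin 0 (bs V) (bs V) u" using u by (intro tlin_slin D) (simp add: tlin_module_hom)
  then show thesis
    using linear_idempotent_power[OF D(2,3,6,4)] that by (metis base_space_simps(1))
qed

text \<open>An idempotent power of a surjective map is surjective, hence the identity, and this
  makes the map injective.\<close>

lemma hom_surj_bij:
  assumes V: "tfrob r V \<theta>" and u: "u \<in> module_hom A V V" "u ` carrier V = carrier V"
  shows "bij_betw u (carrier V) (carrier V)"
proof -
  obtain m where m: "m > 0" "\<And>x. x \<in> carrier V \<Longrightarrow> (u ^^ m) ((u ^^ m) x) = (u ^^ m) x"
    using hom_idempotent_power[OF V u(1)] by metis
  have "(u ^^ i) ` carrier V = carrier V" for i
    by (rule funpow_image[OF u(2)])
  then have id: "(u ^^ m) x = x" if "x \<in> carrier V" for x using m(2) that by (metis imageE)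
  obtain l where l: "m = Suc l" using m(1) by (cases m) auto
  have "inj_on u (carrier V)"
  proof (rule inj_onI)
    fix x y assume "x \<in> carrier V" "y \<in> carrier V" "u x = u y"
    then show "x = y" using id[of x] id[of y] by (simp add: l funpow_Suc_right del: funpow.simps)
  qed
  then show ?thesis using u(2) by (simp add: bij_betw_def)
qed

lemma hom_inj_bij:
  assumes V: "tfrob r V \<theta>" and u: "u \<in> module_hom A V V" "inj_on u (carrier V)"
  shows "bij_betw u (carrier V) (carrier V)"
proof -
  note D = tfrobD[OF V]
  have "slin 0 (bs V) (bs V) u" using u by (intro tlin_slin D) (simp add: tlin_module_hom)
  then have "frob 0 (bs V) u" using slin_inj_frob[OF D(2,3,6,4), of 0 u] u(2) by simp
  then show ?thesis using frob_bij[OF D(2)] by fastforce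
qed

text \<open>The r-th power of u has degree r (j - i). Powers of \<open>\<theta>\<close> and of its
  inverse correct this to degree 0, where \<open>hom_surj_bij\<close> applies.\<close>

lemma tlin_surj_bij:
  assumes V: "tfrob r V \<theta>" and u: "tlin i j V V u" "u ` carrier V = carrier V"
  shows "bij_betw u (carrier V) (carrier V)"
proof -
  note D = tfrobD[OF V]
  let ?t = "inv_into (carrier V) \<theta>"
  have t: "tlin r 0 V V ?t" by (rule tlin_inv[OF D(1,5,9)])
  have tb: "bij_betw ?t (carrier V) (carrier V)" by (rule bij_betw_inv_into[OF D(9)])
  define w where "w x = (?t ^^ j) ((\<theta> ^^ i) ((u ^^ r) x))" for x
  have "tlin (r * i + (0 + j * r)) (r * j + (i * r + 0)) V V w"
    unfolding w_def
    using tlin_comp[OF tlin_comp[OF tlin_funpow[OF u(1), of r] tlin_funpow[OF D(5), of i]] tlin_funpow[OF t, of j]]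
    by (simp add: add.assoc)
  then have "tlin 0 0 V V w" using tlin_shift[of 0 "r * i + j * r" 0 V V w] by (simp add: mult.commute add.commute)
  moreover have "w ` carrier V = (?t ^^ j) ` ((\<theta> ^^ i) ` ((u ^^ r) ` carrier V))"
    by (simp add: w_def image_image)
  then have "w ` carrier V = carrier V"
    using funpow_image[OF u(2)] funpow_image[of \<theta>] funpow_image[of ?t] D(9) tb by (simp add: bij_betw_def)
  ultimately have "inj_on w (carrier V)"
    using hom_surj_bij[OF V] by (simp add: tlin_module_hom bij_betw_def)
  obtain l where l: "r = Suc l" using D(4) by (cases r) auto
  have "inj_on u (carrier V)"
  proof (rule inj_onI)
    fix x y assume xy: "x \<in> carrier V" "y \<in> carrier V" "u x = u y"
    then have "w x = w y" by (simp add: w_def l funpow_Suc_right del: funpow.simps)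
    then show "x = y" using inj_onD[OF \<open>inj_on w _\<close>] xy by blast
  qed
  then show ?thesis using u(2) by (simp add: bij_betw_def)
qed

text \<open>A bijective composite would make u surjective, hence bijective by
  \<open>tlin_surj_bij\<close>. With \<open>nonbij_add\<close> this supplies the closure properties
  required by \<open>fixed_point_elimination\<close>.\<close>

lemma nonbij_comp:
  assumes V: "tfrob r V \<theta>" and u: "tlin i j V V u" "\<not> bij_betw u (carrier V) (carrier V)" and v: "tlin i' j' V V v"
  shows "\<not> bij_betw (\<lambda>x. u (v x)) (carrier V) (carrier V)"
proof
  assume "bij_betw (\<lambda>x. u (v x)) (carrier V) (carrier V)"
  then have "u ` (v ` carrier V) = carrier V" by (simp add: bij_betw_def image_image)
  moreover have "v ` carrier V \<subseteq> carrier V" "u ` carrier V \<subseteq> carrier V" using tlinD(1)[OF u(1)] tlinD(1)[OF v] by auto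
  ultimately have "u ` carrier V = carrier V" by blast
  then show False using tlin_surj_bij[OF V u(1)] u(2) by blast
qed

text \<open>Locality is a condition in degree 0, but it governs every degree: composing with an
  inverse of the sum turns u and v into endomorphisms that add up to the identity.\<close>

lemma nonbij_add:
  assumes V: "left_module A V" "local_module V"
    and u: "tlin i j V V u" "\<not> bij_betw u (carrier V) (carrier V)"
    and v: "tlin i j V V v" "\<not> bij_betw v (carrier V) (carrier V)"
  shows "\<not> bij_betw (\<lambda>x. u x \<oplus>\<^bsub>V\<^esub> v x) (carrier V) (carrier V)"
proof
  let ?w = "\<lambda>x. u x \<oplus>\<^bsub>V\<^esub> v x"
  assume w: "bij_betw ?w (carrier V) (carrier V)"
  have wt: "tlin i j V V ?w" by (rule tlin_add[OF V(1) u(1) v(1)])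
  define b where "b = inv_into (carrier V) ?w"
  have b: "tlin j i V V b" unfolding b_def by (rule tlin_inv[OF V(1) wt w])
  have bb: "bij_betw b (carrier V) (carrier V)" unfolding b_def by (rule bij_betw_inv_into[OF w])
  have hom: "(\<lambda>x. b (f x)) \<in> module_hom A V V" if "tlin i j V V f" for f
    using tlin_comp[OF that b] tlin_shift[of 0 "i + j" 0 V V "\<lambda>x. b (f x)"] by (simp add: tlin_module_hom add.commute)
  have "b (u x) \<oplus>\<^bsub>V\<^esub> b (v x) = x" if x: "x \<in> carrier V" for x
  proof -
    have "b (u x) \<oplus>\<^bsub>V\<^esub> b (v x) = b (?w x)" using tlinD(2)[OF b] tlinD(1)[OF u(1) x] tlinD(1)[OF v(1) x] by simp
    also have "\<dots> = x" unfolding b_def by (rule bij_betw_inv_into_left[OF w x])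
    finally show ?thesis .
  qed
  then have "bij_betw (\<lambda>x. b (u x)) (carrier V) (carrier V) \<or> bij_betw (\<lambda>x. b (v x)) (carrier V) (carrier V)"
    by (intro V(2)[unfolded local_module_def, THEN conjunct2, rule_format, OF hom[OF u(1)] hom[OF v(1)]])
  moreover have "bij_betw f (carrier V) (carrier V)"
    if f: "tlin i j V V f" "bij_betw (\<lambda>x. b (f x)) (carrier V) (carrier V)" for f
  proof -
    have "f \<in> carrier V \<rightarrow> carrier V" using tlinD(1)[OF f(1)] by blast
    moreover have "bij_betw (b \<circ> f) (carrier V) (carrier V)" using f(2) by (simp add: comp_def)
    ultimately show ?thesis using bij_betw_comp_iff2[OF bb, of f "carrier V"] by blast
  qed
  ultimately show False using u v by blast
qed

text \<open>Otherwise the identity would be the sum of the non-bijective maps 1 + u and -u.\<close>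

lemma local_bij:
  assumes V: "left_module A V" "local_module V" and u: "u \<in> module_hom A V V" "\<not> bij_betw u (carrier V) (carrier V)"
  shows "bij_betw (\<lambda>x. x \<oplus>\<^bsub>V\<^esub> u x) (carrier V) (carrier V)"
proof (rule ccontr)
  interpret V: left_module A V by (rule V)
  interpret B: vectorspace L "bs V" by (rule vs_bs[OF V(1)])
  assume n: "\<not> ?thesis"
  define m where "m x = (\<ominus> \<one>) \<odot>\<^bsub>bs V\<^esub> u x" for x
  have ut: "tlin 0 0 V V u" using u by (simp add: tlin_module_hom)
  have mt: "tlin 0 0 V V m" unfolding m_def by (rule tlin_smult[OF V(1) ut]) simp
  have uc: "u x \<in> carrier V" if "x \<in> carrier V" for x using tlinD(1)[OF ut that] .
  have mm: "u x \<oplus>\<^bsub>V\<^esub> m x = \<zero>\<^bsub>V\<^esub>" if "x \<in> carrier V" for x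
    using B.smult_l_distr[of \<one> "\<ominus> \<one>" "u x"] uc[OF that] by (simp add: m_def r_neg)
  have m_bij: "\<not> bij_betw m (carrier V) (carrier V)"
  proof
    assume b: "bij_betw m (carrier V) (carrier V)"
    have "u x = (\<ominus> \<one>) \<odot>\<^bsub>bs V\<^esub> m x" if "x \<in> carrier V" for x
      using uc[OF that] B.smult_assoc1[of "\<ominus> \<one>" "\<ominus> \<one>" "u x"] by (simp add: m_def l_minus)
    moreover have "bij_betw (\<lambda>x. (\<ominus> \<one>) \<odot>\<^bsub>bs V\<^esub> x) (carrier V) (carrier V)"
      by (rule bij_betw_byWitness[where f' = "\<lambda>x. (\<ominus> \<one>) \<odot>\<^bsub>bs V\<^esub> x"])
        (use B.smult_closed B.smult_assoc1[of "\<ominus> \<one>" "\<ominus> \<one>"] in \<open>auto simp: l_minus\<close>)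
    ultimately have "bij_betw u (carrier V) (carrier V)"
      using bij_betw_trans[OF b] by (subst bij_betw_cong[of _ _ "(\<lambda>x. (\<ominus> \<one>) \<odot>\<^bsub>bs V\<^esub> x) \<circ> m"]) auto
    then show False using u(2) by blast
  qed
  have "\<not> bij_betw (\<lambda>x. (x \<oplus>\<^bsub>V\<^esub> u x) \<oplus>\<^bsub>V\<^esub> m x) (carrier V) (carrier V)"
    by (rule nonbij_add[OF V tlin_add[OF V(1) tlin_id ut] n mt m_bij])
  moreover have "(x \<oplus>\<^bsub>V\<^esub> u x) \<oplus>\<^bsub>V\<^esub> m x = x" if "x \<in> carrier V" for x
    using that uc[OF that] tlinD(1)[OF mt that] mm[OF that] by (simp add: V.M.a_assoc)
  then have "bij_betw (\<lambda>x. (x \<oplus>\<^bsub>V\<^esub> u x) \<oplus>\<^bsub>V\<^esub> m x) (carrier V) (carrier V)"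
    by (subst bij_betw_cong[of _ _ "\<lambda>x. x"]) (auto simp: bij_betw_def)
  ultimately show False by blast
qed

lemma nonbij_zero: "local_module V \<Longrightarrow> left_module A V \<Longrightarrow> \<not> bij_betw (\<lambda>x. \<zero>\<^bsub>V\<^esub>) (carrier V) (carrier V)"
proof
  assume V: "local_module V" "left_module A V" and b: "bij_betw (\<lambda>x. \<zero>\<^bsub>V\<^esub>) (carrier V) (carrier V)"
  interpret V: left_module A V by (rule V)
  obtain x where "x \<in> carrier V" "x \<noteq> \<zero>\<^bsub>V\<^esub>" using V by (auto simp: local_module_def)
  then show False using b unfolding bij_betw_def inj_on_def by (metis V.M.zero_closed)
qed

lemma nonbij_finsum:
  assumes V: "left_module A V" "local_module V" and I: "finite I"
    "\<And>l. l \<in> I \<Longrightarrow> tlin i j V V (u l) \<and> \<not> bij_betw (u l) (carrier V) (carrier V)"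
  shows "\<not> bij_betw (\<lambda>x. \<Oplus>\<^bsub>V\<^esub>l\<in>I. u l x) (carrier V) (carrier V)"
  using I
proof (induction I rule: finite_induct)
  case empty
  interpret V: left_module A V by (rule V)
  show ?case using nonbij_zero[OF V(2,1)] by simp
next
  case (insert l I)
  interpret V: left_module A V by (rule V)
  have t: "tlin i j V V (\<lambda>x. \<Oplus>\<^bsub>V\<^esub>l\<in>I. u l x)" using insert by (intro tlin_finsum V) auto
  have eq: "(\<Oplus>\<^bsub>V\<^esub>l\<in>insert l I. u l x) = u l x \<oplus>\<^bsub>V\<^esub> (\<Oplus>\<^bsub>V\<^esub>l\<in>I. u l x)" if "x \<in> carrier V" for x
  proof (rule V.M.finsum_insert[OF insert.hyps])
    show "(\<lambda>l. u l x) \<in> I \<rightarrow> carrier V" "u l x \<in> carrier V"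
      using insert.prems that by (auto dest: tlinD(1))
  qed
  have "\<not> bij_betw (\<lambda>x. u l x \<oplus>\<^bsub>V\<^esub> (\<Oplus>\<^bsub>V\<^esub>l\<in>I. u l x)) (carrier V) (carrier V)"
  proof (rule nonbij_add[OF V _ _ t])
    show "tlin i j V V (u l)" "\<not> bij_betw (u l) (carrier V) (carrier V)" using insert.prems by auto
    show "\<not> bij_betw (\<lambda>x. \<Oplus>\<^bsub>V\<^esub>l\<in>I. u l x) (carrier V) (carrier V)" using insert by simp
  qed
  moreover have "bij_betw (\<lambda>x. \<Oplus>\<^bsub>V\<^esub>l\<in>insert l I. u l x) (carrier V) (carrier V) =
      bij_betw (\<lambda>x. u l x \<oplus>\<^bsub>V\<^esub> (\<Oplus>\<^bsub>V\<^esub>l\<in>I. u l x)) (carrier V) (carrier V)"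
    by (rule bij_betw_cong) (rule eq)
  ultimately show ?case by simp
qed

text \<open>An endomorphism of \<open>V\<^sup>\<theta>\<close> is invertible if its component of degree \<open>0\<close> is, because the other
  components are not.\<close>

lemma fixed_points_bij:
  assumes V: "tfrob r V \<theta>" "local_module V" "aperiodic r V"
    and h: "h \<in> module_hom AF (fixed_points \<theta> V) (fixed_points \<theta> V)"
    and u: "u \<in> module_hom A V V" "bij_betw u (carrier V) (carrier V)"
      "\<And>x. \<lbrakk>x \<in> carrier V; \<theta> x = x\<rbrakk> \<Longrightarrow> u x = hpart r V V 0 h x"
  shows "bij_betw h (carrier (fixed_points \<theta> V)) (carrier (fixed_points \<theta> V))"
proof -
  let ?FV = "fixed_points \<theta> V"
  note D = tfrobD[OF V(1)]
  interpret V: left_module A V by (rule D)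
  interpret W: left_module AF "?FV" by (rule left_module_fixed_points[OF V(1)])
  have hV: "h \<in> module_hom AF ?FV V"
    by (rule module_homI) (use module_homD[OF h] in auto)
  have "\<exists>U. tlin 0 j V V U \<and> (\<forall>x. x \<in> carrier V \<and> \<theta> x = x \<longrightarrow> U x = hpart r V V j h x)" for j
    using hpart_extension[OF V(1) D(1) hV, of j] by metis
  then obtain U where U: "\<And>j. tlin 0 j V V (U j)"
    "\<And>j x. \<lbrakk>x \<in> carrier V; \<theta> x = x\<rbrakk> \<Longrightarrow> U j x = hpart r V V j h x" by metis
  define b where "b = inv_into (carrier V) u"
  have ut: "tlin 0 0 V V u" using u(1) by (simp add: tlin_module_hom)
  have b: "tlin 0 0 V V b" unfolding b_def by (rule tlin_inv[OF D(1) ut u(2)])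
  have bu: "b (u x) = x" if "x \<in> carrier V" for x using u(2) that by (simp add: b_def bij_betw_def)
  \<comment> \<open>Multiplication by the inverse of u turns the component of degree 0 into the
    identity. What remains are components of positive degree below r, which are not bijective
    because r is aperiodic.\<close>
  define \<rho> where "\<rho> j = (if j = 0 then (\<lambda>x. \<zero>\<^bsub>V\<^esub>) else (\<lambda>x. b (U j x)))" for j :: nat
  have \<rho>: "tlin 0 j V V (\<rho> j) \<and> \<not> bij_betw (\<rho> j) (carrier V) (carrier V)" if "j < r" for j
  proof (cases "j = 0")
    case True
    then show ?thesis using tlin_zero[OF D(1)] nonbij_zero[OF V(2) D(1)] by (simp add: \<rho>_def)
  next
    case False
    have "tlin 0 j V V (\<lambda>x. b (U j x))" using tlin_comp0[OF U(1) b] by simp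
    then show ?thesis using False that V(3) by (simp add: \<rho>_def aperiodic_def)
  qed
  have "inj_on h (carrier ?FV)"
  proof (rule additive_inj[OF W.M.abelian_group_axioms W.M.abelian_group_axioms])
    fix x assume x: "x \<in> carrier ?FV" "h x = \<zero>\<^bsub>?FV\<^esub>"
    then have x': "x \<in> carrier V" "\<theta> x = x" by simp_all
    have Uc: "U j x \<in> carrier V" for j using tlinD(1)[OF U(1) x'(1)] .
    have "\<zero>\<^bsub>V\<^esub> = (\<Oplus>\<^bsub>V\<^esub>j\<in>{..<r}. hpart r V V j h x)" using hpart_decomposition[OF V(1) D(1) hV x'] x(2) by simp
    also have "\<dots> = (\<Oplus>\<^bsub>V\<^esub>j\<in>{..<r}. U j x)" using U(2)[OF x'] by simp
    finally have "b \<zero>\<^bsub>V\<^esub> = b (\<Oplus>\<^bsub>V\<^esub>j\<in>{..<r}. U j x)" by simp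
    then have "\<zero>\<^bsub>V\<^esub> = b (\<Oplus>\<^bsub>V\<^esub>j\<in>{..<r}. U j x)" using tlin_0[OF b D(1) D(1)] by simp
    also have "\<dots> = (\<Oplus>\<^bsub>V\<^esub>j\<in>{..<r}. b (U j x))"
      using module_hom_finsum[OF D(1) V.M.abelian_group_axioms, of b "{..<r}" "\<lambda>j. U j x"] b Uc
      by (simp add: tlin_module_hom)
    also have "\<dots> = (\<Oplus>\<^bsub>V\<^esub>j\<in>{..<r}. (if j = 0 then x else \<zero>\<^bsub>V\<^esub>) \<oplus>\<^bsub>V\<^esub> \<rho> j x)"
    proof (rule V.M.finsum_cong')
      fix j
      have "U 0 x = u x" using U(2)[OF x'] u(3)[OF x'] by simp
      then show "b (U j x) = (if j = 0 then x else \<zero>\<^bsub>V\<^esub>) \<oplus>\<^bsub>V\<^esub> \<rho> j x"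
        using bu[OF x'(1)] x' tlinD(1)[OF b Uc] by (simp add: \<rho>_def)
    qed (use x' tlinD(1)[OF conjunct1[OF \<rho>]] in auto)
    also have "\<dots> = (\<Oplus>\<^bsub>V\<^esub>j\<in>{..<r}. if j = 0 then x else \<zero>\<^bsub>V\<^esub>) \<oplus>\<^bsub>V\<^esub> (\<Oplus>\<^bsub>V\<^esub>j\<in>{..<r}. \<rho> j x)"
      using x' tlinD(1)[OF conjunct1[OF \<rho>]] by (intro V.M.finsum_addf) auto
    also have "(\<Oplus>\<^bsub>V\<^esub>j\<in>{..<r}. if j = 0 then x else \<zero>\<^bsub>V\<^esub>) = x"
      using D(4) x' V.M.finsum_singleton[of 0 "{..<r}" "\<lambda>_. x"] by (simp add: if_distrib)
    finally have "x \<oplus>\<^bsub>V\<^esub> (\<Oplus>\<^bsub>V\<^esub>j\<in>{..<r}. \<rho> j x) = \<zero>\<^bsub>V\<^esub>" by simp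
    then show "x = \<zero>\<^bsub>?FV\<^esub>"
      using fixed_point_elimination[OF V(1), where J = "\<lambda>u. \<not> bij_betw u (carrier V) (carrier V)" and \<rho> = \<rho>]
        nonbij_add[OF D(1) V(2)] nonbij_comp[OF V(1)] local_bij[OF D(1) V(2)] \<rho> x' by simp
  qed (use module_homD[OF h] in auto)
  moreover have "h ` carrier ?FV \<subseteq> carrier ?FV"
    using module_homD(1)[OF h] by blast
  ultimately show ?thesis
    using finite_fixed_points[OF V(1)] endo_inj_surj unfolding bij_betw_def by blast
qed

end

section \<open>Scalar extension\<close>

context frobenius_algebra
begin

text \<open>The fixed points span by \<open>fixpts_span\<close>, so their finiteness bounds the
  dimension.\<close>

lemma tfrob_finite_fixed_points:
  assumes Y: "left_module A Y" and F: "tlin 0 (Suc 0) Y Y F" and orb: "\<And>x. x \<in> carrier Y \<Longrightarrow> \<exists>n>0. (F ^^ n) x = x"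
    and fin: "finite (carrier (fixed_points F Y))"
  shows "tfrob (Suc 0) Y F"
proof -
  interpret V: vectorspace L "bs Y" by (rule vs_bs[OF Y])
  have fr: "frob (Suc 0) (bs Y) F" using tlin_slin[OF F Y] orb by (simp add: frob_def)
  have sub: "fixpts (bs Y) F \<subseteq> carrier (bs Y)" by (auto simp: fixpts_def)
  then have "V.span (fixpts (bs Y) F) = carrier (bs Y)"
    using fixpts_span[OF vs_bs[OF Y] fr] V.span_is_subset2[OF sub] by auto
  then have "V.fin_dim" unfolding V.fin_dim_def using fin sub fixpts_carrier[of Y F] by metis
  then show ?thesis using Y F orb by (simp add: tfrob_def fd_module_def)
qed

text \<open>The multiples of the unit of \<open>A\<close> have finite orbits under
  \<open>FA\<close>. Hence every scalar lies in a finite field, which is how the algebraic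
  closedness over the field with q elements enters the coordinates below.\<close>

lemma frob_orbit_scalar:
  assumes S: "finite S" "S \<subseteq> carrier L"
  obtains n where "n > 0" "\<And>c. c \<in> S \<Longrightarrow> c [^] (q ^ n) = c"
proof -
  obtain n where n: "n > 0" "\<And>a. a \<in> (\<lambda>c. c \<odot>\<^bsub>A\<^esub> \<one>\<^bsub>A\<^esub>) ` S \<Longrightarrow> (FA ^^ n) a = a"
    by (rule frob_common_power[OF FA_frob, of "(\<lambda>c. c \<odot>\<^bsub>A\<^esub> \<one>\<^bsub>A\<^esub>) ` S" 1]) (use S in auto)
  have "c [^] (q ^ n) = c" if c: "c \<in> S" for c
  proof (rule AV.smult_right_cancel[OF _ _ A.one_closed one_not_zero_A])
    have cL: "c \<in> carrier L" using c S by blast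
    then show "c [^] (q ^ n) \<in> carrier L" "c \<in> carrier L" by simp_all
    show "c [^] (q ^ n) \<odot>\<^bsub>A\<^esub> \<one>\<^bsub>A\<^esub> = c \<odot>\<^bsub>A\<^esub> \<one>\<^bsub>A\<^esub>" using n(2)[of "c \<odot>\<^bsub>A\<^esub> \<one>\<^bsub>A\<^esub>"] c FA_scalar[OF cL] by simp
  qed
  then show thesis using that n(1) by blast
qed

lemma slin_scaled_sum:
  assumes I: "finite I" "\<And>l. l \<in> I \<Longrightarrow> slin n V LM (u l)" "\<And>l. l \<in> I \<Longrightarrow> c l \<in> carrier L"
  shows "slin n V LM (\<lambda>x. \<Oplus>l\<in>I. u l x \<otimes> c l)"
proof -
  have uc: "u l x \<in> carrier L" if "l \<in> I" "x \<in> carrier V" for l x using slinD(1)[OF I(2)] that by simp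
  have "(\<Oplus>l\<in>I. u l (x \<oplus>\<^bsub>V\<^esub> y) \<otimes> c l) = (\<Oplus>l\<in>I. u l x \<otimes> c l) \<oplus> (\<Oplus>l\<in>I. u l y \<otimes> c l)"
    if xy: "x \<in> carrier V" "y \<in> carrier V" for x y
  proof -
    have "(\<Oplus>l\<in>I. u l (x \<oplus>\<^bsub>V\<^esub> y) \<otimes> c l) = (\<Oplus>l\<in>I. u l x \<otimes> c l \<oplus> u l y \<otimes> c l)"
      using xy uc I(3) slinD(2)[OF I(2)] by (intro finsum_cong') (auto simp: l_distr)
    then show ?thesis using xy uc I(3) by (subst (asm) finsum_addf) auto
  qed
  moreover have "(\<Oplus>l\<in>I. u l (e \<odot>\<^bsub>V\<^esub> x) \<otimes> c l) = e [^] (q ^ n) \<otimes> (\<Oplus>l\<in>I. u l x \<otimes> c l)"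
    if ex: "e \<in> carrier L" "x \<in> carrier V" for e x
  proof -
    have "(\<Oplus>l\<in>I. u l (e \<odot>\<^bsub>V\<^esub> x) \<otimes> c l) = (\<Oplus>l\<in>I. e [^] (q ^ n) \<otimes> (u l x \<otimes> c l))"
      using ex uc I(3) slinD(3)[OF I(2)] by (intro finsum_cong') (auto simp: m_assoc)
    then show ?thesis using ex uc I by (subst finsum_rdistr) auto
  qed
  ultimately show ?thesis using uc I(3) by (auto simp: slin_def intro!: finsum_closed)
qed

text \<open>The scalar extension of \<open>T\<close> consists of the coordinate vectors with respect to a basis \<open>B\<close> of
  \<open>T\<close>; the matrix \<open>P\<close> of the action of \<open>A\<close> is the linear extension of the one of \<open>A\<^sup>F\<close> on \<open>T\<close>.\<close>

lemma base_change:
  fixes T :: "('a, 't) module"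
  assumes T: "fd_module K1 AF T"
  shows "\<exists>(Y :: ('a, 't \<Rightarrow> 'k) module) F e. tfrob (Suc 0) Y F \<and> e \<in> module_iso AF T (fixed_points F Y)"
proof -
  interpret T: left_module AF T using T by (simp add: fd_module_def)
  let ?bT = "base_space K1 AF T"
  interpret V: vectorspace K1 ?bT by (rule vectorspace_base_space[OF fd_AF T.left_module_axioms])
  have "V.fin_dim" using T by (simp add: fd_module_def)
  then obtain B where B: "finite B" "V.basis B" using V.finite_basis_exists by blast
  have BT: "b \<in> carrier T" if "b \<in> B" for b using B that by (auto simp: V.basis_def)
  obtain \<gamma> where \<gamma>c': "\<And>x b. \<lbrakk>x \<in> carrier ?bT; b \<in> B\<rbrakk> \<Longrightarrow> \<gamma> x b \<in> carrier K1"
    and \<gamma>s': "\<And>x. x \<in> carrier ?bT \<Longrightarrow> (\<Oplus>\<^bsub>?bT\<^esub>b\<in>B. \<gamma> x b \<odot>\<^bsub>?bT\<^esub> b) = x"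
    and \<gamma>u': "\<And>a b. \<lbrakk>a \<in> B \<rightarrow> carrier K1; b \<in> B\<rbrakk> \<Longrightarrow> \<gamma> (\<Oplus>\<^bsub>?bT\<^esub>b\<in>B. a b \<odot>\<^bsub>?bT\<^esub> b) b = a b"
    and \<gamma>a': "\<And>x y b. \<lbrakk>x \<in> carrier ?bT; y \<in> carrier ?bT; b \<in> B\<rbrakk> \<Longrightarrow> \<gamma> (x \<oplus>\<^bsub>?bT\<^esub> y) b = \<gamma> x b \<oplus>\<^bsub>K1\<^esub> \<gamma> y b"
    and \<gamma>m': "\<And>c x b. \<lbrakk>c \<in> carrier K1; x \<in> carrier ?bT; b \<in> B\<rbrakk> \<Longrightarrow> \<gamma> (c \<odot>\<^bsub>?bT\<^esub> x) b = c \<otimes>\<^bsub>K1\<^esub> \<gamma> x b"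
    and \<gamma>1': "\<And>b b'. \<lbrakk>b \<in> B; b' \<in> B\<rbrakk> \<Longrightarrow> \<gamma> b b' = (if b = b' then \<one>\<^bsub>K1\<^esub> else \<zero>\<^bsub>K1\<^esub>)"
    by (rule V.basis_coords[OF B]) blast
  have \<gamma>f: "\<gamma> x b \<in> fixed (Suc 0)" if "x \<in> carrier T" "b \<in> B" for x b using \<gamma>c'[of x b] that by simp
  have \<gamma>c: "\<gamma> x b \<in> carrier L" if "x \<in> carrier T" "b \<in> B" for x b using \<gamma>f[OF that] fixed_closed by blast
  have \<gamma>s: "(\<Oplus>\<^bsub>T\<^esub>b\<in>B. \<gamma> x b \<odot>\<^bsub>?bT\<^esub> b) = x" if "x \<in> carrier T" for x using \<gamma>s'[of x] that by simp
  have \<gamma>u: "\<gamma> (\<Oplus>\<^bsub>T\<^esub>b\<in>B. a b \<odot>\<^bsub>?bT\<^esub> b) b = a b" if "a \<in> B \<rightarrow> fixed (Suc 0)" "b \<in> B" for a b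
    using \<gamma>u'[of a b] that by simp
  have \<gamma>a: "\<gamma> (x \<oplus>\<^bsub>T\<^esub> y) b = \<gamma> x b \<oplus> \<gamma> y b" if "x \<in> carrier T" "y \<in> carrier T" "b \<in> B" for x y b
    using \<gamma>a'[of x y b] that by simp
  have \<gamma>m: "\<gamma> (c \<odot>\<^bsub>?bT\<^esub> x) b = c \<otimes> \<gamma> x b" if "c \<in> fixed (Suc 0)" "x \<in> carrier T" "b \<in> B" for c x b
    using \<gamma>m'[of c x b] that by simp
  have \<gamma>1: "\<gamma> b b' = (if b = b' then \<one> else \<zero>)" if "b \<in> B" "b' \<in> B" for b b' using \<gamma>1'[OF that] by simp
  have smc: "c \<odot>\<^bsub>?bT\<^esub> x \<in> carrier T" if "c \<in> fixed (Suc 0)" "x \<in> carrier T" for c x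
    using V.smult_closed[of c x] that by simp
  have central: "a \<odot>\<^bsub>T\<^esub> (c \<odot>\<^bsub>?bT\<^esub> x) = c \<odot>\<^bsub>?bT\<^esub> (a \<odot>\<^bsub>T\<^esub> x)"
    if "a \<in> carrier AF" "c \<in> fixed (Suc 0)" "x \<in> carrier T" for a c x
  proof -
    have "a \<otimes>\<^bsub>A\<^esub> (c \<odot>\<^bsub>A\<^esub> \<one>\<^bsub>A\<^esub>) = (c \<odot>\<^bsub>A\<^esub> \<one>\<^bsub>A\<^esub>) \<otimes>\<^bsub>A\<^esub> a"
      using that smult_mult_A[of c "\<one>\<^bsub>A\<^esub>" a] smult_mult_A[of c a "\<one>\<^bsub>A\<^esub>"] fixed_closed[of c] by simp
    then show ?thesis
      using T.lm_assoc[of a "c \<odot>\<^bsub>A\<^esub> \<one>\<^bsub>A\<^esub>" x] T.lm_assoc[of "c \<odot>\<^bsub>A\<^esub> \<one>\<^bsub>A\<^esub>" a x] that scalar_AF[OF that(2)]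
      by (simp add: base_space_simps(4))
  qed
  have \<gamma>0: "\<gamma> \<zero>\<^bsub>T\<^esub> b = \<zero>" if "b \<in> B" for b
  proof -
    have "\<gamma> \<zero>\<^bsub>T\<^esub> b \<oplus> \<gamma> \<zero>\<^bsub>T\<^esub> b = \<gamma> \<zero>\<^bsub>T\<^esub> b" using \<gamma>a[of "\<zero>\<^bsub>T\<^esub>" "\<zero>\<^bsub>T\<^esub>" b] that by simp
    then show ?thesis using \<gamma>c[of "\<zero>\<^bsub>T\<^esub>" b] that by simp
  qed
  \<comment> \<open>In coordinates, a acts by the matrix whose column j lists the coordinates of a
    times the basis vector j.\<close>
  have \<gamma>act: "\<gamma> (a \<odot>\<^bsub>T\<^esub> x) i = (\<Oplus>j\<in>B. \<gamma> (a \<odot>\<^bsub>T\<^esub> j) i \<otimes> \<gamma> x j)"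
    if a: "a \<in> carrier AF" and x: "x \<in> carrier T" and i: "i \<in> B" for a x i
  proof -
    have "a \<odot>\<^bsub>T\<^esub> x = a \<odot>\<^bsub>T\<^esub> (\<Oplus>\<^bsub>T\<^esub>j\<in>B. \<gamma> x j \<odot>\<^bsub>?bT\<^esub> j)" using \<gamma>s[OF x] by simp
    also have "\<dots> = (\<Oplus>\<^bsub>T\<^esub>j\<in>B. a \<odot>\<^bsub>T\<^esub> (\<gamma> x j \<odot>\<^bsub>?bT\<^esub> j))"
    proof (rule additive_finsum(2)[OF T.M.abelian_monoid_axioms T.M.abelian_monoid_axioms, where S = "carrier T"])
      show "a \<odot>\<^bsub>T\<^esub> \<zero>\<^bsub>T\<^esub> = \<zero>\<^bsub>T\<^esub>" by (rule T.smult_zero[OF a])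
    qed (use a B BT x \<gamma>f smc T.lm_closed T.lm_r_distr in auto)
    also have "\<dots> = (\<Oplus>\<^bsub>T\<^esub>j\<in>B. \<gamma> x j \<odot>\<^bsub>?bT\<^esub> (a \<odot>\<^bsub>T\<^esub> j))"
      using central[OF a \<gamma>f[OF x] BT] smc[OF \<gamma>f[OF x] T.lm_closed[OF a BT]] by (intro T.M.finsum_cong') auto
    finally have "\<gamma> (a \<odot>\<^bsub>T\<^esub> x) i = (\<lambda>y. \<gamma> y i) (\<Oplus>\<^bsub>T\<^esub>j\<in>B. \<gamma> x j \<odot>\<^bsub>?bT\<^esub> (a \<odot>\<^bsub>T\<^esub> j))" by simp
    also have "\<dots> = (\<Oplus>j\<in>B. (\<lambda>y. \<gamma> y i) (\<gamma> x j \<odot>\<^bsub>?bT\<^esub> (a \<odot>\<^bsub>T\<^esub> j)))"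
      by (rule additive_finsum(2)[OF T.M.abelian_monoid_axioms abelian_monoid_axioms, where S = "carrier T"])
        (use B \<gamma>c[OF _ i] \<gamma>0[OF i] \<gamma>a[OF _ _ i] smc[OF \<gamma>f[OF x] T.lm_closed[OF a BT]] in auto)
    also have "\<dots> = (\<Oplus>j\<in>B. \<gamma> (a \<odot>\<^bsub>T\<^esub> j) i \<otimes> \<gamma> x j)"
      using \<gamma>m[OF \<gamma>f[OF x] T.lm_closed[OF a BT] i] \<gamma>c[OF T.lm_closed[OF a BT] i] \<gamma>c[OF x] m_comm
      by (intro finsum_cong') auto
    finally show ?thesis .
  qed
  \<comment> \<open>Each matrix entry is a linear function on \<open>AF\<close> over the field with
    q elements, so it extends linearly to \<open>A\<close>.\<close>
  have "\<exists>P. slin 0 A LM P \<and> (\<forall>a\<in>carrier AF. P a = \<gamma> (a \<odot>\<^bsub>T\<^esub> j) i)" if ij: "i \<in> B" "j \<in> B" for i j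
  proof (rule slin_extension[OF vs_A fin_dim_A FA_frob zero_less_Suc vs_LM, of "\<lambda>a. \<gamma> (a \<odot>\<^bsub>T\<^esub> j) i" 0])
    fix a b assume "a \<in> fixpts A FA" "b \<in> fixpts A FA"
    then have ab: "a \<in> carrier AF" "b \<in> carrier AF" by (simp_all add: fixpts_def)
    show "\<gamma> (a \<odot>\<^bsub>T\<^esub> j) i \<in> carrier LM" using \<gamma>c[OF T.lm_closed[OF ab(1) BT]] ij by simp
    show "\<gamma> ((a \<oplus>\<^bsub>A\<^esub> b) \<odot>\<^bsub>T\<^esub> j) i = \<gamma> (a \<odot>\<^bsub>T\<^esub> j) i \<oplus>\<^bsub>LM\<^esub> \<gamma> (b \<odot>\<^bsub>T\<^esub> j) i"
      using T.lm_l_distr[OF ab BT[OF ij(2)]] \<gamma>a[OF T.lm_closed[OF ab(1) BT] T.lm_closed[OF ab(2) BT]] ij by simp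
  next
    fix c a assume c: "c \<in> fixed (Suc 0)" and "a \<in> fixpts A FA"
    then have a: "a \<in> carrier AF" by (simp add: fixpts_def)
    have "c \<odot>\<^bsub>A\<^esub> a = (c \<odot>\<^bsub>A\<^esub> \<one>\<^bsub>A\<^esub>) \<otimes>\<^bsub>A\<^esub> a" using smult_mult_A[of c "\<one>\<^bsub>A\<^esub>" a] a fixed_closed[OF c] by simp
    then have "(c \<odot>\<^bsub>A\<^esub> a) \<odot>\<^bsub>T\<^esub> j = c \<odot>\<^bsub>?bT\<^esub> (a \<odot>\<^bsub>T\<^esub> j)"
      using T.lm_assoc[OF scalar_AF[OF c] a BT[OF ij(2)]] by (simp add: base_space_simps(4))
    then show "\<gamma> ((c \<odot>\<^bsub>A\<^esub> a) \<odot>\<^bsub>T\<^esub> j) i = c [^] (q ^ 0) \<odot>\<^bsub>LM\<^esub> \<gamma> (a \<odot>\<^bsub>T\<^esub> j) i"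
      using \<gamma>m[OF c T.lm_closed[OF a BT] ] ij fixed_closed[OF c] by simp
  qed (auto simp: fixpts_def)
  then obtain P where P: "\<And>i j. \<lbrakk>i \<in> B; j \<in> B\<rbrakk> \<Longrightarrow> slin 0 A LM (P i j)"
    "\<And>i j a. \<lbrakk>i \<in> B; j \<in> B; a \<in> carrier AF\<rbrakk> \<Longrightarrow> P i j a = \<gamma> (a \<odot>\<^bsub>T\<^esub> j) i" by metis
  have Pc: "P i j a \<in> carrier L" if "i \<in> B" "j \<in> B" "a \<in> carrier A" for i j a
    using slinD(1)[OF P(1)] that by simp
  have P_eq: "u a = v a" if "slin n A LM u" "slin n A LM v" "\<And>a. a \<in> carrier AF \<Longrightarrow> u a = v a" "a \<in> carrier A" for n u v a
    by (rule slin_eq_on_fixpts[OF vs_A vs_LM FA_frob zero_less_Suc that(1,2) _ that(4)])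
      (use that(3) in \<open>auto simp: fixpts_def\<close>)
  have Pmult: "P i j (a \<otimes>\<^bsub>A\<^esub> b) = (\<Oplus>l\<in>B. P i l a \<otimes> P l j b)"
    if ij: "i \<in> B" "j \<in> B" and a: "a \<in> carrier A" and b: "b \<in> carrier A" for i j a b
  proof -
    have right: "slin 0 A A (\<lambda>a. a \<otimes>\<^bsub>A\<^esub> b)" "slin 0 A A (\<lambda>a. b \<otimes>\<^bsub>A\<^esub> a)" if "b \<in> carrier A" for b
      using that smult_mult_A by (auto simp: slin_def A.l_distr A.r_distr)
    \<comment> \<open>Both sides are linear in each of the two algebra elements, so the matrix
      product is checked on \<open>AF\<close>, first extending in a with b in \<open>AF\<close>,
      then in b.\<close>
    have step: "P i j (a \<otimes>\<^bsub>A\<^esub> b) = (\<Oplus>l\<in>B. P i l a \<otimes> P l j b)" if a: "a \<in> carrier A" and b: "b \<in> carrier AF" for a b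
    proof (rule P_eq[of 0 "\<lambda>a. P i j (a \<otimes>\<^bsub>A\<^esub> b)" "\<lambda>a. \<Oplus>l\<in>B. P i l a \<otimes> P l j b" a])
      show "slin 0 A LM (\<lambda>a. P i j (a \<otimes>\<^bsub>A\<^esub> b))"
        using slin_comp[OF right(1)[OF AF_closed[OF b]] P(1)[OF ij]] by simp
      show "slin 0 A LM (\<lambda>a. \<Oplus>l\<in>B. P i l a \<otimes> P l j b)"
        by (rule slin_scaled_sum) (use B P(1) Pc ij b in auto)
      fix a assume a: "a \<in> carrier AF"
      have ab: "a \<otimes>\<^bsub>A\<^esub> b \<in> carrier AF" using T.A.m_closed[OF a b] by simp
      show "P i j (a \<otimes>\<^bsub>A\<^esub> b) = (\<Oplus>l\<in>B. P i l a \<otimes> P l j b)"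
      proof -
        have "P i j (a \<otimes>\<^bsub>A\<^esub> b) = \<gamma> (a \<odot>\<^bsub>T\<^esub> (b \<odot>\<^bsub>T\<^esub> j)) i"
          using P(2)[OF ij ab] T.lm_assoc[OF a b BT[OF ij(2)]] by simp
        also have "\<dots> = (\<Oplus>l\<in>B. P i l a \<otimes> P l j b)"
          unfolding \<gamma>act[OF a T.lm_closed[OF b BT[OF ij(2)]] ij(1)]
          using P(2) ij a b \<gamma>c[OF T.lm_closed[OF _ BT]] by (intro finsum_cong') auto
        finally show ?thesis .
      qed
    qed (rule a)
    show ?thesis
    proof (rule P_eq[of 0 "\<lambda>b. P i j (a \<otimes>\<^bsub>A\<^esub> b)" "\<lambda>b. \<Oplus>l\<in>B. P i l a \<otimes> P l j b" b])
      show "slin 0 A LM (\<lambda>b. P i j (a \<otimes>\<^bsub>A\<^esub> b))" using slin_comp[OF right(2)[OF a] P(1)[OF ij]] by simp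
      have "slin 0 A LM (\<lambda>b. \<Oplus>l\<in>B. P l j b \<otimes> P i l a)"
        by (rule slin_scaled_sum) (use B P(1) Pc ij a in auto)
      moreover have "(\<Oplus>l\<in>B. P l j b \<otimes> P i l a) = (\<Oplus>l\<in>B. P i l a \<otimes> P l j b)" if "b \<in> carrier A" for b
        using that Pc ij a by (intro finsum_cong') (auto simp: m_comm)
      ultimately show "slin 0 A LM (\<lambda>b. \<Oplus>l\<in>B. P i l a \<otimes> P l j b)"
        unfolding slin_def using AV.smult_closed by (auto simp: Pi_def)
    qed (use step a b in auto)
  qed
  have P1: "P i j \<one>\<^bsub>A\<^esub> = (if i = j then \<one> else \<zero>)" if "i \<in> B" "j \<in> B" for i j
  proof -
    have "\<one>\<^bsub>A\<^esub> \<in> carrier AF" using FA_one[of "Suc 0"] by simp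
    then show ?thesis using P(2)[OF that] T.lm_one[OF BT[OF that(2)]] \<gamma>1[OF that(2,1)] by auto
  qed
  \<comment> \<open>Over \<open>AF\<close> the entries lie in the field with q elements, so both
    sides agree there, and both are semilinear of degree 1.\<close>
  have PF: "P i j (FA a) = P i j a [^] q" if ij: "i \<in> B" "j \<in> B" and a: "a \<in> carrier A" for i j a
  proof (rule P_eq[of "Suc 0" "\<lambda>a. P i j (FA a)" "\<lambda>a. P i j a [^] q" a])
    show "slin (Suc 0) A LM (\<lambda>a. P i j (FA a))" using slin_comp[OF FA_slin[of "Suc 0"] P(1)[OF ij]] by simp
    have "slin (Suc 0) LM LM (\<lambda>c. c [^] q)" using frob_add by (auto simp: slin_def nat_pow_distrib)
    from slin_comp[OF P(1)[OF ij] this] show "slin (Suc 0) A LM (\<lambda>a. P i j a [^] q)" by simp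
    fix a assume a: "a \<in> carrier AF"
    then show "P i j (FA a) = P i j a [^] q"
      using P(2)[OF ij a] \<gamma>f[OF T.lm_closed[OF a BT[OF ij(2)]] ij(1)] by (simp add: fixed_def)
  qed (rule a)
  define Y :: "('a, 't \<Rightarrow> 'k) module" where
    "Y = \<lparr>carrier = B \<rightarrow>\<^sub>E carrier L, monoid.mult = undefined, one = undefined, zero = (\<lambda>i\<in>B. \<zero>),
      add = (\<lambda>\<xi> \<eta>. \<lambda>i\<in>B. \<xi> i \<oplus> \<eta> i), smult = (\<lambda>a \<xi>. \<lambda>i\<in>B. \<Oplus>j\<in>B. P i j a \<otimes> \<xi> j)\<rparr>"
  have Ys [simp]: "carrier Y = B \<rightarrow>\<^sub>E carrier L" "\<zero>\<^bsub>Y\<^esub> = (\<lambda>i\<in>B. \<zero>)" "\<xi> \<oplus>\<^bsub>Y\<^esub> \<eta> = (\<lambda>i\<in>B. \<xi> i \<oplus> \<eta> i)"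
    "a \<odot>\<^bsub>Y\<^esub> \<xi> = (\<lambda>i\<in>B. \<Oplus>j\<in>B. P i j a \<otimes> \<xi> j)" for \<xi> \<eta> a by (simp_all add: Y_def)
  have Yc: "\<xi> i \<in> carrier L" if "\<xi> \<in> B \<rightarrow>\<^sub>E carrier L" "i \<in> B" for \<xi> i using that by auto
  have actc: "(\<Oplus>j\<in>B. P i j a \<otimes> \<xi> j) \<in> carrier L" if "i \<in> B" "a \<in> carrier A" "\<xi> \<in> B \<rightarrow>\<^sub>E carrier L" for i a \<xi>
    using that Pc Yc by (intro finsum_closed) auto
  have ext: "\<xi> = \<eta>" if "\<xi> \<in> B \<rightarrow>\<^sub>E S" "\<eta> \<in> B \<rightarrow>\<^sub>E S" "\<And>i. i \<in> B \<Longrightarrow> \<xi> i = \<eta> i" for \<xi> \<eta> :: "'t \<Rightarrow> 'k" and S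
    using that by (rule PiE_ext)
  have abY: "abelian_group Y"
  proof (rule abelian_groupI)
    fix \<xi> assume \<xi>: "\<xi> \<in> carrier Y"
    show "\<exists>\<eta>\<in>carrier Y. \<eta> \<oplus>\<^bsub>Y\<^esub> \<xi> = \<zero>\<^bsub>Y\<^esub>"
      by (rule bexI[of _ "\<lambda>i\<in>B. \<ominus> \<xi> i"]) (use \<xi> in \<open>auto simp: l_neg Yc intro!: restrict_ext\<close>)
    show "\<zero>\<^bsub>Y\<^esub> \<oplus>\<^bsub>Y\<^esub> \<xi> = \<xi>" by (rule ext[of _ "carrier L"]) (use \<xi> Yc in auto)
  next
    fix \<xi> \<eta> \<zeta> assume c: "\<xi> \<in> carrier Y" "\<eta> \<in> carrier Y" "\<zeta> \<in> carrier Y"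
    show "\<xi> \<oplus>\<^bsub>Y\<^esub> \<eta> \<oplus>\<^bsub>Y\<^esub> \<zeta> = \<xi> \<oplus>\<^bsub>Y\<^esub> (\<eta> \<oplus>\<^bsub>Y\<^esub> \<zeta>)"
      using c by (auto simp: a_assoc Yc intro!: restrict_ext)
  next
    fix \<xi> \<eta> assume c: "\<xi> \<in> carrier Y" "\<eta> \<in> carrier Y"
    show "\<xi> \<oplus>\<^bsub>Y\<^esub> \<eta> = \<eta> \<oplus>\<^bsub>Y\<^esub> \<xi>" "\<xi> \<oplus>\<^bsub>Y\<^esub> \<eta> \<in> carrier Y"
      using c by (auto simp: a_comm Yc intro!: restrict_ext)
  qed auto
  have "left_module_axioms A Y"
  proof unfold_locales
    fix a \<xi> assume a: "a \<in> carrier A" and \<xi>: "\<xi> \<in> carrier Y"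
    show "a \<odot>\<^bsub>Y\<^esub> \<xi> \<in> carrier Y" using a \<xi> actc by auto
  next
    fix a b \<xi> assume ab: "a \<in> carrier A" "b \<in> carrier A" and \<xi>: "\<xi> \<in> carrier Y"
    have "(\<Oplus>j\<in>B. P i j (a \<oplus>\<^bsub>A\<^esub> b) \<otimes> \<xi> j) = (\<Oplus>j\<in>B. P i j a \<otimes> \<xi> j) \<oplus> (\<Oplus>j\<in>B. P i j b \<otimes> \<xi> j)" if i: "i \<in> B" for i
    proof -
      have "(\<Oplus>j\<in>B. P i j (a \<oplus>\<^bsub>A\<^esub> b) \<otimes> \<xi> j) = (\<Oplus>j\<in>B. P i j a \<otimes> \<xi> j \<oplus> P i j b \<otimes> \<xi> j)"
        using ab \<xi> i Pc Yc slinD(2)[OF P(1)] by (intro finsum_cong') (auto simp: l_distr)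
      also have "\<dots> = (\<Oplus>j\<in>B. P i j a \<otimes> \<xi> j) \<oplus> (\<Oplus>j\<in>B. P i j b \<otimes> \<xi> j)"
        using ab \<xi> i Pc Yc by (intro finsum_addf) auto
      finally show ?thesis .
    qed
    then show "(a \<oplus>\<^bsub>A\<^esub> b) \<odot>\<^bsub>Y\<^esub> \<xi> = a \<odot>\<^bsub>Y\<^esub> \<xi> \<oplus>\<^bsub>Y\<^esub> b \<odot>\<^bsub>Y\<^esub> \<xi>" by (auto intro!: restrict_ext)
    have "(\<Oplus>j\<in>B. P i j (a \<otimes>\<^bsub>A\<^esub> b) \<otimes> \<xi> j) = (\<Oplus>l\<in>B. P i l a \<otimes> (\<Oplus>j\<in>B. P l j b \<otimes> \<xi> j))" if i: "i \<in> B" for i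
    proof -
      have "(\<Oplus>j\<in>B. P i j (a \<otimes>\<^bsub>A\<^esub> b) \<otimes> \<xi> j) = (\<Oplus>j\<in>B. \<Oplus>l\<in>B. P i l a \<otimes> (P l j b \<otimes> \<xi> j))"
      proof (rule finsum_cong')
        fix j assume j: "j \<in> B"
        have "P i j (a \<otimes>\<^bsub>A\<^esub> b) \<otimes> \<xi> j = (\<Oplus>l\<in>B. P i l a \<otimes> P l j b) \<otimes> \<xi> j" using Pmult[OF i j ab] by simp
        also have "\<dots> = (\<Oplus>l\<in>B. (P i l a \<otimes> P l j b) \<otimes> \<xi> j)"
          using Pc i j ab Yc \<xi> B by (intro finsum_ldistr) auto
        also have "\<dots> = (\<Oplus>l\<in>B. P i l a \<otimes> (P l j b \<otimes> \<xi> j))"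
          using Pc i j ab Yc \<xi> by (intro finsum_cong') (auto simp: m_assoc)
        finally show "P i j (a \<otimes>\<^bsub>A\<^esub> b) \<otimes> \<xi> j = (\<Oplus>l\<in>B. P i l a \<otimes> (P l j b \<otimes> \<xi> j))" .
      qed (use Pc i ab Yc \<xi> in \<open>auto intro!: finsum_closed\<close>)
      also have "\<dots> = (\<Oplus>l\<in>B. \<Oplus>j\<in>B. P i l a \<otimes> (P l j b \<otimes> \<xi> j))"
        using Pc i ab Yc \<xi> B by (intro finsum_swap) auto
      also have "\<dots> = (\<Oplus>l\<in>B. P i l a \<otimes> (\<Oplus>j\<in>B. P l j b \<otimes> \<xi> j))"
        using Pc i ab Yc \<xi> B by (intro finsum_cong' finsum_rdistr[symmetric]) (auto intro!: finsum_closed)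
      finally show ?thesis .
    qed
    moreover have "(\<Oplus>l\<in>B. P i l a \<otimes> (\<lambda>i\<in>B. \<Oplus>j\<in>B. P i j b \<otimes> \<xi> j) l) = (\<Oplus>l\<in>B. P i l a \<otimes> (\<Oplus>j\<in>B. P l j b \<otimes> \<xi> j))"
      if "i \<in> B" for i
      using that Pc ab actc \<xi> by (intro finsum_cong') auto
    ultimately show "(a \<otimes>\<^bsub>A\<^esub> b) \<odot>\<^bsub>Y\<^esub> \<xi> = a \<odot>\<^bsub>Y\<^esub> (b \<odot>\<^bsub>Y\<^esub> \<xi>)" by (auto intro!: restrict_ext)
  next
    fix a \<xi> \<eta> assume a: "a \<in> carrier A" and c: "\<xi> \<in> carrier Y" "\<eta> \<in> carrier Y"
    have "(\<Oplus>j\<in>B. P i j a \<otimes> (\<xi> \<oplus>\<^bsub>Y\<^esub> \<eta>) j) = (\<Oplus>j\<in>B. P i j a \<otimes> \<xi> j) \<oplus> (\<Oplus>j\<in>B. P i j a \<otimes> \<eta> j)" if i: "i \<in> B" for i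
    proof -
      have "(\<Oplus>j\<in>B. P i j a \<otimes> (\<xi> \<oplus>\<^bsub>Y\<^esub> \<eta>) j) = (\<Oplus>j\<in>B. P i j a \<otimes> \<xi> j \<oplus> P i j a \<otimes> \<eta> j)"
        using a c i Pc Yc by (intro finsum_cong') (auto simp: r_distr)
      also have "\<dots> = (\<Oplus>j\<in>B. P i j a \<otimes> \<xi> j) \<oplus> (\<Oplus>j\<in>B. P i j a \<otimes> \<eta> j)"
        using a c i Pc Yc by (intro finsum_addf) auto
      finally show ?thesis .
    qed
    then show "a \<odot>\<^bsub>Y\<^esub> (\<xi> \<oplus>\<^bsub>Y\<^esub> \<eta>) = a \<odot>\<^bsub>Y\<^esub> \<xi> \<oplus>\<^bsub>Y\<^esub> a \<odot>\<^bsub>Y\<^esub> \<eta>" by (auto intro!: restrict_ext)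
  next
    fix \<xi> assume \<xi>: "\<xi> \<in> carrier Y"
    have "(\<Oplus>j\<in>B. P i j \<one>\<^bsub>A\<^esub> \<otimes> \<xi> j) = \<xi> i" if i: "i \<in> B" for i
    proof -
      have "(\<Oplus>j\<in>B. P i j \<one>\<^bsub>A\<^esub> \<otimes> \<xi> j) = (\<Oplus>j\<in>B. if i = j then \<xi> j else \<zero>)"
        using i P1 \<xi> Yc by (intro finsum_cong') auto
      also have "\<dots> = \<xi> i" using i B \<xi> Yc by (intro finsum_singleton) auto
      finally show ?thesis .
    qed
    then show "\<one>\<^bsub>A\<^esub> \<odot>\<^bsub>Y\<^esub> \<xi> = \<xi>" by (intro ext[of _ "carrier L"]) (use \<xi> Yc in auto)
  qed
  then have lmY: "left_module A Y" by (simp add: left_module_def ring_A abY)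
  define F where "F \<xi> = (\<lambda>i\<in>B. \<xi> i [^] q)" for \<xi> :: "'t \<Rightarrow> 'k"
  have Fc: "F \<xi> \<in> carrier Y" if "\<xi> \<in> carrier Y" for \<xi> using that Yc by (auto simp: F_def)
  have Ft: "tlin 0 (Suc 0) Y Y F"
  proof (rule tlinI)
    fix \<xi> \<eta> assume "\<xi> \<in> carrier Y" "\<eta> \<in> carrier Y"
    then show "F (\<xi> \<oplus>\<^bsub>Y\<^esub> \<eta>) = F \<xi> \<oplus>\<^bsub>Y\<^esub> F \<eta>" using Yc by (auto simp: F_def frob_add intro!: restrict_ext)
  next
    fix a \<xi> assume a: "a \<in> carrier A" and \<xi>: "\<xi> \<in> carrier Y"
    have "(\<Oplus>j\<in>B. P i j a \<otimes> \<xi> j) [^] q = (\<Oplus>j\<in>B. P i j (FA a) \<otimes> F \<xi> j)" if i: "i \<in> B" for i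
    proof -
      have "(\<Oplus>j\<in>B. P i j a \<otimes> \<xi> j) [^] (q ^ Suc 0) = (\<Oplus>j\<in>B. (P i j a \<otimes> \<xi> j) [^] (q ^ Suc 0))"
        using Pc i a \<xi> Yc B by (intro frob_pow_finsum) auto
      also have "\<dots> = (\<Oplus>j\<in>B. P i j (FA a) \<otimes> F \<xi> j)"
        using Pc i a \<xi> Yc PF by (intro finsum_cong') (auto simp: F_def nat_pow_distrib)
      finally show ?thesis by simp
    qed
    then show "F ((FA ^^ 0) a \<odot>\<^bsub>Y\<^esub> \<xi>) = (FA ^^ Suc 0) a \<odot>\<^bsub>Y\<^esub> F \<xi>" by (auto simp: F_def intro!: restrict_ext)
  qed (rule Fc)
  have orb: "\<exists>n>0. (F ^^ n) \<xi> = \<xi>" if \<xi>: "\<xi> \<in> carrier Y" for \<xi>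
  proof -
    have Fn: "(F ^^ n) \<xi> \<in> carrier Y \<and> (\<forall>i\<in>B. (F ^^ n) \<xi> i = \<xi> i [^] (q ^ n))" for n
    proof (induction n)
      case 0 then show ?case using \<xi> Yc by auto
    next
      case (Suc n)
      then have "(F ^^ Suc n) \<xi> \<in> carrier Y" using Fc by simp
      moreover have "(F ^^ Suc n) \<xi> i = \<xi> i [^] (q ^ Suc n)" if "i \<in> B" for i
      proof -
        have "(F ^^ Suc n) \<xi> i = (F ^^ n) \<xi> i [^] q" using that by (simp add: F_def[of "(F ^^ n) \<xi>"])
        then show ?thesis using Suc that pow_q_Suc[OF Yc, of \<xi> i n] \<xi> by (simp del: power_Suc)
      qed
      ultimately show ?case by blast
    qed
    \<comment> \<open>The finitely many coordinates of the vector lie in a common finite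
      field.\<close>
    obtain n where n: "n > 0" "\<And>c. c \<in> \<xi> ` B \<Longrightarrow> c [^] (q ^ n) = c"
      by (rule frob_orbit_scalar[of "\<xi> ` B"]) (use B \<xi> Yc in auto)
    have "(F ^^ n) \<xi> = \<xi>" by (rule ext[of _ "carrier L"]) (use Fn[of n] n \<xi> in auto)
    then show ?thesis using n by blast
  qed
  define e where "e x = restrict (\<gamma> x) B" for x
  have ec: "e x \<in> carrier (fixed_points F Y)" if x: "x \<in> carrier T" for x
    using \<gamma>f[OF x] by (auto simp: e_def F_def fixed_def intro!: restrict_ext)
  have "e \<in> module_hom AF T (fixed_points F Y)"
  proof (rule module_homI)
    fix x y assume "x \<in> carrier T" "y \<in> carrier T"
    then show "e (x \<oplus>\<^bsub>T\<^esub> y) = e x \<oplus>\<^bsub>fixed_points F Y\<^esub> e y" using \<gamma>a by (auto simp: e_def intro!: restrict_ext)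
  next
    fix a x assume a: "a \<in> carrier AF" and x: "x \<in> carrier T"
    have "\<gamma> (a \<odot>\<^bsub>T\<^esub> x) i = (\<Oplus>j\<in>B. P i j a \<otimes> e x j)" if i: "i \<in> B" for i
      unfolding \<gamma>act[OF a x i] using P(2)[OF i _ a] a x \<gamma>c \<gamma>c[OF T.lm_closed[OF a BT] i]
      by (intro finsum_cong') (auto simp: e_def)
    then show "e (a \<odot>\<^bsub>T\<^esub> x) = a \<odot>\<^bsub>fixed_points F Y\<^esub> e x" by (auto simp: e_def intro!: restrict_ext)
  qed (rule ec)
  moreover have "bij_betw e (carrier T) (carrier (fixed_points F Y))"
  proof (rule bij_betw_byWitness[where f' = "\<lambda>\<xi>. \<Oplus>\<^bsub>T\<^esub>b\<in>B. \<xi> b \<odot>\<^bsub>?bT\<^esub> b"])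
    have \<xi>f: "\<xi> b \<in> fixed (Suc 0)" if "\<xi> \<in> carrier (fixed_points F Y)" "b \<in> B" for \<xi> b
    proof -
      have "F \<xi> b = \<xi> b" "\<xi> \<in> carrier Y" using that by auto
      then show ?thesis using that(2) Yc by (simp add: F_def fixed_def)
    qed
    show "\<forall>x\<in>carrier T. (\<Oplus>\<^bsub>T\<^esub>b\<in>B. e x b \<odot>\<^bsub>?bT\<^esub> b) = x"
    proof
      fix x assume x: "x \<in> carrier T"
      have "(\<Oplus>\<^bsub>T\<^esub>b\<in>B. e x b \<odot>\<^bsub>?bT\<^esub> b) = (\<Oplus>\<^bsub>T\<^esub>b\<in>B. \<gamma> x b \<odot>\<^bsub>?bT\<^esub> b)"
        using smc[OF \<gamma>f[OF x] BT] by (intro T.M.finsum_cong') (auto simp: e_def)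
      then show "(\<Oplus>\<^bsub>T\<^esub>b\<in>B. e x b \<odot>\<^bsub>?bT\<^esub> b) = x" using \<gamma>s[OF x] by simp
    qed
    show "\<forall>\<xi>\<in>carrier (fixed_points F Y). e (\<Oplus>\<^bsub>T\<^esub>b\<in>B. \<xi> b \<odot>\<^bsub>?bT\<^esub> b) = \<xi>"
    proof
      fix \<xi> assume \<xi>: "\<xi> \<in> carrier (fixed_points F Y)"
      show "e (\<Oplus>\<^bsub>T\<^esub>b\<in>B. \<xi> b \<odot>\<^bsub>?bT\<^esub> b) = \<xi>"
      proof (rule PiE_ext[of _ B "\<lambda>_. UNIV"])
        fix i assume "i \<in> B"
        then show "e (\<Oplus>\<^bsub>T\<^esub>b\<in>B. \<xi> b \<odot>\<^bsub>?bT\<^esub> b) i = \<xi> i" using \<gamma>u[of \<xi> i] \<xi>f[OF \<xi>] by (auto simp: e_def)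
      qed (use \<xi> in \<open>auto simp: e_def\<close>)
    qed
    show "e ` carrier T \<subseteq> carrier (fixed_points F Y)" using ec by blast
    show "(\<lambda>\<xi>. \<Oplus>\<^bsub>T\<^esub>b\<in>B. \<xi> b \<odot>\<^bsub>?bT\<^esub> b) ` carrier (fixed_points F Y) \<subseteq> carrier T"
      using smc[OF \<xi>f BT] by (auto intro!: T.M.finsum_closed)
  qed
  ultimately have "e \<in> module_iso AF T (fixed_points F Y)" by (simp add: module_iso_def)
  moreover have "finite (carrier T)" by (rule finite_AF_module[OF T])
  ultimately have "tfrob (Suc 0) Y F"
    by (intro tfrob_finite_fixed_points[OF lmY Ft orb]) (auto simp: module_iso_def dest: bij_betw_finite)
  then show ?thesis using \<open>e \<in> module_iso AF T (fixed_points F Y)\<close> by blast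
qed

end

section \<open>Almost split morphisms and fixed points\<close>

lemma split_epi_surj:
  assumes "split_epi R M N f" "f \<in> module_hom R M N" shows "f ` carrier M = carrier N"
proof (intro equalityI subsetI)
  fix y assume y: "y \<in> carrier N"
  obtain s where "s \<in> module_hom R N M" "\<forall>x\<in>carrier N. f (s x) = x" using assms(1) by (auto simp: split_epi_def)
  then show "y \<in> f ` carrier M" using y module_homD(1)[of s R N M y] by (metis imageI)
qed (use module_homD(1)[OF assms(2)] in blast)

context frobenius_algebra
begin

lemma hpart_finsum:
  assumes M: "tfrob r M \<theta>" and N: "left_module A N" and I: "finite I"
    and u: "\<And>i x. \<lbrakk>i \<in> I; x \<in> carrier M; \<theta> x = x\<rbrakk> \<Longrightarrow> u i x \<in> carrier N" and x: "x \<in> carrier M" "\<theta> x = x"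
  shows "hpart r M N j (\<lambda>x. \<Oplus>\<^bsub>N\<^esub>i\<in>I. u i x) x = (\<Oplus>\<^bsub>N\<^esub>i\<in>I. hpart r M N j (u i) x)"
proof -
  interpret N: left_module A N by fact
  interpret W: vectorspace L "bs N" by (rule vs_bs[OF N])
  have d: "inv d \<odot>\<^bsub>bs M\<^esub> x \<in> carrier M" "\<theta> (inv d \<odot>\<^bsub>bs M\<^esub> x) = inv d \<odot>\<^bsub>bs M\<^esub> x" "d \<in> carrier L"
    if "d \<in> units_fixed r" for d
    using fixed_points_smult[OF M units_inv_fixed[OF that] x] units_fixed_closed[OF that] by auto
  have uc: "u i (inv d \<odot>\<^bsub>bs M\<^esub> x) \<in> carrier N" if "i \<in> I" "d \<in> units_fixed r" for i d
    using u d that by blast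
  have "hpart r M N j (\<lambda>x. \<Oplus>\<^bsub>N\<^esub>i\<in>I. u i x) x =
      (\<Oplus>\<^bsub>N\<^esub>d\<in>units_fixed r. \<Oplus>\<^bsub>N\<^esub>i\<in>I. (\<ominus> (d [^] (q ^ j))) \<odot>\<^bsub>bs N\<^esub> u i (inv d \<odot>\<^bsub>bs M\<^esub> x))"
    unfolding hpart_def
  proof (rule N.M.finsum_cong')
    fix e assume e: "e \<in> units_fixed r"
    show "(\<ominus> (e [^] (q ^ j))) \<odot>\<^bsub>bs N\<^esub> (\<Oplus>\<^bsub>N\<^esub>i\<in>I. u i (inv e \<odot>\<^bsub>bs M\<^esub> x)) =
        (\<Oplus>\<^bsub>N\<^esub>i\<in>I. (\<ominus> (e [^] (q ^ j))) \<odot>\<^bsub>bs N\<^esub> u i (inv e \<odot>\<^bsub>bs M\<^esub> x))"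
      using W.finsum_smult_ldistr[OF I, of "\<ominus> (e [^] (q ^ j))" "\<lambda>i. u i (inv e \<odot>\<^bsub>bs M\<^esub> x)"] uc e d(3)[OF e] by auto
  qed (use uc d W.smult_closed in \<open>auto intro!: N.M.finsum_closed\<close>)
  also have "\<dots> = (\<Oplus>\<^bsub>N\<^esub>i\<in>I. hpart r M N j (u i) x)"
    unfolding hpart_def
    by (rule N.M.finsum_swap) (use uc d W.smult_closed I finite_units_fixed tfrobD(4)[OF M] in auto)
  finally show ?thesis .
qed

lemma hpart_smult:
  assumes M: "tfrob r M \<theta>" and N: "left_module A N" and c: "c \<in> carrier L"
    and u: "\<And>x. \<lbrakk>x \<in> carrier M; \<theta> x = x\<rbrakk> \<Longrightarrow> u x \<in> carrier N" and x: "x \<in> carrier M" "\<theta> x = x"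
  shows "hpart r M N j (\<lambda>x. c \<odot>\<^bsub>bs N\<^esub> u x) x = c \<odot>\<^bsub>bs N\<^esub> hpart r M N j u x"
proof (rule hpart_comp_slin[OF M N N, where l = 0 and g = "\<lambda>z. c \<odot>\<^bsub>bs N\<^esub> z" and v = u, OF _ u x])
  show "slin (r * 0) (bs N) (bs N) (\<lambda>z. c \<odot>\<^bsub>bs N\<^esub> z)" using tlin_slin[OF tlin_smult[OF N tlin_id c, of 0] N] by simp
qed

text \<open>On \<open>M\<^sup>\<theta>\<close> a degree is visible only modulo r: after the
  substitution of \<open>inv d\<close> for d the sum is that of \<open>dual_sum\<close>, which
  vanishes unless r divides i.\<close>

lemma hpart_slin:
  assumes M: "tfrob r M \<theta>" and N: "left_module A N" and u: "slin i (bs M) (bs N) u" and x: "x \<in> carrier M"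
  shows "hpart r M N 0 u x = (if r dvd i then u x else \<zero>\<^bsub>N\<^esub>)"
proof -
  note D = tfrobD[OF M]
  interpret N: left_module A N by fact
  interpret W: vectorspace L "bs N" by (rule vs_bs[OF N])
  have ux: "u x \<in> carrier N" using slinD(1)[OF u] x by simp
  let ?f = "\<lambda>d. (\<ominus> (inv d \<otimes> d [^] (q ^ i))) \<odot>\<^bsub>bs N\<^esub> u x"
  have d: "d \<in> carrier L" "inv d \<in> carrier L" "inv (inv d) = d" if "d \<in> units_fixed r" for d
    using units_fixed_closed[OF that] units_fixed_nonzero[OF that] by auto
  have "hpart r M N 0 u x = (\<Oplus>\<^bsub>N\<^esub>d\<in>units_fixed r. ?f (inv d))"
    unfolding hpart_def
  proof (rule N.M.finsum_cong')
    fix e assume e: "e \<in> units_fixed r"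
    have "(\<ominus> e) \<otimes> (inv e [^] (q ^ i)) = \<ominus> (e \<otimes> inv e [^] (q ^ i))" using d[OF e] by (simp add: l_minus)
    then show "(\<ominus> (e [^] (q ^ 0))) \<odot>\<^bsub>bs N\<^esub> u (inv e \<odot>\<^bsub>bs M\<^esub> x) = ?f (inv e)"
      using d[OF e] x ux slinD(3)[OF u, of "inv e" x] W.smult_assoc1[of "\<ominus> e" "inv e [^] (q ^ i)" "u x"] by simp
  qed (use d ux W.smult_closed in auto)
  also have "\<dots> = (\<Oplus>\<^bsub>N\<^esub>d\<in>units_fixed r. ?f d)"
    using units_fixed_inv_reindex[of r] N.M.finsum_reindex[of ?f "\<lambda>d. inv d" "units_fixed r"] d ux W.smult_closed
    by (auto simp: bij_betw_def)
  also have "\<dots> = (if r dvd i then u x else \<zero>\<^bsub>N\<^esub>)"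
    using dual_sum[OF vs_bs[OF N] D(4), of "u x" i] ux by simp
  finally show ?thesis .
qed

lemma hpart_inclusion:
  assumes M: "tfrob r M \<theta>" and x: "x \<in> carrier M"
  shows "hpart r M M j (\<lambda>x. x) x = (if r dvd j then x else \<zero>\<^bsub>M\<^esub>)"
proof -
  note D = tfrobD[OF M]
  interpret M: left_module A M by (rule D)
  interpret V: vectorspace L "bs M" by (rule D)
  have "hpart r M M j (\<lambda>x. x) x = (\<Oplus>\<^bsub>bs M\<^esub>d\<in>units_fixed r. (\<ominus> (inv d \<otimes> d [^] (q ^ j))) \<odot>\<^bsub>bs M\<^esub> x)"
    unfolding hpart_def finsum_base_space
  proof (rule M.M.finsum_cong')
    fix d assume "d \<in> units_fixed r"
    then have d: "d \<in> carrier L" "inv d \<in> carrier L" using fixed_closed[OF units_inv_fixed] units_fixed_closed by auto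
    show "(\<ominus> (d [^] (q ^ j))) \<odot>\<^bsub>bs M\<^esub> (inv d \<odot>\<^bsub>bs M\<^esub> x) = (\<ominus> (inv d \<otimes> d [^] (q ^ j))) \<odot>\<^bsub>bs M\<^esub> x"
      using d x V.smult_assoc1[of "\<ominus> (d [^] (q ^ j))" "inv d" x] l_minus[of "d [^] (q ^ j)" "inv d"]
        m_comm[of "d [^] (q ^ j)" "inv d"] by simp
  qed (use x V.smult_closed fixed_closed[OF units_inv_fixed] units_fixed_closed in auto)
  then show ?thesis using dual_sum[OF D(2,4), of x j] x by simp
qed

lemma hom_AF_restrict:
  assumes M: "tfrob r M \<theta>" and N: "left_module A N" and u: "u \<in> module_hom A M N"
  shows "u \<in> module_hom AF (fixed_points \<theta> M) N"
  by (rule module_homI) (use module_homD[OF u] in auto)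

lemma hom_AF_fixed_points:
  assumes "h \<in> module_hom AF Y (fixed_points \<theta> M)" shows "h \<in> module_hom AF Y M"
  by (rule module_homI) (use module_homD[OF assms] in auto)

lemma hom_tlin: "u \<in> module_hom A M N \<Longrightarrow> tlin 0 0 M N u"
  by (simp add: tlin_module_hom)

text \<open>A section \<open>s\<close> of \<open>f0\<close> is turned into \<open>x \<mapsto> \<Sum>\<^sub>i F\<^sup>i (c s(x))\<close>; composed with \<open>f\<close> its part of
  degree \<open>0\<close> is the multiplication by the trace of \<open>c\<close>, which is \<open>1\<close>.\<close>

lemma split_epi_descends:
  assumes M: "tfrob r M \<theta>" "local_module M" "aperiodic r M"
    and Y: "tfrob (Suc 0) Y F" and f: "f \<in> module_hom AF (fixed_points F Y) (fixed_points \<theta> M)"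
    and f0: "f0 \<in> module_hom A Y M" "\<And>y. \<lbrakk>y \<in> carrier Y; F y = y\<rbrakk> \<Longrightarrow> f0 y = f y"
    and split: "split_epi A Y M f0"
  shows "split_epi AF (fixed_points F Y) (fixed_points \<theta> M) f"
proof -
  let ?FM = "fixed_points \<theta> M"
  note D = tfrobD[OF M(1)] and E = tfrobD[OF Y]
  interpret M: left_module A M by (rule D)
  have M0: "left_module AF ?FM" by (rule left_module_fixed_points[OF M(1)])
  obtain s where s: "s \<in> module_hom A M Y" "\<And>x. x \<in> carrier M \<Longrightarrow> f0 (s x) = x"
    using split by (auto simp: split_epi_def)
  \<comment> \<open>Apart from being a common period, n is made a multiple of r, so that the indices
    below n that are divisible by r are exactly the r l with l < \<open>l0\<close>.\<close>
  obtain n where n: "n > 0" "r dvd n" "\<And>y. y \<in> s ` carrier ?FM \<Longrightarrow> (F ^^ n) y = y"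
    by (rule frob_common_power[OF E(6), of "s ` carrier ?FM" r])
      (use finite_fixed_points[OF M(1)] module_homD(1)[OF s(1)] D(4) in auto)
  obtain l0 where l0: "n = r * l0" "l0 > 0" using n by auto
  obtain c where c: "c \<in> fixed (r * l0)" "(\<Oplus>l\<in>{..<l0}. c [^] (q ^ (r * l))) = \<one>"
    using trace_one[OF D(4) l0(2)] by metis
  have cL: "c \<in> carrier L" using c(1) fixed_closed by blast
  define h where "h x = tr (bs Y) F n c (s x)" for x
  have h: "h \<in> module_hom AF ?FM (fixed_points F Y)"
    unfolding h_def
    by (rule tr_hom[OF Y M0 hom_AF_restrict[OF M(1) E(1) s(1)]]) (use n c l0 in auto)
  have g: "(\<lambda>x. f (h x)) \<in> module_hom AF ?FM ?FM"
    using module_hom_comp[OF h f] by (simp add: comp_def)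
  have fs: "slin 0 (bs Y) (bs M) f0" by (rule tlin_slin[OF hom_tlin[OF f0(1)] E(1)])
  have cs: "slin 0 (bs M) (bs Y) (\<lambda>x. c \<odot>\<^bsub>bs Y\<^esub> s x)"
    by (rule tlin_slin[OF tlin_smult[OF E(1) hom_tlin[OF s(1)] cL] D(1)])
  have w: "slin i (bs M) (bs M) (\<lambda>x. f0 ((F ^^ i) (c \<odot>\<^bsub>bs Y\<^esub> s x)))" for i
    using slin_comp[OF slin_comp[OF cs slin_funpow[OF E(2,7), of i]] fs] by simp
  \<comment> \<open>Both sides are semilinear of degree r and agree on the fixed points of F,
    because f takes its values in the fixed points of \<open>\<theta>\<close>.\<close>
  have fF: "f0 ((F ^^ r) y) = \<theta> (f0 y)" if y: "y \<in> carrier Y" for y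
  proof (rule tlin_eq[OF Y D(1), where j = r and u = "\<lambda>y. f0 ((F ^^ r) y)" and v = "\<lambda>y. \<theta> (f0 y)" and x = y])
    show "tlin 0 r Y M (\<lambda>y. f0 ((F ^^ r) y))"
      using tlin_comp0[OF tlin_funpow[OF E(5), of r, simplified] hom_tlin[OF f0(1)]] by simp
    show "tlin 0 r Y M (\<lambda>y. \<theta> (f0 y))" using tlin_comp0[OF hom_tlin[OF f0(1)] D(5)] by simp
    fix y assume y: "y \<in> carrier Y" "F y = y"
    have "(F ^^ r) y = y" using y(2) by (induction r) auto
    then show "f0 ((F ^^ r) y) = \<theta> (f0 y)" using f0(2)[OF y] module_homD(1)[OF f, of y] y by simp
  qed (rule y)
  have Yc: "(F ^^ i) y \<in> carrier Y" if "y \<in> carrier Y" for i y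
    using slinD(1)[OF slin_funpow[OF E(2,7)]] that by simp
  have fFl: "f0 ((F ^^ (r * l)) y) = (\<theta> ^^ l) (f0 y)" if y: "y \<in> carrier Y" for l y
  proof (induction l)
    case (Suc l)
    have "f0 ((F ^^ (r * Suc l)) y) = f0 ((F ^^ r) ((F ^^ (r * l)) y))" by (simp add: funpow_add)
    then show ?case using fF[OF Yc[OF y]] Suc by simp
  qed simp
  have sum: "hpart r M M 0 (\<lambda>x. f (h x)) x = x" if x: "x \<in> carrier M" "\<theta> x = x" for x
  proof -
    have csc: "c \<odot>\<^bsub>bs Y\<^esub> s y \<in> carrier Y" if "y \<in> carrier M" for y using slinD(1)[OF cs] that by simp
    have fh: "f (h y) = (\<Oplus>\<^bsub>M\<^esub>i\<in>{..<n}. f0 ((F ^^ i) (c \<odot>\<^bsub>bs Y\<^esub> s y)))" if y: "y \<in> carrier M" "\<theta> y = y" for y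
    proof -
      have hy: "h y \<in> carrier Y" "F (h y) = h y" using module_homD(1)[OF h, of y] y by auto
      have "f (h y) = f0 (\<Oplus>\<^bsub>bs Y\<^esub>i\<in>{..<n}. (F ^^ i) (c \<odot>\<^bsub>bs Y\<^esub> s y))"
        using f0(2)[OF hy] by (simp add: h_def tr_def)
      also have "\<dots> = (\<Oplus>\<^bsub>bs M\<^esub>i\<in>{..<n}. f0 ((F ^^ i) (c \<odot>\<^bsub>bs Y\<^esub> s y)))"
        by (rule slin_finsum[OF E(2) D(2) fs]) (use csc[OF y(1)] Yc in auto)
      finally show ?thesis by simp
    qed
    have "hpart r M M 0 (\<lambda>x. f (h x)) x = hpart r M M 0 (\<lambda>y. \<Oplus>\<^bsub>M\<^esub>i\<in>{..<n}. f0 ((F ^^ i) (c \<odot>\<^bsub>bs Y\<^esub> s y))) x"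
      by (rule hpart_cong[OF M(1) D(1) _ x]) (use fh slinD(1)[OF w] in \<open>auto intro!: M.M.finsum_closed\<close>)
    also have "\<dots> = (\<Oplus>\<^bsub>M\<^esub>i\<in>{..<n}. hpart r M M 0 (\<lambda>y. f0 ((F ^^ i) (c \<odot>\<^bsub>bs Y\<^esub> s y))) x)"
      by (rule hpart_finsum[OF M(1) D(1) _ _ x]) (use slinD(1)[OF w] in auto)
    also have "\<dots> = (\<Oplus>\<^bsub>M\<^esub>i\<in>{..<n}. if r dvd i then f0 ((F ^^ i) (c \<odot>\<^bsub>bs Y\<^esub> s x)) else \<zero>\<^bsub>M\<^esub>)"
      using hpart_slin[OF M(1) D(1) w x(1)] by simp
    \<comment> \<open>Only the indices divisible by r contribute to degree 0. There
      \<open>f0 \<circ> F ^^ (r * l)\<close> equals \<open>\<theta> ^^ l \<circ> f0\<close>, and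
      since \<open>f0 \<circ> s\<close> is the identity, the trace of c times x remains.\<close>
    also have "\<dots> = (\<Oplus>\<^bsub>M\<^esub>i\<in>(\<lambda>l. r * l) ` {..<l0}. f0 ((F ^^ i) (c \<odot>\<^bsub>bs Y\<^esub> s x)))"
    proof (rule M.M.add.finprod_mono_neutral_cong_left[symmetric])
      show "(\<lambda>l. r * l) ` {..<l0} \<subseteq> {..<n}" using l0 D(4) by auto
      show "(if r dvd i then f0 ((F ^^ i) (c \<odot>\<^bsub>bs Y\<^esub> s x)) else \<zero>\<^bsub>M\<^esub>) = \<zero>\<^bsub>M\<^esub>"
        if "i \<in> {..<n} - (\<lambda>l. r * l) ` {..<l0}" for i
        using that l0 D(4) by (auto elim!: dvdE)
    qed (use slinD(1)[OF w] x in auto)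
    also have "\<dots> = (\<Oplus>\<^bsub>M\<^esub>l\<in>{..<l0}. f0 ((F ^^ (r * l)) (c \<odot>\<^bsub>bs Y\<^esub> s x)))"
      using slinD(1)[OF w] x D(4) by (intro M.M.finsum_reindex) (auto simp: inj_on_def)
    also have "\<dots> = (\<Oplus>\<^bsub>M\<^esub>l\<in>{..<l0}. (\<theta> ^^ l) (c \<odot>\<^bsub>bs M\<^esub> x))"
    proof -
      have "f0 (c \<odot>\<^bsub>bs Y\<^esub> s x) = c \<odot>\<^bsub>bs M\<^esub> x"
        using slinD(3)[OF fs cL, of "s x"] module_homD(1)[OF s(1) x(1)] s(2)[OF x(1)] cL by simp
      then show ?thesis using fFl[OF csc[OF x(1)]] by simp
    qed
    also have "\<dots> = x"
      using tr_fixed_point[OF D(2,7) _ x(2) cL c(2)] x(1) by (simp add: tr_def)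
    finally show ?thesis .
  qed
  \<comment> \<open>The degree-0 part is the identity, which \<open>fixed_points_bij\<close> lifts
    to invertibility. A section of f is then h followed after the inverse of this composite.\<close>
  have gb: "bij_betw (\<lambda>x. f (h x)) (carrier ?FM) (carrier ?FM)"
    by (rule fixed_points_bij[OF M g, of "\<lambda>x. x"])
      (use sum in \<open>auto simp: bij_betw_def tlin_module_hom[symmetric] intro: tlin_id\<close>)
  let ?i = "inv_into (carrier ?FM) (\<lambda>x. f (h x))"
  have "?i \<in> module_hom AF ?FM ?FM"
    by (rule module_iso_inv_into[OF M0]) (use g gb in \<open>simp add: module_iso_def\<close>)
  from module_hom_comp[OF this h] have "h \<circ> ?i \<in> module_hom AF ?FM (fixed_points F Y)" .
  moreover have "f ((h \<circ> ?i) x) = x" if "x \<in> carrier ?FM" for x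
    using bij_betw_inv_into_right[OF gb that] by simp
  ultimately show ?thesis unfolding split_epi_def by blast
qed

text \<open>A non-bijective endomorphism of M is not surjective, hence not a split epimorphism, and
  factors through \<open>\<phi>\<close>. If f and g were both of this kind with f + g = 1, the
  identity would factor through \<open>\<phi>\<close>.\<close>

lemma right_almost_split_local:
  assumes \<phi>: "minimal_right_almost_split L A N M \<phi>" and M: "tfrob r M \<theta>"
  shows "local_module M"
proof -
  note D = tfrobD[OF M]
  interpret M: left_module A M by (rule D)
  have N: "left_module A N" using \<phi> by (simp add: minimal_right_almost_split_def fd_module_def)
  have \<phi>h: "\<phi> \<in> module_hom A N M" and ns: "\<not> split_epi A N M \<phi>"
    using \<phi> by (auto simp: minimal_right_almost_split_def)
  have "\<exists>x\<in>carrier M. x \<noteq> \<zero>\<^bsub>M\<^esub>"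
  proof (rule ccontr)
    interpret N: left_module A N by fact
    assume z: "\<not> ?thesis"
    have "(\<lambda>x. \<zero>\<^bsub>N\<^esub>) \<in> module_hom A M N" using tlin_zero[OF N] by (simp add: tlin_module_hom[symmetric])
    moreover have "\<phi> \<zero>\<^bsub>N\<^esub> = x" if "x \<in> carrier M" for x
      using z that module_homD(1)[OF \<phi>h, of "\<zero>\<^bsub>N\<^esub>"] by (metis N.M.zero_closed)
    ultimately show False using ns by (auto simp: split_epi_def)
  qed
  moreover have "bij_betw f (carrier M) (carrier M) \<or> bij_betw g (carrier M) (carrier M)"
    if f: "f \<in> module_hom A M M" and g: "g \<in> module_hom A M M" and fg: "\<And>x. x \<in> carrier M \<Longrightarrow> f x \<oplus>\<^bsub>M\<^esub> g x = x" for f g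
  proof (rule ccontr)
    assume n: "\<not> ?thesis"
    have factor: "\<exists>u\<in>module_hom A M N. \<forall>x\<in>carrier M. w x = \<phi> (u x)"
      if w: "w \<in> module_hom A M M" "\<not> bij_betw w (carrier M) (carrier M)" for w
    proof (rule minimal_right_almost_split_factors[OF fd_A \<phi> D(8) w(1)])
      show "\<not> split_epi A M M w" using split_epi_surj[OF _ w(1)] hom_surj_bij[OF M w(1)] w(2) by blast
    qed
    obtain u where u: "u \<in> module_hom A M N" "\<And>x. x \<in> carrier M \<Longrightarrow> f x = \<phi> (u x)" using factor[OF f] n by blast
    obtain v where v: "v \<in> module_hom A M N" "\<And>x. x \<in> carrier M \<Longrightarrow> g x = \<phi> (v x)" using factor[OF g] n by blast
    have "(\<lambda>x. u x \<oplus>\<^bsub>N\<^esub> v x) \<in> module_hom A M N"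
      using tlin_add[OF N hom_tlin[OF u(1)] hom_tlin[OF v(1)]] by (simp add: tlin_module_hom)
    moreover have "\<phi> (u x \<oplus>\<^bsub>N\<^esub> v x) = x" if "x \<in> carrier M" for x
      using module_homD(2)[OF \<phi>h module_homD(1)[OF u(1) that] module_homD(1)[OF v(1) that]] u v fg that by simp
    ultimately show False using ns by (auto simp: split_epi_def)
  qed
  ultimately show ?thesis unfolding local_module_def by blast
qed

text \<open>The induced morphism, read on the fixed points of \<open>M\<close> and \<open>L\<close> instead of those of the twisted
  sums.\<close>

lemma fixed_points_minimal_right_almost_split:
  assumes \<phi>: "minimal_right_almost_split L A N M \<phi>"
    and N: "tfrob r N \<theta>N" and M: "tfrob r M \<theta>" "aperiodic r M"
    and comm: "\<And>x. x \<in> carrier N \<Longrightarrow> \<phi> (\<theta>N x) = \<theta> (\<phi> x)"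
  shows "minimal_right_almost_split K1 AF (fixed_points \<theta>N N) (fixed_points \<theta> M) \<phi>"
proof -
  let ?FM = "fixed_points \<theta> M"
  let ?FN = "fixed_points \<theta>N N"
  note D = tfrobD[OF M(1)] and E = tfrobD[OF N]
  interpret M: left_module A M by (rule D)
  interpret N: left_module A N by (rule E)
  interpret NV: vectorspace L "bs N" by (rule E)
  have N0: "left_module AF ?FN" by (rule left_module_fixed_points[OF N])
  interpret N0: left_module AF "?FN" by (rule N0)
  have loc: "local_module M" by (rule right_almost_split_local[OF \<phi> M(1)])
  have \<phi>h: "\<phi> \<in> module_hom A N M" and ns: "\<not> split_epi A N M \<phi>"
    and min: "\<And>f. \<lbrakk>f \<in> module_hom A N N; \<And>x. x \<in> carrier N \<Longrightarrow> \<phi> x = \<phi> (f x)\<rbrakk> \<Longrightarrow> f \<in> module_iso A N N"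
    using \<phi> by (auto simp: minimal_right_almost_split_def)
  have \<phi>0: "\<phi> \<in> module_hom AF ?FN ?FM"
    by (rule module_hom_fixed_points[OF \<phi>h]) (metis comm)
  show ?thesis
    unfolding minimal_right_almost_split_def
  proof (intro conjI allI impI ballI)
    show "fd_module K1 AF ?FN" "fd_module K1 AF ?FM"
      by (rule fd_fixed_points[OF N], rule fd_fixed_points[OF M(1)])
    show "\<phi> \<in> module_hom AF ?FN ?FM" by (rule \<phi>0)
    show "\<not> split_epi AF ?FN ?FM \<phi>"
    proof
      assume "split_epi AF ?FN ?FM \<phi>"
      then obtain s where s: "s \<in> module_hom AF ?FM ?FN"
        "\<And>x. \<lbrakk>x \<in> carrier M; \<theta> x = x\<rbrakk> \<Longrightarrow> \<phi> (s x) = x" by (auto simp: split_epi_def)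
      have sN: "s \<in> module_hom AF ?FM N" by (rule hom_AF_fixed_points[OF s(1)])
      \<comment> \<open>The degree-0 part of a section over \<open>AF\<close> extends to a section
        over \<open>A\<close>, because the inclusion of \<open>M\<^sup>\<theta>\<close> in M has
        degree 0.\<close>
      obtain u where u: "tlin 0 0 M N u" "\<And>x. \<lbrakk>x \<in> carrier M; \<theta> x = x\<rbrakk> \<Longrightarrow> u x = hpart r M N 0 s x"
        using hpart_extension[OF M(1) E(1) sN] by metis
      have fx: "\<phi> (u x) = x" if x: "x \<in> carrier M" "\<theta> x = x" for x
      proof -
        have "\<phi> (u x) = hpart r M M 0 (\<lambda>x. \<phi> (s x)) x"
          using hpart_hom[OF M(1) E(1) D(1) \<phi>h sN x] u(2)[OF x] by simp
        also have "\<dots> = hpart r M M 0 (\<lambda>x. x) x" by (rule hpart_cong[OF M(1) D(1) _ x]) (use s in auto)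
        also have "\<dots> = x" using hpart_inclusion[OF M(1) x(1)] by simp
        finally show ?thesis .
      qed
      have "\<phi> (u x) = x" if x: "x \<in> carrier M" for x
        by (rule tlin_eq[OF M(1) D(1), where j = 0 and u = "\<lambda>x. \<phi> (u x)" and v = "\<lambda>x. x" and x = x])
          (use fx x tlin_comp0[OF u(1) hom_tlin[OF \<phi>h]] tlin_id in auto)
      then show False using ns u(1) by (auto simp: split_epi_def tlin_module_hom)
    qed
  next
    fix T :: "('a, nat \<Rightarrow> 'k) module" and f
    assume "fd_module K1 AF T \<and> f \<in> module_hom AF T ?FM \<and> \<not> split_epi AF T ?FM f"
    then have T: "fd_module K1 AF T" and f: "f \<in> module_hom AF T ?FM"
      and nf: "\<not> split_epi AF T ?FM f" by auto
    have lT: "left_module AF T" using T by (simp add: fd_module_def)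
    obtain Y :: "('a, (nat \<Rightarrow> 'k) \<Rightarrow> 'k) module" and F e
      where Y: "tfrob (Suc 0) Y F" and e: "e \<in> module_iso AF T (fixed_points F Y)"
      using base_change[OF T] by blast
    note EY = tfrobD[OF Y]
    have eh: "e \<in> module_hom AF T (fixed_points F Y)" and eb: "bij_betw e (carrier T) (carrier (fixed_points F Y))"
      using e by (auto simp: module_iso_def)
    define d where "d = inv_into (carrier T) e"
    have dh: "d \<in> module_hom AF (fixed_points F Y) T" unfolding d_def by (rule module_iso_inv_into[OF lT e])
    have de: "d (e x) = x" if "x \<in> carrier T" for x using eb that by (simp add: d_def bij_betw_def)
    have f': "(\<lambda>y. f (d y)) \<in> module_hom AF (fixed_points F Y) ?FM"
      using module_hom_comp[OF dh f] by (simp add: comp_def)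
    obtain f0 where f0: "f0 \<in> module_hom A Y M" "\<And>y. \<lbrakk>y \<in> carrier Y; F y = y\<rbrakk> \<Longrightarrow> f0 y = f (d y)"
      by (rule F_stable_extension[OF Y D(1) hom_AF_fixed_points[OF f']]) blast
    have "\<not> split_epi A Y M f0"
    proof
      assume "split_epi A Y M f0"
      then have "split_epi AF (fixed_points F Y) ?FM (\<lambda>y. f (d y))"
        by (intro split_epi_descends[OF M(1) loc M(2) Y f' f0(1)] f0(2))
      then obtain s where s: "s \<in> module_hom AF ?FM (fixed_points F Y)"
        "\<forall>x\<in>carrier ?FM. f (d (s x)) = x" unfolding split_epi_def by blast
      have "d \<circ> s \<in> module_hom AF ?FM T" by (rule module_hom_comp[OF s(1) dh])
      then have "split_epi AF T ?FM f"
        unfolding split_epi_def using s(2) by (intro bexI[of _ "d \<circ> s"]) auto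
      then show False using nf by blast
    qed
    then obtain g0 where g0: "g0 \<in> module_hom A Y N" "\<And>y. y \<in> carrier Y \<Longrightarrow> f0 y = \<phi> (g0 y)"
      using minimal_right_almost_split_factors[OF fd_A \<phi> EY(8) f0(1)] by blast
    have h: "(\<lambda>x. g0 (e x)) \<in> module_hom AF T N"
      using module_hom_comp[OF eh hom_AF_restrict[OF Y E(1) g0(1)]] by (simp add: comp_def)
    have finT: "finite (carrier T)" by (rule finite_AF_module[OF T])
    \<comment> \<open>The factorisation g0 over \<open>A\<close> need not respect fixed points. Its
      trace does, with n a common period of the finitely many values and c of trace one, so that the
      trace changes nothing after applying \<open>\<phi>\<close>.\<close>
    obtain n where n: "n > 0" "\<And>y. y \<in> (\<lambda>x. g0 (e x)) ` carrier T \<Longrightarrow> (\<theta>N ^^ n) y = y"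
      by (rule frob_common_power[OF E(6), of "(\<lambda>x. g0 (e x)) ` carrier T" 1])
        (use finT module_homD(1)[OF h] in auto)
    obtain c where c: "c \<in> fixed (r * n)" "(\<Oplus>l\<in>{..<n}. c [^] (q ^ (r * l))) = \<one>"
      using trace_one[OF D(4) n(1)] by metis
    have cL: "c \<in> carrier L" using c(1) fixed_closed by blast
    define g where "g x = tr (bs N) \<theta>N n c (g0 (e x))" for x
    have "g \<in> module_hom AF T ?FN"
      unfolding g_def by (rule tr_hom[OF N lT h _ c(1)]) (use n in auto)
    moreover have "f x = \<phi> (g x)" if x: "x \<in> carrier T" for x
    proof -
      have ex: "e x \<in> carrier Y" "F (e x) = e x" using module_homD(1)[OF eh x] by auto
      have fx: "f x \<in> carrier M" "\<theta> (f x) = f x" using module_homD(1)[OF f x] by auto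
      have "\<phi> (g x) = tr (bs M) \<theta> n c (\<phi> (g0 (e x)))"
        unfolding g_def by (rule tr_equivariant[OF N M(1) \<phi>h comm _ cL]) (use module_homD(1)[OF g0(1) ex(1)] in auto)
      also have "\<phi> (g0 (e x)) = f x" using g0(2)[OF ex(1)] f0(2)[OF ex] de[OF x] by simp
      also have "tr (bs M) \<theta> n c (f x) = f x"
        by (rule tr_fixed_point[OF D(2,7) _ fx(2) cL c(2)]) (use fx in simp)
      finally show ?thesis by simp
    qed
    ultimately show "\<exists>g\<in>module_hom AF T ?FN. \<forall>x\<in>carrier T. f x = \<phi> (g x)" by blast
  next
    fix g assume g: "g \<in> module_hom AF ?FN ?FN"
      and \<phi>g: "\<forall>x\<in>carrier ?FN. \<phi> x = \<phi> (g x)"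
    have gN: "g \<in> module_hom AF ?FN N" by (rule hom_AF_fixed_points[OF g])
    have "\<exists>U. tlin 0 j N N U \<and> (\<forall>x. x \<in> carrier N \<and> \<theta>N x = x \<longrightarrow> U x = hpart r N N j g x)" for j
      using hpart_extension[OF N E(1) gN, of j] by metis
    then obtain U where U: "\<And>j. tlin 0 j N N (U j)"
      "\<And>j x. \<lbrakk>x \<in> carrier N; \<theta>N x = x\<rbrakk> \<Longrightarrow> U j x = hpart r N N j g x" by metis
    \<comment> \<open>Comparison of components in \<open>\<phi> \<circ> g = \<phi>\<close>: the
      right-hand side is concentrated in degree 0.\<close>
    have \<phi>U_fixed: "\<phi> (U j x) = (if j = 0 then \<phi> x else \<zero>\<^bsub>M\<^esub>)" if j: "j < r" and x: "x \<in> carrier N" "\<theta>N x = x" for j x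
    proof -
      have "\<phi> (U j x) = hpart r N M j (\<lambda>x. \<phi> (g x)) x"
        using hpart_hom[OF N E(1) D(1) \<phi>h gN x] U(2)[OF x] by simp
      also have "\<dots> = hpart r N M j (\<lambda>x. \<phi> ((\<lambda>x. x) x)) x"
        by (rule hpart_cong[OF N D(1) _ x]) (use \<phi>g module_homD(1)[OF \<phi>h] module_homD(1)[OF gN] in auto)
      also have "\<dots> = \<phi> (hpart r N N j (\<lambda>x. x) x)"
        by (rule hpart_hom[OF N E(1) D(1) \<phi>h _ x, symmetric]) (auto intro!: module_homI)
      also have "\<dots> = (if j = 0 then \<phi> x else \<zero>\<^bsub>M\<^esub>)"
        using hpart_inclusion[OF N x(1), of j] j tlin_0[OF hom_tlin[OF \<phi>h] E(1) D(1)] by (auto dest: dvd_imp_le)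
      finally show ?thesis .
    qed
    have \<phi>U: "\<phi> (U j x) = \<zero>\<^bsub>M\<^esub>" if j: "j < r" "j \<noteq> 0" and x: "x \<in> carrier N" for j x
      by (rule tlin_eq[OF N D(1), where j = j and u = "\<lambda>x. \<phi> (U j x)" and v = "\<lambda>x. \<zero>\<^bsub>M\<^esub>" and x = x])
        (use \<phi>U_fixed[OF j(1)] j x tlin_comp0[OF U(1) hom_tlin[OF \<phi>h], of j] tlin_zero[OF D(1)] in auto)
    have \<phi>U0: "\<phi> (U 0 x) = \<phi> x" if x: "x \<in> carrier N" for x
      by (rule tlin_eq[OF N D(1), where j = 0 and u = "\<lambda>x. \<phi> (U 0 x)" and v = \<phi> and x = x])
        (use \<phi>U_fixed[OF D(4)] x tlin_comp0[OF U(1) hom_tlin[OF \<phi>h], of 0] hom_tlin[OF \<phi>h] in auto)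
    define neg where "neg x = (\<ominus> \<one>) \<odot>\<^bsub>bs N\<^esub> x" for x
    have neg: "tlin 0 0 N N neg" unfolding neg_def by (rule tlin_smult[OF E(1) tlin_id]) simp
    have xneg: "x \<oplus>\<^bsub>N\<^esub> neg x = \<zero>\<^bsub>N\<^esub>" if "x \<in> carrier N" for x
      using NV.smult_l_distr[of \<one> "\<ominus> \<one>" x] that by (simp add: neg_def r_neg)
    have \<phi>_add: "\<phi> (x \<oplus>\<^bsub>N\<^esub> y) = \<phi> x \<oplus>\<^bsub>M\<^esub> \<phi> y" if "x \<in> carrier N" "y \<in> carrier N" for x y
      using module_homD(2)[OF \<phi>h that] .
    have \<phi>c: "\<phi> x \<in> carrier M" if "x \<in> carrier N" for x using module_homD(1)[OF \<phi>h that] .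
    define \<rho> where "\<rho> j = (if j = 0 then (\<lambda>x. U 0 x \<oplus>\<^bsub>N\<^esub> neg x) else U j)" for j :: nat
    \<comment> \<open>If \<open>\<phi>\<close> kills u, then \<open>\<phi>\<close> is unchanged by
      precomposition with 1 + u, so minimality of \<open>\<phi>\<close> over \<open>A\<close>
      provides the invertible pivots of the elimination.\<close>
    define J where "J u \<longleftrightarrow> (\<forall>x\<in>carrier N. \<phi> (u x) = \<zero>\<^bsub>M\<^esub>)" for u :: "'b \<Rightarrow> 'b"
    have \<rho>: "tlin 0 j N N (\<rho> j) \<and> J (\<rho> j)" if j: "j < r" for j
    proof (cases "j = 0")
      case True
      have "\<phi> (U 0 x \<oplus>\<^bsub>N\<^esub> neg x) = \<zero>\<^bsub>M\<^esub>" if x: "x \<in> carrier N" for x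
      proof -
        have "\<phi> (U 0 x \<oplus>\<^bsub>N\<^esub> neg x) = \<phi> (x \<oplus>\<^bsub>N\<^esub> neg x)"
          using \<phi>_add \<phi>U0[OF x] tlinD(1)[OF U(1) x] tlinD(1)[OF neg x] x by simp
        then show ?thesis using xneg[OF x] tlin_0[OF hom_tlin[OF \<phi>h] E(1) D(1)] by simp
      qed
      then show ?thesis using True tlin_add[OF E(1) U(1)[of 0] neg] by (simp add: \<rho>_def J_def)
    next
      case False
      then show ?thesis using U(1) \<phi>U[OF j] by (simp add: \<rho>_def J_def)
    qed
    have "inj_on g (carrier ?FN)"
    proof (rule additive_inj[OF N0.M.abelian_group_axioms N0.M.abelian_group_axioms])
      fix x assume x: "x \<in> carrier ?FN" "g x = \<zero>\<^bsub>?FN\<^esub>"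
      then have x': "x \<in> carrier N" "\<theta>N x = x" by simp_all
      note Uc = tlinD(1)[OF U(1) x'(1)] and negc = tlinD(1)[OF neg x'(1)]
      have \<rho>c: "\<rho> j x \<in> carrier N" for j using Uc negc by (simp add: \<rho>_def)
      have "\<zero>\<^bsub>N\<^esub> = (\<Oplus>\<^bsub>N\<^esub>j\<in>{..<r}. U j x)" using hpart_decomposition[OF N E(1) gN x'] x(2) U(2)[OF x'] by simp
      also have "\<dots> = (\<Oplus>\<^bsub>N\<^esub>j\<in>{..<r}. (if j = 0 then x else \<zero>\<^bsub>N\<^esub>) \<oplus>\<^bsub>N\<^esub> \<rho> j x)"
      proof (rule N.M.finsum_cong')
        fix j
        have "x \<oplus>\<^bsub>N\<^esub> (U 0 x \<oplus>\<^bsub>N\<^esub> neg x) = U 0 x \<oplus>\<^bsub>N\<^esub> (x \<oplus>\<^bsub>N\<^esub> neg x)"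
          using x' Uc negc by (simp add: N.M.a_ac)
        then show "U j x = (if j = 0 then x else \<zero>\<^bsub>N\<^esub>) \<oplus>\<^bsub>N\<^esub> \<rho> j x"
          using xneg[OF x'(1)] Uc by (simp add: \<rho>_def)
      qed (use x' \<rho>c in auto)
      also have "\<dots> = (\<Oplus>\<^bsub>N\<^esub>j\<in>{..<r}. if j = 0 then x else \<zero>\<^bsub>N\<^esub>) \<oplus>\<^bsub>N\<^esub> (\<Oplus>\<^bsub>N\<^esub>j\<in>{..<r}. \<rho> j x)"
        using x' \<rho>c by (intro N.M.finsum_addf) auto
      also have "(\<Oplus>\<^bsub>N\<^esub>j\<in>{..<r}. if j = 0 then x else \<zero>\<^bsub>N\<^esub>) = x"
        using D(4) x' N.M.finsum_singleton[of 0 "{..<r}" "\<lambda>_. x"] by (simp add: if_distrib)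
      finally have sum0: "x \<oplus>\<^bsub>N\<^esub> (\<Oplus>\<^bsub>N\<^esub>j\<in>{..<r}. \<rho> j x) = \<zero>\<^bsub>N\<^esub>" by simp
      have "x = \<zero>\<^bsub>N\<^esub>"
      proof (rule fixed_point_elimination[OF N, where J = J and \<rho> = \<rho>])
        fix i j u v assume "tlin i j N N u" "tlin i j N N v" "J u" "J v"
        then show "J (\<lambda>x. u x \<oplus>\<^bsub>N\<^esub> v x)" using \<phi>_add by (simp add: J_def tlinD(1))
      next
        fix i j i' j' u v assume "tlin i j N N u" "J u" "tlin i' j' N N v"
        then show "J (\<lambda>x. u (v x))" by (simp add: J_def tlinD(1))
      next
        fix u assume u: "u \<in> module_hom A N N" "J u"
        have "(\<lambda>x. x \<oplus>\<^bsub>N\<^esub> u x) \<in> module_hom A N N"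
          using tlin_add[OF E(1) tlin_id hom_tlin[OF u(1)]] by (simp add: tlin_module_hom)
        then have "(\<lambda>x. x \<oplus>\<^bsub>N\<^esub> u x) \<in> module_iso A N N"
          by (rule min) (use u \<phi>_add \<phi>c module_homD(1)[OF u(1)] in \<open>simp add: J_def\<close>)
        then show "bij_betw (\<lambda>x. x \<oplus>\<^bsub>N\<^esub> u x) (carrier N) (carrier N)" by (simp add: module_iso_def)
      qed (use \<rho> x' sum0 in auto)
      then show "x = \<zero>\<^bsub>?FN\<^esub>" by simp
    qed (use module_homD[OF g] in auto)
    moreover have "g ` carrier ?FN \<subseteq> carrier ?FN"
      using module_homD(1)[OF g] by blast
    ultimately have "bij_betw g (carrier ?FN) (carrier ?FN)"
      using finite_fixed_points[OF N] endo_inj_surj unfolding bij_betw_def by blast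
    then show "g \<in> module_iso AF ?FN ?FN" using g by (simp add: module_iso_def)
  qed
qed

end

section \<open>Frobenius twists\<close>

lemma module_isoD:
  assumes "e \<in> module_iso A M N" "left_module A M"
  shows "e \<in> module_hom A M N" "inv_into (carrier M) e \<in> module_hom A N M"
    "x \<in> carrier M \<Longrightarrow> inv_into (carrier M) e (e x) = x"
    "y \<in> carrier N \<Longrightarrow> e (inv_into (carrier M) e y) = y"
    "bij_betw e (carrier M) (carrier N)"
  using assms module_iso_inv_into[OF assms(2,1)]
  by (auto simp: module_iso_def bij_betw_inv_into_left bij_betw_inv_into_right)

lemma minimal_right_almost_split_iso:
  fixes K :: "'k ring" and L1 :: "('a, 'l1) module" and L2 :: "('a, 'l2) module" and M1 :: "('a, 'm1) module" and M2 :: "('a, 'm2) module"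
  assumes \<phi>1: "minimal_right_almost_split K A L1 M1 \<phi>1"
    and fd: "fd_module K A L2" "fd_module K A M2"
    and \<alpha>: "\<alpha> \<in> module_iso A L1 L2" and \<beta>: "\<beta> \<in> module_iso A M1 M2"
    and \<phi>2: "\<phi>2 \<in> module_hom A L2 M2" and comm: "\<And>x. x \<in> carrier L1 \<Longrightarrow> \<phi>2 (\<alpha> x) = \<beta> (\<phi>1 x)"
  shows "minimal_right_almost_split K A L2 M2 \<phi>2"
proof -
  have lm: "left_module A L1" "left_module A M1" "\<phi>1 \<in> module_hom A L1 M1"
    using \<phi>1 by (auto simp: minimal_right_almost_split_def fd_module_def)
  define \<alpha>' where "\<alpha>' = inv_into (carrier L1) \<alpha>"
  define \<beta>' where "\<beta>' = inv_into (carrier M1) \<beta>"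
  note a = module_isoD[OF \<alpha> lm(1), folded \<alpha>'_def] and b = module_isoD[OF \<beta> lm(2), folded \<beta>'_def]
  note ac = module_homD(1)[OF a(1)] and a'c = module_homD(1)[OF a(2)]
  note bc = module_homD(1)[OF b(1)] and b'c = module_homD(1)[OF b(2)]
  note pc = module_homD(1)[OF lm(3)]
  have comm': "\<phi>1 (\<alpha>' y) = \<beta>' (\<phi>2 y)" if "y \<in> carrier L2" for y
    using comm[OF a'c[OF that]] a(4)[OF that] b(3)[OF pc[OF a'c[OF that]]] by simp
  show ?thesis
    unfolding minimal_right_almost_split_def
  proof (intro conjI allI impI ballI)
    show "\<not> split_epi A L2 M2 \<phi>2"
    proof
      assume "split_epi A L2 M2 \<phi>2"
      then obtain s where s: "s \<in> module_hom A M2 L2" "\<forall>x\<in>carrier M2. \<phi>2 (s x) = x" by (auto simp: split_epi_def)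
      have "\<alpha>' \<circ> (s \<circ> \<beta>) \<in> module_hom A M1 L1" by (intro module_hom_comp[OF module_hom_comp[OF b(1) s(1)] a(2)])
      moreover have "\<phi>1 ((\<alpha>' \<circ> (s \<circ> \<beta>)) x) = x" if "x \<in> carrier M1" for x
        using comm'[OF module_homD(1)[OF s(1) bc[OF that]]] s(2) bc[OF that] b(3)[OF that] by simp
      ultimately have "split_epi A L1 M1 \<phi>1" unfolding split_epi_def by blast
      then show False using \<phi>1 by (simp add: minimal_right_almost_split_def)
    qed
  next
    fix T :: "('a, nat \<Rightarrow> 'k) module" and f
    assume "fd_module K A T \<and> f \<in> module_hom A T M2 \<and> \<not> split_epi A T M2 f"
    then have T: "fd_module K A T" "f \<in> module_hom A T M2" "\<not> split_epi A T M2 f" by auto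
    have f1: "\<beta>' \<circ> f \<in> module_hom A T M1" by (rule module_hom_comp[OF T(2) b(2)])
    have "\<not> split_epi A T M1 (\<beta>' \<circ> f)"
    proof
      assume "split_epi A T M1 (\<beta>' \<circ> f)"
      then obtain s where s: "s \<in> module_hom A M1 T" "\<And>x. x \<in> carrier M1 \<Longrightarrow> \<beta>' (f (s x)) = x" by (auto simp: split_epi_def)
      have "f ((s \<circ> \<beta>') y) = y" if y: "y \<in> carrier M2" for y
      proof -
        have "\<beta> (\<beta>' (f (s (\<beta>' y)))) = \<beta> (\<beta>' y)" using s(2)[OF b'c[OF y]] by simp
        then show ?thesis using b(4) module_homD(1)[OF T(2) module_homD(1)[OF s(1) b'c[OF y]]] y by simp
      qed
      moreover have "s \<circ> \<beta>' \<in> module_hom A M2 T" by (rule module_hom_comp[OF b(2) s(1)])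
      ultimately have "split_epi A T M2 f" unfolding split_epi_def by blast
      then show False using T(3) by blast
    qed
    then have "fd_module K A T \<and> \<beta>' \<circ> f \<in> module_hom A T M1 \<and> \<not> split_epi A T M1 (\<beta>' \<circ> f)" using T(1) f1 by simp
    moreover have "\<forall>(T :: ('a, nat \<Rightarrow> 'k) module) f. fd_module K A T \<and> f \<in> module_hom A T M1 \<and> \<not> split_epi A T M1 f \<longrightarrow>
        (\<exists>g\<in>module_hom A T L1. \<forall>x\<in>carrier T. f x = \<phi>1 (g x))"
      using \<phi>1 unfolding minimal_right_almost_split_def by (elim conjE)
    ultimately obtain g where g: "g \<in> module_hom A T L1" "\<forall>x\<in>carrier T. (\<beta>' \<circ> f) x = \<phi>1 (g x)" by blast
    have "f x = \<phi>2 ((\<alpha> \<circ> g) x)" if x: "x \<in> carrier T" for x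
      using comm[OF module_homD(1)[OF g(1) x]] bspec[OF g(2) x, symmetric] b(4)[OF module_homD(1)[OF T(2) x]] by simp
    then show "\<exists>g\<in>module_hom A T L2. \<forall>x\<in>carrier T. f x = \<phi>2 (g x)"
      using module_hom_comp[OF g(1) a(1)] by blast
  next
    fix f assume f: "f \<in> module_hom A L2 L2" and eq: "\<forall>x\<in>carrier L2. \<phi>2 x = \<phi>2 (f x)"
    have h: "\<alpha>' \<circ> (f \<circ> \<alpha>) \<in> module_hom A L1 L1" by (intro module_hom_comp[OF module_hom_comp[OF a(1) f] a(2)])
    have "\<phi>1 x = \<phi>1 ((\<alpha>' \<circ> (f \<circ> \<alpha>)) x)" if x: "x \<in> carrier L1" for x
      using comm'[OF module_homD(1)[OF f ac[OF x]]] eq ac[OF x] comm[OF x] b(3)[OF pc[OF x]] by simp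
    moreover have "\<forall>f\<in>module_hom A L1 L1. (\<forall>x\<in>carrier L1. \<phi>1 x = \<phi>1 (f x)) \<longrightarrow> f \<in> module_iso A L1 L1"
      using \<phi>1 unfolding minimal_right_almost_split_def by (elim conjE)
    ultimately have "\<alpha>' \<circ> (f \<circ> \<alpha>) \<in> module_iso A L1 L1" using h by blast
    then have bij: "bij_betw (\<alpha>' \<circ> (f \<circ> \<alpha>)) (carrier L1) (carrier L1)" by (simp add: module_iso_def)
    have ba': "bij_betw \<alpha>' (carrier L2) (carrier L1)" unfolding \<alpha>'_def by (rule bij_betw_inv_into[OF a(5)])
    have "bij_betw (\<alpha> \<circ> ((\<alpha>' \<circ> (f \<circ> \<alpha>)) \<circ> \<alpha>')) (carrier L2) (carrier L2)"
      by (intro bij_betw_trans[OF bij_betw_trans[OF ba' bij] a(5)])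
    moreover have "(\<alpha> \<circ> ((\<alpha>' \<circ> (f \<circ> \<alpha>)) \<circ> \<alpha>')) x = f x" if "x \<in> carrier L2" for x
      using a(4)[OF that] a(4)[OF module_homD(1)[OF f that]] by simp
    ultimately have "bij_betw f (carrier L2) (carrier L2)" using bij_betw_cong by blast
    then show "f \<in> module_iso A L2 L2" using f by (simp add: module_iso_def)
  qed (use fd \<phi>2 in auto)
qed

context frobenius_algebra
begin

section \<open>Frobenius twists and the period\<close>

lemma frob_frobenius_map: "frobenius_map q L V F \<Longrightarrow> frob (Suc 0) V F"
  unfolding frobenius_map_def frob_def slin_def by (auto dest: bij_betwE)

lemma tfrob_F_stable:
  assumes M: "tfrob (Suc 0) M F" shows "F_stable q L A FA M F"
proof -
  note D = tfrobD[OF M]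
  have "F (c \<odot>\<^bsub>bs M\<^esub> x) = c [^] q \<odot>\<^bsub>bs M\<^esub> F x" if "c \<in> carrier L" "x \<in> carrier M" for c x
    using slinD(3)[OF D(7), of c x] that by simp
  moreover have "F (a \<odot>\<^bsub>M\<^esub> x) = FA a \<odot>\<^bsub>M\<^esub> F x" if "a \<in> carrier A" "x \<in> carrier M" for a x
    using tlinD(3)[OF D(5), of a x] that by simp
  ultimately show ?thesis
    using D(8,9) tlinD(2)[OF D(5)] M by (auto simp: F_stable_def frobenius_map_def tfrob_def)
qed

text \<open>F need not respect the action of \<open>A\<close>. But for bases of \<open>A\<close> and
  M made of fixed vectors there are finitely many products, and a power of F that fixes them all is
  compatible with the action. Hence some twist is isomorphic to M and the period is well
  defined.\<close>

lemma frob_power_tlin: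
  assumes M: "fd_module L A M" and F: "frob (Suc 0) (bs M) F"
  obtains n where "n > 0" "tlin 0 n M M (F ^^ n)"
proof -
  have lm: "left_module A M" and fd: "vectorspace.fin_dim L (bs M)" using M by (auto simp: fd_module_def)
  interpret M: left_module A M by (rule lm)
  note vM = vs_bs[OF lm]
  interpret V: vectorspace L "bs M" by (rule vM)
  obtain BA where BA: "finite BA" "BA \<subseteq> fixpts A FA" "AV.basis BA"
    using fixpts_basis[OF vs_A fin_dim_A FA_frob] by blast
  obtain BM where BM: "finite BM" "BM \<subseteq> fixpts (bs M) F" "V.basis BM"
    using fixpts_basis[OF vM fd F] by blast
  have BAc: "BA \<subseteq> carrier A" "carrier A \<subseteq> AV.span BA" using BA by (auto simp: AV.basis_def)
  have BMc: "BM \<subseteq> carrier (bs M)" "carrier (bs M) \<subseteq> V.span BM" using BM by (auto simp: V.basis_def)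
  have fixA: "(FA ^^ n) a = a" if "a \<in> BA" for a n using FA_fixed[of a n] that BA(2) by (auto simp: fixpts_def)
  have fixM: "(F ^^ n) x = x" if "x \<in> BM" for x n using that BM(2) by (induction n) (auto simp: fixpts_def)
  obtain n where n: "n > 0" "\<And>y. y \<in> (\<lambda>(a, x). a \<odot>\<^bsub>M\<^esub> x) ` (BA \<times> BM) \<Longrightarrow> (F ^^ n) y = y"
  proof (rule frob_common_power[OF F, of "(\<lambda>(a, x). a \<odot>\<^bsub>M\<^esub> x) ` (BA \<times> BM)" 1])
    show "(\<lambda>(a, x). a \<odot>\<^bsub>M\<^esub> x) ` (BA \<times> BM) \<subseteq> carrier (bs M)" using BAc BMc by (auto intro!: M.lm_closed)
  qed (use BA BM in auto)
  have s: "slin n (bs M) (bs M) (F ^^ n)" using slin_funpow[OF vM, of "Suc 0" F n] F by (simp add: frob_def)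
  have step: "(F ^^ n) (a \<odot>\<^bsub>M\<^esub> x) = a \<odot>\<^bsub>M\<^esub> (F ^^ n) x" if a: "a \<in> BA" and x: "x \<in> carrier M" for a x
  proof (rule slin_eq_on_span[OF vM vM BMc, where n = n and u = "\<lambda>x. (F ^^ n) (a \<odot>\<^bsub>M\<^esub> x)" and v = "\<lambda>x. a \<odot>\<^bsub>M\<^esub> (F ^^ n) x" and x = x])
    have aA: "a \<in> carrier A" using a BAc by blast
    show "slin n (bs M) (bs M) (\<lambda>x. (F ^^ n) (a \<odot>\<^bsub>M\<^esub> x))" using slin_comp[OF left_mult_slin(1)[OF lm aA] s] by simp
    show "slin n (bs M) (bs M) (\<lambda>x. a \<odot>\<^bsub>M\<^esub> (F ^^ n) x)" using slin_comp[OF s left_mult_slin(1)[OF lm aA]] by simp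
    show "(F ^^ n) (a \<odot>\<^bsub>M\<^esub> b) = a \<odot>\<^bsub>M\<^esub> (F ^^ n) b" if "b \<in> BM" for b using n(2)[of "a \<odot>\<^bsub>M\<^esub> b"] a that fixM by auto
  qed (use x in simp)
  have "(F ^^ n) (a \<odot>\<^bsub>M\<^esub> x) = (FA ^^ n) a \<odot>\<^bsub>M\<^esub> (F ^^ n) x" if a: "a \<in> carrier A" and x: "x \<in> carrier M" for a x
  proof (rule slin_eq_on_span[OF vs_A vM BAc, where n = n and u = "\<lambda>a. (F ^^ n) (a \<odot>\<^bsub>M\<^esub> x)" and v = "\<lambda>a. (FA ^^ n) a \<odot>\<^bsub>M\<^esub> (F ^^ n) x" and x = a])
    have Fx: "(F ^^ n) x \<in> carrier M" using slinD(1)[OF s] x by simp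
    show "slin n A (bs M) (\<lambda>a. (F ^^ n) (a \<odot>\<^bsub>M\<^esub> x))" using slin_comp[OF left_mult_slin(2)[OF lm x] s] by simp
    show "slin n A (bs M) (\<lambda>a. (FA ^^ n) a \<odot>\<^bsub>M\<^esub> (F ^^ n) x)" using slin_comp[OF FA_slin left_mult_slin(2)[OF lm Fx]] by simp
    show "(F ^^ n) (b \<odot>\<^bsub>M\<^esub> x) = (FA ^^ n) b \<odot>\<^bsub>M\<^esub> (F ^^ n) x" if "b \<in> BA" for b using step[OF that x] fixA[OF that] by simp
  qed (rule a)
  then have "tlin 0 n M M (F ^^ n)" using slinD[OF s] by (intro tlinI) auto
  then show thesis using that n(1) by blast
qed

text \<open>If c lies in the field with q^(m + 1) elements, then c^(q^(m s)) is a root, since the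
  exponents m s and s add up to a multiple of m + 1.\<close>

lemma frob_root:
  assumes c: "c \<in> carrier L"
  obtains d where "d \<in> carrier L" "d [^] (q ^ s) = c"
proof -
  obtain n where n: "n > 0" "c \<in> fixed n"
    using frob_orbit_scalar[of "{c}"] c by (auto simp: fixed_def)
  then obtain m where m: "n = Suc m" by (cases n) auto
  have "c [^] (q ^ (n * s)) = c" using fixed_mult[OF n(2), of s] by (simp add: fixed_def)
  then have "(c [^] (q ^ (m * s))) [^] (q ^ s) = c" using pow_q_add[OF c, of "m * s" s] by (simp add: m add.commute)
  then show thesis using that[of "c [^] (q ^ (m * s))"] c by simp
qed

abbreviation tw where "tw F s M \<equiv> (twist A FA F ^^ s) M"

lemma tw_simps [simp]:
  "carrier (tw F s M) = carrier M" "zero (tw F s M) = zero M" "add (tw F s M) = add M"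
  by (induction s) (simp_all add: twist_def)

lemma tw_Suc_smult:
  assumes F: "bij_betw F (carrier M) (carrier M)" and a: "a \<in> carrier A" and x: "x \<in> carrier M"
  shows "FA a \<odot>\<^bsub>tw F (Suc s) M\<^esub> F x = F (a \<odot>\<^bsub>tw F s M\<^esub> x)"
proof -
  have "inv_into (carrier A) FA (FA a) = a" using FA_bij[of "Suc 0"] a by (simp add: bij_betw_def)
  moreover have "inv_into (carrier M) F (F x) = x" using F x by (simp add: bij_betw_def)
  ultimately show ?thesis by (simp add: twist_def)
qed

lemma funpow_closed_bij:
  assumes "bij_betw F S S" shows "bij_betw (F ^^ s) S S"
proof (induction s)
  case (Suc s) then show ?case using bij_betw_trans[OF Suc assms] by (simp add: comp_def)
qed (simp add: bij_betw_def)

text \<open>Every element of \<open>A\<close> and of M is of the form displayed here, and for such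
  arguments the inverses in the definition of the twist cancel. The module laws of the twist are
  therefore verified on them.\<close>

lemma tw_smult:
  assumes F: "bij_betw F (carrier M) (carrier M)" and a: "a \<in> carrier A" and x: "x \<in> carrier M"
  shows "(FA ^^ s) a \<odot>\<^bsub>tw F s M\<^esub> (F ^^ s) x = (F ^^ s) (a \<odot>\<^bsub>M\<^esub> x)"
proof (induction s)
  case (Suc s)
  have "(F ^^ s) x \<in> carrier M" using funpow_closed_bij[OF F] x by (auto dest: bij_betwE)
  then show ?case using tw_Suc_smult[OF F FA_closed[OF a, of s], of "(F ^^ s) x" s] Suc by simp
qed simp

lemma tw_left_module:
  assumes M: "left_module A M" and F: "bij_betw F (carrier M) (carrier M)"
    and add: "\<And>x y. \<lbrakk>x \<in> carrier M; y \<in> carrier M\<rbrakk> \<Longrightarrow> F (x \<oplus>\<^bsub>M\<^esub> y) = F x \<oplus>\<^bsub>M\<^esub> F y"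
  shows "left_module A (tw F s M)"
proof -
  interpret M: left_module A M by fact
  have Fs: "bij_betw (F ^^ s) (carrier M) (carrier M)" by (rule funpow_closed_bij[OF F])
  have Fc: "(F ^^ s) x \<in> carrier M" if "x \<in> carrier M" for x using Fs that by (auto dest: bij_betwE)
  have adds: "(F ^^ s) (x \<oplus>\<^bsub>M\<^esub> y) = (F ^^ s) x \<oplus>\<^bsub>M\<^esub> (F ^^ s) y" if "x \<in> carrier M" "y \<in> carrier M" for x y
  proof (induction s)
    case (Suc s)
    have "(F ^^ s) z \<in> carrier M" if "z \<in> carrier M" for z using funpow_closed_bij[OF F] that by (auto dest: bij_betwE)
    then show ?case using Suc add that by simp
  qed simp
  have obt: "\<exists>y\<in>carrier M. x = (F ^^ s) y" if "x \<in> carrier M" for x using Fs that unfolding bij_betw_def by (metis imageE)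
  have obtA: "\<exists>b\<in>carrier A. a = (FA ^^ s) b" if "a \<in> carrier A" for a using FA_surj[OF that, of s] by metis
  note tws = tw_smult[OF F]
  have "abelian_group (tw F s M)"
  proof (rule abelian_groupI)
    fix x assume "x \<in> carrier (tw F s M)"
    then show "\<exists>y\<in>carrier (tw F s M). y \<oplus>\<^bsub>tw F s M\<^esub> x = \<zero>\<^bsub>tw F s M\<^esub>"
      by (auto intro!: bexI[of _ "\<ominus>\<^bsub>M\<^esub> x"] simp: M.M.l_neg)
  qed (auto simp: M.M.a_ac)
  moreover have "left_module_axioms A (tw F s M)"
  proof unfold_locales
    fix a x assume "a \<in> carrier A" "x \<in> carrier (tw F s M)"
    then obtain b y where bb: "b \<in> carrier A" "a = (FA ^^ s) b" "y \<in> carrier M" "x = (F ^^ s) y" using obt obtA by (metis tw_simps(1))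
    then show "a \<odot>\<^bsub>tw F s M\<^esub> x \<in> carrier (tw F s M)" by (simp add: tws Fc M.lm_closed)
  next
    fix a a' x assume c: "a \<in> carrier A" "a' \<in> carrier A" "x \<in> carrier (tw F s M)"
    obtain b b' y where bb: "b \<in> carrier A" "a = (FA ^^ s) b" "b' \<in> carrier A" "a' = (FA ^^ s) b'"
      "y \<in> carrier M" "x = (F ^^ s) y" using c obt obtA by (metis tw_simps(1))
    then show "(a \<oplus>\<^bsub>A\<^esub> a') \<odot>\<^bsub>tw F s M\<^esub> x = a \<odot>\<^bsub>tw F s M\<^esub> x \<oplus>\<^bsub>tw F s M\<^esub> a' \<odot>\<^bsub>tw F s M\<^esub> x"
      "(a \<otimes>\<^bsub>A\<^esub> a') \<odot>\<^bsub>tw F s M\<^esub> x = a \<odot>\<^bsub>tw F s M\<^esub> (a' \<odot>\<^bsub>tw F s M\<^esub> x)"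
      using slinD(2)[OF FA_slin, of b b' s] tws[of "b \<oplus>\<^bsub>A\<^esub> b'" y s] tws[of "b \<otimes>\<^bsub>A\<^esub> b'" y s] FA_mult[of b b' s]
      by (simp_all add: tws adds M.lm_l_distr M.lm_assoc M.lm_closed)
  next
    fix a x x' assume c: "a \<in> carrier A" "x \<in> carrier (tw F s M)" "x' \<in> carrier (tw F s M)"
    obtain b y y' where bb: "b \<in> carrier A" "a = (FA ^^ s) b"
      "y \<in> carrier M" "x = (F ^^ s) y" "y' \<in> carrier M" "x' = (F ^^ s) y'" using c obt obtA by (metis tw_simps(1))
    then show "a \<odot>\<^bsub>tw F s M\<^esub> (x \<oplus>\<^bsub>tw F s M\<^esub> x') = a \<odot>\<^bsub>tw F s M\<^esub> x \<oplus>\<^bsub>tw F s M\<^esub> a \<odot>\<^bsub>tw F s M\<^esub> x'"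
      using tws[of b "y \<oplus>\<^bsub>M\<^esub> y'" s] by (simp add: tws adds M.lm_r_distr M.lm_closed)
  next
    fix x assume "x \<in> carrier (tw F s M)"
    then obtain y where "y \<in> carrier M" "x = (F ^^ s) y" using obt by auto
    then show "\<one>\<^bsub>A\<^esub> \<odot>\<^bsub>tw F s M\<^esub> x = x" using tws[of "\<one>\<^bsub>A\<^esub>" y s] by (simp add: FA_one M.lm_one)
  qed
  ultimately show ?thesis by (simp add: left_module_def ring_A)
qed

text \<open>Write c as the power q^s of d. Raising coefficients to this power under
  \<open>FA ^^ s\<close> and under \<open>F ^^ s\<close> cancels out, so the twist affects the
  action of \<open>A\<close> but not the underlying space.\<close>

lemma tw_scalar:
  assumes M: "left_module A M" and F: "frob (Suc 0) (bs M) F"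
    and c: "c \<in> carrier L" and x: "x \<in> carrier M"
  shows "c \<odot>\<^bsub>bs (tw F s M)\<^esub> x = c \<odot>\<^bsub>bs M\<^esub> x"
proof -
  note vM = vs_bs[OF M]
  have Fb: "bij_betw F (carrier M) (carrier M)" using frob_bij[OF vM F] by simp
  have sl: "slin s (bs M) (bs M) (F ^^ s)" using slin_funpow[OF vM, of "Suc 0" F s] F by (simp add: frob_def)
  obtain d where d: "d \<in> carrier L" "d [^] (q ^ s) = c" using frob_root[OF c] .
  obtain y where y: "y \<in> carrier M" "x = (F ^^ s) y"
    using funpow_closed_bij[OF Fb, of s] x unfolding bij_betw_def by (metis imageE)
  have "c \<odot>\<^bsub>bs (tw F s M)\<^esub> x = (FA ^^ s) (d \<odot>\<^bsub>A\<^esub> \<one>\<^bsub>A\<^esub>) \<odot>\<^bsub>tw F s M\<^esub> (F ^^ s) y"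
    using FA_scalar[OF d(1), of s] d y by (simp add: base_space_simps(4))
  also have "\<dots> = (F ^^ s) (d \<odot>\<^bsub>bs M\<^esub> y)" using tw_smult[OF Fb, of "d \<odot>\<^bsub>A\<^esub> \<one>\<^bsub>A\<^esub>" y s] d y by (simp add: base_space_simps(4))
  also have "\<dots> = c \<odot>\<^bsub>bs M\<^esub> x" using slinD(3)[OF sl d(1), of y] d y by simp
  finally show ?thesis .
qed

lemma tw_fd_module:
  assumes M: "fd_module L A M" and F: "frob (Suc 0) (bs M) F"
  shows "fd_module L A (tw F s M)"
proof -
  have lm: "left_module A M" and fd: "vectorspace.fin_dim L (bs M)" using M by (auto simp: fd_module_def)
  note vM = vs_bs[OF lm]
  have Fb: "bij_betw F (carrier M) (carrier M)" using frob_bij[OF vM F] by simp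
  have lt: "left_module A (tw F s M)"
    by (rule tw_left_module[OF lm Fb]) (use F in \<open>auto simp: frob_def slin_def\<close>)
  interpret V: vectorspace L "bs M" by (rule vM)
  interpret W: vectorspace L "bs (tw F s M)" by (rule vs_bs[OF lt])
  have "(\<lambda>x. x) \<in> module_hom L (bs M) (bs (tw F s M))"
    by (rule module_homI) (use tw_scalar[OF lm F] in auto)
  then interpret E: linear_map L "bs M" "bs (tw F s M)" "\<lambda>x. x" by unfold_locales
  have "W.fin_dim" by (rule E.surj_fin_dim[OF fd]) simp
  then show ?thesis using lt by (simp add: fd_module_def)
qed

lemma funpow_frob:
  assumes M: "left_module A M" and F: "frob (Suc 0) (bs M) F"
  shows "bij_betw (F ^^ s) (carrier M) (carrier M)"
    "x \<in> carrier M \<Longrightarrow> (F ^^ s) x \<in> carrier M"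
    "\<lbrakk>x \<in> carrier M; y \<in> carrier M\<rbrakk> \<Longrightarrow> (F ^^ s) (x \<oplus>\<^bsub>M\<^esub> y) = (F ^^ s) x \<oplus>\<^bsub>M\<^esub> (F ^^ s) y"
    "\<lbrakk>a \<in> carrier A; x \<in> carrier M\<rbrakk> \<Longrightarrow> (FA ^^ s) a \<odot>\<^bsub>tw F s M\<^esub> (F ^^ s) x = (F ^^ s) (a \<odot>\<^bsub>M\<^esub> x)"
proof -
  note vM = vs_bs[OF M]
  have Fb: "bij_betw F (carrier M) (carrier M)" using frob_bij[OF vM F] by simp
  then show "bij_betw (F ^^ s) (carrier M) (carrier M)" by (rule funpow_closed_bij)
  have sl: "slin s (bs M) (bs M) (F ^^ s)" using slin_funpow[OF vM, of "Suc 0" F s] F by (simp add: frob_def)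
  then show "x \<in> carrier M \<Longrightarrow> (F ^^ s) x \<in> carrier M"
    "\<lbrakk>x \<in> carrier M; y \<in> carrier M\<rbrakk> \<Longrightarrow> (F ^^ s) (x \<oplus>\<^bsub>M\<^esub> y) = (F ^^ s) x \<oplus>\<^bsub>M\<^esub> (F ^^ s) y"
    using slinD[OF sl] by simp_all
  show "\<lbrakk>a \<in> carrier A; x \<in> carrier M\<rbrakk> \<Longrightarrow> (FA ^^ s) a \<odot>\<^bsub>tw F s M\<^esub> (F ^^ s) x = (F ^^ s) (a \<odot>\<^bsub>M\<^esub> x)"
    by (rule tw_smult[OF Fb])
qed

lemma inv_funpow_frob:
  fixes s :: nat
  assumes M: "left_module A M" and F: "frob (Suc 0) (bs M) F"
  defines "G \<equiv> inv_into (carrier M) (F ^^ s)"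
  shows "x \<in> carrier M \<Longrightarrow> G x \<in> carrier M" "x \<in> carrier M \<Longrightarrow> (F ^^ s) (G x) = x" "x \<in> carrier M \<Longrightarrow> G ((F ^^ s) x) = x"
    "\<lbrakk>x \<in> carrier M; y \<in> carrier M\<rbrakk> \<Longrightarrow> G (x \<oplus>\<^bsub>M\<^esub> y) = G x \<oplus>\<^bsub>M\<^esub> G y"
    "\<lbrakk>a \<in> carrier A; x \<in> carrier M\<rbrakk> \<Longrightarrow> G ((FA ^^ s) a \<odot>\<^bsub>tw F s M\<^esub> x) = a \<odot>\<^bsub>M\<^esub> G x"
proof -
  interpret M: left_module A M by fact
  note bij = funpow_frob(1)[OF M F, of s]
  show ic: "G x \<in> carrier M" "(F ^^ s) (G x) = x" if "x \<in> carrier M" for x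
    using bij that unfolding G_def by (auto simp: bij_betw_def inv_into_into f_inv_into_f)
  show ii: "G ((F ^^ s) x) = x" if "x \<in> carrier M" for x using bij that by (simp add: bij_betw_def G_def)
  show "\<lbrakk>x \<in> carrier M; y \<in> carrier M\<rbrakk> \<Longrightarrow> G (x \<oplus>\<^bsub>M\<^esub> y) = G x \<oplus>\<^bsub>M\<^esub> G y"
    using ii[of "G x \<oplus>\<^bsub>M\<^esub> G y"] funpow_frob(3)[OF M F, of "G x" "G y" s] ic by simp
  show "\<lbrakk>a \<in> carrier A; x \<in> carrier M\<rbrakk> \<Longrightarrow> G ((FA ^^ s) a \<odot>\<^bsub>tw F s M\<^esub> x) = a \<odot>\<^bsub>M\<^esub> G x"
    using funpow_frob(4)[OF M F, of a "G x" s] ic ii[of "a \<odot>\<^bsub>M\<^esub> G x"] M.lm_closed by simp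
qed

text \<open>The dictionary between twists and degrees: composition with \<open>F ^^ s\<close> or its
  inverse converts homomorphisms out of or into the s-th twist into twisted maps of M itself, here
  and in the next two lemmas.\<close>

lemma tw_hom_tlin:
  assumes M: "left_module A M" and F: "frob (Suc 0) (bs M) F" and e: "e \<in> module_hom A (tw F s M) N"
  shows "tlin 0 s M N (\<lambda>x. e ((F ^^ s) x))"
proof (rule tlinI)
  note f = funpow_frob[OF M F, where s = s]
  fix x assume x: "x \<in> carrier M" 
  show "e ((F ^^ s) x) \<in> carrier N" using module_homD(1)[OF e] f(2) x by simp
  show "e ((F ^^ s) (x \<oplus>\<^bsub>M\<^esub> y)) = e ((F ^^ s) x) \<oplus>\<^bsub>N\<^esub> e ((F ^^ s) y)" if "y \<in> carrier M" for y
    using module_homD(2)[OF e] f(2,3) x that by simp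
  show "e ((F ^^ s) ((FA ^^ 0) a \<odot>\<^bsub>M\<^esub> x)) = (FA ^^ s) a \<odot>\<^bsub>N\<^esub> e ((F ^^ s) x)" if "a \<in> carrier A" for a
    using module_homD(3)[OF e, of "(FA ^^ s) a" "(F ^^ s) x"] f(2)[OF x] f(4)[OF that x] FA_closed[OF that] by simp
qed

lemma tlin_tw_hom:
  assumes M: "left_module A M" and F: "frob (Suc 0) (bs M) F" and u: "tlin 0 s M N u"
  shows "(\<lambda>x. u (inv_into (carrier M) (F ^^ s) x)) \<in> module_hom A (tw F s M) N"
proof (rule module_homI)
  note f = inv_funpow_frob[OF M F, where s = s]
  fix x assume "x \<in> carrier (tw F s M)"
  then have x: "x \<in> carrier M" by simp
  show "u (inv_into (carrier M) (F ^^ s) x) \<in> carrier N" using tlinD(1)[OF u f(1)[OF x]] .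
  show "u (inv_into (carrier M) (F ^^ s) (x \<oplus>\<^bsub>tw F s M\<^esub> y)) = u (inv_into (carrier M) (F ^^ s) x) \<oplus>\<^bsub>N\<^esub> u (inv_into (carrier M) (F ^^ s) y)"
    if "y \<in> carrier (tw F s M)" for y using tlinD(2)[OF u] f(1,4) x that by simp
  show "u (inv_into (carrier M) (F ^^ s) (a \<odot>\<^bsub>tw F s M\<^esub> x)) = a \<odot>\<^bsub>N\<^esub> u (inv_into (carrier M) (F ^^ s) x)" if a: "a \<in> carrier A" for a
  proof -
    obtain b where b: "b \<in> carrier A" "(FA ^^ s) b = a" using FA_surj[OF a] by blast
    show ?thesis using tlinD(3)[OF u b(1) f(1)[OF x]] f(5)[OF b(1) x] b by simp
  qed
qed

lemma hom_tw_tlin: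
  assumes M: "left_module A M" and F: "frob (Suc 0) (bs M) F" and e: "e \<in> module_hom A N (tw F s M)"
  shows "tlin s 0 N M (\<lambda>x. inv_into (carrier M) (F ^^ s) (e x))"
proof (rule tlinI)
  note f = inv_funpow_frob[OF M F, where s = s]
  have ec: "e x \<in> carrier M" if "x \<in> carrier N" for x using module_homD(1)[OF e that] by simp
  fix x assume x: "x \<in> carrier N"
  show "inv_into (carrier M) (F ^^ s) (e x) \<in> carrier M" by (rule f(1)[OF ec[OF x]])
  show "inv_into (carrier M) (F ^^ s) (e (x \<oplus>\<^bsub>N\<^esub> y)) = inv_into (carrier M) (F ^^ s) (e x) \<oplus>\<^bsub>M\<^esub> inv_into (carrier M) (F ^^ s) (e y)"
    if "y \<in> carrier N" for y using module_homD(2)[OF e x that] f(4) ec x that by simp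
  show "inv_into (carrier M) (F ^^ s) (e ((FA ^^ s) a \<odot>\<^bsub>N\<^esub> x)) = (FA ^^ 0) a \<odot>\<^bsub>M\<^esub> inv_into (carrier M) (F ^^ s) (e x)" if "a \<in> carrier A" for a
    using module_homD(3)[OF e FA_closed[OF that] x] f(5)[OF that ec[OF x]] by simp
qed

text \<open>The right-hand side does not mention F, so the period is independent of the Frobenius
  map chosen on M.\<close>

lemma module_iso_tw_iff:
  assumes M: "left_module A M" and F: "frob (Suc 0) (bs M) F"
  shows "module_iso A (tw F s M) M \<noteq> {} \<longleftrightarrow> (\<exists>u. tlin 0 s M M u \<and> bij_betw u (carrier M) (carrier M))"
proof -
  have Fs: "bij_betw (F ^^ s) (carrier M) (carrier M)" by (rule funpow_frob[OF M F])
  show ?thesis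
  proof
    assume "module_iso A (tw F s M) M \<noteq> {}"
    then obtain e where "e \<in> module_hom A (tw F s M) M" "bij_betw e (carrier M) (carrier M)" by (auto simp: module_iso_def)
    then show "\<exists>u. tlin 0 s M M u \<and> bij_betw u (carrier M) (carrier M)"
      using tw_hom_tlin[OF M F] bij_betw_trans[OF Fs] unfolding comp_def by blast
  next
    assume "\<exists>u. tlin 0 s M M u \<and> bij_betw u (carrier M) (carrier M)"
    then obtain u where u: "tlin 0 s M M u" "bij_betw u (carrier M) (carrier M)" by blast
    have "(\<lambda>x. u (inv_into (carrier M) (F ^^ s) x)) \<in> module_iso A (tw F s M) M"
      using tlin_tw_hom[OF M F u(1)] bij_betw_trans[OF bij_betw_inv_into[OF Fs] u(2)] by (simp add: comp_def module_iso_def)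
    then show "module_iso A (tw F s M) M \<noteq> {}" by blast
  qed
qed

text \<open>The least exponent exists by \<open>frob_power_tlin\<close>. The bijection found for it
  has finite orbits by \<open>slin_inj_frob\<close>, and leastness is the aperiodicity.\<close>

lemma period_semilinear:
  assumes M: "fd_module L A M" and F: "frob (Suc 0) (bs M) F"
  obtains \<theta> where "tfrob (period A FA F M) M \<theta>" "aperiodic (period A FA F M) M"
proof -
  have lm: "left_module A M" and fd: "vectorspace.fin_dim L (bs M)" using M by (auto simp: fd_module_def)
  note vM = vs_bs[OF lm]
  have Fb: "bij_betw F (carrier M) (carrier M)" using frob_bij[OF vM F] by simp
  note iff = module_iso_tw_iff[OF lm F]
  define r where "r = period A FA F M"
  have r: "r = (LEAST r. 1 \<le> r \<and> (\<exists>u. tlin 0 r M M u \<and> bij_betw u (carrier M) (carrier M)))"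
    unfolding r_def period_def iff ..
  obtain n where "n > 0" "tlin 0 n M M (F ^^ n)" using frob_power_tlin[OF M F] .
  then have "1 \<le> n \<and> (\<exists>u. tlin 0 n M M u \<and> bij_betw u (carrier M) (carrier M))"
    using funpow_closed_bij[OF Fb, of n] by auto
  then have "1 \<le> r \<and> (\<exists>u. tlin 0 r M M u \<and> bij_betw u (carrier M) (carrier M))"
    unfolding r by (rule LeastI)
  then obtain u where u: "1 \<le> r" "tlin 0 r M M u" "bij_betw u (carrier M) (carrier M)" by blast
  have "slin r (bs M) (bs M) u" by (rule tlin_slin[OF u(2) lm])
  then have "frob r (bs M) u" using slin_inj_frob[OF vM fd F, of r u] u(3) by (simp add: bij_betw_def)
  then have "tfrob r M u" using M u by (simp add: tfrob_def frob_def)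
  moreover have "aperiodic r M"
    unfolding aperiodic_def
  proof (intro allI impI notI)
    fix j u assume j: "0 < j \<and> j < r \<and> tlin 0 j M M u" and b: "bij_betw u (carrier M) (carrier M)"
    have "\<not> (1 \<le> j \<and> (\<exists>u. tlin 0 j M M u \<and> bij_betw u (carrier M) (carrier M)))"
      using j unfolding r by (intro not_less_Least) simp
    then show False using j b by auto
  qed
  ultimately show thesis using that by (simp add: r_def)
qed


text \<open>The normal form needed for the sum of twists: a copy of the module on the same space in
  which \<open>\<theta>\<close> has become the power \<open>F ^^ r\<close> of the prescribed
  Frobenius map. That \<open>F ^^ r\<close> is compatible with \<open>A\<close> is the condition
  that the r-th twist of the copy is the copy itself.\<close>

definition frame where
  "frame r M \<theta> F M' \<beta> \<longleftrightarrow> tfrob r M \<theta> \<and> periodic_replacement L A FA r F M M' \<beta> \<and> tfrob r M' (F ^^ r) \<and>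
     frob (Suc 0) (bs M') F \<and> (\<forall>x\<in>carrier M. \<beta> (\<theta> x) = (F ^^ r) (\<beta> x)) \<and> carrier M' = carrier M"

text \<open>On the underlying space, \<open>\<theta>\<close> and \<open>F ^^ r\<close> are Frobenius
  maps of the same degree, so by \<open>frob_conjugate\<close> a linear automorphism
  \<open>\<beta>\<close> carries one into the other.\<close>

lemma frame_exists:
  assumes M: "tfrob r M \<theta>" and F: "frob (Suc 0) (bs M) F"
  obtains M' \<beta> where "frame r M \<theta> F M' \<beta>"
proof -
  note D = tfrobD[OF M]
  interpret M: left_module A M by (rule D(1))
  have Fr: "frob r (bs M) (F ^^ r)" using frob_funpow[OF D(2) F D(4)] by simp
  obtain \<beta> where \<beta>: "slin 0 (bs M) (bs M) \<beta>" "bij_betw \<beta> (carrier M) (carrier M)"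
    "\<And>x. x \<in> carrier M \<Longrightarrow> \<beta> (\<theta> x) = (F ^^ r) (\<beta> x)"
    using frob_conjugate[OF D(2,3,6) Fr D(4)] by auto
  define \<beta>' where "\<beta>' = inv_into (carrier M) \<beta>"
  \<comment> \<open>The action of \<open>A\<close> is transported along \<open>\<beta>\<close>,
    while addition and scalars stay as they are because \<open>\<beta>\<close> is linear.\<close>
  define M' where "M' = M\<lparr>smult := (\<lambda>a x. \<beta> (a \<odot>\<^bsub>M\<^esub> \<beta>' x))\<rparr>"
  have M'_simps [simp]: "carrier M' = carrier M" "zero M' = zero M" "add M' = add M" "a \<odot>\<^bsub>M'\<^esub> x = \<beta> (a \<odot>\<^bsub>M\<^esub> \<beta>' x)" for a x
    by (simp_all add: M'_def)
  have b: "\<beta> x \<in> carrier M" "\<beta>' x \<in> carrier M" "\<beta>' (\<beta> x) = x" "\<beta> (\<beta>' x) = x" if "x \<in> carrier M" for x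
    using \<beta>(2) that unfolding \<beta>'_def by (auto simp: bij_betw_def f_inv_into_f inv_into_into)
  have badd: "\<beta> (x \<oplus>\<^bsub>M\<^esub> y) = \<beta> x \<oplus>\<^bsub>M\<^esub> \<beta> y" if "x \<in> carrier M" "y \<in> carrier M" for x y
    using slinD(2)[OF \<beta>(1)] that by simp
  have bz: "\<beta> \<zero>\<^bsub>M\<^esub> = \<zero>\<^bsub>M\<^esub>" using slin_zero[OF D(2) D(2) \<beta>(1)] by simp
  have lm: "left_module A M'"
    by (rule left_module_transport[OF D(1), of \<beta>]) (use \<beta>(2) badd bz b in auto)
  have sm: "c \<odot>\<^bsub>bs M'\<^esub> x = c \<odot>\<^bsub>bs M\<^esub> x" if "c \<in> carrier L" "x \<in> carrier M" for c x
    using slinD(3)[OF \<beta>(1) that(1), of "\<beta>' x"] b that by (simp add: base_space_simps(4))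
  have iso: "\<beta> \<in> module_iso A M M'" unfolding module_iso_def
    by (intro CollectI conjI module_homI) (use badd b \<beta>(2) in simp_all)
  have "linear_map L (bs M) (bs M') (\<lambda>x. x)"
    using vs_bs[OF lm] D(2) sm by (auto simp: linear_map_def mod_hom_def mod_hom_axioms_def vectorspace_def intro!: module_homI)
  then interpret E: linear_map L "bs M" "bs M'" "\<lambda>x. x" .
  have fd: "fd_module L A M'" using lm E.surj_fin_dim[OF D(3)] by (simp add: fd_module_def)
  have "slin (Suc 0) (bs M) (bs M) F" using F by (simp add: frob_def)
  note sF = slinD[OF this]
  have "slin (Suc 0) (bs M') (bs M') F"
    unfolding slin_def
  proof (intro conjI ballI)
    fix c x assume c: "c \<in> carrier L" and "x \<in> carrier (bs M')"
    then have x: "x \<in> carrier M" by simp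
    have "F x \<in> carrier M" using sF(1)[of x] x by simp
    then show "F (c \<odot>\<^bsub>bs M'\<^esub> x) = c [^] (q ^ Suc 0) \<odot>\<^bsub>bs M'\<^esub> F x"
      using sF(3)[OF c, of x] x by (simp only: sm[OF c x] sm[OF nat_pow_closed[OF c] \<open>F x \<in> carrier M\<close>] base_space_simps(1))
  qed (use sF(1,2) in auto)
  then have F': "frob (Suc 0) (bs M') F" using F by (simp add: frob_def)
  have Frc: "(F ^^ r) x \<in> carrier M" if "x \<in> carrier M" for x
    using slinD(1)[of r "bs M" "bs M" "F ^^ r"] Fr that by (simp add: frob_def)
  have tl: "tlin 0 r M' M' (F ^^ r)"
  proof (rule tlinI)
    fix a x assume a: "a \<in> carrier A" and "x \<in> carrier M'"
    then have x: "x \<in> carrier M" by simp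
    have e: "\<beta>' ((F ^^ r) x) = \<theta> (\<beta>' x)" using \<beta>(3)[OF b(2)[OF x]] b(3)[OF tlinD(1)[OF D(5) b(2)[OF x]]] b(4)[OF x] by simp
    show "(F ^^ r) ((FA ^^ 0) a \<odot>\<^bsub>M'\<^esub> x) = (FA ^^ r) a \<odot>\<^bsub>M'\<^esub> (F ^^ r) x"
      using \<beta>(3)[OF M.lm_closed[OF a b(2)[OF x]]] tlinD(3)[OF D(5) a b(2)[OF x]] by (simp add: e)
  next
    fix x y assume "x \<in> carrier M'" "y \<in> carrier M'"
    then show "(F ^^ r) (x \<oplus>\<^bsub>M'\<^esub> y) = (F ^^ r) x \<oplus>\<^bsub>M'\<^esub> (F ^^ r) y"
      using slinD(2)[of r "bs M" "bs M" "F ^^ r"] Fr by (simp add: frob_def)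
  qed (simp add: Frc)
  have tf: "tfrob r M' (F ^^ r)" using fd D(4) tl Fr by (simp add: tfrob_def frob_def)
  have Fb: "bij_betw F (carrier M') (carrier M')" using frob_bij[OF D(2) F] by simp
  have "a \<odot>\<^bsub>tw F r M'\<^esub> x = a \<odot>\<^bsub>M'\<^esub> x" if a: "a \<in> carrier A" and x: "x \<in> carrier M" for a x
  proof -
    obtain c where c: "c \<in> carrier A" "(FA ^^ r) c = a" using FA_surj[OF a] by blast
    obtain y where y: "y \<in> carrier M" "x = (F ^^ r) y"
      using funpow_closed_bij[OF Fb, of r] x unfolding bij_betw_def by (metis M'_simps(1) imageE)
    show ?thesis using tw_smult[OF Fb c(1), of y r] tlinD(3)[OF tl c(1), of y] y c by simp
  qed
  then have "same_module A (tw F r M') M'" by (simp add: same_module_def)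
  then have "periodic_replacement L A FA r F M M' \<beta>"
    using lm sm iso by (simp add: periodic_replacement_def)
  then have "frame r M \<theta> F M' \<beta>" using M tf F' \<beta>(3) by (simp add: frame_def)
  then show thesis by (rule that)
qed

section \<open>Sums of twists and their fixed points\<close>

lemma cyclic_frobenius_funpow:
  assumes "r > 0" "i < r"
  shows "(cyclic_frobenius r F ^^ j) \<xi> ((i + j) mod r) = (F ^^ j) (\<xi> i)"
proof (induction j)
  case (Suc j)
  have "(if (i + Suc j) mod r = 0 then r - 1 else (i + Suc j) mod r - 1) = (i + j) mod r"
    using assms by (auto simp: mod_Suc)
  moreover have "(i + Suc j) mod r < r" using assms by simp
  ultimately have "cyclic_frobenius r F \<zeta> ((i + Suc j) mod r) = F (\<zeta> ((i + j) mod r))" for \<zeta>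
    unfolding cyclic_frobenius_def by (simp only: lessThan_iff restrict_apply if_True)
  then show ?case using Suc by (simp del: add_Suc_right)
qed (use assms in simp)

lemma twist_sum_simps [simp]:
  "carrier (twist_sum A FA r F M) = (\<Pi>\<^sub>E i\<in>{..<r}. carrier M)"
  "i < r \<Longrightarrow> (\<xi> \<oplus>\<^bsub>twist_sum A FA r F M\<^esub> \<zeta>) i = \<xi> i \<oplus>\<^bsub>M\<^esub> \<zeta> i"
  "i < r \<Longrightarrow> \<zero>\<^bsub>twist_sum A FA r F M\<^esub> i = \<zero>\<^bsub>M\<^esub>"
  "i < r \<Longrightarrow> (a \<odot>\<^bsub>twist_sum A FA r F M\<^esub> \<xi>) i = a \<odot>\<^bsub>tw F i M\<^esub> \<xi> i"
  by (simp_all add: twist_sum_def)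

lemma twist_sum_closed:
  assumes "left_module A M"
  shows "\<lbrakk>\<xi> \<in> (\<Pi>\<^sub>E i\<in>{..<r}. carrier M); \<zeta> \<in> (\<Pi>\<^sub>E i\<in>{..<r}. carrier M)\<rbrakk> \<Longrightarrow> \<xi> \<oplus>\<^bsub>twist_sum A FA r F M\<^esub> \<zeta> \<in> (\<Pi>\<^sub>E i\<in>{..<r}. carrier M)"
    "\<zero>\<^bsub>twist_sum A FA r F M\<^esub> \<in> (\<Pi>\<^sub>E i\<in>{..<r}. carrier M)"
proof -
  interpret M: left_module A M by fact
  show "\<lbrakk>\<xi> \<in> (\<Pi>\<^sub>E i\<in>{..<r}. carrier M); \<zeta> \<in> (\<Pi>\<^sub>E i\<in>{..<r}. carrier M)\<rbrakk> \<Longrightarrow> \<xi> \<oplus>\<^bsub>twist_sum A FA r F M\<^esub> \<zeta> \<in> (\<Pi>\<^sub>E i\<in>{..<r}. carrier M)"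
    "\<zero>\<^bsub>twist_sum A FA r F M\<^esub> \<in> (\<Pi>\<^sub>E i\<in>{..<r}. carrier M)"
    by (auto simp: twist_sum_def PiE_iff)
qed

lemma twist_sum_left_module:
  assumes M: "left_module A M" and F: "bij_betw F (carrier M) (carrier M)"
    and add: "\<And>x y. \<lbrakk>x \<in> carrier M; y \<in> carrier M\<rbrakk> \<Longrightarrow> F (x \<oplus>\<^bsub>M\<^esub> y) = F x \<oplus>\<^bsub>M\<^esub> F y"
  shows "left_module A (twist_sum A FA r F M)" (is "left_module A ?S")
proof -
  interpret M: left_module A M by fact
  note lt = tw_left_module[OF M F add]
  have ext: "\<xi> = \<zeta>" if "\<xi> \<in> carrier ?S" "\<zeta> \<in> carrier ?S" "\<And>i. i < r \<Longrightarrow> \<xi> i = \<zeta> i" for \<xi> \<zeta>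
    using that PiE_ext[of \<xi> "{..<r}" "\<lambda>_. carrier M" \<zeta>] by auto
  note cl = twist_sum_closed[OF M, where r = r and F = F]
  have sc: "a \<odot>\<^bsub>?S\<^esub> \<xi> \<in> carrier ?S" if "a \<in> carrier A" "\<xi> \<in> carrier ?S" for a \<xi>
    using that left_module.lm_closed[OF lt, of a] by (auto simp: twist_sum_def PiE_iff)
  have c: "\<xi> i \<in> carrier M" if "\<xi> \<in> carrier ?S" "i < r" for \<xi> i using that by auto
  have "abelian_group ?S"
  proof (rule abelian_groupI)
    fix \<xi> assume x: "\<xi> \<in> carrier ?S"
    let ?n = "\<lambda>i\<in>{..<r}. \<ominus>\<^bsub>M\<^esub> \<xi> i"
    have n: "?n \<in> carrier ?S" using c[OF x] by auto
    have "?n \<oplus>\<^bsub>?S\<^esub> \<xi> = \<zero>\<^bsub>?S\<^esub>" by (rule ext) (use cl n x c[OF x] in \<open>auto simp: M.M.l_neg\<close>)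
    then show "\<exists>y\<in>carrier ?S. y \<oplus>\<^bsub>?S\<^esub> \<xi> = \<zero>\<^bsub>?S\<^esub>" using n by blast
  next
    fix x y z assume xyz: "x \<in> carrier ?S" "y \<in> carrier ?S" "z \<in> carrier ?S"
    show "x \<oplus>\<^bsub>?S\<^esub> y \<oplus>\<^bsub>?S\<^esub> z = x \<oplus>\<^bsub>?S\<^esub> (y \<oplus>\<^bsub>?S\<^esub> z)"
      by (rule ext) (use cl xyz c[OF xyz(1)] c[OF xyz(2)] c[OF xyz(3)] in \<open>auto simp: M.M.a_assoc\<close>)
    show "x \<oplus>\<^bsub>?S\<^esub> y = y \<oplus>\<^bsub>?S\<^esub> x"
      by (rule ext) (use cl xyz c[OF xyz(1)] c[OF xyz(2)] in \<open>auto simp: M.M.a_comm\<close>)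
    show "\<zero>\<^bsub>?S\<^esub> \<oplus>\<^bsub>?S\<^esub> x = x"
      by (rule ext) (use cl xyz c[OF xyz(1)] in auto)
  qed (use cl in auto)
  moreover have "left_module_axioms A ?S"
  proof unfold_locales
    fix a b x assume ab: "a \<in> carrier A" "b \<in> carrier A" and x: "x \<in> carrier ?S"
    note m = sc ab x c[OF x] left_module.lm_l_distr[OF lt, of a b] left_module.lm_assoc[OF lt, of a b]
    show "(a \<oplus>\<^bsub>A\<^esub> b) \<odot>\<^bsub>?S\<^esub> x = a \<odot>\<^bsub>?S\<^esub> x \<oplus>\<^bsub>?S\<^esub> b \<odot>\<^bsub>?S\<^esub> x"
      by (rule ext) (use m sc[OF ab(1) x] sc[OF ab(2) x] sc[OF A.a_closed[OF ab] x] cl in simp_all)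
    show "(a \<otimes>\<^bsub>A\<^esub> b) \<odot>\<^bsub>?S\<^esub> x = a \<odot>\<^bsub>?S\<^esub> (b \<odot>\<^bsub>?S\<^esub> x)"
      by (rule ext) (use m sc[OF ab(1) sc[OF ab(2) x]] sc[OF A.m_closed[OF ab] x] in simp_all)
  next
    fix a x y assume a: "a \<in> carrier A" and xy: "x \<in> carrier ?S" "y \<in> carrier ?S"
    have xy': "x \<oplus>\<^bsub>?S\<^esub> y \<in> carrier ?S" using cl xy by simp
    have "a \<odot>\<^bsub>?S\<^esub> x \<oplus>\<^bsub>?S\<^esub> a \<odot>\<^bsub>?S\<^esub> y \<in> carrier ?S" using cl(1)[of "a \<odot>\<^bsub>?S\<^esub> x" "a \<odot>\<^bsub>?S\<^esub> y"] sc[OF a xy(1)] sc[OF a xy(2)] by simp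
    then show "a \<odot>\<^bsub>?S\<^esub> (x \<oplus>\<^bsub>?S\<^esub> y) = a \<odot>\<^bsub>?S\<^esub> x \<oplus>\<^bsub>?S\<^esub> a \<odot>\<^bsub>?S\<^esub> y"
      by (intro ext sc[OF a xy']) (use c[OF xy(1)] c[OF xy(2)] left_module.lm_r_distr[OF lt a] in simp_all)
  next
    fix x assume x: "x \<in> carrier ?S"
    show "\<one>\<^bsub>A\<^esub> \<odot>\<^bsub>?S\<^esub> x = x"
      by (rule ext) (use x sc[OF A.one_closed x] c[OF x] left_module.lm_one[OF lt] in simp_all)
  qed (use sc in auto)
  ultimately show ?thesis by (simp add: left_module_def ring_A)
qed

text \<open>The shape of a tuple fixed by the cyclic Frobenius map: it is determined by its entry 0,
  and the only condition on this entry is to be fixed by \<open>F ^^ r\<close>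
  (\<open>cyclic_frobenius_fixed\<close>).\<close>

definition orbit :: "nat \<Rightarrow> ('m \<Rightarrow> 'm) \<Rightarrow> 'm \<Rightarrow> nat \<Rightarrow> 'm" where
  "orbit r F x = (\<lambda>i\<in>{..<r}. (F ^^ i) x)"

lemma cyclic_frobenius_fixed:
  assumes r: "r > 0" and \<xi>: "\<xi> \<in> extensional {..<r}"
  shows "cyclic_frobenius r F \<xi> = \<xi> \<longleftrightarrow> (F ^^ r) (\<xi> 0) = \<xi> 0 \<and> \<xi> = orbit r F (\<xi> 0)"
proof
  assume G: "cyclic_frobenius r F \<xi> = \<xi>"
  have "cyclic_frobenius r F \<xi> i = \<xi> i" for i by (simp only: G)
  then have S: "\<xi> (Suc i) = F (\<xi> i)" if "Suc i < r" for i
    using \<open>\<And>i. cyclic_frobenius r F \<xi> i = \<xi> i\<close>[of "Suc i"] that by (simp add: cyclic_frobenius_def)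
  have Z: "\<xi> 0 = F (\<xi> (r - 1))"
    using \<open>\<And>i. cyclic_frobenius r F \<xi> i = \<xi> i\<close>[of 0] r by (simp add: cyclic_frobenius_def)
  have eq: "i < r \<Longrightarrow> \<xi> i = (F ^^ i) (\<xi> 0)" for i
  proof (induction i)
    case (Suc i) then show ?case using S[of i] by simp
  qed simp
  have "(F ^^ r) (\<xi> 0) = \<xi> 0" using Z eq[of "r - 1"] r by (cases r) auto
  moreover have "\<xi> i = orbit r F (\<xi> 0) i" for i
  proof (cases "i < r")
    case True then show ?thesis using eq[OF True] by (simp add: orbit_def)
  next
    case False then show ?thesis using \<xi> by (simp add: orbit_def extensional_def)
  qed
  ultimately show "(F ^^ r) (\<xi> 0) = \<xi> 0 \<and> \<xi> = orbit r F (\<xi> 0)" by blast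
next
  assume a: "(F ^^ r) (\<xi> 0) = \<xi> 0 \<and> \<xi> = orbit r F (\<xi> 0)"
  have "cyclic_frobenius r F (orbit r F x) i = orbit r F x i" if "(F ^^ r) x = x" for i x
  proof (cases i)
    case 0 then show ?thesis using that r by (cases r) (auto simp: cyclic_frobenius_def orbit_def)
  qed (use r in \<open>auto simp: cyclic_frobenius_def orbit_def\<close>)
  then show "cyclic_frobenius r F \<xi> = \<xi>" using a by (intro ext) metis
qed

lemma orbit_iso:
  assumes M: "tfrob r M (F ^^ r)" and F: "bij_betw F (carrier M) (carrier M)"
    and add: "\<And>x y. \<lbrakk>x \<in> carrier M; y \<in> carrier M\<rbrakk> \<Longrightarrow> F (x \<oplus>\<^bsub>M\<^esub> y) = F x \<oplus>\<^bsub>M\<^esub> F y"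
  shows "orbit r F \<in> module_iso AF (fixed_points (F ^^ r) M) (fixed_points (cyclic_frobenius r F) (twist_sum A FA r F M))"
    (is "_ \<in> module_iso AF ?M ?S")
proof -
  note D = tfrobD[OF M]
  have Fc: "(F ^^ i) x \<in> carrier M" if "x \<in> carrier M" for x i using funpow_closed_bij[OF F] that by (auto dest: bij_betwE)
  have oc: "orbit r F x \<in> carrier (twist_sum A FA r F M)" if "x \<in> carrier M" for x using Fc[OF that] by (auto simp: orbit_def)
  have o0: "orbit r F x 0 = x" for x using D(4) by (simp add: orbit_def)
  have oS: "orbit r F x \<in> carrier ?S" if "x \<in> carrier ?M" for x
    using oc that cyclic_frobenius_fixed[OF D(4), of "orbit r F x" F] by (simp add: o0) (simp add: orbit_def)
  have adds: "(F ^^ i) (x \<oplus>\<^bsub>M\<^esub> y) = (F ^^ i) x \<oplus>\<^bsub>M\<^esub> (F ^^ i) y" if "x \<in> carrier M" "y \<in> carrier M" for x y i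
    by (induction i) (simp_all add: add Fc that)
  have "orbit r F \<in> module_hom AF ?M ?S"
  proof (rule module_homI)
    fix x y assume "x \<in> carrier ?M" "y \<in> carrier ?M"
    then show "orbit r F (x \<oplus>\<^bsub>?M\<^esub> y) = orbit r F x \<oplus>\<^bsub>?S\<^esub> orbit r F y"
      by (simp add: orbit_def fun_eq_iff twist_sum_def adds)
  next
    fix a x assume a: "a \<in> carrier AF" and x: "x \<in> carrier ?M"
    have "(F ^^ i) (a \<odot>\<^bsub>M\<^esub> x) = a \<odot>\<^bsub>tw F i M\<^esub> (F ^^ i) x" for i
      using tw_smult[OF F AF_closed[OF a], of x i] x FA_fixed[OF a] by simp
    then show "orbit r F (a \<odot>\<^bsub>?M\<^esub> x) = a \<odot>\<^bsub>?S\<^esub> orbit r F x"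
      by (simp add: orbit_def fun_eq_iff twist_sum_def)
  qed (rule oS)
  moreover have "bij_betw (orbit r F) (carrier ?M) (carrier ?S)"
  proof (rule bij_betwI[where g = "\<lambda>\<xi>. \<xi> 0"])
    fix \<xi> assume x: "\<xi> \<in> carrier ?S"
    then have e: "\<xi> \<in> extensional {..<r}" "\<xi> 0 \<in> carrier M" using D(4) by (simp_all add: PiE_iff)
    show "orbit r F (\<xi> 0) = \<xi>" using x cyclic_frobenius_fixed[OF D(4) e(1), of F] by simp
  next
    show "(\<lambda>\<xi>. \<xi> 0) \<in> carrier ?S \<rightarrow> carrier ?M"
    proof
      fix \<xi> assume x: "\<xi> \<in> carrier ?S"
      then have e: "\<xi> \<in> extensional {..<r}" "\<xi> 0 \<in> carrier M" using D(4) by (simp_all add: PiE_iff)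
      then show "\<xi> 0 \<in> carrier ?M" using x cyclic_frobenius_fixed[OF D(4) e(1), of F] by simp
    qed
  qed (use oS in \<open>simp_all add: o0\<close>)
  ultimately show ?thesis by (simp add: module_iso_def)
qed

lemma twist_sum_tfrob:
  assumes M: "tfrob r M (F ^^ r)" and F: "frob (Suc 0) (bs M) F"
  shows "tfrob (Suc 0) (twist_sum A FA r F M) (cyclic_frobenius r F)" (is "tfrob _ ?S ?G")
proof -
  note D = tfrobD[OF M]
  have Fb: "bij_betw F (carrier M) (carrier M)" using frob_bij[OF D(2) F] by simp
  have add: "F (x \<oplus>\<^bsub>M\<^esub> y) = F x \<oplus>\<^bsub>M\<^esub> F y" if "x \<in> carrier M" "y \<in> carrier M" for x y
    using slinD(2)[of "Suc 0" "bs M" "bs M" F] F that by (simp add: frob_def)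
  have lm: "left_module A ?S" by (rule twist_sum_left_module[OF D(1) Fb add])
  \<comment> \<open>The r-th twist is the module itself. This is what makes the step from the last
    coordinate back to coordinate 0 compatible with \<open>A\<close>.\<close>
  have twr: "a \<odot>\<^bsub>tw F r M\<^esub> x = a \<odot>\<^bsub>M\<^esub> x" if a: "a \<in> carrier A" and x: "x \<in> carrier M" for a x
  proof -
    obtain c where c: "c \<in> carrier A" "(FA ^^ r) c = a" using FA_surj[OF a] by blast
    obtain y where y: "y \<in> carrier M" "x = (F ^^ r) y"
      using funpow_closed_bij[OF Fb, of r] x unfolding bij_betw_def by (metis imageE)
    show ?thesis using tw_smult[OF Fb c(1), of y r] tlinD(3)[OF D(5) c(1), of y] y c by simp
  qed
  have Fc: "F x \<in> carrier M" if "x \<in> carrier M" for x using Fb that by (auto dest: bij_betwE)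
  have Gc: "?G \<xi> \<in> carrier ?S" if "\<xi> \<in> carrier ?S" for \<xi>
  proof -
    have "F (\<xi> i) \<in> carrier M" if "i < r" for i using Fc \<open>\<xi> \<in> carrier ?S\<close> that by (simp add: PiE_iff)
    then show ?thesis using D(4) by (auto simp: cyclic_frobenius_def)
  qed
  have tl: "tlin 0 (Suc 0) ?S ?S ?G"
  proof (rule tlinI)
    fix x y assume "x \<in> carrier ?S" "y \<in> carrier ?S"
    then have "x i \<in> carrier M" "y i \<in> carrier M" if "i < r" for i using that by auto
    then show "?G (x \<oplus>\<^bsub>?S\<^esub> y) = ?G x \<oplus>\<^bsub>?S\<^esub> ?G y" using D(4) add
      by (auto simp: cyclic_frobenius_def fun_eq_iff twist_sum_def)
  next
    fix a x assume a: "a \<in> carrier A" and x: "x \<in> carrier ?S"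
    have xc: "x i \<in> carrier M" if "i < r" for i using x that by auto
    have "?G (a \<odot>\<^bsub>?S\<^esub> x) i = (FA a \<odot>\<^bsub>?S\<^esub> ?G x) i" for i
    proof (cases i)
      case 0
      obtain l where l: "r = Suc l" using D(4) by (cases r) auto
      have "F (a \<odot>\<^bsub>tw F l M\<^esub> x l) = FA a \<odot>\<^bsub>M\<^esub> F (x l)"
        using tw_Suc_smult[OF Fb a xc[of l], of l] twr[of "FA a" "F (x l)"] FA_closed[OF a, of "Suc 0", simplified] Fc[OF xc[of l]] l
        by (simp del: funpow.simps)
      then show ?thesis using 0 l by (simp add: cyclic_frobenius_def)
    next
      case (Suc l)
      show ?thesis
      proof (cases "i < r")
        case True
        then show ?thesis using Suc tw_Suc_smult[OF Fb a xc[of l], of l] by (simp add: cyclic_frobenius_def del: funpow.simps)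
      qed (simp add: cyclic_frobenius_def twist_sum_def)
    qed
    then show "?G ((FA ^^ 0) a \<odot>\<^bsub>?S\<^esub> x) = (FA ^^ Suc 0) a \<odot>\<^bsub>?S\<^esub> ?G x" by (simp add: fun_eq_iff)
  qed (rule Gc)
  have per: "\<exists>n>0. (?G ^^ n) \<xi> = \<xi>" if x: "\<xi> \<in> carrier ?S" for \<xi>
  proof -
    obtain n where n: "n > 0" "r dvd n" "\<And>x. x \<in> \<xi> ` {..<r} \<Longrightarrow> (F ^^ n) x = x"
      using frob_common_power[OF F _ _ D(4), of "\<xi> ` {..<r}"] x by auto
    have c: "(?G ^^ n) \<xi> \<in> carrier ?S" by (induction n) (use x Gc in auto)
    have "(?G ^^ n) \<xi> i = \<xi> i" if i: "i < r" for i
      using cyclic_frobenius_funpow[OF D(4) i, where F = F and j = n and \<xi> = \<xi>] n(2,3) i by (auto elim!: dvdE)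
    then have "(?G ^^ n) \<xi> = \<xi>" using x c PiE_ext[of "(?G ^^ n) \<xi>" "{..<r}" "\<lambda>_. carrier M" \<xi>] by auto
    then show ?thesis using n(1) by blast
  qed
  \<comment> \<open>Finite dimension of the sum is deduced from the finiteness of its fixed points,
    which \<open>orbit\<close> identifies with those of \<open>F ^^ r\<close> on M.\<close>
  have fin: "finite (carrier (fixed_points ?G ?S))"
    using orbit_iso[OF M Fb add] finite_fixed_points[OF M] bij_betw_finite unfolding module_iso_def by blast
  show ?thesis by (rule tfrob_finite_fixed_points[OF lm tl]) (use per fin in auto)
qed

end

section \<open>Lifting semilinear maps through an almost split morphism\<close>

lemma minimal_right_almost_split_minimal:
  assumes "minimal_right_almost_split K A P M \<phi>" "f \<in> module_hom A P P" "\<And>x. x \<in> carrier P \<Longrightarrow> \<phi> x = \<phi> (f x)"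
  shows "f \<in> module_iso A P P"
  using assms unfolding minimal_right_almost_split_def by blast

lemma module_iso_comp: "\<lbrakk>f \<in> module_iso R M N; g \<in> module_iso R N P\<rbrakk> \<Longrightarrow> g \<circ> f \<in> module_iso R M P"
  using module_hom_comp[of f R M N g P] bij_betw_trans[of f "carrier M" "carrier N" g "carrier P"] by (simp add: module_iso_def)

context frobenius_algebra
begin

text \<open>The composite of \<open>\<beta>\<close>, \<open>\<phi>\<close> and
  \<open>\<theta>\<close> has total degree m, hence is a homomorphism to M from the m-th twist of P,
  and the factorisation property of \<open>\<phi>\<close> can be applied to it. Two degrees for each
  map admit the inverse of a semilinear isomorphism as well.\<close>

lemma factor_twisted:
  assumes \<phi>: "minimal_right_almost_split L A P M \<phi>" and F: "frob (Suc 0) (bs P) F"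
    and \<theta>: "tlin i j M M \<theta>" "bij_betw \<theta> (carrier M) (carrier M)" and \<beta>: "tlin i' j' P P \<beta>"
    and deg: "m + (i + i') = j + j'"
  obtains g where "tlin 0 m P P g" "\<And>x. x \<in> carrier P \<Longrightarrow> \<theta> (\<phi> (\<beta> x)) = \<phi> (g x)"
proof -
  have P: "fd_module L A P" and \<phi>h: "\<phi> \<in> module_hom A P M" and ns: "\<not> split_epi A P M \<phi>"
    using \<phi> by (auto simp: minimal_right_almost_split_def)
  have lm: "left_module A P" using P by (simp add: fd_module_def)
  let ?G = "inv_into (carrier P) (F ^^ m)"
  note G = inv_funpow_frob[OF lm F, where s = m]
  have "tlin (0 + (i' + i)) (m + (i' + i)) P M (\<lambda>x. \<theta> (\<phi> (\<beta> x)))"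
    using tlin_comp[OF tlin_comp[OF \<beta> hom_tlin[OF \<phi>h]] \<theta>(1)] deg by (simp add: ac_simps)
  then have z: "tlin 0 m P M (\<lambda>x. \<theta> (\<phi> (\<beta> x)))" by (simp only: tlin_shift)
  note zt = tlin_tw_hom[OF lm F z]
  have "\<not> split_epi A (tw F m P) M (\<lambda>x. \<theta> (\<phi> (\<beta> (?G x))))"
  proof
    assume "split_epi A (tw F m P) M (\<lambda>x. \<theta> (\<phi> (\<beta> (?G x))))"
    then obtain s where s: "s \<in> module_hom A M (tw F m P)" "\<And>x. x \<in> carrier M \<Longrightarrow> \<theta> (\<phi> (\<beta> (?G (s x)))) = x"
      by (auto simp: split_epi_def)
    \<comment> \<open>A section of the twisted composite gives a section of \<open>\<phi>\<close>
      when conjugated by \<open>\<theta>\<close>; its total degree is 0.\<close>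
    let ?t = "\<lambda>x. \<beta> (?G (s (\<theta> x)))"
    have "tlin (0 + (m + i + i')) (0 + (m + i + i')) M P ?t"
      using tlin_comp[OF tlin_comp[OF \<theta>(1) hom_tw_tlin[OF lm F s(1)]] \<beta>] deg by (simp add: ac_simps)
    then have t: "?t \<in> module_hom A M P" by (simp only: tlin_shift tlin_module_hom)
    have "\<phi> (?t x) = x" if x: "x \<in> carrier M" for x
    proof -
      have "\<theta> (\<phi> (?t x)) = \<theta> x" using s(2)[OF tlinD(1)[OF \<theta>(1) x]] .
      then show ?thesis using \<theta>(2) x module_homD(1)[OF \<phi>h module_homD(1)[OF t x]] by (simp add: bij_betw_def inj_on_def)
    qed
    then have "split_epi A P M \<phi>" unfolding split_epi_def using t by (intro bexI[of _ ?t]) auto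
    then show False using ns by blast
  qed
  then obtain g where g: "g \<in> module_hom A (tw F m P) P" "\<And>x. x \<in> carrier P \<Longrightarrow> \<theta> (\<phi> (\<beta> (?G x))) = \<phi> (g x)"
    using minimal_right_almost_split_factors[OF fd_A \<phi> tw_fd_module[OF P F] zt] by auto
  have "\<theta> (\<phi> (\<beta> x)) = \<phi> (g ((F ^^ m) x))" if x: "x \<in> carrier P" for x
    using g(2)[OF funpow_frob(2)[OF lm F x, of m]] G(3)[OF x] by simp
  then show thesis by (rule that[OF tw_hom_tlin[OF lm F g(1)]])
qed

text \<open>The lift of \<open>\<theta>\<close> through \<open>\<phi>\<close> is bijective because a lift of the inverse of \<open>\<theta>\<close>, multiplied by a large
  power of \<open>F\<close>, is an inverse up to automorphisms, by minimality.\<close>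

lemma lift_semilinear:
  assumes \<phi>: "minimal_right_almost_split L A P M \<phi>" and F: "frob (Suc 0) (bs P) F"
    and M: "tfrob r M \<theta>"
  obtains \<theta>' where "tfrob r P \<theta>'" "\<And>x. x \<in> carrier P \<Longrightarrow> \<phi> (\<theta>' x) = \<theta> (\<phi> x)"
proof -
  note D = tfrobD[OF M]
  have P: "fd_module L A P" and \<phi>h: "\<phi> \<in> module_hom A P M"
    using \<phi> by (auto simp: minimal_right_almost_split_def)
  have lm: "left_module A P" and fd: "vectorspace.fin_dim L (bs P)" using P by (auto simp: fd_module_def)
  obtain g where g: "tlin 0 r P P g" "\<And>x. x \<in> carrier P \<Longrightarrow> \<theta> (\<phi> x) = \<phi> (g x)"
    using factor_twisted[OF \<phi> F D(5,9) tlin_id[where i = 0], of r] by auto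
  obtain n where n: "n > 0" "tlin 0 n P P (F ^^ n)" using frob_power_tlin[OF P F] .
  \<comment> \<open>A multiple of n, so that \<open>F ^^ N\<close> is compatible with
    \<open>A\<close>, and at least r, so that the lift of the inverse of \<open>\<theta>\<close>
    composed with it has the natural degree N - r.\<close>
  define N where "N = n * r"
  have tN: "tlin 0 N P P (F ^^ N)" using tlin_funpow[OF n(2), of r] by (simp add: N_def funpow_mult mult.commute)
  have N: "N > 0" "N \<ge> r" using n(1) D(4) by (auto simp: N_def)
  have FN: "tfrob N P (F ^^ N)"
    using frob_funpow[OF vs_bs[OF lm] F N(1)] P N tN by (simp add: tfrob_def frob_def)
  let ?i = "inv_into (carrier M) \<theta>"
  have ti: "tlin r 0 M M ?i" by (rule tlin_inv[OF D(1,5,9)])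
  obtain h where h: "tlin 0 (N - r) P P h" "\<And>x. x \<in> carrier P \<Longrightarrow> ?i (\<phi> ((F ^^ N) x)) = \<phi> (h x)"
    using factor_twisted[OF \<phi> F ti bij_betw_inv_into[OF D(9)] tN, of "N - r"] N(2) by auto
  let ?G = "inv_into (carrier P) (F ^^ N)"
  note G = inv_funpow_frob[OF lm F, where s = N]
  have tG: "tlin N 0 P P ?G" by (rule tlin_inv[OF lm tN tfrobD(9)[OF FN]])
  have "tlin (0 + N) (0 + N) P P (\<lambda>x. g (h (?G x)))"
    using tlin_comp[OF tG tlin_comp0[OF h(1) g(1)]] N(2) by simp
  then have w: "(\<lambda>x. g (h (?G x))) \<in> module_hom A P P" by (simp only: tlin_shift tlin_module_hom)
  have "\<phi> x = \<phi> (g (h (?G x)))" if x: "x \<in> carrier P" for x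
  proof -
    have "\<phi> (g (h (?G x))) = \<theta> (?i (\<phi> ((F ^^ N) (?G x))))"
      using g(2)[OF tlinD(1)[OF h(1) G(1)[OF x]]] h(2)[OF G(1)[OF x]] by simp
    also have "\<dots> = \<phi> x" using G(2)[OF x] D(9) module_homD(1)[OF \<phi>h x] by (simp add: bij_betw_def f_inv_into_f)
    finally show ?thesis by simp
  qed
  then have "bij_betw (\<lambda>x. g (h (?G x))) (carrier P) (carrier P)" using minimal_right_almost_split_minimal[OF \<phi> w] by (simp add: module_iso_def)
  then have "carrier P \<subseteq> g ` carrier P"
    using tlinD(1)[OF h(1) G(1)] unfolding bij_betw_def by blast
  then have "g ` carrier P = carrier P" using tlinD(1)[OF g(1)] by blast
  then have "inj_on g (carrier P)" using tlin_surj_bij[OF FN g(1)] by (simp add: bij_betw_def)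
  then have "frob r (bs P) g" using slin_inj_frob[OF vs_bs[OF lm] fd F, of r g] tlin_slin[OF g(1) lm] by simp
  then have "tfrob r P g" using P D(4) g(1) by (simp add: tfrob_def frob_def)
  then show thesis using that g(2) by simp
qed

lemma frameD:
  assumes "frame r M \<theta> F M' \<beta>"
  shows "tfrob r M \<theta>" "periodic_replacement L A FA r F M M' \<beta>" "tfrob r M' (F ^^ r)" "frob (Suc 0) (bs M') F"
    "x \<in> carrier M \<Longrightarrow> \<beta> (\<theta> x) = (F ^^ r) (\<beta> x)" "carrier M' = carrier M" "\<beta> \<in> module_iso A M M'"
  using assms by (auto simp: frame_def periodic_replacement_def)

lemma frame_tfrob: "frame r M \<theta> F M' \<beta> \<Longrightarrow> tfrob (Suc 0) (twist_sum A FA r F M') (cyclic_frobenius r F)"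
  by (rule twist_sum_tfrob[OF frameD(3,4)])

lemma frame_iso:
  assumes fr: "frame r M \<theta> F M' \<beta>"
  shows "(\<lambda>x. orbit r F (\<beta> x)) \<in> module_iso AF (fixed_points \<theta> M) (fixed_points (cyclic_frobenius r F) (twist_sum A FA r F M'))"
proof -
  let ?FM = "fixed_points \<theta> M"
  note d = frameD[OF fr] and D = tfrobD[OF frameD(1)[OF fr]] and D' = tfrobD[OF frameD(3)[OF fr]]
  note b = module_isoD[OF d(7) D(1)]
  have o: "orbit r F \<in> module_iso AF (fixed_points (F ^^ r) M') (fixed_points (cyclic_frobenius r F) (twist_sum A FA r F M'))"
    using orbit_iso[OF d(3)] frob_bij[OF D'(2) d(4)] funpow_frob(3)[OF D'(1) d(4), of _ _ "Suc 0"] by simp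
  have bF: "(F ^^ r) (\<beta> x) = \<beta> x \<longleftrightarrow> \<theta> x = x" if x: "x \<in> carrier M" for x
  proof -
    have "inj_on \<beta> (carrier M)" using b(5) by (simp add: bij_betw_def)
    from inj_on_eq_iff[OF this tlinD(1)[OF D(5) x] x] show ?thesis using d(5)[OF x] by simp
  qed
  have bc: "\<beta> x \<in> carrier M'" if "x \<in> carrier M" for x by (rule bij_betwE[OF b(5), rule_format, OF that])
  have "bij_betw \<beta> (carrier ?FM) (carrier (fixed_points (F ^^ r) M'))"
  proof (rule bij_betw_subset[OF b(5)])
    show "\<beta> ` carrier ?FM = carrier (fixed_points (F ^^ r) M')"
    proof (intro equalityI subsetI)
      fix y assume "y \<in> carrier (fixed_points (F ^^ r) M')"
      then have y: "y \<in> carrier M'" "(F ^^ r) y = y" by simp_all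
      then obtain x where x: "x \<in> carrier M" "y = \<beta> x" using b(5) unfolding bij_betw_def by blast
      then show "y \<in> \<beta> ` carrier ?FM" using bF[OF x(1)] y by simp
    next
      fix y assume "y \<in> \<beta> ` carrier ?FM"
      then obtain x where x: "x \<in> carrier M" "\<theta> x = x" "y = \<beta> x" by auto
      then show "y \<in> carrier (fixed_points (F ^^ r) M')" using bF[OF x(1)] bc[OF x(1)] by simp
    qed
  qed simp
  moreover have "\<beta> \<in> module_hom AF ?FM (fixed_points (F ^^ r) M')"
    using module_hom_fixed_points[OF b(1), of \<theta> "F ^^ r"] bF by blast
  ultimately have "\<beta> \<in> module_iso AF ?FM (fixed_points (F ^^ r) M')" by (simp add: module_iso_def)
  from module_iso_comp[OF this o] show ?thesis by (simp add: comp_def)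
qed

text \<open>The iterated twist of a homomorphism is conjugation by powers of the Frobenius maps; on
  arguments of this form the inverses disappear.\<close>

lemma funpow_hom_twist:
  assumes F: "bij_betw F (carrier P) (carrier P)" and x: "x \<in> carrier P"
  shows "(hom_twist P F G ^^ s) \<phi> ((F ^^ s) x) = (G ^^ s) (\<phi> x)"
proof (induction s)
  case (Suc s)
  have "(F ^^ s) x \<in> carrier P" using funpow_closed_bij[OF F] x by (auto dest: bij_betwE)
  then have "inv_into (carrier P) F (F ((F ^^ s) x)) = (F ^^ s) x" using F by (simp add: bij_betw_def)
  then show ?case using Suc by (simp add: hom_twist_def)
qed simp

text \<open>The replacement is \<open>\<beta> \<circ> \<phi> \<circ> \<alpha>\<inverse>\<close>, and
  its invariance under the r-th twist is the relation between \<open>\<phi>\<close> and the two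
  semilinear maps. The last conclusion says that on fixed points the diagonal morphism is
  \<open>\<phi>\<close> itself, seen through \<open>orbit\<close>.\<close>

lemma induced_hom:
  assumes P: "frame r P \<theta>P FP P' \<alpha>" and M: "frame r M \<theta>M FM M' \<beta>"
    and \<phi>: "\<phi> \<in> module_hom A P M" and comm: "\<And>x. x \<in> carrier P \<Longrightarrow> \<phi> (\<theta>P x) = \<theta>M (\<phi> x)"
  obtains \<phi>' where "periodic_composite r P FP FM \<phi> \<alpha> \<beta> \<phi>'"
    "diag_hom r P' FP FM \<phi>' \<in> F_stable_hom A (twist_sum A FA r FP P') (cyclic_frobenius r FP)
       (twist_sum A FA r FM M') (cyclic_frobenius r FM)"
    "\<And>x. x \<in> carrier P \<Longrightarrow> diag_hom r P' FP FM \<phi>' (orbit r FP (\<alpha> x)) = orbit r FM (\<beta> (\<phi> x))"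
proof -
  let ?TP = "twist_sum A FA r FP P'"
  note p = frameD[OF P] and m = frameD[OF M]
  note DP = tfrobD[OF p(1)] and DM = tfrobD[OF m(1)] and DP' = tfrobD[OF p(3)] and DM' = tfrobD[OF m(3)]
  note a = module_isoD[OF p(7) DP(1)] and b = module_isoD[OF m(7) DM(1)]
  let ?a = "inv_into (carrier P) \<alpha>"
  define \<phi>' where "\<phi>' = \<beta> \<circ> (\<phi> \<circ> ?a)"
  have h: "\<phi>' \<in> module_hom A P' M'"
    unfolding \<phi>'_def by (intro module_hom_comp[OF module_hom_comp[OF a(2) \<phi>] b(1)])
  have e: "\<phi>' (\<alpha> x) = \<beta> (\<phi> x)" if "x \<in> carrier P" for x using a(3)[OF that] by (simp add: \<phi>'_def)
  have cr: "carrier P' = carrier P" "carrier M' = carrier M" using p(6) m(6) by auto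
  have FP: "bij_betw FP (carrier P) (carrier P)" using frob_bij[OF DP'(2) p(4)] cr by simp
  have ht: "hom_twist P' FP FM = hom_twist P FP FM" by (simp add: hom_twist_def fun_eq_iff cr)
  \<comment> \<open>In the frames the maps \<open>\<theta>P\<close> and \<open>\<theta>M\<close> are
    powers of \<open>FP\<close> and \<open>FM\<close>, so the hypothesis \<open>comm\<close> becomes
    the commutation with r-th powers.\<close>
  have per: "\<phi>' ((FP ^^ r) y) = (FM ^^ r) (\<phi>' y)" if y: "y \<in> carrier P" for y
  proof -
    define x where "x = ?a y"
    have x: "x \<in> carrier P" "\<alpha> x = y" using module_homD(1)[OF a(2)] a(4) y cr by (auto simp: x_def)
    have "(FP ^^ r) y = \<alpha> (\<theta>P x)" using p(5)[OF x(1)] x(2) by simp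
    then show ?thesis using e[OF tlinD(1)[OF DP(5) x(1)]] comm[OF x(1)] m(5)[OF module_homD(1)[OF \<phi> x(1)]] e[OF x(1)] x(2) by simp
  qed
  note hp = funpow_hom_twist[OF FP, where G = FM and \<phi> = \<phi>']
  have surj: "\<exists>y\<in>carrier P. x = (FP ^^ i) y" if "x \<in> carrier P" for x i
    using funpow_closed_bij[OF FP, of i] that unfolding bij_betw_def by (metis imageE)
  have per2: "(hom_twist P FP FM ^^ r) \<phi>' x = \<phi>' x" if x: "x \<in> carrier P" for x
  proof -
    obtain y where y: "y \<in> carrier P" "x = (FP ^^ r) y" using surj[OF x] by blast
    then show ?thesis using hp[OF y(1), of r] per[OF y(1)] by simp
  qed
  have pc: "periodic_composite r P FP FM \<phi> \<alpha> \<beta> \<phi>'" using e per2 by (simp add: periodic_composite_def)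
  let ?d = "diag_hom r P' FP FM \<phi>'"
  have d: "?d \<xi> i = (hom_twist P FP FM ^^ i) \<phi>' (\<xi> i)" if "i < r" for \<xi> i using that by (simp add: diag_hom_def ht)
  have fm: "(FM ^^ i) z \<in> carrier M" if "z \<in> carrier M" for z i using funpow_frob(2)[OF DM'(1) m(4)] that cr by simp
  have h1: "(hom_twist P FP FM ^^ i) \<phi>' x \<in> carrier M" if x: "x \<in> carrier P" for x i
    using surj[OF x, of i] hp fm module_homD(1)[OF h] cr by auto
  have h2: "(hom_twist P FP FM ^^ i) \<phi>' (x \<oplus>\<^bsub>P'\<^esub> y) = (hom_twist P FP FM ^^ i) \<phi>' x \<oplus>\<^bsub>M'\<^esub> (hom_twist P FP FM ^^ i) \<phi>' y"
    if x: "x \<in> carrier P" and y: "y \<in> carrier P" for x y i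
  proof -
    interpret P': left_module A P' by (rule DP'(1))
    obtain u v where uv: "u \<in> carrier P" "x = (FP ^^ i) u" "v \<in> carrier P" "y = (FP ^^ i) v" using surj[OF x, of i] surj[OF y, of i] by blast
    have "u \<oplus>\<^bsub>P'\<^esub> v \<in> carrier P" using uv P'.M.a_closed cr by simp
    then show ?thesis using uv hp[of u i] hp[of v i] hp[of "u \<oplus>\<^bsub>P'\<^esub> v" i] funpow_frob(3)[OF DP'(1) p(4), of u v i]
        funpow_frob(3)[OF DM'(1) m(4), of "\<phi>' u" "\<phi>' v" i] module_homD(1,2)[OF h] cr by simp
  qed
  have h3: "(hom_twist P FP FM ^^ i) \<phi>' (c \<odot>\<^bsub>tw FP i P'\<^esub> x) = c \<odot>\<^bsub>tw FM i M'\<^esub> (hom_twist P FP FM ^^ i) \<phi>' x"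
    if c: "c \<in> carrier A" and x: "x \<in> carrier P" for c x i
  proof -
    interpret P': left_module A P' by (rule DP'(1))
    obtain u where u: "u \<in> carrier P" "x = (FP ^^ i) u" using surj[OF x, of i] by blast
    obtain k where k: "k \<in> carrier A" "c = (FA ^^ i) k" using FA_surj[OF c, of i] by blast
    have ku: "k \<odot>\<^bsub>P'\<^esub> u \<in> carrier P" using P'.lm_closed k(1) u(1) cr by simp
    show ?thesis using u k hp[OF u(1), of i] hp[OF ku, of i] funpow_frob(4)[OF DP'(1) p(4), of k u i]
        funpow_frob(4)[OF DM'(1) m(4), of k "\<phi>' u" i] module_homD(1,3)[OF h] cr by simp
  qed
  have dh: "?d \<in> module_hom A ?TP (twist_sum A FA r FM M')"
  proof (rule module_homI)
    fix x y assume "x \<in> carrier ?TP" "y \<in> carrier ?TP"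
    then have "x i \<in> carrier P" "y i \<in> carrier P" if "i < r" for i using that cr by (simp_all add: PiE_iff)
    then show "?d (x \<oplus>\<^bsub>twist_sum A FA r FP P'\<^esub> y) = ?d x \<oplus>\<^bsub>twist_sum A FA r FM M'\<^esub> ?d y"
      by (simp add: diag_hom_def twist_sum_def fun_eq_iff ht h2)
  next
    fix x assume x: "x \<in> carrier ?TP"
    then have xc: "x i \<in> carrier P" if "i < r" for i using that cr by (simp add: PiE_iff)
    then show "?d x \<in> carrier (twist_sum A FA r FM M')" using h1 cr by (simp add: diag_hom_def ht)
    show "?d (c \<odot>\<^bsub>twist_sum A FA r FP P'\<^esub> x) = c \<odot>\<^bsub>twist_sum A FA r FM M'\<^esub> ?d x" if "c \<in> carrier A" for c
      using xc that by (simp add: diag_hom_def twist_sum_def fun_eq_iff ht h3)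
  qed
  have "?d (cyclic_frobenius r FP \<xi>) i = cyclic_frobenius r FM (?d \<xi>) i" if x: "\<xi> \<in> carrier ?TP" for \<xi> i
  proof (cases "i < r")
    case True
    define l where "l = (if i = 0 then r - 1 else i - 1)"
    have l: "l < r" "i = Suc l \<or> i = 0 \<and> r = Suc l" using True by (auto simp: l_def)
    have xl: "\<xi> l \<in> carrier P" using x l(1) cr by (simp add: PiE_iff)
    then have Fl: "FP (\<xi> l) \<in> carrier P" using FP by (auto dest: bij_betwE)
    have S: "(hom_twist P FP FM ^^ Suc l) \<phi>' (FP (\<xi> l)) = FM ((hom_twist P FP FM ^^ l) \<phi>' (\<xi> l))"
      using FP xl by (simp add: hom_twist_def bij_betw_def)
    \<comment> \<open>For i = 0 this is the invariance under the r-th twist, used where the cyclic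
      shift wraps around.\<close>
    have "(hom_twist P FP FM ^^ i) \<phi>' (FP (\<xi> l)) = (hom_twist P FP FM ^^ Suc l) \<phi>' (FP (\<xi> l))"
      using l(2) per2[OF Fl] by (auto simp del: funpow.simps simp: funpow_0)
    then show ?thesis using S True l by (simp add: diag_hom_def cyclic_frobenius_def ht flip: l_def del: funpow.simps)
  qed (simp add: diag_hom_def cyclic_frobenius_def)
  then have "?d \<in> F_stable_hom A ?TP (cyclic_frobenius r FP) (twist_sum A FA r FM M') (cyclic_frobenius r FM)"
    using dh by (auto simp: F_stable_hom_def fun_eq_iff)
  moreover have "?d (orbit r FP (\<alpha> x)) = orbit r FM (\<beta> (\<phi> x))" if x: "x \<in> carrier P" for x
    using hp[of "\<alpha> x"] module_homD(1)[OF a(1) x] cr e[OF x] by (simp add: diag_hom_def orbit_def fun_eq_iff ht)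
  ultimately show thesis using that pc by blast
qed

lemma F_stable_hom_fixed_points:
  assumes P: "tfrob (Suc 0) P F" and f: "f \<in> F_stable_hom A P F M G"
  shows "f \<in> module_hom AF (fixed_points F P) (fixed_points G M)"
proof (rule module_hom_fixed_points)
  have h: "f \<in> module_hom A P M" "\<forall>x\<in>carrier P. f (F x) = G (f x)" using f by (simp_all add: F_stable_hom_def)
  show "f \<in> module_hom A P M" by (rule h(1))
  show "G (f x) = f x" if "x \<in> carrier P" "F x = x" for x using bspec[OF h(2) that(1)] that(2) by simp
qed

end

section \<open>Induced almost split sequences\<close>

lemma iso_zero_iff:
  assumes M: "left_module R M" and N: "left_module R N" and e: "e \<in> module_iso R M N" and x: "x \<in> carrier M"
  shows "e x = \<zero>\<^bsub>N\<^esub> \<longleftrightarrow> x = \<zero>\<^bsub>M\<^esub>"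
proof -
  interpret M: left_module R M by fact
  interpret N: left_module R N by fact
  note h = module_isoD[OF e M]
  have "e \<zero>\<^bsub>M\<^esub> = \<zero>\<^bsub>N\<^esub>"
    by (rule additive_zero[OF M.M.abelian_group_axioms N.M.abelian_group_axioms]) (use module_homD[OF h(1)] in auto)
  then show ?thesis using inj_on_eq_iff[OF bij_betw_imp_inj_on[OF h(5)] x M.M.zero_closed] by simp
qed

lemma short_exact_iso:
  assumes ex: "short_exact R N1 L1 M1 \<psi>1 \<phi>1"
    and lm: "left_module R N1" "left_module R L1" "left_module R M1" "left_module R M2"
    and \<nu>: "\<nu> \<in> module_iso R N1 N2" and \<rho>: "\<rho> \<in> module_iso R L1 L2" and \<mu>: "\<mu> \<in> module_iso R M1 M2"
    and \<psi>2: "\<psi>2 \<in> module_hom R N2 L2" "\<And>x. x \<in> carrier N1 \<Longrightarrow> \<psi>2 (\<nu> x) = \<rho> (\<psi>1 x)"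
    and \<phi>2: "\<phi>2 \<in> module_hom R L2 M2" "\<And>x. x \<in> carrier L1 \<Longrightarrow> \<phi>2 (\<rho> x) = \<mu> (\<phi>1 x)"
  shows "short_exact R N2 L2 M2 \<psi>2 \<phi>2"
proof -
  have e: "\<psi>1 \<in> module_hom R N1 L1" "\<phi>1 \<in> module_hom R L1 M1" "inj_on \<psi>1 (carrier N1)"
    "\<psi>1 ` carrier N1 = {x \<in> carrier L1. \<phi>1 x = \<zero>\<^bsub>M1\<^esub>}" "\<phi>1 ` carrier L1 = carrier M1"
    using ex by (auto simp: short_exact_def)
  have b: "carrier N2 = \<nu> ` carrier N1" "carrier L2 = \<rho> ` carrier L1" "carrier M2 = \<mu> ` carrier M1" "inj_on \<rho> (carrier L1)"
    using \<nu> \<rho> \<mu> by (auto simp: module_iso_def bij_betw_def)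
  have "inj_on \<psi>2 (carrier N2)"
    unfolding b(1)
  proof (rule inj_onI)
    fix x y assume "x \<in> \<nu> ` carrier N1" "y \<in> \<nu> ` carrier N1" and eq: "\<psi>2 x = \<psi>2 y"
    then obtain u v where uv: "u \<in> carrier N1" "x = \<nu> u" "v \<in> carrier N1" "y = \<nu> v" by blast
    then have "\<rho> (\<psi>1 u) = \<rho> (\<psi>1 v)" using eq \<psi>2(2) by simp
    then have "\<psi>1 u = \<psi>1 v" using inj_onD[OF b(4)] module_homD(1)[OF e(1)] uv by blast
    then show "x = y" using inj_onD[OF e(3)] uv by blast
  qed
  moreover have "\<psi>2 ` carrier N2 = {x \<in> carrier L2. \<phi>2 x = \<zero>\<^bsub>M2\<^esub>}"
  proof -
    have "\<psi>2 ` carrier N2 = \<rho> ` (\<psi>1 ` carrier N1)" unfolding b(1) image_image using \<psi>2(2) by (rule image_cong[OF refl])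
    also have "\<dots> = {x \<in> carrier L2. \<phi>2 x = \<zero>\<^bsub>M2\<^esub>}"
    proof -
      have "\<phi>2 (\<rho> x) = \<zero>\<^bsub>M2\<^esub> \<longleftrightarrow> \<phi>1 x = \<zero>\<^bsub>M1\<^esub>" if "x \<in> carrier L1" for x
        by (simp only: \<phi>2(2)[OF that] iso_zero_iff[OF lm(3,4) \<mu> module_homD(1)[OF e(2) that]])
      then show ?thesis unfolding e(4) b(2) by blast
    qed
    finally show ?thesis .
  qed
  moreover have "\<phi>2 ` carrier L2 = carrier M2"
  proof -
    have "\<phi>2 ` carrier L2 = \<mu> ` (\<phi>1 ` carrier L1)" unfolding b(2) image_image using \<phi>2(2) by (rule image_cong[OF refl])
    then show ?thesis by (simp add: e(5) b(3))
  qed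
  ultimately show ?thesis using \<psi>2(1) \<phi>2(1) by (simp add: short_exact_def)
qed

lemma almost_split_iso:
  assumes as: "almost_split K R N1 L1 M1 \<psi>1 \<phi>1"
    and fd: "fd_module K R N2" "fd_module K R L2" "fd_module K R M2"
    and \<nu>: "\<nu> \<in> module_iso R N1 N2" and \<rho>: "\<rho> \<in> module_iso R L1 L2" and \<mu>: "\<mu> \<in> module_iso R M1 M2"
    and \<psi>2: "\<psi>2 \<in> module_hom R N2 L2" "\<And>x. x \<in> carrier N1 \<Longrightarrow> \<psi>2 (\<nu> x) = \<rho> (\<psi>1 x)"
    and \<phi>2: "\<phi>2 \<in> module_hom R L2 M2" "\<And>x. x \<in> carrier L1 \<Longrightarrow> \<phi>2 (\<rho> x) = \<mu> (\<phi>1 x)"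
  shows "almost_split K R N2 L2 M2 \<psi>2 \<phi>2"
proof -
  have s: "short_exact R N1 L1 M1 \<psi>1 \<phi>1" "minimal_right_almost_split K R L1 M1 \<phi>1"
    and lm: "left_module R N1" "left_module R L1" "left_module R M1" "left_module R M2"
    using as fd by (auto simp: almost_split_def fd_module_def)
  have "minimal_right_almost_split K R L2 M2 \<phi>2" using minimal_right_almost_split_iso[OF s(2) fd(2,3) \<rho> \<mu> \<phi>2(1)] \<phi>2(2) by blast
  moreover have "short_exact R N2 L2 M2 \<psi>2 \<phi>2" using short_exact_iso[OF s(1) lm \<nu> \<rho> \<mu> \<psi>2(1) _ \<phi>2(1)] \<psi>2(2) \<phi>2(2) by blast
  ultimately show ?thesis using fd by (simp add: almost_split_def)
qed

lemma right_almost_split_lift: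
  assumes A: "fd_algebra K R" and \<phi>1: "minimal_right_almost_split K R L1 M1 \<phi>1" and \<phi>2: "minimal_right_almost_split K R L2 M2 \<phi>2"
    and \<mu>: "\<mu> \<in> module_iso R M1 M2"
  obtains \<rho> where "\<rho> \<in> module_hom R L1 L2" "\<And>x. x \<in> carrier L1 \<Longrightarrow> \<mu> (\<phi>1 x) = \<phi>2 (\<rho> x)"
proof -
  have h: "fd_module K R L1" "\<phi>1 \<in> module_hom R L1 M1" "\<not> split_epi R L1 M1 \<phi>1" "left_module R M1"
    using \<phi>1 by (auto simp: minimal_right_almost_split_def fd_module_def)
  note m = module_isoD[OF \<mu> h(4)]
  have "\<not> split_epi R L1 M2 (\<mu> \<circ> \<phi>1)"
  proof
    assume "split_epi R L1 M2 (\<mu> \<circ> \<phi>1)"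
    then obtain s where s: "s \<in> module_hom R M2 L1" "\<And>x. x \<in> carrier M2 \<Longrightarrow> \<mu> (\<phi>1 (s x)) = x" by (auto simp: split_epi_def)
    have "\<phi>1 ((s \<circ> \<mu>) x) = x" if x: "x \<in> carrier M1" for x
      using s(2)[OF module_homD(1)[OF m(1) x]] inj_onD[OF bij_betw_imp_inj_on[OF m(5)] _ module_homD(1)[OF h(2)] x]
        module_homD(1)[OF s(1) module_homD(1)[OF m(1) x]] by simp
    then have "split_epi R L1 M1 \<phi>1" unfolding split_epi_def using module_hom_comp[OF m(1) s(1)] by blast
    then show False using h(3) by blast
  qed
  from minimal_right_almost_split_factors[OF A \<phi>2 h(1) module_hom_comp[OF h(2) m(1)] this]
  show thesis using that by (auto simp: comp_def)
qed

text \<open>The map \<open>\<tau>\<close> on scalars covers two uses: it is the identity for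
  homomorphisms between kernels, and \<open>FA ^^ r\<close> for the restriction of a semilinear map
  to a kernel.\<close>

lemma lift_through_injective:
  assumes N: "left_module R N" and N1: "left_module R N1" and \<psi>: "\<psi> \<in> module_hom R N P" "inj_on \<psi> (carrier N)"
    and g: "\<And>x. x \<in> carrier N1 \<Longrightarrow> g x \<in> \<psi> ` carrier N"
      "\<And>x y. \<lbrakk>x \<in> carrier N1; y \<in> carrier N1\<rbrakk> \<Longrightarrow> g (x \<oplus>\<^bsub>N1\<^esub> y) = g x \<oplus>\<^bsub>P\<^esub> g y"
      "\<And>a x. \<lbrakk>a \<in> carrier R; x \<in> carrier N1\<rbrakk> \<Longrightarrow> g (a \<odot>\<^bsub>N1\<^esub> x) = \<tau> a \<odot>\<^bsub>P\<^esub> g x"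
    and \<tau>: "\<And>a. a \<in> carrier R \<Longrightarrow> \<tau> a \<in> carrier R"
  obtains \<nu> where "\<And>x. x \<in> carrier N1 \<Longrightarrow> \<nu> x \<in> carrier N" "\<And>x. x \<in> carrier N1 \<Longrightarrow> \<psi> (\<nu> x) = g x"
    "\<And>x y. \<lbrakk>x \<in> carrier N1; y \<in> carrier N1\<rbrakk> \<Longrightarrow> \<nu> (x \<oplus>\<^bsub>N1\<^esub> y) = \<nu> x \<oplus>\<^bsub>N\<^esub> \<nu> y"
    "\<And>a x. \<lbrakk>a \<in> carrier R; x \<in> carrier N1\<rbrakk> \<Longrightarrow> \<nu> (a \<odot>\<^bsub>N1\<^esub> x) = \<tau> a \<odot>\<^bsub>N\<^esub> \<nu> x"
proof -
  interpret N: left_module R N by (rule N)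
  interpret N1: left_module R N1 by (rule N1)
  have "\<forall>x\<in>carrier N1. \<exists>y\<in>carrier N. \<psi> y = g x" using g(1) by force
  then obtain \<nu> where \<nu>: "\<And>x. x \<in> carrier N1 \<Longrightarrow> \<nu> x \<in> carrier N" "\<And>x. x \<in> carrier N1 \<Longrightarrow> \<psi> (\<nu> x) = g x" by metis
  note p = module_homD[OF \<psi>(1)]
  show thesis
  proof (rule that[of \<nu>])
    fix x assume x: "x \<in> carrier N1"
    show "\<nu> (x \<oplus>\<^bsub>N1\<^esub> y) = \<nu> x \<oplus>\<^bsub>N\<^esub> \<nu> y" if y: "y \<in> carrier N1" for y
      by (rule inj_onD[OF \<psi>(2)]) (use \<nu> g(2)[OF x y] p(2)[of "\<nu> x" "\<nu> y"] x y in simp_all)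
    show "\<nu> (a \<odot>\<^bsub>N1\<^esub> x) = \<tau> a \<odot>\<^bsub>N\<^esub> \<nu> x" if a: "a \<in> carrier R" for a
      by (rule inj_onD[OF \<psi>(2)]) (use \<nu> g(3)[OF a x] p(3)[OF \<tau>[OF a], of "\<nu> x"] x a N1.lm_closed N.lm_closed \<tau> in simp_all)
  qed (use \<nu> in auto)
qed

text \<open>An isomorphism of end terms lifts to the middle terms in both directions. Both
  composites of the lifts lie over the identity, so they are automorphisms by minimality, and the
  kernels follow along.\<close>

lemma almost_split_unique:
  assumes A: "fd_algebra K R" and as1: "almost_split K R N1 L1 M1 \<psi>1 \<phi>1" and as2: "almost_split K R N2 L2 M2 \<psi>2 \<phi>2"
    and \<mu>: "\<mu> \<in> module_iso R M1 M2"
  shows "isomorphic_sequences R N1 L1 M1 \<psi>1 \<phi>1 N2 L2 M2 \<psi>2 \<phi>2"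
proof -
  have m1: "minimal_right_almost_split K R L1 M1 \<phi>1" "left_module R N1" "left_module R L1" "left_module R M1"
    and e1: "\<psi>1 \<in> module_hom R N1 L1" "\<phi>1 \<in> module_hom R L1 M1" "inj_on \<psi>1 (carrier N1)"
    "\<psi>1 ` carrier N1 = {x \<in> carrier L1. \<phi>1 x = \<zero>\<^bsub>M1\<^esub>}"
    using as1 by (auto simp: almost_split_def fd_module_def short_exact_def)
  have m2: "minimal_right_almost_split K R L2 M2 \<phi>2" "left_module R N2" "left_module R L2" "left_module R M2"
    and e2: "\<psi>2 \<in> module_hom R N2 L2" "\<phi>2 \<in> module_hom R L2 M2" "inj_on \<psi>2 (carrier N2)"
    "\<psi>2 ` carrier N2 = {x \<in> carrier L2. \<phi>2 x = \<zero>\<^bsub>M2\<^esub>}"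
    using as2 by (auto simp: almost_split_def fd_module_def short_exact_def)
  note m = module_isoD[OF \<mu> m1(4)]
  let ?m = "inv_into (carrier M1) \<mu>"
  have \<mu>': "?m \<in> module_iso R M2 M1" using m(2) bij_betw_inv_into[OF m(5)] by (simp add: module_iso_def)
  obtain \<rho> where \<rho>: "\<rho> \<in> module_hom R L1 L2" "\<And>x. x \<in> carrier L1 \<Longrightarrow> \<mu> (\<phi>1 x) = \<phi>2 (\<rho> x)"
    using right_almost_split_lift[OF A m1(1) m2(1) \<mu>] by blast
  obtain \<sigma> where \<sigma>: "\<sigma> \<in> module_hom R L2 L1" "\<And>x. x \<in> carrier L2 \<Longrightarrow> ?m (\<phi>2 x) = \<phi>1 (\<sigma> x)"
    using right_almost_split_lift[OF A m2(1) m1(1) \<mu>'] by blast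
  note \<rho>c = module_homD(1)[OF \<rho>(1)] and \<sigma>c = module_homD(1)[OF \<sigma>(1)]
  have e1': "\<phi>1 x = \<phi>1 ((\<sigma> \<circ> \<rho>) x)" if x: "x \<in> carrier L1" for x
    using \<sigma>(2)[OF \<rho>c[OF x]] \<rho>(2)[OF x, symmetric] m(3)[OF module_homD(1)[OF e1(2) x]] by simp
  have "\<sigma> \<circ> \<rho> \<in> module_iso R L1 L1"
    by (rule minimal_right_almost_split_minimal[OF m1(1)]) (rule module_hom_comp[OF \<rho>(1) \<sigma>(1)], rule e1')
  then have b1: "bij_betw (\<sigma> \<circ> \<rho>) (carrier L1) (carrier L1)" by (simp add: module_iso_def)
  have e2': "\<phi>2 x = \<phi>2 ((\<rho> \<circ> \<sigma>) x)" if x: "x \<in> carrier L2" for x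
    using \<rho>(2)[OF \<sigma>c[OF x]] \<sigma>(2)[OF x, symmetric] m(4)[OF module_homD(1)[OF e2(2) x]] by simp
  have "\<rho> \<circ> \<sigma> \<in> module_iso R L2 L2"
    by (rule minimal_right_almost_split_minimal[OF m2(1)]) (rule module_hom_comp[OF \<sigma>(1) \<rho>(1)], rule e2')
  then have b2: "bij_betw (\<rho> \<circ> \<sigma>) (carrier L2) (carrier L2)" by (simp add: module_iso_def)
  have inj: "inj_on \<rho> (carrier L1)" using b1 by (auto simp: bij_betw_def dest: inj_on_imageI2)
  have "carrier L2 \<subseteq> \<rho> ` carrier L1" using b2 \<sigma>c unfolding bij_betw_def image_comp[symmetric] by blast
  then have surj: "\<rho> ` carrier L1 = carrier L2" using \<rho>c by blast
  have \<rho>i: "\<rho> \<in> module_iso R L1 L2" using \<rho>(1) inj surj by (simp add: module_iso_def bij_betw_def)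
  have im: "\<rho> (\<psi>1 x) \<in> \<psi>2 ` carrier N2" if x: "x \<in> carrier N1" for x
  proof -
    have p: "\<psi>1 x \<in> carrier L1" "\<phi>1 (\<psi>1 x) = \<zero>\<^bsub>M1\<^esub>" using e1(4) x by auto
    have "\<phi>2 (\<rho> (\<psi>1 x)) = \<zero>\<^bsub>M2\<^esub>"
      using \<rho>(2)[OF p(1)] p(2) iso_zero_iff[OF m1(4) m2(4) \<mu> module_homD(1)[OF e1(2) p(1)]] by simp
    then show ?thesis using e2(4) \<rho>c[OF p(1)] by simp
  qed
  note p1 = module_homD[OF e1(1)] and r = module_homD[OF \<rho>(1)]
  obtain \<nu> where \<nu>: "\<And>x. x \<in> carrier N1 \<Longrightarrow> \<nu> x \<in> carrier N2" "\<And>x. x \<in> carrier N1 \<Longrightarrow> \<psi>2 (\<nu> x) = \<rho> (\<psi>1 x)"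
    and h: "\<nu> \<in> module_hom R N1 N2"
  proof (rule lift_through_injective[OF m2(2) m1(2) e2(1,3), where g = "\<lambda>x. \<rho> (\<psi>1 x)" and \<tau> = "\<lambda>a. a"])
    fix \<nu> assume "\<And>x. x \<in> carrier N1 \<Longrightarrow> \<nu> x \<in> carrier N2" "\<And>x. x \<in> carrier N1 \<Longrightarrow> \<psi>2 (\<nu> x) = \<rho> (\<psi>1 x)"
      "\<And>x y. \<lbrakk>x \<in> carrier N1; y \<in> carrier N1\<rbrakk> \<Longrightarrow> \<nu> (x \<oplus>\<^bsub>N1\<^esub> y) = \<nu> x \<oplus>\<^bsub>N2\<^esub> \<nu> y"
      "\<And>a x. \<lbrakk>a \<in> carrier R; x \<in> carrier N1\<rbrakk> \<Longrightarrow> \<nu> (a \<odot>\<^bsub>N1\<^esub> x) = a \<odot>\<^bsub>N2\<^esub> \<nu> x"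
    then show thesis by (intro that[of \<nu>] module_homI)
  qed (use im p1 r in simp_all)
  have "inj_on \<nu> (carrier N1)"
  proof (rule inj_onI)
    fix x y assume xy: "x \<in> carrier N1" "y \<in> carrier N1" "\<nu> x = \<nu> y"
    then have "\<rho> (\<psi>1 x) = \<rho> (\<psi>1 y)" using \<nu>(2) by metis
    then have "\<psi>1 x = \<psi>1 y" using inj_onD[OF inj] p1(1) xy by blast
    then show "x = y" using inj_onD[OF e1(3)] xy by blast
  qed
  moreover have "y \<in> \<nu> ` carrier N1" if y: "y \<in> carrier N2" for y
  proof -
    have py: "\<psi>2 y \<in> carrier L2" "\<phi>2 (\<psi>2 y) = \<zero>\<^bsub>M2\<^esub>" using e2(4) y by auto
    obtain z where z: "z \<in> carrier L1" "\<psi>2 y = \<rho> z" using surj py(1) by auto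
    have "\<phi>1 z = \<zero>\<^bsub>M1\<^esub>" using \<rho>(2)[OF z(1)] z(2) py(2) iso_zero_iff[OF m1(4) m2(4) \<mu> module_homD(1)[OF e1(2) z(1)]] by simp
    then have "z \<in> \<psi>1 ` carrier N1" using e1(4) z(1) by simp
    then obtain x where x: "x \<in> carrier N1" "z = \<psi>1 x" by blast
    then have "\<nu> x = y" using \<nu> z(2) y inj_onD[OF e2(3)] by metis
    then show ?thesis using x(1) by blast
  qed
  ultimately have "\<nu> \<in> module_iso R N1 N2" using h \<nu>(1) by (auto simp: module_iso_def bij_betw_def)
  then show ?thesis unfolding isomorphic_sequences_def using \<rho>i \<mu> \<rho>(2) \<nu>(2) by (intro bexI[of _ \<nu>] bexI[of _ \<rho>] bexI[of _ \<mu>]) auto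
qed

context frobenius_algebra
begin

text \<open>Since \<open>\<theta>P\<close> lies over \<open>\<theta>\<close>, it preserves the
  kernel of \<open>\<phi>\<close>, and this defines \<open>\<theta>N\<close>. Left exactness on
  fixed points is then immediate; surjectivity is where traces enter.\<close>

lemma fixed_points_almost_split:
  assumes as: "almost_split L A N P M \<psi> \<phi>"
    and P: "tfrob r P \<theta>P" and M: "tfrob r M \<theta>" "aperiodic r M"
    and comm: "\<And>x. x \<in> carrier P \<Longrightarrow> \<phi> (\<theta>P x) = \<theta> (\<phi> x)"
  obtains \<theta>N where "tfrob r N \<theta>N" "\<And>x. x \<in> carrier N \<Longrightarrow> \<psi> (\<theta>N x) = \<theta>P (\<psi> x)"
    "almost_split K1 AF (fixed_points \<theta>N N) (fixed_points \<theta>P P) (fixed_points \<theta> M) \<psi> \<phi>"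
proof -
  let ?FM = "fixed_points \<theta> M"
  let ?FP = "fixed_points \<theta>P P"
  have \<phi>: "minimal_right_almost_split L A P M \<phi>" and N: "fd_module L A N" "left_module A N"
    and e: "\<psi> \<in> module_hom A N P" "\<phi> \<in> module_hom A P M" "inj_on \<psi> (carrier N)"
    "\<psi> ` carrier N = {x \<in> carrier P. \<phi> x = \<zero>\<^bsub>M\<^esub>}" "\<phi> ` carrier P = carrier M"
    using as by (auto simp: almost_split_def fd_module_def short_exact_def)
  note DP = tfrobD[OF P] and DM = tfrobD[OF M(1)]
  interpret P: left_module A P by (rule DP(1))
  note p = module_homD[OF e(1)]
  have \<theta>0: "\<theta> \<zero>\<^bsub>M\<^esub> = \<zero>\<^bsub>M\<^esub>" by (rule tlin_0[OF DM(5,1,1)])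
  have im: "\<theta>P (\<psi> x) \<in> \<psi> ` carrier N" if x: "x \<in> carrier N" for x
  proof -
    have "\<psi> x \<in> carrier P" "\<phi> (\<psi> x) = \<zero>\<^bsub>M\<^esub>" using e(4) x by auto
    then show ?thesis using e(4) comm \<theta>0 tlinD(1)[OF DP(5)] by simp
  qed
  obtain \<theta>N where t: "\<And>x. x \<in> carrier N \<Longrightarrow> \<theta>N x \<in> carrier N" "\<And>x. x \<in> carrier N \<Longrightarrow> \<psi> (\<theta>N x) = \<theta>P (\<psi> x)"
    and tl: "tlin 0 r N N \<theta>N"
  proof (rule lift_through_injective[OF N(2) N(2) e(1,3), where g = "\<lambda>x. \<theta>P (\<psi> x)" and \<tau> = "FA ^^ r"])
    fix \<nu> assume "\<And>x. x \<in> carrier N \<Longrightarrow> \<nu> x \<in> carrier N" "\<And>x. x \<in> carrier N \<Longrightarrow> \<psi> (\<nu> x) = \<theta>P (\<psi> x)"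
      "\<And>x y. \<lbrakk>x \<in> carrier N; y \<in> carrier N\<rbrakk> \<Longrightarrow> \<nu> (x \<oplus>\<^bsub>N\<^esub> y) = \<nu> x \<oplus>\<^bsub>N\<^esub> \<nu> y"
      "\<And>a x. \<lbrakk>a \<in> carrier A; x \<in> carrier N\<rbrakk> \<Longrightarrow> \<nu> (a \<odot>\<^bsub>N\<^esub> x) = (FA ^^ r) a \<odot>\<^bsub>N\<^esub> \<nu> x"
    then show thesis by (intro that[of \<nu>] tlinI) simp_all
  qed (use im p tlinD(2)[OF DP(5)] tlinD(3)[OF DP(5)] FA_closed in simp_all)
  have per: "\<exists>n>0. (\<theta>N ^^ n) x = x" if x: "x \<in> carrier N" for x
  proof -
    obtain n where n: "n > 0" "(\<theta>P ^^ n) (\<psi> x) = \<psi> x" using P p(1)[OF x] by (auto simp: tfrob_def)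
    have "(\<theta>N ^^ k) x \<in> carrier N \<and> \<psi> ((\<theta>N ^^ k) x) = (\<theta>P ^^ k) (\<psi> x)" for k
      by (induction k) (use x t in auto)
    then have "(\<theta>N ^^ n) x = x" using n(2) inj_onD[OF e(3)] x by metis
    then show ?thesis using n(1) by blast
  qed
  have tN: "tfrob r N \<theta>N" using N(1) DP(4) tl per by (simp add: tfrob_def)
  have tfix: "\<theta>N x = x \<longleftrightarrow> \<theta>P (\<psi> x) = \<psi> x" if x: "x \<in> carrier N" for x
    using inj_on_eq_iff[OF e(3) t(1)[OF x] x] t(2)[OF x] by simp
  have "short_exact AF (fixed_points \<theta>N N) ?FP ?FM \<psi> \<phi>"
    unfolding short_exact_def
  proof (intro conjI)
    show "\<psi> \<in> module_hom AF (fixed_points \<theta>N N) ?FP"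
    proof (rule module_hom_fixed_points[OF e(1)])
      show "\<theta>P (\<psi> x) = \<psi> x" if "x \<in> carrier N" "\<theta>N x = x" for x using tfix that by blast
    qed
    show "\<phi> \<in> module_hom AF ?FP ?FM"
    proof (rule module_hom_fixed_points[OF e(2)])
      show "\<theta> (\<phi> x) = \<phi> x" if "x \<in> carrier P" "\<theta>P x = x" for x using comm[OF that(1)] that(2) by simp
    qed
    show "inj_on \<psi> (carrier (fixed_points \<theta>N N))" using e(3) by (auto simp: inj_on_def)
    show "\<psi> ` carrier (fixed_points \<theta>N N) = {x \<in> carrier ?FP. \<phi> x = \<zero>\<^bsub>?FM\<^esub>}"
    proof (intro equalityI subsetI)
      fix y assume "y \<in> {x \<in> carrier ?FP. \<phi> x = \<zero>\<^bsub>?FM\<^esub>}"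
      then have y: "y \<in> carrier P" "\<theta>P y = y" "\<phi> y = \<zero>\<^bsub>M\<^esub>" by auto
      then have "y \<in> \<psi> ` carrier N" using e(4) by simp
      then obtain x where "x \<in> carrier N" "y = \<psi> x" by blast
      then show "y \<in> \<psi> ` carrier (fixed_points \<theta>N N)" using tfix y(2) by auto
    next
      fix y assume "y \<in> \<psi> ` carrier (fixed_points \<theta>N N)"
      then obtain x where x: "x \<in> carrier N" "\<theta>N x = x" "y = \<psi> x" by auto
      then have "y \<in> {x \<in> carrier P. \<phi> x = \<zero>\<^bsub>M\<^esub>}" using e(4) by blast
      then show "y \<in> {x \<in> carrier ?FP. \<phi> x = \<zero>\<^bsub>?FM\<^esub>}" using tfix[OF x(1)] x by simp
    qed
    \<comment> \<open>Any preimage of the fixed vector m is replaced by its trace with a scalar c of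
      trace one, which is fixed and still maps to m.\<close>
    have "m \<in> \<phi> ` carrier ?FP" if m: "m \<in> carrier M" "\<theta> m = m" for m
    proof -
      have "m \<in> \<phi> ` carrier P" using e(5) m(1) by simp
      then obtain x where x: "x \<in> carrier P" "m = \<phi> x" by blast
      obtain n where n: "n > 0" "(\<theta>P ^^ n) x = x" using P x(1) by (auto simp: tfrob_def)
      obtain c where c: "c \<in> fixed (r * n)" "(\<Oplus>l\<in>{..<n}. c [^] (q ^ (r * l))) = \<one>" using trace_one[OF DP(4) n(1)] .
      have cL: "c \<in> carrier L" by (rule fixed_closed[OF c(1)])
      have "tr (bs P) \<theta>P n c x \<in> fixpts (bs P) \<theta>P" using tr_fix[OF DP(2,7) _ n(2) c(1)] x(1) by simp
      moreover have "\<phi> (tr (bs P) \<theta>P n c x) = m"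
        using tr_equivariant[OF P M(1) e(2) comm x(1) cL] tr_fixed_point[OF DM(2,7) _ m(2) cL c(2)] m(1) x(2) by simp
      ultimately show ?thesis unfolding fixpts_carrier by blast
    qed
    then show "\<phi> ` carrier ?FP = carrier ?FM"
      using comm module_homD(1)[OF e(2)] by fastforce
  qed
  then have "almost_split K1 AF (fixed_points \<theta>N N) ?FP ?FM \<psi> \<phi>"
    using fixed_points_minimal_right_almost_split[OF \<phi> P M comm] fd_fixed_points[OF tN] fd_fixed_points[OF P] fd_fixed_points[OF M(1)]
    by (simp add: almost_split_def)
  then show thesis using that tN t(2) by blast
qed

lemma induced_minimal_right_almost_split:
  assumes \<phi>: "minimal_right_almost_split L A P M \<phi>"
    and F: "frobenius_map q L (bs P) FP" "frobenius_map q L (bs M) FM"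
  shows "\<exists>Pt GP Mt GM \<phi>t. induced_morphism L A FA P FP M FM \<phi> Pt GP Mt GM \<phi>t \<and>
    F_stable q L A FA Pt GP \<and> F_stable q L A FA Mt GM \<and> \<phi>t \<in> F_stable_hom A Pt GP Mt GM \<and>
    minimal_right_almost_split K1 AF (fixed_points GP Pt) (fixed_points GM Mt) \<phi>t"
proof -
  note fF = frob_frobenius_map[OF F(1)] frob_frobenius_map[OF F(2)]
  have M: "fd_module L A M" and \<phi>h: "\<phi> \<in> module_hom A P M" using \<phi> by (auto simp: minimal_right_almost_split_def)
  define r where "r = period A FA FM M"
  obtain \<theta> where \<theta>: "tfrob r M \<theta>" "aperiodic r M" using period_semilinear[OF M fF(2)] unfolding r_def by blast
  obtain \<theta>P where \<theta>P: "tfrob r P \<theta>P" "\<And>x. x \<in> carrier P \<Longrightarrow> \<phi> (\<theta>P x) = \<theta> (\<phi> x)" using lift_semilinear[OF \<phi> fF(1) \<theta>(1)] by blast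
  obtain P' \<alpha> where P': "frame r P \<theta>P FP P' \<alpha>" using frame_exists[OF \<theta>P(1) fF(1)] .
  obtain M' \<beta> where M': "frame r M \<theta> FM M' \<beta>" using frame_exists[OF \<theta>(1) fF(2)] .
  obtain \<phi>' where \<phi>': "periodic_composite r P FP FM \<phi> \<alpha> \<beta> \<phi>'"
    "diag_hom r P' FP FM \<phi>' \<in> F_stable_hom A (twist_sum A FA r FP P') (cyclic_frobenius r FP) (twist_sum A FA r FM M') (cyclic_frobenius r FM)"
    "\<And>x. x \<in> carrier P \<Longrightarrow> diag_hom r P' FP FM \<phi>' (orbit r FP (\<alpha> x)) = orbit r FM (\<beta> (\<phi> x))"
    using induced_hom[OF P' M' \<phi>h \<theta>P(2)] by blast
  note tP = frame_tfrob[OF P'] and tM = frame_tfrob[OF M']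
  have "minimal_right_almost_split K1 AF (fixed_points (cyclic_frobenius r FP) (twist_sum A FA r FP P'))
      (fixed_points (cyclic_frobenius r FM) (twist_sum A FA r FM M')) (diag_hom r P' FP FM \<phi>')"
    by (rule minimal_right_almost_split_iso[OF fixed_points_minimal_right_almost_split[OF \<phi> \<theta>P(1) \<theta> \<theta>P(2)] fd_fixed_points[OF tP]
        fd_fixed_points[OF tM] frame_iso[OF P'] frame_iso[OF M'] F_stable_hom_fixed_points[OF tP \<phi>'(2)]]) (use \<phi>'(3) in auto)
  moreover have "induced_morphism L A FA P FP M FM \<phi> (twist_sum A FA r FP P') (cyclic_frobenius r FP)
      (twist_sum A FA r FM M') (cyclic_frobenius r FM) (diag_hom r P' FP FM \<phi>')"
    unfolding induced_morphism_def r_def[symmetric] Let_def using frameD(2)[OF P'] frameD(2)[OF M'] \<phi>'(1) by blast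
  ultimately show ?thesis using tfrob_F_stable[OF tP] tfrob_F_stable[OF tM] \<phi>'(2) by blast
qed

text \<open>The last conclusion identifies the end term with \<open>M\<^sup>\<theta>\<close>. The
  converse uses it to compare the induced sequence with a given one.\<close>

lemma induced_almost_split:
  assumes as: "almost_split L A N P M \<psi> \<phi>"
    and F: "frobenius_map q L (bs N) FN" "frobenius_map q L (bs P) FP" "frobenius_map q L (bs M) FM"
    and \<theta>: "tfrob r M \<theta>" "aperiodic r M" and r: "r = period A FA FM M"
  shows "\<exists>Nt GN Pt GP Mt GM \<psi>t \<phi>t. induced_sequence L A FA N FN P FP M FM \<psi> \<phi> Nt GN Pt GP Mt GM \<psi>t \<phi>t \<and>
    F_stable q L A FA Nt GN \<and> F_stable q L A FA Pt GP \<and> F_stable q L A FA Mt GM \<and>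
    \<psi>t \<in> F_stable_hom A Nt GN Pt GP \<and> \<phi>t \<in> F_stable_hom A Pt GP Mt GM \<and>
    almost_split K1 AF (fixed_points GN Nt) (fixed_points GP Pt) (fixed_points GM Mt) \<psi>t \<phi>t \<and>
    module_iso AF (fixed_points \<theta> M) (fixed_points GM Mt) \<noteq> {}"
proof -
  let ?GP = "cyclic_frobenius r FP"
  note fF = frob_frobenius_map[OF F(1)] frob_frobenius_map[OF F(2)] frob_frobenius_map[OF F(3)]
  have \<phi>: "minimal_right_almost_split L A P M \<phi>" and h: "\<phi> \<in> module_hom A P M" "\<psi> \<in> module_hom A N P"
    using as by (auto simp: almost_split_def short_exact_def)
  obtain \<theta>P where \<theta>P: "tfrob r P \<theta>P" "\<And>x. x \<in> carrier P \<Longrightarrow> \<phi> (\<theta>P x) = \<theta> (\<phi> x)" using lift_semilinear[OF \<phi> fF(2) \<theta>(1)] by blast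
  obtain \<theta>N where \<theta>N: "tfrob r N \<theta>N" "\<And>x. x \<in> carrier N \<Longrightarrow> \<psi> (\<theta>N x) = \<theta>P (\<psi> x)"
    and as': "almost_split K1 AF (fixed_points \<theta>N N) (fixed_points \<theta>P P) (fixed_points \<theta> M) \<psi> \<phi>"
    using fixed_points_almost_split[OF as \<theta>P(1) \<theta> \<theta>P(2)] by blast
  obtain N' \<nu> where N': "frame r N \<theta>N FN N' \<nu>" using frame_exists[OF \<theta>N(1) fF(1)] .
  obtain P' \<alpha> where P': "frame r P \<theta>P FP P' \<alpha>" using frame_exists[OF \<theta>P(1) fF(2)] .
  obtain M' \<beta> where M': "frame r M \<theta> FM M' \<beta>" using frame_exists[OF \<theta>(1) fF(3)] .
  obtain \<phi>' where \<phi>': "periodic_composite r P FP FM \<phi> \<alpha> \<beta> \<phi>'"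
    "diag_hom r P' FP FM \<phi>' \<in> F_stable_hom A (twist_sum A FA r FP P') ?GP (twist_sum A FA r FM M') (cyclic_frobenius r FM)"
    "\<And>x. x \<in> carrier P \<Longrightarrow> diag_hom r P' FP FM \<phi>' (orbit r FP (\<alpha> x)) = orbit r FM (\<beta> (\<phi> x))"
    using induced_hom[OF P' M' h(1) \<theta>P(2)] by blast
  obtain \<psi>' where \<psi>': "periodic_composite r N FN FP \<psi> \<nu> \<alpha> \<psi>'"
    "diag_hom r N' FN FP \<psi>' \<in> F_stable_hom A (twist_sum A FA r FN N') (cyclic_frobenius r FN) (twist_sum A FA r FP P') ?GP"
    "\<And>x. x \<in> carrier N \<Longrightarrow> diag_hom r N' FN FP \<psi>' (orbit r FN (\<nu> x)) = orbit r FP (\<alpha> (\<psi> x))"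
    using induced_hom[OF N' P' h(2) \<theta>N(2)] by blast
  note tN = frame_tfrob[OF N'] and tP = frame_tfrob[OF P'] and tM = frame_tfrob[OF M']
  have "almost_split K1 AF (fixed_points (cyclic_frobenius r FN) (twist_sum A FA r FN N'))
      (fixed_points ?GP (twist_sum A FA r FP P'))
      (fixed_points (cyclic_frobenius r FM) (twist_sum A FA r FM M')) (diag_hom r N' FN FP \<psi>') (diag_hom r P' FP FM \<phi>')"
    by (rule almost_split_iso[OF as' fd_fixed_points[OF tN] fd_fixed_points[OF tP] fd_fixed_points[OF tM]
        frame_iso[OF N'] frame_iso[OF P'] frame_iso[OF M'] F_stable_hom_fixed_points[OF tN \<psi>'(2)] _
        F_stable_hom_fixed_points[OF tP \<phi>'(2)]]) (use \<phi>'(3) \<psi>'(3) in auto)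
  moreover have "induced_sequence L A FA N FN P FP M FM \<psi> \<phi> (twist_sum A FA r FN N') (cyclic_frobenius r FN)
      (twist_sum A FA r FP P') ?GP (twist_sum A FA r FM M') (cyclic_frobenius r FM)
      (diag_hom r N' FN FP \<psi>') (diag_hom r P' FP FM \<phi>')"
    unfolding induced_sequence_def r[symmetric] Let_def
    using frameD(2)[OF N'] frameD(2)[OF P'] frameD(2)[OF M'] \<phi>'(1) \<psi>'(1) by blast
  ultimately show ?thesis
    using tfrob_F_stable[OF tN] tfrob_F_stable[OF tP] tfrob_F_stable[OF tM] \<phi>'(2) \<psi>'(2) frame_iso[OF M'] by blast
qed

end

section \<open>Almost split sequences of fixed point modules\<close>

lemma (in vectorspace) subspace_dim_less:
  assumes fd: "fin_dim" and W: "submodule K W V" "W \<noteq> carrier V"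
  shows "vectorspace.dim K (vs W) < dim"
proof -
  interpret W: vectorspace K "vs W"
    using W by (intro subspace_is_vs) (simp add: subspace_def vectorspace_axioms)
  obtain B where B: "finite B" "W.basis B" using W.finite_basis_exists[OF subspace_fin_dim[OF fd W(1)]] by blast
  then have BW: "B \<subseteq> W" "W.lin_indpt B" "W.span B = W" by (auto simp: W.basis_def)
  have li: "lin_indpt B" and sp: "span B = W" using span_li_not_depend[OF BW(1) W(1)] BW(2,3) by auto
  have BV: "B \<subseteq> carrier V" using BW(1) W(1) by (auto simp: submodule_def)
  have "card B \<noteq> dim"
  proof
    assume "card B = dim"
    then have "basis B" using dim_li_is_basis[OF fd B(1) BV li] by simp
    then show False using sp W(2) by (simp add: basis_def)
  qed
  then show ?thesis using li_le_dim(2)[OF fd BV li] W.dim_basis[OF B] by simp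
qed

lemma idempotent_surj:
  assumes "\<And>x. x \<in> S \<Longrightarrow> e (e x) = e x" "e ` S = S" "x \<in> S" shows "e x = x"
proof -
  obtain y where "y \<in> S" "x = e y" using assms(2,3) by auto
  then show ?thesis using assms(1) by simp
qed

lemma module_hom_restrict:
  assumes "h \<in> module_hom R M N" "W \<subseteq> carrier M" shows "h \<in> module_hom R (M\<lparr>carrier := W\<rparr>) N"
  by (rule module_homI) (use module_homD[OF assms(1)] assms(2) in \<open>simp_all add: subset_iff\<close>)

lemma funpow_surj:
  assumes f: "\<And>x. x \<in> S \<Longrightarrow> f x \<in> S" and m: "m > 0" "(f ^^ m) ` S = S" shows "f ` S = S"
proof -
  obtain l where l: "m = Suc l" using m(1) by (cases m) auto
  have "(f ^^ l) ` S \<subseteq> S" by (induction l) (use f in auto)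
  then have "(f ^^ m) ` S \<subseteq> f ` S" unfolding l funpow.simps image_comp[symmetric] by blast
  then show ?thesis using f m(2) by blast
qed

text \<open>The end term of an almost split morphism is indecomposable: with s a section of t, the
  identity of M is the sum of the idempotents e = s t and f = 1 - e. The argument of
  \<open>right_almost_split_local\<close> is repeated for idempotents, since \<open>R\<close> will
  be the algebra of fixed points.\<close>

lemma split_epi_from_local_iso:
  assumes A: "fd_algebra K R" and \<phi>: "minimal_right_almost_split K R P M \<phi>" and Z: "left_module R Z" "\<exists>z\<in>carrier Z. z \<noteq> \<zero>\<^bsub>Z\<^esub>"
    and t: "t \<in> module_hom R M Z" "split_epi R M Z t"
  shows "t \<in> module_iso R M Z"
proof -
  have M: "fd_module K R M" "left_module R M" and \<phi>h: "\<phi> \<in> module_hom R P M" "\<not> split_epi R P M \<phi>" and P: "left_module R P"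
    using \<phi> by (auto simp: minimal_right_almost_split_def fd_module_def)
  interpret M: left_module R M by (rule M(2))
  interpret P: left_module R P by (rule P)
  interpret Z: left_module R Z by (rule Z(1))
  obtain s where s: "s \<in> module_hom R Z M" "\<And>z. z \<in> carrier Z \<Longrightarrow> t (s z) = z" using t(2) by (auto simp: split_epi_def)
  define e where "e = s \<circ> t"
  define f where "f x = x \<oplus>\<^bsub>M\<^esub> (\<ominus>\<^bsub>R\<^esub> \<one>\<^bsub>R\<^esub>) \<odot>\<^bsub>M\<^esub> e x" for x
  have eh: "e \<in> module_hom R M M" unfolding e_def by (rule module_hom_comp[OF t(1) s(1)])
  note ec = module_homD(1)[OF eh]
  have ee: "e (e x) = e x" if "x \<in> carrier M" for x using s(2)[OF module_homD(1)[OF t(1) that]] by (simp add: e_def)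
  have m1: "\<ominus>\<^bsub>R\<^esub> \<one>\<^bsub>R\<^esub> \<in> carrier R" by simp
  have neg: "x \<oplus>\<^bsub>M\<^esub> (\<ominus>\<^bsub>R\<^esub> \<one>\<^bsub>R\<^esub>) \<odot>\<^bsub>M\<^esub> x = \<zero>\<^bsub>M\<^esub>" if x: "x \<in> carrier M" for x
    using M.lm_l_distr[of "\<one>\<^bsub>R\<^esub>" "\<ominus>\<^bsub>R\<^esub> \<one>\<^bsub>R\<^esub>" x] x M.lm_one[OF x] M.zero_smult[OF x] M.A.r_neg[OF M.A.one_closed] by simp
  have m1c: "(\<ominus>\<^bsub>R\<^esub> \<one>\<^bsub>R\<^esub>) \<odot>\<^bsub>M\<^esub> x \<in> carrier M" if "x \<in> carrier M" for x using M.lm_closed[OF m1 that] .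
  have fc: "f x \<in> carrier M" if "x \<in> carrier M" for x using that ec m1c by (simp add: f_def)
  have fh: "f \<in> module_hom R M M"
  proof (rule module_homI)
    fix x assume x: "x \<in> carrier M"
    show "f x \<in> carrier M" by (rule fc[OF x])
    show "f (x \<oplus>\<^bsub>M\<^esub> y) = f x \<oplus>\<^bsub>M\<^esub> f y" if y: "y \<in> carrier M" for y
      using module_homD(2)[OF eh x y] M.lm_r_distr[OF m1 ec[OF x] ec[OF y]] x y ec m1c by (simp add: f_def M.M.a_ac)
    show "f (a \<odot>\<^bsub>M\<^esub> x) = a \<odot>\<^bsub>M\<^esub> f x" if a: "a \<in> carrier R" for a
    proof -
      have "(\<ominus>\<^bsub>R\<^esub> \<one>\<^bsub>R\<^esub>) \<odot>\<^bsub>M\<^esub> (a \<odot>\<^bsub>M\<^esub> e x) = a \<odot>\<^bsub>M\<^esub> ((\<ominus>\<^bsub>R\<^esub> \<one>\<^bsub>R\<^esub>) \<odot>\<^bsub>M\<^esub> e x)"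
        using M.lm_assoc[OF m1 a ec[OF x]] M.lm_assoc[OF a m1 ec[OF x]] a by (simp add: M.A.l_minus M.A.r_minus)
      then show ?thesis using module_homD(3)[OF eh a x] M.lm_r_distr[OF a x m1c[OF ec[OF x]]] by (simp add: f_def)
    qed
  qed
  have ef: "e x \<oplus>\<^bsub>M\<^esub> f x = x" if x: "x \<in> carrier M" for x
  proof -
    have "e x \<oplus>\<^bsub>M\<^esub> f x = x \<oplus>\<^bsub>M\<^esub> (e x \<oplus>\<^bsub>M\<^esub> (\<ominus>\<^bsub>R\<^esub> \<one>\<^bsub>R\<^esub>) \<odot>\<^bsub>M\<^esub> e x)"
      using x ec m1c by (simp add: f_def M.M.a_ac)
    then show ?thesis using neg[OF ec[OF x]] x by simp
  qed
  have e0f: "e x = \<zero>\<^bsub>M\<^esub>" if x: "x \<in> carrier M" "f x = x" for x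
    using ef[OF x(1)] x ec[OF x(1)] by simp
  have f0: "f (e x) = \<zero>\<^bsub>M\<^esub>" if x: "x \<in> carrier M" for x using ee[OF x] neg[OF ec[OF x]] by (simp add: f_def)
  have ff: "f (f x) = f x" if x: "x \<in> carrier M" for x
    using module_homD(2)[OF fh ec[OF x] fc[OF x]] ef[OF x] f0[OF x] fc[OF fc[OF x]] by simp
  obtain w where w: "w \<in> carrier Z" "w \<noteq> \<zero>\<^bsub>Z\<^esub>" using Z(2) by blast
  have t0: "t \<zero>\<^bsub>M\<^esub> = \<zero>\<^bsub>Z\<^esub>"
    by (rule additive_zero[OF M.M.abelian_group_axioms Z.M.abelian_group_axioms]) (use module_homD[OF t(1)] in auto)
  \<comment> \<open>A surjective idempotent is the identity; for f this would mean e = 0 and hence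
    \<open>Z\<close> = 0.\<close>
  have nf: "\<not> split_epi R M M f"
  proof
    assume "split_epi R M M f"
    then have "f x = x" if "x \<in> carrier M" for x using idempotent_surj[OF ff split_epi_surj[OF _ fh] that] by blast
    then have "e (s w) = \<zero>\<^bsub>M\<^esub>" using e0f module_homD(1)[OF s(1) w(1)] by blast
    then have "t (s (t (s w))) = \<zero>\<^bsub>Z\<^esub>" using t0 by (simp add: e_def)
    then show False using s(2) w by simp
  qed
  \<comment> \<open>Otherwise both e and f factor through \<open>\<phi>\<close>, and so does their
    sum, the identity.\<close>
  have "split_epi R M M e"
  proof (rule ccontr)
    assume ne: "\<not> split_epi R M M e"
    obtain g where g: "g \<in> module_hom R M P" "\<And>x. x \<in> carrier M \<Longrightarrow> e x = \<phi> (g x)"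
      using minimal_right_almost_split_factors[OF A \<phi> M(1) eh ne] by blast
    obtain h where h: "h \<in> module_hom R M P" "\<And>x. x \<in> carrier M \<Longrightarrow> f x = \<phi> (h x)"
      using minimal_right_almost_split_factors[OF A \<phi> M(1) fh nf] by blast
    note gh = module_homD[OF g(1)] module_homD[OF h(1)]
    have "(\<lambda>x. g x \<oplus>\<^bsub>P\<^esub> h x) \<in> module_hom R M P"
      by (rule module_homI) (use gh P.lm_r_distr in \<open>simp_all add: P.M.a_ac\<close>)
    moreover have "\<phi> (g x \<oplus>\<^bsub>P\<^esub> h x) = x" if x: "x \<in> carrier M" for x
      using module_homD(2)[OF \<phi>h(1) gh(1)[OF x] gh(4)[OF x]] g(2)[OF x] h(2)[OF x] ef[OF x] by simp
    ultimately have "split_epi R P M \<phi>" unfolding split_epi_def by (intro bexI[of _ "\<lambda>x. g x \<oplus>\<^bsub>P\<^esub> h x"]) auto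
    then show False using \<phi>h(2) by blast
  qed
  then have e1: "e x = x" if "x \<in> carrier M" for x using idempotent_surj[OF ee split_epi_surj[OF _ eh] that] by blast
  have "bij_betw t (carrier M) (carrier Z)"
    by (rule bij_betwI[where g = s]) (use module_homD(1)[OF t(1)] module_homD(1)[OF s(1)] e1 s(2) in \<open>auto simp: e_def\<close>)
  then show ?thesis using t(1) by (simp add: module_iso_def)
qed

context frobenius_algebra
begin

section \<open>Indecomposable summands and minimal versions of morphisms\<close>

lemma fd_submodule:
  assumes M: "fd_module L A M" and W: "W \<subseteq> carrier M" "\<zero>\<^bsub>M\<^esub> \<in> W" "\<And>x y. \<lbrakk>x \<in> W; y \<in> W\<rbrakk> \<Longrightarrow> x \<oplus>\<^bsub>M\<^esub> y \<in> W"
    "\<And>a x. \<lbrakk>a \<in> carrier A; x \<in> W\<rbrakk> \<Longrightarrow> a \<odot>\<^bsub>M\<^esub> x \<in> W"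
  shows "fd_module L A (M\<lparr>carrier := W\<rparr>)"
    "W \<noteq> carrier M \<Longrightarrow> vectorspace.dim L (bs (M\<lparr>carrier := W\<rparr>)) < vectorspace.dim L (bs M)"
proof -
  have lm: "left_module A M" and fd: "vectorspace.fin_dim L (bs M)" using M by (auto simp: fd_module_def)
  interpret M: left_module A M by (rule lm)
  interpret V: vectorspace L "bs M" by (rule vs_bs[OF lm])
  have Wc: "x \<in> carrier M" if "x \<in> W" for x using W(1) that by blast
  have "abelian_group (M\<lparr>carrier := W\<rparr>)"
  proof (rule abelian_groupI)
    fix x assume "x \<in> carrier (M\<lparr>carrier := W\<rparr>)"
    then have x: "x \<in> W" by simp
    let ?y = "(\<ominus> \<one>) \<odot>\<^bsub>bs M\<^esub> x"
    have "?y = \<ominus>\<^bsub>bs M\<^esub> x" using V.smult_l_minus[of \<one> x] Wc[OF x] by simp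
    then have "?y \<oplus>\<^bsub>M\<^esub> x = \<zero>\<^bsub>M\<^esub>" using V.M.l_neg[of x] Wc[OF x] by simp
    moreover have "?y \<in> W" using W(4)[OF _ x] AV.smult_closed by (simp add: base_space_simps(4))
    ultimately show "\<exists>y\<in>carrier (M\<lparr>carrier := W\<rparr>). y \<oplus>\<^bsub>M\<lparr>carrier := W\<rparr>\<^esub> x = \<zero>\<^bsub>M\<lparr>carrier := W\<rparr>\<^esub>"
      by (intro bexI[of _ ?y]) simp_all
  qed (use W Wc in \<open>simp_all add: M.M.a_ac\<close>)
  then have lW: "left_module A (M\<lparr>carrier := W\<rparr>)"
    unfolding left_module_def left_module_axioms_def
    using W(4) Wc M.lm_l_distr M.lm_r_distr M.lm_assoc M.lm_one ring_A by simp
  have eq: "bs (M\<lparr>carrier := W\<rparr>) = V.vs W" by (simp add: base_space_def)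
  have sub: "submodule L W (bs M)"
    unfolding submodule_def using W V.module_axioms AV.smult_closed by (simp add: base_space_simps(4))
  show "fd_module L A (M\<lparr>carrier := W\<rparr>)" using lW V.subspace_fin_dim[OF fd sub] by (simp add: fd_module_def eq)
  show "W \<noteq> carrier M \<Longrightarrow> vectorspace.dim L (bs (M\<lparr>carrier := W\<rparr>)) < vectorspace.dim L (bs M)"
    using V.subspace_dim_less[OF fd sub] by (simp add: eq)
qed

lemma fd_image:
  assumes M: "fd_module L A M" and e: "e \<in> module_hom A M M"
  shows "fd_module L A (M\<lparr>carrier := e ` carrier M\<rparr>)"
    "e ` carrier M \<noteq> carrier M \<Longrightarrow> vectorspace.dim L (bs (M\<lparr>carrier := e ` carrier M\<rparr>)) < vectorspace.dim L (bs M)"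
proof -
  have lm: "left_module A M" using M by (simp add: fd_module_def)
  interpret M: left_module A M by (rule lm)
  note h = module_homD[OF e]
  have z: "e \<zero>\<^bsub>M\<^esub> = \<zero>\<^bsub>M\<^esub>" by (rule tlin_0[OF hom_tlin[OF e] lm lm])
  have "e ` carrier M \<subseteq> carrier M" using h(1) by blast
  moreover have "\<zero>\<^bsub>M\<^esub> \<in> e ` carrier M" using z by (metis M.M.zero_closed imageI)
  moreover have "x \<oplus>\<^bsub>M\<^esub> y \<in> e ` carrier M" if "x \<in> e ` carrier M" "y \<in> e ` carrier M" for x y
    using that h(2) by (metis (no_types, lifting) M.M.a_closed imageE imageI)
  moreover have "a \<odot>\<^bsub>M\<^esub> x \<in> e ` carrier M" if "a \<in> carrier A" "x \<in> e ` carrier M" for a x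
    using that h(3) by (metis (no_types, lifting) M.lm_closed imageE imageI)
  ultimately show "fd_module L A (M\<lparr>carrier := e ` carrier M\<rparr>)"
    "e ` carrier M \<noteq> carrier M \<Longrightarrow> vectorspace.dim L (bs (M\<lparr>carrier := e ` carrier M\<rparr>)) < vectorspace.dim L (bs M)"
    using fd_submodule[OF M, of "e ` carrier M"] by auto
qed

lemma fd_tfrob:
  assumes M: "fd_module L A M" and F: "frob (Suc 0) (bs M) F"
  obtains r \<theta> where "tfrob r M \<theta>"
proof -
  have lm: "left_module A M" using M by (simp add: fd_module_def)
  obtain n where n: "n > 0" "tlin 0 n M M (F ^^ n)" using frob_power_tlin[OF M F] .
  have "tfrob n M (F ^^ n)" using M n frob_funpow[OF vs_bs[OF lm] F n(1)] by (simp add: tfrob_def frob_def)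
  then show thesis by (rule that)
qed

lemma hom_funpow: fixes M :: "('a, 'm) module" shows "u \<in> module_hom A M M \<Longrightarrow> (u ^^ n) \<in> module_hom A M M"
  using tlin_funpow[of 0 0 M u n] by (simp add: tlin_module_hom)

text \<open>A nonzero direct summand of least dimension has a local endomorphism ring. Given f + g =
  1, an idempotent power e of f is either zero, or its image is again a nonzero summand and hence
  everything.\<close>

lemma local_summand_exists:
  fixes T :: "('a, 't) module"
  assumes T: "fd_module L A T" "\<exists>x\<in>carrier T. x \<noteq> \<zero>\<^bsub>T\<^esub>"
    and Fr: "\<And>V :: ('a, nat \<Rightarrow> 'k) module. fd_module L A V \<Longrightarrow> frob (Suc 0) (bs V) (Fr V)"
  obtains M :: "('a, nat \<Rightarrow> 'k) module" and p i where "fd_module L A M" "local_module M"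
    "p \<in> module_hom A T M" "i \<in> module_hom A M T" "\<And>x. x \<in> carrier M \<Longrightarrow> p (i x) = x"
proof -
  define Q where "Q M \<longleftrightarrow> fd_module L A M \<and> (\<exists>x\<in>carrier M. x \<noteq> \<zero>\<^bsub>M\<^esub>) \<and>
    (\<exists>p\<in>module_hom A T M. \<exists>i\<in>module_hom A M T. \<forall>x\<in>carrier M. p (i x) = x)" for M :: "('a, nat \<Rightarrow> 'k) module"
  have lT: "left_module A T" using T(1) by (simp add: fd_module_def)
  obtain M0 :: "('a, nat \<Rightarrow> 'k) module" and e where e: "fd_module L A M0" "e \<in> module_iso A T M0"
    using fd_module_iso_standard[OF fd_A T(1)] .
  have lM0: "left_module A M0" using e(1) by (simp add: fd_module_def)
  note h = module_isoD[OF e(2) lT]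
  obtain x where "x \<in> carrier T" "x \<noteq> \<zero>\<^bsub>T\<^esub>" using T(2) by blast
  then have "\<exists>x\<in>carrier M0. x \<noteq> \<zero>\<^bsub>M0\<^esub>" using iso_zero_iff[OF lT lM0 e(2)] module_homD(1)[OF h(1)] by blast
  then have "Q M0" unfolding Q_def using e(1) h(1,2,4) by blast
  then obtain M where QM: "Q M" and min: "\<And>N. Q N \<Longrightarrow> vectorspace.dim L (bs M) \<le> vectorspace.dim L (bs N)"
    using exists_least_iff[of "\<lambda>d. \<exists>M. Q M \<and> vectorspace.dim L (bs M) = d"] by (metis leI)
  obtain p i where pi: "p \<in> module_hom A T M" "i \<in> module_hom A M T" "\<And>x. x \<in> carrier M \<Longrightarrow> p (i x) = x"
    and M: "fd_module L A M" and nz: "\<exists>x\<in>carrier M. x \<noteq> \<zero>\<^bsub>M\<^esub>" using QM unfolding Q_def by blast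
  have lm: "left_module A M" using M by (simp add: fd_module_def)
  interpret M: left_module A M by (rule lm)
  obtain r \<theta> where \<theta>: "tfrob r M \<theta>" using fd_tfrob[OF M Fr[OF M]] .
  have "local_module M"
    unfolding local_module_def
  proof (intro conjI ballI impI)
    fix f g assume f: "f \<in> module_hom A M M" and g: "g \<in> module_hom A M M" and fg: "\<forall>x\<in>carrier M. f x \<oplus>\<^bsub>M\<^esub> g x = x"
    obtain m where m: "m > 0" "\<And>x. x \<in> carrier M \<Longrightarrow> (f ^^ m) ((f ^^ m) x) = (f ^^ m) x" using hom_idempotent_power[OF \<theta> f] by blast
    define e where "e = f ^^ m"
    have eh: "e \<in> module_hom A M M" unfolding e_def by (rule hom_funpow[OF f])
    note ec = module_homD[OF eh]
    have ee: "e (e x) = e x" if "x \<in> carrier M" for x using m(2)[OF that] by (simp add: e_def)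
    show "bij_betw f (carrier M) (carrier M) \<or> bij_betw g (carrier M) (carrier M)"
    proof (cases "\<forall>x\<in>carrier M. e x = \<zero>\<^bsub>M\<^esub>")
      \<comment> \<open>A vector killed by g is fixed by f, hence by its power e, which is
        zero.\<close>
      case True
      have "inj_on g (carrier M)"
      proof (rule additive_inj[OF M.M.abelian_group_axioms M.M.abelian_group_axioms])
        fix x assume x: "x \<in> carrier M" "g x = \<zero>\<^bsub>M\<^esub>"
        then have fx: "f x = x" using fg[rule_format, OF x(1)] module_homD(1)[OF f x(1)] by simp
        have "(f ^^ n) x = x" for n by (induction n) (simp_all add: fx)
        then have "e x = x" by (simp add: e_def)
        then show "x = \<zero>\<^bsub>M\<^esub>" using True x(1) by simp
      qed (use module_homD[OF g] in auto)
      then show ?thesis using hom_inj_bij[OF \<theta> g] by blast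
    next
      case False
      \<comment> \<open>The image of e is a summand of T through \<open>e \<circ> p\<close> and the
        restriction of i. Being of full dimension, it makes e surjective, and f with it.\<close>
      let ?W = "e ` carrier M" let ?N = "M\<lparr>carrier := ?W\<rparr>"
      have eW: "e w = w" if "w \<in> ?W" for w using that ee by auto
      have WM: "?W \<subseteq> carrier M" using ec(1) by blast
      have "e \<circ> p \<in> module_hom A T ?N"
        using module_homD[OF module_hom_comp[OF pi(1) eh]] module_homD(1)[OF pi(1)] by (intro module_homI) auto
      moreover have "i \<in> module_hom A ?N T" by (rule module_hom_restrict[OF pi(2) WM])
      moreover have "(e \<circ> p) (i x) = x" if "x \<in> carrier ?N" for x
      proof -
        have x: "x \<in> ?W" using that by simp
        then have "p (i x) = x" using pi(3) WM by blast
        then show ?thesis using eW[OF x] by simp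
      qed
      moreover have "\<exists>x\<in>carrier ?N. x \<noteq> \<zero>\<^bsub>?N\<^esub>" using False by auto
      ultimately have "Q ?N" unfolding Q_def using fd_image(1)[OF M eh] by blast
      then have "?W = carrier M" using fd_image(2)[OF M eh] min[of ?N] by (metis leD)
      then have "f ` carrier M = carrier M" using funpow_surj[OF module_homD(1)[OF f] m(1)] by (simp add: e_def)
      then show ?thesis using hom_surj_bij[OF \<theta> f] by blast
    qed
  qed (rule nz)
  then show thesis using that M pi by blast
qed

text \<open>Among the surjective, non-split morphisms to M with the factorisation property, one
  whose source has least dimension is minimal. The standard module type is used for the sources so
  that they can be compared within one type.\<close>

lemma minimal_right_almost_split_exists:
  fixes P0 :: "('a, 'p) module" and M :: "('a, nat \<Rightarrow> 'k) module"
  assumes P0: "fd_module L A P0" and M: "fd_module L A M" and \<phi>0: "\<phi>0 \<in> module_hom A P0 M" "\<phi>0 ` carrier P0 = carrier M" "\<not> split_epi A P0 M \<phi>0"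
    and fac: "\<And>(T :: ('a, nat \<Rightarrow> 'k) module) f. \<lbrakk>fd_module L A T; f \<in> module_hom A T M; \<not> split_epi A T M f\<rbrakk> \<Longrightarrow>
      \<exists>g\<in>module_hom A T P0. \<forall>x\<in>carrier T. f x = \<phi>0 (g x)"
    and Fr: "\<And>V :: ('a, nat \<Rightarrow> 'k) module. fd_module L A V \<Longrightarrow> frob (Suc 0) (bs V) (Fr V)"
  obtains P :: "('a, nat \<Rightarrow> 'k) module" and \<phi> where "minimal_right_almost_split L A P M \<phi>" "\<phi> ` carrier P = carrier M"
proof -
  define Q where "Q P \<phi> \<longleftrightarrow> fd_module L A P \<and> \<phi> \<in> module_hom A P M \<and> \<phi> ` carrier P = carrier M \<and> \<not> split_epi A P M \<phi> \<and>
    (\<forall>(T :: ('a, nat \<Rightarrow> 'k) module) f. fd_module L A T \<and> f \<in> module_hom A T M \<and> \<not> split_epi A T M f \<longrightarrow>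
      (\<exists>g\<in>module_hom A T P. \<forall>x\<in>carrier T. f x = \<phi> (g x)))" for P :: "('a, nat \<Rightarrow> 'k) module" and \<phi>
  have l0: "left_module A P0" using P0 by (simp add: fd_module_def)
  obtain P1 :: "('a, nat \<Rightarrow> 'k) module" and e where e: "fd_module L A P1" "e \<in> module_iso A P0 P1"
    using fd_module_iso_standard[OF fd_A P0] .
  note h = module_isoD[OF e(2) l0]
  let ?e = "inv_into (carrier P0) e"
  have "Q P1 (\<phi>0 \<circ> ?e)"
    unfolding Q_def
  proof (intro conjI allI impI)
    show "(\<phi>0 \<circ> ?e) ` carrier P1 = carrier M"
      using bij_betw_inv_into[OF h(5)] \<phi>0(2) unfolding bij_betw_def image_comp[symmetric] by simp
    show "\<not> split_epi A P1 M (\<phi>0 \<circ> ?e)"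
    proof
      assume "split_epi A P1 M (\<phi>0 \<circ> ?e)"
      then obtain s where s: "s \<in> module_hom A M P1" "\<forall>x\<in>carrier M. (\<phi>0 \<circ> ?e) (s x) = x" by (auto simp: split_epi_def)
      then have "split_epi A P0 M \<phi>0" unfolding split_epi_def using module_hom_comp[OF s(1) h(2)] by (intro bexI[of _ "?e \<circ> s"]) auto
      then show False using \<phi>0(3) by blast
    qed
    fix T :: "('a, nat \<Rightarrow> 'k) module" and f assume "fd_module L A T \<and> f \<in> module_hom A T M \<and> \<not> split_epi A T M f"
    then obtain g where g: "g \<in> module_hom A T P0" "\<forall>x\<in>carrier T. f x = \<phi>0 (g x)" using fac[of T f] by blast
    then show "\<exists>g\<in>module_hom A T P1. \<forall>x\<in>carrier T. f x = (\<phi>0 \<circ> ?e) (g x)"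
      using module_hom_comp[OF g(1) h(1)] h(3) module_homD(1)[OF g(1)] by (intro bexI[of _ "e \<circ> g"]) auto
  qed (use e(1) module_hom_comp[OF h(2) \<phi>0(1)] in auto)
  then obtain P \<phi> where QP: "Q P \<phi>" and min: "\<And>N \<psi>. Q N \<psi> \<Longrightarrow> vectorspace.dim L (bs P) \<le> vectorspace.dim L (bs N)"
    using exists_least_iff[of "\<lambda>d. \<exists>P \<phi>. Q P \<phi> \<and> vectorspace.dim L (bs P) = d"] by (metis leI)
  have P: "fd_module L A P" and \<phi>: "\<phi> \<in> module_hom A P M" "\<phi> ` carrier P = carrier M" "\<not> split_epi A P M \<phi>"
    and fP: "\<And>(T :: ('a, nat \<Rightarrow> 'k) module) f. fd_module L A T \<and> f \<in> module_hom A T M \<and> \<not> split_epi A T M f \<Longrightarrow>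
      \<exists>g\<in>module_hom A T P. \<forall>x\<in>carrier T. f x = \<phi> (g x)"
    using QP unfolding Q_def by blast+
  obtain r \<theta> where \<theta>: "tfrob r P \<theta>" using fd_tfrob[OF P Fr[OF P]] .
  have "f \<in> module_iso A P P" if f: "f \<in> module_hom A P P" and eq: "\<forall>x\<in>carrier P. \<phi> x = \<phi> (f x)" for f
  proof -
    obtain m where m: "m > 0" "\<And>x. x \<in> carrier P \<Longrightarrow> (f ^^ m) ((f ^^ m) x) = (f ^^ m) x" using hom_idempotent_power[OF \<theta> f] by blast
    define e where "e = f ^^ m"
    have eh: "e \<in> module_hom A P P" unfolding e_def by (rule hom_funpow[OF f])
    note ec = module_homD[OF eh]
    have "\<phi> ((f ^^ n) x) = \<phi> x" if x: "x \<in> carrier P" for x n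
      by (induction n) (use module_homD(1)[OF hom_funpow[OF f] x] eq in auto)
    then have pe: "\<phi> (e x) = \<phi> x" if "x \<in> carrier P" for x using that by (simp add: e_def)
    let ?W = "e ` carrier P" let ?N = "P\<lparr>carrier := ?W\<rparr>"
    have WP: "?W \<subseteq> carrier P" using ec(1) by blast
    \<comment> \<open>If \<open>\<phi> \<circ> f = \<phi>\<close>, the same holds for the idempotent
      power e, and the restriction of \<open>\<phi>\<close> to the image of e inherits all the
      properties. Leastness forces this image to be all of P.\<close>
    have "Q ?N \<phi>"
      unfolding Q_def
    proof (intro conjI allI impI)
      show "fd_module L A ?N" by (rule fd_image(1)[OF P eh])
      show "\<phi> \<in> module_hom A ?N M" by (rule module_hom_restrict[OF \<phi>(1) WP])
      have "\<phi> ` (e ` carrier P) = \<phi> ` carrier P" unfolding image_image by (rule image_cong[OF refl pe])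
      then show "\<phi> ` carrier ?N = carrier M" using \<phi>(2) by simp
      show "\<not> split_epi A ?N M \<phi>"
      proof
        assume "split_epi A ?N M \<phi>"
        then obtain s where s: "s \<in> module_hom A M ?N" "\<forall>x\<in>carrier M. \<phi> (s x) = x" by (auto simp: split_epi_def)
        have "s \<in> module_hom A M P" using module_homD[OF s(1)] WP by (intro module_homI) auto
        then show False using \<phi>(3) s(2) by (auto simp: split_epi_def)
      qed
      fix T :: "('a, nat \<Rightarrow> 'k) module" and f assume "fd_module L A T \<and> f \<in> module_hom A T M \<and> \<not> split_epi A T M f"
      from fP[OF this] obtain g where g: "g \<in> module_hom A T P" "\<forall>x\<in>carrier T. f x = \<phi> (g x)" by blast
      have "e \<circ> g \<in> module_hom A T ?N"
        using module_homD[OF module_hom_comp[OF g(1) eh]] module_homD(1)[OF g(1)] by (intro module_homI) auto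
      moreover have "\<forall>x\<in>carrier T. f x = \<phi> ((e \<circ> g) x)" using g(2) pe module_homD(1)[OF g(1)] by simp
      ultimately show "\<exists>g\<in>module_hom A T ?N. \<forall>x\<in>carrier T. f x = \<phi> (g x)" by blast
    qed
    then have W: "?W = carrier P" using fd_image(2)[OF P eh] min[of ?N \<phi>] by (metis leD)
    then have "f ` carrier P = carrier P" using funpow_surj[OF module_homD(1)[OF f] m(1)] by (simp add: e_def)
    then show ?thesis using hom_surj_bij[OF \<theta> f] f by (simp add: module_iso_def)
  qed
  then have "minimal_right_almost_split L A P M \<phi>"
    unfolding minimal_right_almost_split_def using P M \<phi>(1,3) fP by blast
  then show thesis using that \<phi>(2) by blast
qed


text \<open>The component of degree \<open>0\<close> of \<open>h\<close> is not an automorphism. These \<open>h\<close> form a space that does not contain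
  the identity, which replaces the Krull-Remak-Schmidt theorem below.\<close>

definition radical_hom :: "nat \<Rightarrow> ('a, 'm) module \<Rightarrow> ('m \<Rightarrow> 'm) \<Rightarrow> ('m \<Rightarrow> 'm) \<Rightarrow> bool" where
  "radical_hom r M \<theta> h \<longleftrightarrow> h \<in> module_hom AF (fixed_points \<theta> M) M \<and>
     (\<exists>w. tlin 0 0 M M w \<and> \<not> bij_betw w (carrier M) (carrier M) \<and> (\<forall>x\<in>carrier M. \<theta> x = x \<longrightarrow> w x = hpart r M M 0 h x))"

text \<open>If the degree-0 component were bijective, \<open>fixed_points_bij\<close> would make v
  bijective.\<close>

lemma radical_homI:
  assumes M: "tfrob r M \<theta>" "local_module M" "aperiodic r M"
    and v: "v \<in> module_hom AF (fixed_points \<theta> M) (fixed_points \<theta> M)"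
      "\<not> bij_betw v (carrier (fixed_points \<theta> M)) (carrier (fixed_points \<theta> M))"
  shows "radical_hom r M \<theta> v"
proof -
  note vh = hom_AF_fixed_points[OF v(1)]
  obtain w where w: "tlin 0 0 M M w" "\<And>x. \<lbrakk>x \<in> carrier M; \<theta> x = x\<rbrakk> \<Longrightarrow> w x = hpart r M M 0 v x"
    using hpart_extension[OF M(1) tfrobD(1)[OF M(1)] vh, where j = 0] by blast
  have "\<not> bij_betw w (carrier M) (carrier M)"
    using fixed_points_bij[OF M v(1), of w] w v(2) by (auto simp: tlin_module_hom)
  then show ?thesis using vh w unfolding radical_hom_def by blast
qed

text \<open>Coefficients from the big field are allowed although they do not preserve
  \<open>M\<^sup>\<theta>\<close>; this is why \<open>radical_hom\<close> takes values in M. Passing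
  to degree-0 components is linear, and sums of non-bijective endomorphisms of a local module are
  not bijective.\<close>

lemma radical_hom_combination:
  assumes M: "tfrob r M \<theta>" "local_module M" and I: "finite I" and h: "\<And>i. i \<in> I \<Longrightarrow> radical_hom r M \<theta> (h i)"
    and c: "\<And>i. i \<in> I \<Longrightarrow> c i \<in> carrier L"
  shows "radical_hom r M \<theta> (\<lambda>x. \<Oplus>\<^bsub>M\<^esub>i\<in>I. c i \<odot>\<^bsub>bs M\<^esub> h i x)"
proof -
  note D = tfrobD[OF M(1)]
  interpret M: left_module A M by (rule D(1))
  interpret V: vectorspace L "bs M" by (rule D(2))
  have hh: "h i \<in> module_hom AF (fixed_points \<theta> M) M" if "i \<in> I" for i using h[OF that] by (simp add: radical_hom_def)
  have "\<forall>i\<in>I. \<exists>w. tlin 0 0 M M w \<and> \<not> bij_betw w (carrier M) (carrier M) \<and> (\<forall>x\<in>carrier M. \<theta> x = x \<longrightarrow> w x = hpart r M M 0 (h i) x)"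
    using h by (auto simp: radical_hom_def)
  then obtain w where w: "\<And>i. i \<in> I \<Longrightarrow> tlin 0 0 M M (w i) \<and> \<not> bij_betw (w i) (carrier M) (carrier M) \<and>
      (\<forall>x\<in>carrier M. \<theta> x = x \<longrightarrow> w i x = hpart r M M 0 (h i) x)" by metis
  let ?w = "\<lambda>i x. w i (c i \<odot>\<^bsub>bs M\<^esub> x)"
  have ct: "tlin 0 0 M M (\<lambda>x. c i \<odot>\<^bsub>bs M\<^esub> x)" if "i \<in> I" for i by (rule tlin_smult[OF D(1) tlin_id c[OF that]])
  have wt: "tlin 0 0 M M (?w i) \<and> \<not> bij_betw (?w i) (carrier M) (carrier M)" if i: "i \<in> I" for i
    using tlin_comp0[OF ct[OF i], of 0 M "w i"] nonbij_comp[OF M(1) _ _ ct[OF i], of 0 0 "w i"] w[OF i] by simp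
  have hc: "h i x \<in> carrier M" "c i \<odot>\<^bsub>bs M\<^esub> h i x \<in> carrier M" if "i \<in> I" "x \<in> carrier M" "\<theta> x = x" for i x
  proof -
    show hx: "h i x \<in> carrier M" using module_homD(1)[OF hh[OF that(1)], of x] that by simp
    show "c i \<odot>\<^bsub>bs M\<^esub> h i x \<in> carrier M" using V.smult_closed[OF c[OF that(1)], of "h i x"] hx by simp
  qed
  have eq: "(\<Oplus>\<^bsub>M\<^esub>i\<in>I. ?w i x) = hpart r M M 0 (\<lambda>x. \<Oplus>\<^bsub>M\<^esub>i\<in>I. c i \<odot>\<^bsub>bs M\<^esub> h i x) x" if x: "x \<in> carrier M" "\<theta> x = x" for x
  proof -
    have "hpart r M M 0 (\<lambda>x. \<Oplus>\<^bsub>M\<^esub>i\<in>I. c i \<odot>\<^bsub>bs M\<^esub> h i x) x = (\<Oplus>\<^bsub>M\<^esub>i\<in>I. hpart r M M 0 (\<lambda>x. c i \<odot>\<^bsub>bs M\<^esub> h i x) x)"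
      by (rule hpart_finsum[OF M(1) D(1) I]) (use hc x in auto)
    also have "\<dots> = (\<Oplus>\<^bsub>M\<^esub>i\<in>I. ?w i x)"
    proof (rule M.M.finsum_cong')
      fix i assume i: "i \<in> I"
      have "hpart r M M 0 (\<lambda>x. c i \<odot>\<^bsub>bs M\<^esub> h i x) x = c i \<odot>\<^bsub>bs M\<^esub> hpart r M M 0 (h i) x"
        by (rule hpart_smult[OF M(1) D(1) c[OF i]]) (use hc(1)[OF i] x in auto)
      also have "\<dots> = c i \<odot>\<^bsub>bs M\<^esub> w i x" using w[OF i] x by simp
      also have "\<dots> = ?w i x" using slinD(3)[OF tlin_slin[of 0 M M "w i", OF _ D(1)] c[OF i], of x] w[OF i] x c[OF i] by simp
      finally show "hpart r M M 0 (\<lambda>x. c i \<odot>\<^bsub>bs M\<^esub> h i x) x = ?w i x" .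
    next
      show "(\<lambda>i. ?w i x) \<in> I \<rightarrow> carrier M"
      proof
        fix i assume "i \<in> I"
        from conjunct1[OF wt[OF this]] show "?w i x \<in> carrier M" by (rule tlinD(1)) (rule x(1))
      qed
    qed simp
    finally show ?thesis by simp
  qed
  have "\<not> bij_betw (\<lambda>x. \<Oplus>\<^bsub>M\<^esub>i\<in>I. ?w i x) (carrier M) (carrier M)" by (rule nonbij_finsum[OF D(1) M(2) I wt])
  moreover have "tlin 0 0 M M (\<lambda>x. \<Oplus>\<^bsub>M\<^esub>i\<in>I. ?w i x)" by (rule tlin_finsum[OF D(1) D(1) I]) (use wt in blast)
  moreover have "(\<lambda>x. \<Oplus>\<^bsub>M\<^esub>i\<in>I. c i \<odot>\<^bsub>bs M\<^esub> h i x) \<in> module_hom AF (fixed_points \<theta> M) M"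
    by (rule hom_AF_combination[OF D(1) I]) (use hh c in auto)
  ultimately show ?thesis unfolding radical_hom_def
    by (intro conjI exI[of _ "\<lambda>x. \<Oplus>\<^bsub>M\<^esub>i\<in>I. ?w i x"] ballI impI) (assumption | rule eq)+
qed

text \<open>The inclusion of \<open>M\<^sup>\<theta>\<close> in M has the identity as its degree-0
  component.\<close>

lemma radical_hom_nonidentity:
  assumes M: "tfrob r M \<theta>" and h: "radical_hom r M \<theta> h"
  obtains x where "x \<in> carrier M" "\<theta> x = x" "h x \<noteq> x"
proof (rule ccontr)
  assume no: "\<not> thesis"
  note obt = that
  have id: "h x = x" if "x \<in> carrier M" "\<theta> x = x" for x using obt[OF that] no by blast
  note D = tfrobD[OF M]
  obtain w where w: "tlin 0 0 M M w" "\<not> bij_betw w (carrier M) (carrier M)"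
    "\<And>x. \<lbrakk>x \<in> carrier M; \<theta> x = x\<rbrakk> \<Longrightarrow> w x = hpart r M M 0 h x" using h by (auto simp: radical_hom_def)
  have "w x = x" if x: "x \<in> carrier M" for x
  proof (rule tlin_eq[OF M D(1), where j = 0 and u = w and v = "\<lambda>x. x" and x = x])
    fix x assume x: "x \<in> carrier M" "\<theta> x = x"
    have "hpart r M M 0 h x = hpart r M M 0 (\<lambda>x. x) x" by (rule hpart_cong[OF M D(1)]) (use id x in auto)
    then show "w x = x" using w(3)[OF x] hpart_inclusion[OF M x(1), of 0] by simp
  qed (use w(1) tlin_id x in auto)
  then have "bij_betw w (carrier M) (carrier M)" by (simp add: bij_betw_def inj_on_def image_def)
  then show False using w(2) by blast
qed

section \<open>Splittings over the algebra compared with splittings over its fixed points\<close>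

lemma common_power:
  assumes M: "tfrob r M \<theta>" and h: "\<And>x. x \<in> S \<Longrightarrow> h x \<in> carrier M" and S: "finite S"
  obtains n where "n > 0" "\<And>x. x \<in> S \<Longrightarrow> (\<theta> ^^ n) (h x) = h x"
proof (rule frob_common_power[OF tfrobD(6)[OF M], of "h ` S" "Suc 0"])
  show "h ` S \<subseteq> carrier (bs M)" using h by auto
  fix n assume "n > 0" "\<And>x. x \<in> h ` S \<Longrightarrow> (\<theta> ^^ n) x = x"
  then show thesis using that by blast
qed (use S in auto)

text \<open>M is a summand of the scalar extension of \<open>M0\<close>, and
  \<open>M\<^sup>\<theta>\<close> is to become a summand of \<open>M0\<close>. The traces of p and i
  are homomorphisms over \<open>AF\<close>. If no trace of p splits, all composites of traces are
  radical; but a combination of them is p i = 1 on fixed vectors, which is not radical.\<close>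

lemma split_epi_fixed_points:
  assumes M: "tfrob r M \<theta>" "local_module M" "aperiodic r M" and T: "tfrob (Suc 0) T F"
    and M0: "fd_module K1 AF M0" and e: "e \<in> module_iso AF M0 (fixed_points F T)"
    and p: "p \<in> module_hom A T M" and i: "i \<in> module_hom A M T" and pi: "\<And>x. x \<in> carrier M \<Longrightarrow> p (i x) = x"
  obtains t where "t \<in> module_hom AF M0 (fixed_points \<theta> M)" "split_epi AF M0 (fixed_points \<theta> M) t"
proof (rule ccontr)
  assume no: "\<not> thesis"
  note obt = that
  note D = tfrobD[OF M(1)] and DT = tfrobD[OF T]
  interpret M: left_module A M by (rule D(1))
  have l0: "left_module AF M0" and f0: "finite (carrier M0)" using M0 finite_AF_module[OF M0] by (auto simp: fd_module_def)
  note eh = module_isoD[OF e l0]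
  let ?e = "inv_into (carrier M0) e"
  define h where "h y = p (e y)" for y
  have h: "h \<in> module_hom AF M0 M"
    using module_hom_comp[OF eh(1) hom_AF_restrict[OF T D(1) p]] by (simp add: h_def[abs_def] comp_def)
  obtain n where n: "n > 0" "\<And>x. x \<in> carrier M0 \<Longrightarrow> (\<theta> ^^ n) (h x) = h x"
    by (rule common_power[OF M(1), where S = "carrier M0" and h = h]) (use module_homD(1)[OF h] f0 in auto)
  define t where "t c x = tr (bs M) \<theta> n c (h x)" for c x
  have t: "t c \<in> module_hom AF M0 (fixed_points \<theta> M)" if "c \<in> units_fixed (r * n)" for c
    using tr_hom[OF M(1) l0 h n(2), of c] that by (simp add: t_def[abs_def] units_fixed_def)
  have iF: "i \<in> module_hom AF (fixed_points \<theta> M) T" by (rule hom_AF_restrict[OF M(1) DT(1) i])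
  obtain m where m: "m > 0" "\<And>x. x \<in> carrier (fixed_points \<theta> M) \<Longrightarrow> (F ^^ m) (i x) = i x"
    by (rule common_power[OF T, where S = "carrier (fixed_points \<theta> M)" and h = i])
      (use module_homD(1)[OF iF] finite_fixed_points[OF M(1)] in auto)
  define s where "s d x = tr (bs T) F m d (i x)" for d x
  have s: "s d \<in> module_hom AF (fixed_points \<theta> M) (fixed_points F T)" if "d \<in> units_fixed (Suc 0 * m)" for d
    using tr_hom[OF T left_module_fixed_points[OF M(1)] iF m(2), of d] that by (simp add: s_def[abs_def] units_fixed_def)
  \<comment> \<open>A bijective composite would make the trace of p with parameter c a split
    epimorphism.\<close>
  have v: "radical_hom r M \<theta> (\<lambda>x. t c (?e (s d x)))" if c: "c \<in> units_fixed (r * n)" and d: "d \<in> units_fixed (Suc 0 * m)" for c d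
  proof (rule radical_homI[OF M])
    note sd = module_hom_comp[OF s[OF d] eh(2)]
    show vh: "(\<lambda>x. t c (?e (s d x))) \<in> module_hom AF (fixed_points \<theta> M) (fixed_points \<theta> M)"
      using module_hom_comp[OF sd t[OF c]] by (simp add: comp_def)
    show "\<not> bij_betw (\<lambda>x. t c (?e (s d x))) (carrier (fixed_points \<theta> M)) (carrier (fixed_points \<theta> M))"
    proof
      assume "bij_betw (\<lambda>x. t c (?e (s d x))) (carrier (fixed_points \<theta> M)) (carrier (fixed_points \<theta> M))"
      then have "(\<lambda>x. t c (?e (s d x))) \<in> module_iso AF (fixed_points \<theta> M) (fixed_points \<theta> M)" using vh by (simp add: module_iso_def)
      note vi = module_isoD[OF this left_module_fixed_points[OF M(1)]]
      have "split_epi AF M0 (fixed_points \<theta> M) (t c)"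
        unfolding split_epi_def by (rule bexI[OF _ module_hom_comp[OF vi(2) sd]]) (use vi(4) in auto)
      then show False using no obt[OF t[OF c]] by blast
    qed
  qed
  let ?I = "units_fixed (r * n)" and ?J = "units_fixed (Suc 0 * m)"
  have fin: "finite ?I" "finite ?J" using finite_units_fixed n(1) m(1) D(4) by simp_all
  have u: "\<ominus> (inv c) \<in> carrier L" if "c \<in> units_fixed l" for c l using units_fixed_nonzero[OF that] by simp
  \<comment> \<open>The weights are those of \<open>tr_expand\<close>: the inner sum recovers p from
    its traces, the outer sum recovers i.\<close>
  have "radical_hom r M \<theta> (\<lambda>x. \<Oplus>\<^bsub>M\<^esub>d\<in>?J. (\<ominus> (inv d)) \<odot>\<^bsub>bs M\<^esub> (\<Oplus>\<^bsub>M\<^esub>c\<in>?I. (\<ominus> (inv c)) \<odot>\<^bsub>bs M\<^esub> t c (?e (s d x))))"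
    by (intro radical_hom_combination[OF M(1,2)] fin v) (auto intro: u)
  then obtain x where x: "x \<in> carrier M" "\<theta> x = x"
    "(\<Oplus>\<^bsub>M\<^esub>d\<in>?J. (\<ominus> (inv d)) \<odot>\<^bsub>bs M\<^esub> (\<Oplus>\<^bsub>M\<^esub>c\<in>?I. (\<ominus> (inv c)) \<odot>\<^bsub>bs M\<^esub> t c (?e (s d x)))) \<noteq> x"
    using radical_hom_nonidentity[OF M(1)] by blast
  have ix: "i x \<in> carrier T" by (rule module_homD(1)[OF i x(1)])
  have sx: "s d x \<in> carrier (fixed_points F T)" if "d \<in> ?J" for d using module_homD(1)[OF s[OF that], of x] x by simp
  have "(\<Oplus>\<^bsub>M\<^esub>c\<in>?I. (\<ominus> (inv c)) \<odot>\<^bsub>bs M\<^esub> t c (?e (s d x))) = p (s d x)" if d: "d \<in> ?J" for d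
    using tr_expand[OF D(2,7) _ D(4) n(1), of "h (?e (s d x))"] module_homD(1)[OF h module_homD(1)[OF eh(2) sx[OF d]]] eh(4)[OF sx[OF d]]
    by (simp add: t_def h_def)
  then have "(\<Oplus>\<^bsub>M\<^esub>d\<in>?J. (\<ominus> (inv d)) \<odot>\<^bsub>bs M\<^esub> (\<Oplus>\<^bsub>M\<^esub>c\<in>?I. (\<ominus> (inv c)) \<odot>\<^bsub>bs M\<^esub> t c (?e (s d x)))) =
      (\<Oplus>\<^bsub>M\<^esub>d\<in>?J. p ((\<ominus> (inv d)) \<odot>\<^bsub>bs T\<^esub> s d x))"
  proof (intro M.M.finsum_cong')
    fix d assume d: "d \<in> ?J"
    have sT: "s d x \<in> carrier T" using sx[OF d] by simp
    show "(\<ominus> (inv d)) \<odot>\<^bsub>bs M\<^esub> (\<Oplus>\<^bsub>M\<^esub>c\<in>?I. (\<ominus> (inv c)) \<odot>\<^bsub>bs M\<^esub> t c (?e (s d x))) = p ((\<ominus> (inv d)) \<odot>\<^bsub>bs T\<^esub> s d x)"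
      using slinD(3)[OF tlin_slin[OF hom_tlin[OF p] DT(1)] u[OF d], of "s d x"] sT u[OF d] \<open>\<And>d. d \<in> ?J \<Longrightarrow> _ = p (s d x)\<close>[OF d] by simp
  next
    interpret VT: vectorspace L "bs T" by (rule DT(2))
    show "(\<lambda>d. p ((\<ominus> (inv d)) \<odot>\<^bsub>bs T\<^esub> s d x)) \<in> ?J \<rightarrow> carrier M"
    proof
      fix d assume d: "d \<in> ?J"
      then show "p ((\<ominus> (inv d)) \<odot>\<^bsub>bs T\<^esub> s d x) \<in> carrier M"
        using VT.smult_closed[OF u[OF d], of "s d x"] sx[OF d] module_homD(1)[OF p] by simp
    qed
  qed simp
  also have "\<dots> = p (\<Oplus>\<^bsub>T\<^esub>d\<in>?J. (\<ominus> (inv d)) \<odot>\<^bsub>bs T\<^esub> s d x)"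
  proof (rule module_hom_finsum[symmetric, OF DT(1) M.M.abelian_group_axioms p fin(2)])
    interpret VT: vectorspace L "bs T" by (rule DT(2))
    show "(\<ominus> (inv d)) \<odot>\<^bsub>bs T\<^esub> s d x \<in> carrier T" if d: "d \<in> ?J" for d
      using VT.smult_closed[OF u[OF d], of "s d x"] sx[OF d] by simp
  qed
  also have "\<dots> = x" using tr_expand[OF DT(2,7) _ _ m(1), of "i x"] ix pi[OF x(1)] by (simp add: s_def)
  finally show False using x(3) by simp
qed

text \<open>Let v split the trace and let \<open>v0\<close> be the degree-0 component of v. The
  degree-0 part of the splitting identity writes 1 as a sum of conjugates of c y v0 by powers of
  \<open>\<theta>\<close>. By locality one conjugate is bijective, hence y v0 is injective and then
  bijective.\<close>

lemma trace_split_epi: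
  assumes M: "tfrob r M \<theta>" "local_module M" and Y: "tfrob s Y \<theta>Y" and y: "y \<in> module_hom A Y M" and c: "c \<in> carrier L"
    and split: "split_epi AF (fixed_points \<theta>Y Y) (fixed_points \<theta> M) (\<lambda>x. tr (bs M) \<theta> n c (y x))"
  shows "split_epi A Y M y"
proof -
  note D = tfrobD[OF M(1)] and DY = tfrobD[OF Y]
  interpret M: left_module A M by (rule D(1))
  obtain v where v: "v \<in> module_hom AF (fixed_points \<theta> M) (fixed_points \<theta>Y Y)"
    "\<And>x. \<lbrakk>x \<in> carrier M; \<theta> x = x\<rbrakk> \<Longrightarrow> tr (bs M) \<theta> n c (y (v x)) = x" using split by (auto simp: split_epi_def)
  note vY = hom_AF_fixed_points[OF v(1)]
  obtain v0 where v0: "tlin 0 0 M Y v0" "\<And>x. \<lbrakk>x \<in> carrier M; \<theta> x = x\<rbrakk> \<Longrightarrow> v0 x = hpart r M Y 0 v x"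
    using hpart_extension[OF M(1) DY(1) vY, where j = 0] by blast
  have cy: "tlin 0 0 Y M (\<lambda>z. c \<odot>\<^bsub>bs M\<^esub> y z)" by (rule tlin_smult[OF D(1) hom_tlin[OF y] c])
  define g where "g l z = (\<theta> ^^ l) (c \<odot>\<^bsub>bs M\<^esub> y z)" for l z
  have tl: "tlin 0 (l * r) M M (\<theta> ^^ l)" for l using tlin_funpow[OF D(5), of l] by simp
  have gt: "tlin 0 (l * r) Y M (g l)" for l using tlin_comp0[OF cy tl[of l]] by (simp add: g_def[abs_def])
  have gs: "slin (r * l) (bs Y) (bs M) (g l)" for l using tlin_slin[OF gt DY(1), of l] by (simp add: mult.commute)
  let ?G = "\<lambda>l. inv_into (carrier M) (\<theta> ^^ l)"
  have tb: "bij_betw (\<theta> ^^ l) (carrier M) (carrier M)" for l by (rule funpow_closed_bij[OF D(9)])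
  have Gt: "tlin (l * r) 0 M M (?G l)" for l by (rule tlin_inv[OF D(1) tl tb])
  have Gl: "?G l ((\<theta> ^^ l) x) = x" if "x \<in> carrier M" for l x using tb[of l] that by (simp add: bij_betw_def)
  \<comment> \<open>The inverse of \<open>\<theta> ^^ l\<close> brings the l-th summand of the
    trace, which has degree r l, back to degree 0, and it does nothing on fixed vectors.\<close>
  define w where "w l x = g l (v0 (?G l x))" for l x
  have wt: "tlin 0 0 M M (w l)" for l
  proof -
    have "tlin (0 + l * r) (0 + l * r) M M (w l)"
      using tlin_comp[OF tlin_comp[OF Gt[of l] v0(1)] gt[of l]] by (simp add: w_def[abs_def])
    then show ?thesis by (simp only: tlin_shift)
  qed
  have vc: "v x \<in> carrier Y" if "x \<in> carrier M" "\<theta> x = x" for x using module_homD(1)[OF vY, of x] that by simp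
  have one: "(\<Oplus>\<^bsub>M\<^esub>l\<in>{..<n}. w l x) = x" if x: "x \<in> carrier M" for x
  proof (rule tlin_eq[OF M(1) D(1), where j = 0 and u = "\<lambda>x. \<Oplus>\<^bsub>M\<^esub>l\<in>{..<n}. w l x" and v = "\<lambda>x. x" and x = x])
    fix x assume x: "x \<in> carrier M" "\<theta> x = x"
    have "(\<theta> ^^ l) x = x" for l by (induction l) (simp_all add: x(2))
    then have G: "?G l x = x" for l using Gl[OF x(1), of l] by simp
    have "x = hpart r M M 0 (\<lambda>x. x) x" using hpart_inclusion[OF M(1) x(1), of 0] by simp
    also have "\<dots> = hpart r M M 0 (\<lambda>x. \<Oplus>\<^bsub>M\<^esub>l\<in>{..<n}. g l (v x)) x"
    proof (rule hpart_cong[OF M(1) D(1)])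
      fix z assume z: "z \<in> carrier M" "\<theta> z = z"
      show "z = (\<Oplus>\<^bsub>M\<^esub>l\<in>{..<n}. g l (v z)) \<and> (\<Oplus>\<^bsub>M\<^esub>l\<in>{..<n}. g l (v z)) \<in> carrier M"
        using v(2)[OF z] z(1) by (simp add: tr_def g_def)
    qed (use x in auto)
    also have "\<dots> = (\<Oplus>\<^bsub>M\<^esub>l\<in>{..<n}. hpart r M M 0 (\<lambda>x. g l (v x)) x)"
      by (rule hpart_finsum[OF M(1) D(1)]) (use tlinD(1)[OF gt] vc x in auto)
    also have "\<dots> = (\<Oplus>\<^bsub>M\<^esub>l\<in>{..<n}. w l x)"
    proof (rule M.M.finsum_cong')
      fix l
      show "hpart r M M 0 (\<lambda>x. g l (v x)) x = w l x"
        using hpart_comp_slin[OF M(1) DY(1) D(1) gs[of l] vc x] v0(2)[OF x] by (simp add: w_def G)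
    qed (use tlinD(1)[OF wt] x in auto)
    finally show "(\<Oplus>\<^bsub>M\<^esub>l\<in>{..<n}. w l x) = x" by simp
  qed (use tlin_finsum[OF D(1) D(1), of "{..<n}" 0 0 w] wt tlin_id x in auto)
  have "\<exists>l<n. bij_betw (w l) (carrier M) (carrier M)"
  proof (rule ccontr)
    assume "\<not> ?thesis"
    then have "\<not> bij_betw (\<lambda>x. \<Oplus>\<^bsub>M\<^esub>l\<in>{..<n}. w l x) (carrier M) (carrier M)"
      using nonbij_finsum[OF D(1) M(2), of "{..<n}" 0 0 w] wt by simp
    moreover have "bij_betw (\<lambda>x. \<Oplus>\<^bsub>M\<^esub>l\<in>{..<n}. w l x) (carrier M) (carrier M)"
      using bij_betw_cong[of "carrier M" "\<lambda>x. \<Oplus>\<^bsub>M\<^esub>l\<in>{..<n}. w l x" "\<lambda>x. x" "carrier M"] one by (simp add: bij_betw_def)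
    ultimately show False by blast
  qed
  then obtain l where l: "bij_betw (w l) (carrier M) (carrier M)" by blast
  let ?u = "\<lambda>x. y (v0 x)"
  have uh: "?u \<in> module_hom A M M" using tlin_comp0[OF v0(1) hom_tlin[OF y]] by (simp add: tlin_module_hom)
  \<comment> \<open>Both \<open>\<theta> ^^ l\<close> and its inverse are bijective, so the
    injectivity of \<open>w l\<close> can only come from y v0.\<close>
  have "inj_on ?u (carrier M)"
  proof (rule inj_onI)
    fix x z assume xz: "x \<in> carrier M" "z \<in> carrier M" "y (v0 x) = y (v0 z)"
    have "w l ((\<theta> ^^ l) x) = w l ((\<theta> ^^ l) z)" using Gl xz by (simp add: w_def g_def)
    then have "(\<theta> ^^ l) x = (\<theta> ^^ l) z"
      using inj_onD[OF bij_betw_imp_inj_on[OF l]] tlinD(1)[OF tl] xz(1,2) by blast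
    then show "x = z" using inj_onD[OF bij_betw_imp_inj_on[OF tb]] xz(1,2) by blast
  qed
  then have "?u \<in> module_iso A M M" using hom_inj_bij[OF M(1) uh] uh by (simp add: module_iso_def)
  note ui = module_isoD[OF this D(1)]
  have "v0 \<circ> inv_into (carrier M) ?u \<in> module_hom A M Y"
    using module_hom_comp[OF ui(2), of v0 Y] v0(1) by (simp add: tlin_module_hom)
  then show ?thesis unfolding split_epi_def by (rule bexI[rotated]) (use ui(4) in auto)
qed

end

lemma split_epi_zero:
  assumes P: "left_module R P" and \<phi>: "\<phi> \<in> module_hom R P M" and M: "\<And>x. x \<in> carrier M \<Longrightarrow> x = \<zero>\<^bsub>M\<^esub>"
  shows "split_epi R P M \<phi>"
proof -
  interpret P: left_module R P by (rule P)
  have "(\<lambda>_. \<zero>\<^bsub>P\<^esub>) \<in> module_hom R M P" by (rule module_homI) (simp_all add: P.smult_zero)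
  moreover have "\<phi> \<zero>\<^bsub>P\<^esub> = x" if "x \<in> carrier M" for x
    using M[OF module_homD(1)[OF \<phi> P.M.zero_closed]] M[OF that] by simp
  ultimately show ?thesis unfolding split_epi_def by (intro bexI[of _ "\<lambda>_. \<zero>\<^bsub>P\<^esub>"]) auto
qed

text \<open>Every morphism to a zero module splits, and over the zero ring all modules are zero. In
  this way the nonzero unit required by \<open>frobenius_algebra\<close> is extracted from the given
  morphism.\<close>

lemma minimal_right_almost_split_nonzero:
  assumes \<phi>: "minimal_right_almost_split K R P M \<phi>"
  shows "\<exists>x\<in>carrier M. x \<noteq> \<zero>\<^bsub>M\<^esub>" "\<one>\<^bsub>R\<^esub> \<noteq> \<zero>\<^bsub>R\<^esub>"
proof -
  have P: "left_module R P" and M: "left_module R M" and h: "\<phi> \<in> module_hom R P M" "\<not> split_epi R P M \<phi>"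
    using \<phi> by (auto simp: minimal_right_almost_split_def fd_module_def)
  interpret M: left_module R M by (rule M)
  show nz: "\<exists>x\<in>carrier M. x \<noteq> \<zero>\<^bsub>M\<^esub>" using split_epi_zero[OF P h(1)] h(2) by blast
  show "\<one>\<^bsub>R\<^esub> \<noteq> \<zero>\<^bsub>R\<^esub>"
  proof
    assume "\<one>\<^bsub>R\<^esub> = \<zero>\<^bsub>R\<^esub>"
    then have "x = \<zero>\<^bsub>M\<^esub>" if "x \<in> carrier M" for x using M.lm_one[OF that] M.zero_smult[OF that] by simp
    then show False using nz by blast
  qed
qed

context frobenius_algebra
begin

text \<open>The scalar extension of a minimal right almost split morphism over \<open>AF\<close> is
  almost split up to minimality once its end is cut down to M. Surjectivity and factorisation are
  solved for every trace over \<open>AF\<close> and recombined; a splitting over \<open>A\<close>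
  would descend by \<open>split_epi_descends\<close>.\<close>

lemma right_almost_split_extension:
  assumes M: "tfrob r M \<theta>" "local_module M" "aperiodic r M"
    and \<phi>0: "minimal_right_almost_split K1 AF L0 M0 \<phi>0" "\<phi>0 ` carrier L0 = carrier M0"
    and t: "t \<in> module_iso AF M0 (fixed_points \<theta> M)" and T: "tfrob (Suc 0) T F" and e: "e \<in> module_iso AF L0 (fixed_points F T)"
    and f: "f \<in> module_hom A T M" and comm: "\<forall>x\<in>carrier L0. f (e x) = t (\<phi>0 x)"
  shows "f ` carrier T = carrier M" "\<not> split_epi A T M f"
    "\<lbrakk>fd_module L A Y; frob (Suc 0) (bs Y) FY; y \<in> module_hom A Y M; \<not> split_epi A Y M y\<rbrakk> \<Longrightarrow>
      \<exists>g\<in>module_hom A Y T. \<forall>x\<in>carrier Y. y x = f (g x)"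
proof -
  let ?FT = "fixed_points F T"
  let ?FM = "fixed_points \<theta> M"
  note fe = bspec[OF comm]
  note D = tfrobD[OF M(1)] and DT = tfrobD[OF T]
  have l0: "left_module AF L0" "left_module AF M0" and ph: "\<phi>0 \<in> module_hom AF L0 M0" "\<not> split_epi AF L0 M0 \<phi>0"
    using \<phi>0(1) by (auto simp: minimal_right_almost_split_def fd_module_def)
  note eh = module_isoD[OF e l0(1)] and th = module_isoD[OF t l0(2)]
  interpret M: left_module A M by (rule D(1))
  interpret T: left_module A T by (rule DT(1))
  interpret VM: vectorspace L "bs M" by (rule D(2))
  interpret VT: vectorspace L "bs T" by (rule DT(2))
  have u: "\<ominus> (inv c) \<in> carrier L" if "c \<in> units_fixed l" for c l using units_fixed_nonzero[OF that] by simp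
  have eT: "e x \<in> carrier T" if "x \<in> carrier L0" for x using module_homD(1)[OF eh(1) that] by simp
  \<comment> \<open>Combinations of fixed vectors with the weights of \<open>tr_expand\<close> are
    mapped by f term by term, which reduces f to \<open>\<phi>0\<close>.\<close>
  have lift: "f (\<Oplus>\<^bsub>T\<^esub>c\<in>units_fixed l. (\<ominus> (inv c)) \<odot>\<^bsub>bs T\<^esub> e (x c)) = (\<Oplus>\<^bsub>M\<^esub>c\<in>units_fixed l. (\<ominus> (inv c)) \<odot>\<^bsub>bs M\<^esub> t (\<phi>0 (x c)))"
    if l: "l > 0" and x: "\<And>c. c \<in> units_fixed l \<Longrightarrow> x c \<in> carrier L0" for l x
  proof -
    have "f (\<Oplus>\<^bsub>T\<^esub>c\<in>units_fixed l. (\<ominus> (inv c)) \<odot>\<^bsub>bs T\<^esub> e (x c)) = (\<Oplus>\<^bsub>M\<^esub>c\<in>units_fixed l. f ((\<ominus> (inv c)) \<odot>\<^bsub>bs T\<^esub> e (x c)))"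
    proof (rule module_hom_finsum[OF DT(1) M.M.abelian_group_axioms f finite_units_fixed[OF l]])
      show "(\<ominus> (inv c)) \<odot>\<^bsub>bs T\<^esub> e (x c) \<in> carrier T" if "c \<in> units_fixed l" for c
        using VT.smult_closed[OF u[OF that], of "e (x c)"] eT[OF x[OF that]] by simp
    qed
    also have "\<dots> = (\<Oplus>\<^bsub>M\<^esub>c\<in>units_fixed l. (\<ominus> (inv c)) \<odot>\<^bsub>bs M\<^esub> t (\<phi>0 (x c)))"
    proof (rule M.M.finsum_cong')
      fix c assume c: "c \<in> units_fixed l"
      show "f ((\<ominus> (inv c)) \<odot>\<^bsub>bs T\<^esub> e (x c)) = (\<ominus> (inv c)) \<odot>\<^bsub>bs M\<^esub> t (\<phi>0 (x c))"
        using slinD(3)[OF tlin_slin[OF hom_tlin[OF f] DT(1)] u[OF c], of "e (x c)"] eT[OF x[OF c]] fe[OF x[OF c]] u[OF c] by simp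
    next
      show "(\<lambda>c. (\<ominus> (inv c)) \<odot>\<^bsub>bs M\<^esub> t (\<phi>0 (x c))) \<in> units_fixed l \<rightarrow> carrier M"
      proof
        fix c assume c: "c \<in> units_fixed l"
        then show "(\<ominus> (inv c)) \<odot>\<^bsub>bs M\<^esub> t (\<phi>0 (x c)) \<in> carrier M"
          using VM.smult_closed[OF u[OF c], of "t (\<phi>0 (x c))"] module_homD(1)[OF th(1) module_homD(1)[OF ph(1) x[OF c]]] by simp
      qed
    qed simp
    finally show ?thesis .
  qed
  show "f ` carrier T = carrier M"
  proof (intro equalityI subsetI)
    fix x assume x: "x \<in> carrier M"
    obtain n where n: "n > 0" "(\<theta> ^^ n) x = x" using M(1) x by (auto simp: tfrob_def)
    \<comment> \<open>The traces of x lie in \<open>M\<^sup>\<theta>\<close>, so each of them is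
      reached through \<open>\<phi>0\<close>.\<close>
    have "\<exists>z\<in>carrier L0. t (\<phi>0 z) = tr (bs M) \<theta> n c x" if c: "c \<in> units_fixed (r * n)" for c
    proof -
      have "tr (bs M) \<theta> n c x \<in> carrier ?FM"
        using tr_fix[OF D(2,7) _ n(2), of c] x c unfolding fixpts_carrier by (simp add: units_fixed_def)
      then have "tr (bs M) \<theta> n c x \<in> t ` \<phi>0 ` carrier L0" using th(5) \<phi>0(2) by (simp add: bij_betw_def)
      then show ?thesis by force
    qed
    then obtain z where z: "\<And>c. c \<in> units_fixed (r * n) \<Longrightarrow> z c \<in> carrier L0"
      "\<And>c. c \<in> units_fixed (r * n) \<Longrightarrow> t (\<phi>0 (z c)) = tr (bs M) \<theta> n c x" by metis
    let ?y = "\<Oplus>\<^bsub>T\<^esub>c\<in>units_fixed (r * n). (\<ominus> (inv c)) \<odot>\<^bsub>bs T\<^esub> e (z c)"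
    have "f ?y = (\<Oplus>\<^bsub>M\<^esub>c\<in>units_fixed (r * n). (\<ominus> (inv c)) \<odot>\<^bsub>bs M\<^esub> t (\<phi>0 (z c)))"
      by (rule lift) (use D(4) n(1) z(1) in auto)
    also have "\<dots> = (\<Oplus>\<^bsub>M\<^esub>c\<in>units_fixed (r * n). (\<ominus> (inv c)) \<odot>\<^bsub>bs M\<^esub> tr (bs M) \<theta> n c x)"
    proof (rule M.M.finsum_cong')
      show "(\<lambda>c. (\<ominus> (inv c)) \<odot>\<^bsub>bs M\<^esub> tr (bs M) \<theta> n c x) \<in> units_fixed (r * n) \<rightarrow> carrier M"
      proof
        fix c assume c: "c \<in> units_fixed (r * n)"
        show "(\<ominus> (inv c)) \<odot>\<^bsub>bs M\<^esub> tr (bs M) \<theta> n c x \<in> carrier M"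
          using VM.smult_closed[OF u[OF c] tr_closed[OF D(2,7) _ units_fixed_closed[OF c], of x]] x by simp
      qed
    qed (simp_all only: z(2))
    also have "\<dots> = x" using tr_expand[OF D(2,7) _ D(4) n(1), of x] x by simp
    finally have "f ?y = x" .
    moreover have "?y \<in> carrier T"
    proof (rule T.M.finsum_closed, rule)
      fix c assume c: "c \<in> units_fixed (r * n)"
      show "(\<ominus> (inv c)) \<odot>\<^bsub>bs T\<^esub> e (z c) \<in> carrier T" using VT.smult_closed[OF u[OF c], of "e (z c)"] eT[OF z(1)[OF c]] by simp
    qed
    ultimately show "x \<in> f ` carrier T" by blast
  qed (use module_homD(1)[OF f] in blast)
  have ff: "f \<in> module_hom AF ?FT ?FM"
  proof (rule module_hom_fixed_points[OF f])
    fix x assume "x \<in> carrier T" "F x = x"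
    then have x: "x \<in> carrier ?FT" by simp
    define z where "z = inv_into (carrier L0) e x"
    have z: "z \<in> carrier L0" "e z = x" using module_homD(1)[OF eh(2) x] eh(4)[OF x] by (simp_all add: z_def)
    have "t (\<phi>0 z) \<in> carrier ?FM" using module_homD(1)[OF th(1) module_homD(1)[OF ph(1) z(1)]] .
    then show "\<theta> (f x) = f x" using fe[OF z(1)] z(2) by simp
  qed
  show "\<not> split_epi A T M f"
  proof
    assume "split_epi A T M f"
    then have "split_epi AF ?FT ?FM f" by (intro split_epi_descends[OF M T ff f]) auto
    then obtain s where s: "s \<in> module_hom AF ?FM ?FT" "\<And>x. x \<in> carrier ?FM \<Longrightarrow> f (s x) = x"
      by (auto simp: split_epi_def)
    note sh = module_hom_comp[OF module_hom_comp[OF th(1) s(1)] eh(2)]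
    have "\<phi>0 ((inv_into (carrier L0) e \<circ> (s \<circ> t)) x) = x" if x: "x \<in> carrier M0" for x
    proof -
      have tx: "t x \<in> carrier ?FM" by (rule module_homD(1)[OF th(1) x])
      have "t (\<phi>0 ((inv_into (carrier L0) e \<circ> (s \<circ> t)) x)) = t x"
        using fe[OF module_homD(1)[OF sh x]] eh(4)[OF module_homD(1)[OF s(1) tx]] s(2)[OF tx] by simp
      then show ?thesis using inj_onD[OF bij_betw_imp_inj_on[OF th(5)]] module_homD(1)[OF ph(1) module_homD(1)[OF sh x]] x by blast
    qed
    then have "split_epi AF L0 M0 \<phi>0" unfolding split_epi_def using sh by blast
    then show False using ph(2) by blast
  qed
  assume Y: "fd_module L A Y" "frob (Suc 0) (bs Y) FY" and y: "y \<in> module_hom A Y M" "\<not> split_epi A Y M y"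
  obtain s \<theta>Y where Yf: "tfrob s Y \<theta>Y" using fd_tfrob[OF Y] .
  note DY = tfrobD[OF Yf]
  have yF: "y \<in> module_hom AF (fixed_points \<theta>Y Y) M" by (rule hom_AF_restrict[OF Yf D(1) y(1)])
  obtain n where n: "n > 0" "\<And>x. x \<in> carrier (fixed_points \<theta>Y Y) \<Longrightarrow> (\<theta> ^^ n) (y x) = y x"
    by (rule common_power[OF M(1), where S = "carrier (fixed_points \<theta>Y Y)" and h = y])
      (use module_homD(1)[OF yF] finite_fixed_points[OF Yf] in auto)
  let ?I = "units_fixed (r * n)"
  have rn: "r * n > 0" using D(4) n(1) by simp
  have "\<exists>h\<in>module_hom AF (fixed_points \<theta>Y Y) L0. \<forall>x\<in>carrier (fixed_points \<theta>Y Y). t (\<phi>0 (h x)) = tr (bs M) \<theta> n c (y x)" if c: "c \<in> ?I" for c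
  proof -
    let ?y = "\<lambda>x. tr (bs M) \<theta> n c (y x)"
    let ?t = "inv_into (carrier M0) t"
    have yc: "?y \<in> module_hom AF (fixed_points \<theta>Y Y) ?FM"
      using tr_hom[OF M(1) left_module_fixed_points[OF Yf] yF n(2), of c] c by (simp add: units_fixed_def)
    \<comment> \<open>The contrapositive of \<open>trace_split_epi\<close>: as y does not split over
      \<open>A\<close>, none of its traces splits over \<open>AF\<close>, and each factors through
      \<open>\<phi>0\<close>.\<close>
    have ns: "\<not> split_epi AF (fixed_points \<theta>Y Y) ?FM ?y"
      using trace_split_epi[OF M(1,2) Yf y(1) units_fixed_closed[OF c]] y(2) by blast
    have "\<not> split_epi AF (fixed_points \<theta>Y Y) M0 (?t \<circ> ?y)"
    proof
      assume "split_epi AF (fixed_points \<theta>Y Y) M0 (?t \<circ> ?y)"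
      then obtain v where v: "v \<in> module_hom AF M0 (fixed_points \<theta>Y Y)" "\<And>x. x \<in> carrier M0 \<Longrightarrow> ?t (?y (v x)) = x" by (auto simp: split_epi_def)
      have "?y ((v \<circ> ?t) x) = x" if x: "x \<in> carrier ?FM" for x
      proof -
        have tx: "?t x \<in> carrier M0" by (rule module_homD(1)[OF th(2) x])
        have "t (?t (?y (v (?t x)))) = t (?t x)" using v(2)[OF tx] by simp
        then show ?thesis using th(4)[OF x] th(4)[OF module_homD(1)[OF yc module_homD(1)[OF v(1) tx]]] by simp
      qed
      then have "split_epi AF (fixed_points \<theta>Y Y) ?FM ?y"
        unfolding split_epi_def using module_hom_comp[OF th(2) v(1)] by blast
      then show False using ns by blast
    qed
    then obtain h where h: "h \<in> module_hom AF (fixed_points \<theta>Y Y) L0" "\<And>x. x \<in> carrier (fixed_points \<theta>Y Y) \<Longrightarrow> ?t (?y x) = \<phi>0 (h x)"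
      using minimal_right_almost_split_factors[OF fd_AF \<phi>0(1) fd_fixed_points[OF Yf] module_hom_comp[OF yc th(2)]] by auto
    have "t (\<phi>0 (h x)) = ?y x" if x: "x \<in> carrier (fixed_points \<theta>Y Y)" for x
      using h(2)[OF x] th(4)[OF module_homD(1)[OF yc x]] by simp
    then show ?thesis using h(1) by blast
  qed
  then obtain h where h: "\<And>c. c \<in> ?I \<Longrightarrow> h c \<in> module_hom AF (fixed_points \<theta>Y Y) L0"
    "\<And>c x. \<lbrakk>c \<in> ?I; x \<in> carrier (fixed_points \<theta>Y Y)\<rbrakk> \<Longrightarrow> t (\<phi>0 (h c x)) = tr (bs M) \<theta> n c (y x)" by metis
  \<comment> \<open>The factorisations of all traces, recombined so that f composed with H is y on
    fixed vectors.\<close>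
  define H where "H x = (\<Oplus>\<^bsub>T\<^esub>c\<in>?I. (\<ominus> (inv c)) \<odot>\<^bsub>bs T\<^esub> e (h c x))" for x
  have Hh: "H \<in> module_hom AF (fixed_points \<theta>Y Y) T"
    unfolding H_def[abs_def]
  proof (rule hom_AF_combination[OF DT(1) finite_units_fixed[OF rn]])
    show "(\<lambda>x. e (h c x)) \<in> module_hom AF (fixed_points \<theta>Y Y) T" if "c \<in> ?I" for c
      using hom_AF_fixed_points[OF module_hom_comp[OF h(1)[OF that] eh(1)]] by (simp add: comp_def)
  qed (rule u)
  have fH: "f (H x) = y x" if x: "x \<in> carrier Y" "\<theta>Y x = x" for x
  proof -
    have xf: "x \<in> carrier (fixed_points \<theta>Y Y)" using x by simp
    have yx: "y x \<in> carrier M" by (rule module_homD(1)[OF y(1) x(1)])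
    have "f (H x) = (\<Oplus>\<^bsub>M\<^esub>c\<in>?I. (\<ominus> (inv c)) \<odot>\<^bsub>bs M\<^esub> t (\<phi>0 (h c x)))"
      unfolding H_def by (rule lift[OF rn]) (rule module_homD(1)[OF h(1) xf])
    also have "\<dots> = (\<Oplus>\<^bsub>M\<^esub>c\<in>?I. (\<ominus> (inv c)) \<odot>\<^bsub>bs M\<^esub> tr (bs M) \<theta> n c (y x))"
    proof (rule M.M.finsum_cong')
      show "(\<lambda>c. (\<ominus> (inv c)) \<odot>\<^bsub>bs M\<^esub> tr (bs M) \<theta> n c (y x)) \<in> ?I \<rightarrow> carrier M"
      proof
        fix c assume c: "c \<in> ?I"
        show "(\<ominus> (inv c)) \<odot>\<^bsub>bs M\<^esub> tr (bs M) \<theta> n c (y x) \<in> carrier M"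
          using VM.smult_closed[OF u[OF c] tr_closed[OF D(2,7) _ units_fixed_closed[OF c], of "y x"]] yx by simp
      qed
    qed (simp_all only: h(2)[OF _ xf])
    also have "\<dots> = y x" using tr_expand[OF D(2,7) _ D(4) n(1), of "y x"] yx by simp
    finally show ?thesis .
  qed
  \<comment> \<open>H is linear over \<open>AF\<close> only. Since y has degree 0, the degree-0
    component of H already lifts it, and this component extends to \<open>Y\<close>.\<close>
  obtain g where g: "tlin 0 0 Y T g" "\<And>x. \<lbrakk>x \<in> carrier Y; \<theta>Y x = x\<rbrakk> \<Longrightarrow> g x = hpart s Y T 0 H x"
    using hpart_extension[OF Yf DT(1) Hh, where j = 0] by blast
  have "y x = f (g x)" if x: "x \<in> carrier Y" for x
  proof (rule tlin_eq[OF Yf D(1), where j = 0 and u = y and v = "\<lambda>x. f (g x)" and x = x])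
    show "tlin 0 0 Y M y" by (rule hom_tlin[OF y(1)])
    show "tlin 0 0 Y M (\<lambda>x. f (g x))" using tlin_comp0[OF g(1) hom_tlin[OF f]] by simp
    fix x assume x: "x \<in> carrier Y" "\<theta>Y x = x"
    have "f (g x) = hpart s Y M 0 (\<lambda>x. f (H x)) x" using hpart_hom[OF Yf DT(1) D(1) f Hh x, of 0] g(2)[OF x] by simp
    also have "\<dots> = hpart s Y M 0 y x" by (rule hpart_cong[OF Yf D(1)]) (use fH module_homD(1)[OF y(1)] x in auto)
    also have "\<dots> = y x" using hpart_slin[OF Yf D(1) tlin_slin[OF hom_tlin[OF y(1)] DY(1)] x(1)] by simp
    finally show "y x = f (g x)" by simp
  qed (rule x)
  then show "\<exists>g\<in>module_hom A Y T. \<forall>x\<in>carrier Y. y x = f (g x)" using g(1) by (auto simp: tlin_module_hom)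
qed

text \<open>It suffices to find an almost split sequence over \<open>A\<close> whose induced
  sequence has an end term isomorphic to \<open>M0\<close>, because the end term determines the
  sequence (\<open>almost_split_unique\<close>). The function \<open>Fr\<close> provides the
  Frobenius maps on the modules constructed here.\<close>

lemma almost_split_over_fixed_points_induced:
  fixes N0 :: "('a, 'x) module" and L0 :: "('a, 'y) module" and M0 :: "('a, 'z) module"
  assumes Fr: "\<And>V :: ('a, nat \<Rightarrow> 'k) module. fd_module L A V \<Longrightarrow> frobenius_map q L (bs V) (Fr V)"
    and as0: "almost_split K1 AF N0 L0 M0 \<psi>0 \<phi>0"
  shows "\<exists>(N :: ('a, nat \<Rightarrow> 'k) module) (P :: ('a, nat \<Rightarrow> 'k) module) (M :: ('a, nat \<Rightarrow> 'k) module) \<psi> \<phi> Nt GN Pt GP Mt GM \<psi>t \<phi>t.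
    almost_split L A N P M \<psi> \<phi> \<and> induced_sequence L A FA N (Fr N) P (Fr P) M (Fr M) \<psi> \<phi> Nt GN Pt GP Mt GM \<psi>t \<phi>t \<and>
    isomorphic_sequences AF (fixed_points GN Nt) (fixed_points GP Pt) (fixed_points GM Mt) \<psi>t \<phi>t N0 L0 M0 \<psi>0 \<phi>0"
proof -
  have m0: "minimal_right_almost_split K1 AF L0 M0 \<phi>0" and fd0: "fd_module K1 AF L0" "fd_module K1 AF M0"
    and p0: "\<phi>0 \<in> module_hom AF L0 M0" "\<phi>0 ` carrier L0 = carrier M0"
    using as0 by (auto simp: almost_split_def short_exact_def)
  have l0: "left_module AF M0" "left_module AF L0" using fd0 by (auto simp: fd_module_def)
  have fFr: "frob (Suc 0) (bs V) (Fr V)" if "fd_module L A V" for V using frob_frobenius_map[OF Fr[OF that]] .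
  obtain T :: "('a, 'z \<Rightarrow> 'k) module" and F e where T: "tfrob (Suc 0) T F" "e \<in> module_iso AF M0 (fixed_points F T)"
    using base_change[OF fd0(2)] by blast
  obtain z where z: "z \<in> carrier M0" "z \<noteq> \<zero>\<^bsub>M0\<^esub>" using minimal_right_almost_split_nonzero(1)[OF m0] by blast
  have "e z \<in> carrier T" "e z \<noteq> \<zero>\<^bsub>T\<^esub>"
    using iso_zero_iff[OF l0(1) left_module_fixed_points[OF T(1)] T(2) z(1)] z(2) module_homD(1)[OF module_isoD(1)[OF T(2) l0(1)] z(1)] by simp_all
  then have nzT: "\<exists>x\<in>carrier T. x \<noteq> \<zero>\<^bsub>T\<^esub>" by blast
  obtain M :: "('a, nat \<Rightarrow> 'k) module" and p i where M: "fd_module L A M" "local_module M"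
    and pi: "p \<in> module_hom A T M" "i \<in> module_hom A M T" "\<And>x. x \<in> carrier M \<Longrightarrow> p (i x) = x"
    using local_summand_exists[OF tfrobD(8)[OF T(1)] nzT fFr] by blast
  define r where "r = period A FA (Fr M) M"
  obtain \<theta> where \<theta>: "tfrob r M \<theta>" "aperiodic r M" using period_semilinear[OF M(1) fFr[OF M(1)]] unfolding r_def by blast
  note D = tfrobD[OF \<theta>(1)]
  \<comment> \<open>First only a split epimorphism from \<open>M0\<close> to
    \<open>M\<^sup>\<theta>\<close> is available; indecomposability of \<open>M0\<close> turns it
    into an isomorphism below.\<close>
  obtain t where t: "t \<in> module_hom AF M0 (fixed_points \<theta> M)" "split_epi AF M0 (fixed_points \<theta> M) t"
  proof (rule split_epi_fixed_points[OF \<theta>(1) M(2) \<theta>(2) T(1) fd0(2) T(2) pi(1,2)])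
    show "p (i x) = x" if "x \<in> carrier M" for x by (rule pi(3)[OF that])
  qed
  have "\<exists>x\<in>carrier (fixed_points \<theta> M). x \<noteq> \<zero>\<^bsub>fixed_points \<theta> M\<^esub>"
  proof (rule ccontr)
    assume z: "\<not> ?thesis"
    have "x = \<zero>\<^bsub>M\<^esub>" if x: "x \<in> carrier M" for x
      by (rule tlin_eq[OF \<theta>(1) D(1), where j = 0 and u = "\<lambda>x. x" and v = "\<lambda>_. \<zero>\<^bsub>M\<^esub>" and x = x])
        (use z tlin_id tlin_zero[OF D(1)] x in auto)
    then show False using M(2) by (auto simp: local_module_def)
  qed
  then have ti: "t \<in> module_iso AF M0 (fixed_points \<theta> M)"
    by (rule split_epi_from_local_iso[OF fd_AF m0 left_module_fixed_points[OF \<theta>(1)] _ t])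
  \<comment> \<open>The scalar extension of the middle term supplies a right almost split morphism
    to M, which is afterwards replaced by a minimal one.\<close>
  obtain S :: "('a, 'y \<Rightarrow> 'k) module" and G d where S: "tfrob (Suc 0) S G" "d \<in> module_iso AF L0 (fixed_points G S)"
    using base_change[OF fd0(1)] by blast
  note dh = module_isoD[OF S(2) l0(2)]
  have "t \<circ> (\<phi>0 \<circ> inv_into (carrier L0) d) \<in> module_hom AF (fixed_points G S) M"
    by (rule hom_AF_fixed_points[OF module_hom_comp[OF module_hom_comp[OF dh(2) p0(1)] t(1)]])
  then obtain f where f: "f \<in> module_hom A S M" "\<And>y. \<lbrakk>y \<in> carrier S; G y = y\<rbrakk> \<Longrightarrow> f y = (t \<circ> (\<phi>0 \<circ> inv_into (carrier L0) d)) y"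
    using F_stable_extension[OF S(1) D(1)] by blast
  have fe: "\<forall>x\<in>carrier L0. f (d x) = t (\<phi>0 x)"
  proof
    fix x assume x: "x \<in> carrier L0"
    then show "f (d x) = t (\<phi>0 x)" using f(2)[of "d x"] module_homD(1)[OF dh(1) x] dh(3)[OF x] by simp
  qed
  note ext = right_almost_split_extension[where f = f and e = d and t = t and ?\<phi>0.0 = \<phi>0, OF \<theta>(1) M(2) \<theta>(2) m0 p0(2) ti S f(1) fe]
  obtain P :: "('a, nat \<Rightarrow> 'k) module" and \<phi> where \<phi>: "minimal_right_almost_split L A P M \<phi>" "\<phi> ` carrier P = carrier M"
  proof (rule minimal_right_almost_split_exists[OF tfrobD(8)[OF S(1)] M(1) f(1) ext(1,2), where Fr = Fr])
    show "\<exists>g\<in>module_hom A Y S. \<forall>x\<in>carrier Y. y x = f (g x)"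
      if "fd_module L A Y" "y \<in> module_hom A Y M" "\<not> split_epi A Y M y" for Y :: "('a, nat \<Rightarrow> 'k) module" and y
      by (rule ext(3)[OF that(1) fFr[OF that(1)] that(2,3)])
    show "frob (Suc 0) (bs V) (Fr V)" if "fd_module L A V" for V by (rule fFr[OF that])
  qed
  have P: "fd_module L A P" "left_module A P" and ph: "\<phi> \<in> module_hom A P M"
    using \<phi>(1) by (auto simp: minimal_right_almost_split_def fd_module_def)
  interpret P: left_module A P by (rule P(2))
  interpret M: left_module A M by (rule D(1))
  \<comment> \<open>The kernel of \<open>\<phi>\<close> as a submodule on the same type, so that the
    inclusion is the identity function.\<close>
  define N where "N = P\<lparr>carrier := {x \<in> carrier P. \<phi> x = \<zero>\<^bsub>M\<^esub>}\<rparr>"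
  note h = module_homD[OF ph]
  have N: "fd_module L A N"
    unfolding N_def
  proof (rule fd_submodule(1)[OF P(1)])
    show "\<zero>\<^bsub>P\<^esub> \<in> {x \<in> carrier P. \<phi> x = \<zero>\<^bsub>M\<^esub>}" using tlin_0[OF hom_tlin[OF ph] P(2) D(1)] by simp
  qed (use h M.smult_zero P.lm_closed in auto)
  have "(\<lambda>x. x) \<in> module_hom A N P" by (rule module_homI) (auto simp: N_def)
  then have as: "almost_split L A N P M (\<lambda>x. x) \<phi>"
    using N P(1) M(1) \<phi> ph by (auto simp: almost_split_def short_exact_def N_def)
  obtain Nt GN Pt GP Mt GM \<psi>t \<phi>t where ind: "induced_sequence L A FA N (Fr N) P (Fr P) M (Fr M) (\<lambda>x. x) \<phi> Nt GN Pt GP Mt GM \<psi>t \<phi>t"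
    and ast: "almost_split K1 AF (fixed_points GN Nt) (fixed_points GP Pt) (fixed_points GM Mt) \<psi>t \<phi>t"
    and iso: "module_iso AF (fixed_points \<theta> M) (fixed_points GM Mt) \<noteq> {}"
    using induced_almost_split[OF as Fr[OF N] Fr[OF P(1)] Fr[OF M(1)] \<theta> r_def] by blast
  obtain \<eta> where "\<eta> \<in> module_iso AF (fixed_points \<theta> M) (fixed_points GM Mt)" using iso by blast
  from module_isoD(2,5)[OF module_iso_comp[OF ti this] l0(1)]
  have "inv_into (carrier M0) (\<eta> \<circ> t) \<in> module_iso AF (fixed_points GM Mt) M0"
    by (simp add: module_iso_def bij_betw_inv_into)
  from almost_split_unique[OF fd_AF ast as0 this]
  show ?thesis using as ind by blast
qed

end

theorem theorem7p4:
  fixes k :: "'k ring" and Fq :: "'k set" and q :: nat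
    and A :: "('k, 'a) module" and F\<^sub>A :: "'a \<Rightarrow> 'a"
  assumes "primepow q" and "card Fq = q" and "algebraic_closure k Fq"
    and "fd_algebra k A" and "frobenius_morphism q k A F\<^sub>A"
  shows
    "(\<forall>(L :: ('a, 'l) module) F\<^sub>L (M :: ('a, 'm) module) F\<^sub>M \<phi>.
        minimal_right_almost_split k A L M \<phi> \<and>
        frobenius_map q k (base_space k A L) F\<^sub>L \<and>
        frobenius_map q k (base_space k A M) F\<^sub>M \<longrightarrow>
        (\<exists>Lt GL Mt GM \<phi>t.
           induced_morphism k A F\<^sub>A L F\<^sub>L M F\<^sub>M \<phi> Lt GL Mt GM \<phi>t \<and>
           F_stable q k A F\<^sub>A Lt GL \<and> F_stable q k A F\<^sub>A Mt GM \<and>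
           \<phi>t \<in> F_stable_hom A Lt GL Mt GM \<and>
           minimal_right_almost_split (k\<lparr>carrier := Fq\<rparr>) (fixed_points F\<^sub>A A)
             (fixed_points GL Lt) (fixed_points GM Mt) \<phi>t)) \<and>
     (\<forall>(N :: ('a, 'n) module) F\<^sub>N (L :: ('a, 'l) module) F\<^sub>L (M :: ('a, 'm) module) F\<^sub>M \<psi> \<phi>.
        almost_split k A N L M \<psi> \<phi> \<and>
        frobenius_map q k (base_space k A N) F\<^sub>N \<and>
        frobenius_map q k (base_space k A L) F\<^sub>L \<and>
        frobenius_map q k (base_space k A M) F\<^sub>M \<longrightarrow>
        (\<exists>Nt GN Lt GL Mt GM \<psi>t \<phi>t.
           induced_sequence k A F\<^sub>A N F\<^sub>N L F\<^sub>L M F\<^sub>M \<psi> \<phi> Nt GN Lt GL Mt GM \<psi>t \<phi>t \<and>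
           F_stable q k A F\<^sub>A Nt GN \<and> F_stable q k A F\<^sub>A Lt GL \<and> F_stable q k A F\<^sub>A Mt GM \<and>
           \<psi>t \<in> F_stable_hom A Nt GN Lt GL \<and> \<phi>t \<in> F_stable_hom A Lt GL Mt GM \<and>
           almost_split (k\<lparr>carrier := Fq\<rparr>) (fixed_points F\<^sub>A A)
             (fixed_points GN Nt) (fixed_points GL Lt) (fixed_points GM Mt) \<psi>t \<phi>t)) \<and>
     (\<forall>Fr :: ('a, nat \<Rightarrow> 'k) module \<Rightarrow> (nat \<Rightarrow> 'k) \<Rightarrow> (nat \<Rightarrow> 'k).
        (\<forall>V. fd_module k A V \<longrightarrow> frobenius_map q k (base_space k A V) (Fr V)) \<longrightarrow>
        (\<forall>(N0 :: ('a, 'x) module) (L0 :: ('a, 'y) module) (M0 :: ('a, 'z) module) \<psi>0 \<phi>0.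
           almost_split (k\<lparr>carrier := Fq\<rparr>) (fixed_points F\<^sub>A A) N0 L0 M0 \<psi>0 \<phi>0 \<longrightarrow>
           (\<exists>(N :: ('a, nat \<Rightarrow> 'k) module) (L :: ('a, nat \<Rightarrow> 'k) module)
             (M :: ('a, nat \<Rightarrow> 'k) module) \<psi> \<phi> Nt GN Lt GL Mt GM \<psi>t \<phi>t.
              almost_split k A N L M \<psi> \<phi> \<and>
              induced_sequence k A F\<^sub>A N (Fr N) L (Fr L) M (Fr M) \<psi> \<phi>
                Nt GN Lt GL Mt GM \<psi>t \<phi>t \<and>
              isomorphic_sequences (fixed_points F\<^sub>A A)
                (fixed_points GN Nt) (fixed_points GL Lt) (fixed_points GM Mt) \<psi>t \<phi>t
                N0 L0 M0 \<psi>0 \<phi>0)))"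
proof -
  interpret algebraic_closure k Fq by fact
  have q: "q > 1" using primepow_gt_Suc_0[OF assms(1)] by simp
  have Fq: "Fq \<subseteq> carrier k" "finite Fq" using subset assms(2) q by (auto intro: card_ge_0_finite)
  have pow: "c [^]\<^bsub>k\<^esub> q = c" if "c \<in> Fq" for c
  proof -
    interpret Q: field "k\<lparr>carrier := Fq\<rparr>" by (rule subfield_iff(2)[OF subfield_axioms])
    show ?thesis using Q.pow_card[of c] Fq(2) that assms(2) by (simp add: nat_pow_def)
  qed
  interpret A: vectorspace k A using assms(4) by (simp add: fd_algebra_def)
  interpret AR: ring A using assms(4) by (simp add: fd_algebra_def)
  have FA: "F\<^sub>A (x \<oplus>\<^bsub>A\<^esub> y) = F\<^sub>A x \<oplus>\<^bsub>A\<^esub> F\<^sub>A y" "F\<^sub>A (c \<odot>\<^bsub>A\<^esub> x) = (c [^]\<^bsub>k\<^esub> q) \<odot>\<^bsub>A\<^esub> F\<^sub>A x" "F\<^sub>A \<one>\<^bsub>A\<^esub> = \<one>\<^bsub>A\<^esub>"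
    if "x \<in> carrier A" "y \<in> carrier A" "c \<in> carrier k" for x y c
    using assms(5) that by (simp_all add: frobenius_morphism_def frobenius_map_def)
  \<comment> \<open>Additivity of the q-th power on k follows from that of \<open>F\<^sub>A\<close>
    on multiples of the unit, which can be cancelled because the unit is nonzero.\<close>
  have fr: "frobenius_algebra k q A F\<^sub>A" if ne: "\<one>\<^bsub>A\<^esub> \<noteq> \<zero>\<^bsub>A\<^esub>"
  proof (unfold_locales)
    fix x y assume xy: "x \<in> carrier k" "y \<in> carrier k"
    let ?s = "\<lambda>c. c \<odot>\<^bsub>A\<^esub> \<one>\<^bsub>A\<^esub>"
    have s: "?s x \<in> carrier A" "?s y \<in> carrier A" using xy by simp_all
    have "?s ((x \<oplus>\<^bsub>k\<^esub> y) [^]\<^bsub>k\<^esub> q) = F\<^sub>A (?s x \<oplus>\<^bsub>A\<^esub> ?s y)"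
      using FA(2,3)[of "\<one>\<^bsub>A\<^esub>" "\<one>\<^bsub>A\<^esub>" "x \<oplus>\<^bsub>k\<^esub> y"] xy A.smult_l_distr[of x y "\<one>\<^bsub>A\<^esub>"] by simp
    also have "\<dots> = ?s (x [^]\<^bsub>k\<^esub> q \<oplus>\<^bsub>k\<^esub> y [^]\<^bsub>k\<^esub> q)"
      using FA(1)[OF s xy(1)] FA(2,3)[of "\<one>\<^bsub>A\<^esub>" "\<one>\<^bsub>A\<^esub>"] xy A.smult_l_distr[of "x [^]\<^bsub>k\<^esub> q" "y [^]\<^bsub>k\<^esub> q" "\<one>\<^bsub>A\<^esub>"] by simp
    finally show "(x \<oplus>\<^bsub>k\<^esub> y) [^]\<^bsub>k\<^esub> q = x [^]\<^bsub>k\<^esub> q \<oplus>\<^bsub>k\<^esub> y [^]\<^bsub>k\<^esub> q"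
      using A.smult_right_cancel[of _ _ "\<one>\<^bsub>A\<^esub>"] ne xy by simp
  qed (use q assms(4,5) ne in auto)
  \<comment> \<open>Elements of \<open>Fq\<close> are fixed by the q-th power, and both sets have q
    elements.\<close>
  have K1: "frobenius_field.fixed k q (Suc 0) = Fq" if "\<one>\<^bsub>A\<^esub> \<noteq> \<zero>\<^bsub>A\<^esub>"
  proof -
    interpret frobenius_algebra k q A F\<^sub>A by (rule fr[OF that])
    have "Fq \<subseteq> fixed (Suc 0)" using pow Fq(1) by (auto simp: fixed_def)
    then show ?thesis using card_subset_eq[OF card_fixed(1), of "Suc 0" Fq] card_fixed(2)[of "Suc 0"] assms(2) by simp
  qed
  show ?thesis
  proof (intro conjI allI impI; (elim conjE)?)
    fix L :: "('a, 'l) module" and F\<^sub>L and M :: "('a, 'm) module" and F\<^sub>M \<phi>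
    assume a: "minimal_right_almost_split k A L M \<phi>" "frobenius_map q k (base_space k A L) F\<^sub>L" "frobenius_map q k (base_space k A M) F\<^sub>M"
    have ne: "\<one>\<^bsub>A\<^esub> \<noteq> \<zero>\<^bsub>A\<^esub>" by (rule minimal_right_almost_split_nonzero(2)[OF a(1)])
    from frobenius_algebra.induced_minimal_right_almost_split[OF fr[OF ne] a]
    show "\<exists>Lt GL Mt GM \<phi>t. induced_morphism k A F\<^sub>A L F\<^sub>L M F\<^sub>M \<phi> Lt GL Mt GM \<phi>t \<and>
        F_stable q k A F\<^sub>A Lt GL \<and> F_stable q k A F\<^sub>A Mt GM \<and> \<phi>t \<in> F_stable_hom A Lt GL Mt GM \<and>
        minimal_right_almost_split (k\<lparr>carrier := Fq\<rparr>) (fixed_points F\<^sub>A A) (fixed_points GL Lt) (fixed_points GM Mt) \<phi>t"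
      unfolding K1[OF ne] .
  next
    fix N :: "('a, 'n) module" and F\<^sub>N and L :: "('a, 'l) module" and F\<^sub>L and M :: "('a, 'm) module" and F\<^sub>M \<psi> \<phi>
    assume a: "almost_split k A N L M \<psi> \<phi>" and F: "frobenius_map q k (base_space k A N) F\<^sub>N"
      "frobenius_map q k (base_space k A L) F\<^sub>L" "frobenius_map q k (base_space k A M) F\<^sub>M"
    have ne: "\<one>\<^bsub>A\<^esub> \<noteq> \<zero>\<^bsub>A\<^esub>" using a by (auto simp: almost_split_def dest: minimal_right_almost_split_nonzero(2))
    interpret frobenius_algebra k q A F\<^sub>A by (rule fr[OF ne])
    have M: "fd_module k A M" using a by (simp add: almost_split_def)
    obtain \<theta> where "tfrob (period A F\<^sub>A F\<^sub>M M) M \<theta>" "aperiodic (period A F\<^sub>A F\<^sub>M M) M"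
      using period_semilinear[OF M frob_frobenius_map[OF F(3)]] by blast
    from induced_almost_split[OF a F this refl]
    show "\<exists>Nt GN Lt GL Mt GM \<psi>t \<phi>t. induced_sequence k A F\<^sub>A N F\<^sub>N L F\<^sub>L M F\<^sub>M \<psi> \<phi> Nt GN Lt GL Mt GM \<psi>t \<phi>t \<and>
        F_stable q k A F\<^sub>A Nt GN \<and> F_stable q k A F\<^sub>A Lt GL \<and> F_stable q k A F\<^sub>A Mt GM \<and>
        \<psi>t \<in> F_stable_hom A Nt GN Lt GL \<and> \<phi>t \<in> F_stable_hom A Lt GL Mt GM \<and>
        almost_split (k\<lparr>carrier := Fq\<rparr>) (fixed_points F\<^sub>A A) (fixed_points GN Nt) (fixed_points GL Lt) (fixed_points GM Mt) \<psi>t \<phi>t"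
      unfolding K1[OF ne] by blast
  next
    fix Fr :: "('a, nat \<Rightarrow> 'k) module \<Rightarrow> (nat \<Rightarrow> 'k) \<Rightarrow> (nat \<Rightarrow> 'k)"
      and N0 :: "('a, 'x) module" and L0 :: "('a, 'y) module" and M0 :: "('a, 'z) module" and \<psi>0 \<phi>0
    assume Fr: "\<forall>V. fd_module k A V \<longrightarrow> frobenius_map q k (base_space k A V) (Fr V)"
      and a: "almost_split (k\<lparr>carrier := Fq\<rparr>) (fixed_points F\<^sub>A A) N0 L0 M0 \<psi>0 \<phi>0"
    have "minimal_right_almost_split (k\<lparr>carrier := Fq\<rparr>) (fixed_points F\<^sub>A A) L0 M0 \<phi>0" using a by (simp add: almost_split_def)
    from minimal_right_almost_split_nonzero(2)[OF this] have ne: "\<one>\<^bsub>A\<^esub> \<noteq> \<zero>\<^bsub>A\<^esub>" by simp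
    show "\<exists>(N :: ('a, nat \<Rightarrow> 'k) module) (L :: ('a, nat \<Rightarrow> 'k) module) (M :: ('a, nat \<Rightarrow> 'k) module) \<psi> \<phi> Nt GN Lt GL Mt GM \<psi>t \<phi>t.
        almost_split k A N L M \<psi> \<phi> \<and> induced_sequence k A F\<^sub>A N (Fr N) L (Fr L) M (Fr M) \<psi> \<phi> Nt GN Lt GL Mt GM \<psi>t \<phi>t \<and>
        isomorphic_sequences (fixed_points F\<^sub>A A) (fixed_points GN Nt) (fixed_points GL Lt) (fixed_points GM Mt) \<psi>t \<phi>t N0 L0 M0 \<psi>0 \<phi>0"
      by (rule frobenius_algebra.almost_split_over_fixed_points_induced[OF fr[OF ne] _ a[folded K1[OF ne]]]) (use Fr in blast)
  qed
qed

end
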